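(* Let $H=(V_H,\mathcal{E}_H)$ be a fixed connected graph on $k$ vertices, $V_H=[k]$, $k\ge3$, with minimum degree at least $2$, such that the maximizer in the optimization problem defining $B^{(\mathrm{sub})}(H)$ is unique and $B^{(\mathrm{sub})}(H)=0$. Then $$\frac{N^{(\mathrm{sub})}(H)}{n^{\frac{k}{2}(3-\tau)}}\stackrel{\mathbb{P}}{\longrightarrow}A^{(\mathrm{sub})}(H)<\infty,$$ with $$A^{(\mathrm{sub})}(H)=c^k\mu^{-\frac{k}{2}(\tau-1)}\int_0^\infty\cdots\int_0^\infty (x_1\cdots x_k)^{-\tau}\prod_{\{i,j\}\in\mathcal{E}_H}(1-\mathrm{e}^{-x_ix_j})\,\mathrm{d}x_1\cdots\mathrm{d}x_k .$$ The same holds for induced subgraphs: if instead the maximizer in the optimization problem defining $B^{(\mathrm{ind})}(H)$ is unique and $B^{(\mathrm{ind})}(H)=0$, then $N^{(\mathrm{ind})}(H)/n^{\frac{k}{2}(3-\tau)}\stackrel{\mathbb{P}}{\longrightarrow}A^{(\mathrm{ind})}(H)<\infty$ with $$A^{(\mathrm{ind})}(H)=c^k\mu^{-\frac{k}{2}(\tau-1)}\int_0^\infty\cdots\int_0^\infty (x_1\cdots x_k)^{-\tau}\prod_{\{i,j\}\in\mathcal{E}_H}(1-\mathrm{e}^{-x_ix_j})\prod_{\{i,j\}\notin\mathcal{E}_H}\mathrm{e}^{-x_ix_j}\,\mathrm{d}x_1\cdots\mathrm{d}x_k,$$ where the last product is over unordered pairs $\{i,j\}\subseteq[k]$, $i\neq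 j$, that are not edges of $H$.
   Context: Model. Fix $\tau\in(2,3)$ and $c>0$. Let $D$ be a random variable on the positive integers with $\mathbb{P}(D=k)=ck^{-\tau}(1+o(1))$ as $k\to\infty$, and $\mu=\mathbb{E}[D]<\infty$. For each $n$, the degrees $(D_v)_{v\in[n]}$ are i.i.d. copies of $D$ (if their sum is odd, one extra half-edge is added to vertex $n$). The configuration model on $[n]=\{1,\dots,n\}$ attaches $D_v$ half-edges to each vertex $v$ and pairs all half-edges uniformly at random into edges. The erased configuration model $\mathrm{ECM}^{(n)}$ is the simple graph obtained from it by removing all self-loops and merging multiple edges. Counts. Copies of $H$ are counted as labeled copies (automorphisms of $H$ give separate copies): $N^{(\mathrm{sub})}(H)$ is the number of tuples $(v_1,\dots,v_k)$ of distinct vertices in $[n]$ such that $\{v_i,v_j\}$ is an edge of $\mathrm{ECM}^{(n)}$ for every $\{i,j\}\in\mathcal{E}_H$; $N^{(\mathrm{ind})}(H)$ is the number of such tuples for which, in addition, $\{v_i,v_j\}$ is not an edge for every pair $i\ne j$ with $\{i,j\}\notin\mathcal{E}_H$. Optimization problems. Let $V_1$ be the set of vertices of degree one in $H$ (empty under the assumption of the theorem). For a partition $\mathcal{P}=(S_1,S_2,S_3)$ of $V_H\setminus V_1$ into three disjoint (possibly empty) sets, let $E_{S_i}$ be the number of edges of $H$ inside $S_i$, $E_{S_i,S_j}$ the number of edges of $H$ between $S_i$ and $S_j$, and $E_{S_i,V_1}$ the number of edges of $H$ between $S_i$ and $V_1$. Define $$B^{(\mathrm{sub})}(H)=\max_{\mathcal{P}}\Big[|S_1|-|S_2|-\frac{2E_{S_1}+E_{S_1,S_3}+E_{S_1,V_1}-E_{S_2,V_1}}{\tau-1}\Big],$$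 and let $B^{(\mathrm{ind})}(H)$ be the maximum of the same expression over those partitions satisfying $\{i,j\}\in\mathcal{E}_H$ for all $i\in S_2$, $j\in S_2\cup S_3$, $i\neq j$. $\stackrel{\mathbb{P}}{\longrightarrow}$ denotes convergence in probability as $n\to\infty$. *)

theory Defs
  imports "HOL-Probability.Probability"
begin

text \<open>
  Graphs are given by a vertex set \<open>V\<close> and a set \<open>E\<close> of edges, each edge being the two-element
  set of its endpoints.
\<close>

definition simple_graph :: "'a set \<Rightarrow> 'a set set \<Rightarrow> bool" where
  "simple_graph V E \<longleftrightarrow> finite V \<and> (\<forall>e\<in>E. e \<subseteq> V \<and> card e = 2)"

definition connected_graph :: "'a set \<Rightarrow> 'a set set \<Rightarrow> bool" where
  "connected_graph V E \<longleftrightarrow>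
     V \<noteq> {} \<and> (\<forall>u\<in>V. \<forall>v\<in>V. (u, v) \<in> {(a, b). {a, b} \<in> E}\<^sup>*)"

definition vertex_degree :: "'a set set \<Rightarrow> 'a \<Rightarrow> nat" where
  "vertex_degree E v = card {e\<in>E. v \<in> e}"

text \<open>The \<open>i\<close>-th half-edge of vertex \<open>v\<close> is \<open>(v, i)\<close>.\<close>

definition half_edges :: "nat \<Rightarrow> (nat \<Rightarrow> nat) \<Rightarrow> (nat \<times> nat) set" where
  "half_edges n d = (SIGMA v:{1..n}. {..<d v})"

definition fix_parity :: "nat \<Rightarrow> (nat \<Rightarrow> nat) \<Rightarrow> (nat \<Rightarrow> nat)" where
  "fix_parity n d = (if odd (\<Sum>v\<in>{1..n}. d v) then d(n := d n + 1) else d)"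

definition pairings :: "'a set \<Rightarrow> 'a set set set" where
  "pairings A = {M. partition_on A M \<and> (\<forall>e\<in>M. card e = 2)}"

definition erase :: "(nat \<times> nat) set set \<Rightarrow> nat set set" where
  "erase M = {{u, v} | u v i j. u \<noteq> v \<and> {(u, i), (v, j)} \<in> M}"

text \<open>
  The law of the (random) edge set of the erased configuration model on \<open>{1..n}\<close>, where \<open>p\<close> is
  the law of \<open>D\<close>. \<open>Pi_pmf {1..n} 0 (\<lambda>_. p)\<close> is the law of a family \<open>(D\<^sub>v)\<close> of independent
  \<open>p\<close>-distributed degrees.
\<close>

definition ECM :: "nat pmf \<Rightarrow> nat \<Rightarrow> nat set set pmf" where
  "ECM p n =
     bind_pmf (Pi_pmf {1..n} 0 (\<lambda>_. p)) (\<lambda>d.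
       map_pmf erase (pmf_of_set (pairings (half_edges n (fix_parity n d)))))"

text \<open>\<open>pmf_of_set\<close> is only meaningful for finite nonempty sets; here this is always the case.\<close>

lemma finite_pairings: "finite A \<Longrightarrow> finite (pairings A)"
  by (rule finite_subset[of _ "Pow (Pow A)"]) (auto simp: pairings_def partition_on_def)

lemma pairings_nonempty:
  assumes "finite A" "even (card A)"
  shows "pairings A \<noteq> {}"
  using assms
proof (induction "card A" arbitrary: A rule: less_induct)
  case less
  show ?case
  proof (cases "A = {}")
    case True
    then have "{} \<in> pairings A" by (simp add: pairings_def partition_on_def)
    then show ?thesis by blast
  next
    case False
    then obtain a where a: "a \<in> A" by blast
    have "A \<noteq> {a}" using less.prems by auto
    then obtain b where b: "b \<in> A" "b \<noteq> a" using a by blast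
    let ?B = "A - {a, b}"
    have card: "card ?B = card A - 2" "card A \<ge> 2"
      using a b less.prems card_mono[of A "{a, b}"] by (auto simp: card_Diff_subset)
    then have "pairings ?B \<noteq> {}"
      using less.prems by (intro less.hyps) auto
    then obtain M where M: "M \<in> pairings ?B" by blast
    then have "\<Union>M = ?B" by (auto simp: pairings_def partition_on_def)
    then have "insert {a, b} M \<in> pairings A"
      using M a b by (auto simp: pairings_def partition_on_def disjoint_def)
    then show ?thesis by blast
  qed
qed

lemma pairings_half_edges:
  "finite (pairings (half_edges n (fix_parity n d)))"
  "pairings (half_edges n (fix_parity n d)) \<noteq> {}"
proof -
  have "even (\<Sum>v\<in>{1..n}. fix_parity n d v)"
  proof (cases "n = 0")
    case False
    then have "(\<Sum>v\<in>{1..n}. (d(n := d n + 1)) v) = (\<Sum>v\<in>{1..n}. d v) + 1"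
      by (simp add: sum.remove[of _ n] )
    then show ?thesis by (auto simp: fix_parity_def)
  qed (simp add: fix_parity_def)
  then have "even (card (half_edges n (fix_parity n d)))"
    by (simp add: half_edges_def)
  moreover have fin: "finite (half_edges n (fix_parity n d))"
    by (auto simp: half_edges_def)
  ultimately show "pairings (half_edges n (fix_parity n d)) \<noteq> {}"
    by (intro pairings_nonempty)
  show "finite (pairings (half_edges n (fix_parity n d)))"
    using fin by (rule finite_pairings)
qed

text \<open>
  \<open>H\<close> is the graph with vertex set \<open>{1..k}\<close> and edge set \<open>E\<close>; \<open>G\<close> is the edge set of a graph on
  \<open>{1..n}\<close>. A tuple \<open>(v\<^sub>1, \<dots>, v\<^sub>k)\<close> is an extensional function on \<open>{1..k}\<close>.
\<close>

definition N_sub :: "nat \<Rightarrow> nat set set \<Rightarrow> nat \<Rightarrow> nat set set \<Rightarrow> nat" where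
  "N_sub k E n G = card {v \<in> {1..k} \<rightarrow>\<^sub>E {1..n}. inj_on v {1..k} \<and>
     (\<forall>i\<in>{1..k}. \<forall>j\<in>{1..k}. {i, j} \<in> E \<longrightarrow> {v i, v j} \<in> G)}"

definition N_ind :: "nat \<Rightarrow> nat set set \<Rightarrow> nat \<Rightarrow> nat set set \<Rightarrow> nat" where
  "N_ind k E n G = card {v \<in> {1..k} \<rightarrow>\<^sub>E {1..n}. inj_on v {1..k} \<and>
     (\<forall>i\<in>{1..k}. \<forall>j\<in>{1..k}. {i, j} \<in> E \<longrightarrow> {v i, v j} \<in> G) \<and>
     (\<forall>i\<in>{1..k}. \<forall>j\<in>{1..k}. i \<noteq> j \<and> {i, j} \<notin> E \<longrightarrow> {v i, v j} \<notin> G)}"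

definition deg1_vertices :: "'a set \<Rightarrow> 'a set set \<Rightarrow> 'a set" where
  "deg1_vertices V E = {v\<in>V. vertex_degree E v = 1}"

definition edges_in :: "'a set set \<Rightarrow> 'a set \<Rightarrow> nat" where
  "edges_in E S = card {e\<in>E. e \<subseteq> S}"

definition edges_between :: "'a set set \<Rightarrow> 'a set \<Rightarrow> 'a set \<Rightarrow> nat" where
  "edges_between E S T = card {e\<in>E. \<exists>i\<in>S. \<exists>j\<in>T. e = {i, j}}"

definition partitions_sub :: "'a set \<Rightarrow> 'a set set \<Rightarrow> ('a set \<times> 'a set \<times> 'a set) set" where
  "partitions_sub V E = {(S1, S2, S3). S1 \<union> S2 \<union> S3 = V - deg1_vertices V E \<and>
     S1 \<inter> S2 = {} \<and> S1 \<inter> S3 = {} \<and> S2 \<inter> S3 = {}}"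

definition partitions_ind :: "'a set \<Rightarrow> 'a set set \<Rightarrow> ('a set \<times> 'a set \<times> 'a set) set" where
  "partitions_ind V E = {(S1, S2, S3) \<in> partitions_sub V E.
     \<forall>i\<in>S2. \<forall>j\<in>S2 \<union> S3. i \<noteq> j \<longrightarrow> {i, j} \<in> E}"

definition objective ::
  "real \<Rightarrow> 'a set \<Rightarrow> 'a set set \<Rightarrow> 'a set \<times> 'a set \<times> 'a set \<Rightarrow> real" where
  "objective \<tau> V E = (\<lambda>(S1, S2, S3). real (card S1) - real (card S2) -
     (2 * real (edges_in E S1) + real (edges_between E S1 S3)
        + real (edges_between E S1 (deg1_vertices V E))
        - real (edges_between E S2 (deg1_vertices V E))) / (\<tau> - 1))"

definition B_sub :: "real \<Rightarrow> 'a set \<Rightarrow> 'a set set \<Rightarrow> real" where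
  "B_sub \<tau> V E = Max (objective \<tau> V E ` partitions_sub V E)"

definition B_ind :: "real \<Rightarrow> 'a set \<Rightarrow> 'a set set \<Rightarrow> real" where
  "B_ind \<tau> V E = Max (objective \<tau> V E ` partitions_ind V E)"

definition unique_maximizer :: "('b \<Rightarrow> real) \<Rightarrow> 'b set \<Rightarrow> bool" where
  "unique_maximizer f X \<longleftrightarrow> (\<exists>!P. is_arg_max f (\<lambda>P. P \<in> X) P)"

text \<open>
  The constants are extended nonnegative reals, so that their finiteness is a genuine claim.
  Here \<open>\<mu>\<close> is the mean of the degree distribution.
\<close>

definition non_edges :: "'a set \<Rightarrow> 'a set set \<Rightarrow> 'a set set" where
  "non_edges V E = {e. e \<subseteq> V \<and> card e = 2 \<and> e \<notin> E}"

definition A_sub :: "real \<Rightarrow> real \<Rightarrow> real \<Rightarrow> nat \<Rightarrow> nat set set \<Rightarrow> ennreal" where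
  "A_sub \<tau> c \<mu> k E =
     ennreal (c ^ k * \<mu> powr (- (real k / 2) * (\<tau> - 1))) *
     (\<integral>\<^sup>+x \<in> {1..k} \<rightarrow>\<^sub>E {0<..}.
        ennreal ((\<Prod>i\<in>{1..k}. x i) powr (-\<tau>) * (\<Prod>e\<in>E. 1 - exp (- (\<Prod>i\<in>e. x i))))
      \<partial>(\<Pi>\<^sub>M i\<in>{1..k}. lborel))"

definition A_ind :: "real \<Rightarrow> real \<Rightarrow> real \<Rightarrow> nat \<Rightarrow> nat set set \<Rightarrow> ennreal" where
  "A_ind \<tau> c \<mu> k E =
     ennreal (c ^ k * \<mu> powr (- (real k / 2) * (\<tau> - 1))) *
     (\<integral>\<^sup>+x \<in> {1..k} \<rightarrow>\<^sub>E {0<..}.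
        ennreal ((\<Prod>i\<in>{1..k}. x i) powr (-\<tau>) * (\<Prod>e\<in>E. 1 - exp (- (\<Prod>i\<in>e. x i))) *
          (\<Prod>e\<in>non_edges {1..k} E. exp (- (\<Prod>i\<in>e. x i))))
      \<partial>(\<Pi>\<^sub>M i\<in>{1..k}. lborel))"

text \<open>
  Since the limit is deterministic, convergence in probability depends only on the law of each
  member of the sequence; no coupling of the different \<open>M n\<close> is needed.
\<close>

definition conv_in_prob :: "(nat \<Rightarrow> 'a measure) \<Rightarrow> (nat \<Rightarrow> 'a \<Rightarrow> real) \<Rightarrow> real \<Rightarrow> bool" where
  "conv_in_prob M X a \<longleftrightarrow>
     (\<forall>\<epsilon>>0. (\<lambda>n. measure (M n) {\<omega> \<in> space (M n). \<bar>X n \<omega> - a\<bar> > \<epsilon>}) \<longlonglongrightarrow> 0)"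

end

(*
The number of half-edges is close to mu n, so for fixed degrees of order sqrt n the edges of the
erased model behave as if they were present independently with probability 1 - exp (-d_u d_v / (mu n));
this follows from the Bonferroni inequalities for the number of pairs joining u and v. In the window
eps sqrt (mu n) < d <= sqrt (mu n) / eps the first moment of the count is a Riemann sum of the
integral restricted to the box (eps, 1/eps]^k, and second moments factorize for disjoint tuples, so
Chebyshev's inequality applies.

Outside the window the first moment is controlled by integrability. In the variables u = log x the
logarithm of the integrand with respect to prod dx / x, with each 1 - exp (-x_i x_j) replaced by
min (1, x_i x_j), is a function which is additive along the decomposition of u into level sets.
On vectors with entries in {-1, 0, 1} it is tau - 1 times the objective of the optimization problem,
which is negative away from 0 because S3 = V is the only maximizer; for induced subgraphs, the decay
of exp (-x_i x_j) along non-edges rules out the partitions violating the constraint. Hence it is at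
most -delta |u|, and the integral over the complement of the box tends to 0 with eps.
*)

theory Submission
  imports Defs
begin

text \<open>Three points go beyond the sketch. A deviation of the total degree from \<mu> n need not
  be unlikely compared with the event that a given k-tuple falls into the window, whose probability
  is a negative power of n. It is therefore decoupled by using the law of large numbers only on the
  vertices outside the tuple; since \<tau> < 3 the degrees have infinite variance, and that law
  rests on truncation. Secondly, the Poisson approximation is available only for degrees of order
  sqrt n, whereas the first moment outside the window ranges over all degrees. There a cruder bound
  is used: present edges of weight below n by a union bound over half-edge pairs, heavier ones by 1,
  and absent edges through the heaviest one alone, whose decay is shared among all of them. Thirdly,
  the approximation must be uniform in degrees and tuples; it is proved along arbitrary sequences
  and made uniform by contradiction. Required edges are reduced to forbidden ones by
  inclusion-exclusion, at the cost of a factor 2 per edge in the error.\<close>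

section \<open>Counting pairings\<close>

lemma pairings_iff:
  "M \<in> pairings A \<longleftrightarrow> \<Union>M = A \<and> disjoint M \<and> (\<forall>e\<in>M. card e = 2)"
  by (auto simp: pairings_def partition_on_def)

text \<open>Deleting the prescribed pairs leaves an arbitrary pairing of the points they do not
  cover. All counts of pairings below recurse through this bijection.\<close>

lemma bij_betw_pairings_containing:
  assumes "disjoint R" "\<Union>R \<subseteq> A" "\<forall>e\<in>R. card e = 2"
  shows "bij_betw (\<lambda>M. M - R) {M \<in> pairings A. R \<subseteq> M} (pairings (A - \<Union>R))"
proof (rule bij_betw_byWitness[where f' = "\<lambda>M. M \<union> R"])
  have ne: "e \<noteq> {}" if "e \<in> R" for e using assms(3) that by auto
  show "\<forall>M\<in>{M \<in> pairings A. R \<subseteq> M}. M - R \<union> R = M" by auto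
  show "\<forall>M\<in>pairings (A - \<Union>R). M \<union> R - R = M"
  proof
    fix M assume "M \<in> pairings (A - \<Union>R)"
    then have "\<Union>M = A - \<Union>R" by (simp add: pairings_iff)
    \<comment> \<open>The members of \<open>R\<close> are nonempty sets of points that
      \<open>M\<close> does not cover.\<close>
    then have "M \<inter> R = {}" using ne by (metis Diff_disjoint Int_commute Union_Int_subset
      Union_empty_conv IntE equals0I subset_empty)
    then show "M \<union> R - R = M" by blast
  qed
  show "(\<lambda>M. M - R) ` {M \<in> pairings A. R \<subseteq> M} \<subseteq> pairings (A - \<Union>R)"
  proof safe
    fix M assume M: "M \<in> pairings A" "R \<subseteq> M"
    then have "A = \<Union>(M - R) \<union> \<Union>R" "\<Union>(M - R) \<inter> \<Union>R = {}"
      using disjointD[of M] by (fastforce simp: pairings_iff)+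
    then have "\<Union>(M - R) = A - \<Union>R" by blast
    then show "M - R \<in> pairings (A - \<Union>R)"
      using M by (simp add: pairings_iff disjoint_def)
  qed
  show "(\<lambda>M. M \<union> R) ` pairings (A - \<Union>R) \<subseteq> {M \<in> pairings A. R \<subseteq> M}"
  proof safe
    fix M assume M: "M \<in> pairings (A - \<Union>R)"
    then have U: "\<Union>M = A - \<Union>R" by (simp add: pairings_iff)
    have "disjoint (M \<union> R)"
      using M assms(1) U by (intro disjoint_union) (auto simp: pairings_iff)
    moreover have "\<Union>(M \<union> R) = A" using U assms(2) by auto
    ultimately show "M \<union> R \<in> pairings A" using M assms(3) by (auto simp: pairings_iff)
  qed
qed

lemma pairings_partner:
  assumes "M \<in> pairings A" "x \<in> A"
  obtains z where "z \<in> A" "z \<noteq> x" "{x, z} \<in> M"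
proof -
  from assms obtain e where e: "e \<in> M" "x \<in> e" "card e = 2" by (auto simp: pairings_iff)
  then obtain z where z: "e = {x, z}" "z \<noteq> x" by (metis card_2_iff insertE singletonD insert_commute)
  have "e \<subseteq> A" using e(1) assms(1) unfolding pairings_iff by blast
  then show ?thesis using that[of z] e z by simp
qed

lemma pairings_unique_partner:
  assumes "M \<in> pairings A" "{x, z} \<in> M" "{x, z'} \<in> M"
  shows "z = z'"
proof -
  have "disjoint M" using assms(1) by (simp add: pairings_iff)
  then have "{x, z} = {x, z'}"
    using disjointD[OF _ assms(2,3)] by blast
  then show ?thesis by (metis doubleton_eq_iff)
qed

text \<open>The double factorial (n - 1)!!. Odd arguments obey the same recursion, so ratios can be
  estimated without a parity hypothesis.\<close>

fun matchings :: "nat \<Rightarrow> nat" where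
  "matchings 0 = 1"
| "matchings (Suc 0) = 1"
| "matchings (Suc (Suc n)) = (n + 1) * matchings n"

lemma matchings_pos: "matchings n > 0"
  by (induction n rule: matchings.induct) auto

text \<open>Fix one point: its partner is any of the \<open>card A - 1\<close> others, and the
  remaining points are then paired freely.\<close>

lemma card_pairings:
  assumes "finite A" "even (card A)"
  shows "card (pairings A) = matchings (card A)"
  using assms
proof (induction "card A" arbitrary: A rule: less_induct)
  case less
  show ?case
  proof (cases "A = {}")
    case True
    have "pairings ({} :: 'a set) = {{}}"
      unfolding pairings_def partition_on_empty by auto
    then show ?thesis unfolding True by simp
  next
    case False
    then obtain x where x: "x \<in> A" by blast
    have c: "card A \<noteq> 0" using False less.prems by simp
    then obtain L where L: "card A = Suc (Suc L)" using less.prems(2)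
      by (metis even_Suc not0_implies_Suc even_zero)
    let ?S = "\<lambda>z. {M \<in> pairings A. {{x, z}} \<subseteq> M}"
    have "pairings A = (\<Union>z\<in>A - {x}. ?S z)"
    proof (rule set_eqI, rule iffI)
      fix M assume M: "M \<in> pairings A"
      show "M \<in> (\<Union>z\<in>A - {x}. ?S z)" by (rule pairings_partner[OF M x]) (use M in auto)
    qed blast
    also have "card \<dots> = (\<Sum>z\<in>A - {x}. card (?S z))"
      using less.prems by (intro card_UN_disjoint)
        (auto intro: finite_subset[OF _ finite_pairings[OF less.prems(1)]]
            dest: pairings_unique_partner)
    also have "\<dots> = (\<Sum>z\<in>A - {x}. matchings L)"
    proof (intro sum.cong refl)
      fix z assume z: "z \<in> A - {x}"
      have "card (?S z) = card (pairings (A - \<Union>{{x, z}}))"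
        using x z by (intro bij_betw_same_card[OF bij_betw_pairings_containing]) auto
      also have "\<dots> = matchings (card (A - \<Union>{{x, z}}))"
        using less.prems x z L by (intro less.hyps) (auto simp: card_Diff_subset)
      also have "card (A - \<Union>{{x, z}}) = L"
        using x z L by (auto simp: card_Diff_subset)
      finally show "card (?S z) = matchings L" .
    qed
    also have "\<dots> = matchings (card A)"
      using x L less.prems by simp
    finally show ?thesis .
  qed
qed

lemma card_Union_pairs:
  assumes "disjoint R" "\<forall>e\<in>R. card e = 2"
  shows "card (\<Union>R) = 2 * card R"
proof -
  have "card (\<Union>R) = (\<Sum>e\<in>R. card e)"
    using assms by (intro card_Union_disjoint) (auto simp: card_ge_0_finite)
  with assms show ?thesis by simp
qed

lemma card_pairings_containing:
  assumes "finite A" "even (card A)" "disjoint R" "\<Union>R \<subseteq> A" "\<forall>e\<in>R. card e = 2"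
  shows "card {M \<in> pairings A. R \<subseteq> M} = matchings (card A - 2 * card R)"
proof -
  have "card (A - \<Union>R) = card A - 2 * card R"
    using assms card_Union_pairs[OF assms(3,5)] by (subst card_Diff_subset) (auto intro: finite_subset)
  then show ?thesis
    using bij_betw_same_card[OF bij_betw_pairings_containing[OF assms(3-5)]] assms
    by (simp add: card_pairings)
qed

text \<open>The partners of the points of \<open>X\<close> are revealed one at a time. With
  \<open>card A = N + 2\<close>, a revealed partner avoids \<open>Y\<close> with probability at most
  1 - \<open>card Y / (N + 1)\<close>, hence at most \<open>exp (- card Y / L)\<close>. A revealed
  pair may use up two points of \<open>X\<close>, which is the origin of the 2 in the exponent.
  \<open>L\<close> is a fixed bound on \<open>card A\<close>, so the exponent survives the shrinking
  of \<open>A\<close> in the induction.\<close>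

lemma card_pairings_avoiding_le:
  assumes "finite A" "even (card A)" "X \<subseteq> A" "Y \<subseteq> A" "X \<inter> Y = {}" "card A \<le> L"
  shows "real (card {M \<in> pairings A. \<forall>x\<in>X. \<forall>y\<in>Y. {x, y} \<notin> M})
           \<le> matchings (card A) * exp (- real (card X) * real (card Y) / (2 * real L))"
  using assms
proof (induction "card X" arbitrary: X A rule: less_induct)
  case less
  let ?no = "\<lambda>X M. \<forall>x\<in>X. \<forall>y\<in>Y. {x, y} \<notin> M"
  have fin: "finite (pairings A)" using less.prems by (simp add: finite_pairings)
  show ?case
  proof (cases "X = {}")
    case True
    then show ?thesis using less.prems by (simp add: card_pairings)
  next
    case False
    then obtain x where x: "x \<in> X" by blast
    have xA: "x \<in> A" "x \<notin> Y" using x less.prems by auto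
    have "card A \<noteq> 0" using xA less.prems by auto
    then obtain N where N: "card A = Suc (Suc N)" using less.prems(2)
      by (metis even_Suc not0_implies_Suc even_zero)
    let ?B = "A - {x} - Y"
    let ?b = "real (card Y)"
    \<comment> \<open>Real subtraction: for a single point of \<open>X\<close> this value is at
      least 1, which only weakens the estimate \<open>each\<close>.\<close>
    let ?q = "exp (- (real (card X) - 2) * ?b / (2 * real L))"
    have finY: "finite Y" using less.prems finite_subset by blast
    have finX: "finite X" using less.prems finite_subset by blast
    have L: "L > 0" using less.prems N by auto
    have sub: "{M \<in> pairings A. ?no X M} \<subseteq> (\<Union>z\<in>?B. {M \<in> pairings A. {{x,z}} \<subseteq> M \<and> ?no X M})"
    proof
      fix M assume M: "M \<in> {M \<in> pairings A. ?no X M}"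
      then obtain z where "z \<in> A" "z \<noteq> x" "{x, z} \<in> M" using xA by (auto elim: pairings_partner)
      then show "M \<in> (\<Union>z\<in>?B. {M \<in> pairings A. {{x,z}} \<subseteq> M \<and> ?no X M})" using M x by auto
    qed
    have each: "real (card {M \<in> pairings A. {{x,z}} \<subseteq> M \<and> ?no X M}) \<le> matchings N * ?q"
      if z: "z \<in> ?B" for z
    proof -
      let ?A' = "A - \<Union>{{x,z}}" and ?X' = "X - {x,z}"
      have bij: "bij_betw (\<lambda>M. M - {{x,z}}) {M \<in> pairings A. {{x,z}} \<subseteq> M} (pairings ?A')"
        using z xA by (intro bij_betw_pairings_containing) auto
      have "x \<noteq> z" "z \<in> A" using z by auto
      then have cA': "card ?A' = N" using xA N by (simp add: card_Diff_subset)
      have A': "finite ?A'" "even (card ?A')" "?X' \<subseteq> ?A'" "Y \<subseteq> ?A'" "?X' \<inter> Y = {}" "card ?A' \<le> L"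
        using less.prems z N cA' xA by auto
      have "card {M \<in> pairings A. {{x,z}} \<subseteq> M \<and> ?no X M} \<le> card {M \<in> pairings ?A'. ?no ?X' M}"
      proof (rule card_inj_on_le[where f = "\<lambda>M. M - {{x,z}}"])
        show "inj_on (\<lambda>M. M - {{x,z}}) {M \<in> pairings A. {{x,z}} \<subseteq> M \<and> ?no X M}"
          using bij_betw_imp_inj_on[OF bij] by (rule inj_on_subset) blast
        show "(\<lambda>M. M - {{x,z}}) ` {M \<in> pairings A. {{x,z}} \<subseteq> M \<and> ?no X M} \<subseteq> {M \<in> pairings ?A'. ?no ?X' M}"
        proof (rule image_subsetI)
          fix M assume M: "M \<in> {M \<in> pairings A. {{x,z}} \<subseteq> M \<and> ?no X M}"
          then have "M - {{x,z}} \<in> pairings ?A'"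
            using bij_betwE[OF bij] by simp
          then show "M - {{x,z}} \<in> {M \<in> pairings ?A'. ?no ?X' M}" using M by blast
        qed
        show "finite {M \<in> pairings ?A'. ?no ?X' M}" 
          using finite_pairings[of ?A'] less.prems by simp
      qed
      also have "real \<dots> \<le> matchings (card ?A') * exp (- real (card ?X') * ?b / (2 * real L))"
      proof (intro less.hyps)
        show "card ?X' < card X" using x finX by (intro psubset_card_mono) auto
      qed (fact A')+
      also have "\<dots> \<le> matchings N * ?q"
      proof -
        have "card X \<le> card ?X' + card {x,z}" 
          using card_mono[of "?X' \<union> {x,z}" X] finX
          by (intro order.trans[OF card_mono card_Un_le]) auto
        then have "real (card X) - 2 \<le> real (card ?X')" using card_insert_le_m1[of 2 "{z}" x] by auto
        then have "(real (card X) - 2) * ?b \<le> real (card ?X') * ?b" by (intro mult_right_mono) auto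
        then have "- real (card ?X') * ?b / (2 * real L) \<le> - (real (card X) - 2) * ?b / (2 * real L)"
          by (intro divide_right_mono) (simp_all add: algebra_simps)
        then show ?thesis unfolding cA' by (intro mult_left_mono) auto
      qed
      finally show ?thesis by simp
    qed
    have "real (card {M \<in> pairings A. ?no X M}) \<le> real (card (\<Union>z\<in>?B. {M \<in> pairings A. {{x,z}} \<subseteq> M \<and> ?no X M}))"
      using sub less.prems fin by (intro of_nat_mono card_mono) auto
    also have "\<dots> \<le> real (\<Sum>z\<in>?B. card {M \<in> pairings A. {{x,z}} \<subseteq> M \<and> ?no X M})"
      using less.prems by (intro of_nat_mono card_UN_le) auto
    also have "\<dots> \<le> (\<Sum>z\<in>?B. matchings N * ?q)"
      unfolding of_nat_sum by (intro sum_mono each)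
    also have "\<dots> = real (card ?B) * (matchings N * ?q)" by simp
    also have "real (card ?B) = real (N + 1) - ?b"
    proof -
      have "card (A - {x} - Y) = card (A - {x}) - card Y" 
        using less.prems xA finY by (intro card_Diff_subset) auto
      moreover have "card Y \<le> card (A - {x})" using less.prems xA by (intro card_mono) auto
      ultimately show ?thesis using N xA less.prems by auto
    qed
    also have "(real (N + 1) - ?b) * (matchings N * ?q) \<le> (real (N + 1) * exp (- ?b / L)) * (matchings N * ?q)"
    proof (intro mult_right_mono)
      have "real (N + 1) - ?b = real (N + 1) * (1 - ?b / (N + 1))" by (simp add: field_simps)
      also have "\<dots> \<le> real (N + 1) * (1 - ?b / L)"
        using less.prems N by (intro mult_left_mono diff_left_mono divide_left_mono) (auto)
      also have "\<dots> \<le> real (N + 1) * exp (- ?b / L)"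
        using exp_ge_add_one_self[of "- ?b / L"] by (intro mult_left_mono) auto
      finally show "real (N + 1) - ?b \<le> real (N + 1) * exp (- ?b / L)" .
    qed auto
    also have "\<dots> = matchings (card A) * (exp (- ?b / L) * ?q)" using N by (simp add: algebra_simps)
    \<comment> \<open>The gain of one exposure pays exactly for two points of \<open>X\<close> at
      rate \<open>card Y / (2 * L)\<close> each.\<close>
    also have "exp (- ?b / L) * ?q = exp (- real (card X) * ?b / (2 * real L))"
      using L by (simp add: exp_add[symmetric] field_simps)
    finally show ?thesis .
  qed
qed

section \<open>Bonferroni inequalities for pairs in a random pairing\<close>

lemma alternating_binomial_partial_sum:
  "(\<Sum>i\<le>r. (-1)^i * real (Suc x choose i)) = (-1)^r * real (x choose r)"
  by (induction r) (auto simp: algebra_simps)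

text \<open>Inclusion-exclusion for the indicator of x = 0, stopped at order r. For x = y + 1 the
  truncated sum telescopes to y choose r up to sign, which Pascal's rule bounds by the next term of
  the expansion. The absolute value makes the bound independent of the parity of r.\<close>

lemma bonferroni_pointwise:
  "\<bar>(if x = 0 then 1 else 0) - (\<Sum>i\<le>r. (-1)^i * real (x choose i))\<bar> \<le> real (x choose Suc r)"
proof (cases x)
  case 0
  have "(\<Sum>i\<le>r. (-1)^i * real (0 choose i)) = (\<Sum>i\<le>r. if i = 0 then 1 else 0)"
    by (intro sum.cong) auto
  then show ?thesis using 0 by simp
next
  case (Suc y)
  have "\<bar>(-1)^r * real (y choose r)\<bar> = real (y choose r)" by (simp add: abs_mult)
  then show ?thesis using Suc by (simp add: alternating_binomial_partial_sum del: binomial_Suc_Suc) simp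
qed

text \<open>Only pairwise disjoint pairs can occur together in one pairing, so these are the
  families that contribute to the moments of \<open>card (P \<inter> M)\<close>.\<close>

definition disjoint_subfamilies :: "'a set set \<Rightarrow> nat \<Rightarrow> 'a set set set" where
  "disjoint_subfamilies P r = {R. R \<subseteq> P \<and> card R = r \<and> disjoint R}"

lemma finite_disjoint_subfamilies: "finite P \<Longrightarrow> finite (disjoint_subfamilies P r)"
  by (rule finite_subset[of _ "Pow P"]) (auto simp: disjoint_subfamilies_def)

text \<open>Double counting of the r-element families \<open>R\<close> contained in both
  \<open>P\<close> and \<open>M\<close>. Such an \<open>R\<close> is disjoint because
  \<open>M\<close> is, and it extends to a pairing in \<open>matchings (card A - 2 * r)\<close>
  ways.\<close>

lemma sum_binomial_pairings:
  assumes A: "finite A" "even (card A)" and P: "finite P" "\<forall>e\<in>P. e \<subseteq> A \<and> card e = 2"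
  shows "(\<Sum>M\<in>pairings A. card (P \<inter> M) choose r)
           = card (disjoint_subfamilies P r) * matchings (card A - 2 * r)"
proof -
  have fin: "finite (pairings A)" "finite (disjoint_subfamilies P r)"
    using A P by (auto simp: finite_pairings finite_disjoint_subfamilies)
  have "(\<Sum>M\<in>pairings A. card (P \<inter> M) choose r) = (\<Sum>M\<in>pairings A. card {R\<in>disjoint_subfamilies P r. R \<subseteq> M})"
  proof (intro sum.cong refl)
    fix M assume "M \<in> pairings A"
    then have d: "disjoint M" by (simp add: pairings_iff)
    have "card (P \<inter> M) choose r = card {R. R \<subseteq> P \<inter> M \<and> card R = r}"
      using P by (intro n_subsets[symmetric]) auto
    also have "{R. R \<subseteq> P \<inter> M \<and> card R = r} = {R\<in>disjoint_subfamilies P r. R \<subseteq> M}"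
      using pairwise_subset[OF d] by (auto simp: disjoint_subfamilies_def)
    finally show "card (P \<inter> M) choose r = card {R\<in>disjoint_subfamilies P r. R \<subseteq> M}" .
  qed
  also have "\<dots> = (\<Sum>R\<in>disjoint_subfamilies P r. card {M\<in>pairings A. R \<subseteq> M})"
    by (rule sum_multicount_gen) (use fin in auto)
  also have "\<dots> = (\<Sum>R\<in>disjoint_subfamilies P r. matchings (card A - 2 * r))"
  proof (intro sum.cong refl)
    fix R assume "R \<in> disjoint_subfamilies P r"
    then have R: "R \<subseteq> P" "card R = r" "disjoint R" by (auto simp: disjoint_subfamilies_def)
    then show "card {M\<in>pairings A. R \<subseteq> M} = matchings (card A - 2 * r)"
      using A P by (subst card_pairings_containing) auto
  qed
  finally show ?thesis by simp
qed

text \<open>Double counting of families with a marked pair: removing the mark from a family of size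
  r + 1 leaves a family of size r and a pair disjoint from it.\<close>

lemma card_disjoint_subfamilies_Suc:
  assumes P: "finite P" "\<forall>e\<in>P. card e = 2"
  shows "Suc r * card (disjoint_subfamilies P (Suc r))
           = (\<Sum>R\<in>disjoint_subfamilies P r. card {e\<in>P. e \<inter> \<Union>R = {}})"
proof -
  let ?X = "SIGMA R:disjoint_subfamilies P (Suc r). R"
  let ?Y = "SIGMA R:disjoint_subfamilies P r. {e\<in>P. e \<inter> \<Union>R = {}}"
  have finR: "finite R" if "R \<in> disjoint_subfamilies P r" for R r
    using that P finite_subset by (auto simp: disjoint_subfamilies_def)
  have ne: "e \<noteq> {}" if "e \<in> P" for e using that P by auto
  have "bij_betw (\<lambda>(R, e). (R - {e}, e)) ?X ?Y"
  proof (rule bij_betw_byWitness[where f' = "\<lambda>(R, e). (insert e R, e)"])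
    show "\<forall>a\<in>?Y. (case case a of (R, e) \<Rightarrow> (insert e R, e) of (R, e) \<Rightarrow> (R - {e}, e)) = a"
      using ne by (auto simp: disjoint_subfamilies_def)
    show "(\<lambda>(R, e). (R - {e}, e)) ` ?X \<subseteq> ?Y"
    proof (rule image_subsetI)
      fix a assume "a \<in> ?X"
      then obtain R e where a: "a = (R, e)" and R: "R \<in> disjoint_subfamilies P (Suc r)" and e: "e \<in> R"
        by auto
      have d: "disjoint R" "R \<subseteq> P" "card R = Suc r" using R by (auto simp: disjoint_subfamilies_def)
      have "e \<inter> f = {}" if "f \<in> R - {e}" for f using disjointD[OF d(1) e, of f] that by auto
      then have "e \<inter> \<Union>(R - {e}) = {}" by blast
      moreover have "disjoint (R - {e})" using d(1) by (rule pairwise_subset) auto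
      ultimately show "(\<lambda>(R, e). (R - {e}, e)) a \<in> ?Y"
        using d e finR[OF R] by (auto simp: a disjoint_subfamilies_def)
    qed
    show "(\<lambda>(R, e). (insert e R, e)) ` ?Y \<subseteq> ?X"
    proof (rule image_subsetI)
      fix a assume "a \<in> ?Y"
      then obtain R e where a: "a = (R, e)" and R: "R \<in> disjoint_subfamilies P r"
        and e: "e \<in> P" "e \<inter> \<Union>R = {}" by auto
      have d: "disjoint R" "R \<subseteq> P" "card R = r" using R by (auto simp: disjoint_subfamilies_def)
      have "e \<notin> R" using e(2) ne[OF e(1)] by blast
      moreover have "disjoint (insert e R)" using d(1) e by (auto simp: disjoint_def)
      ultimately show "(\<lambda>(R, e). (insert e R, e)) a \<in> ?X"
        using d e finR[OF R] by (auto simp: a disjoint_subfamilies_def)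
    qed
  qed auto
  then have "card ?X = card ?Y" by (rule bij_betw_same_card)
  moreover have "card ?X = (\<Sum>R\<in>disjoint_subfamilies P (Suc r). card R)"
    using P finR by (intro card_SigmaI) (auto simp: finite_disjoint_subfamilies)
  moreover have "\<dots> = (\<Sum>R\<in>disjoint_subfamilies P (Suc r). Suc r)"
    by (intro sum.cong) (auto simp: disjoint_subfamilies_def)
  moreover have "card ?Y = (\<Sum>R\<in>disjoint_subfamilies P r. card {e\<in>P. e \<inter> \<Union>R = {}})"
    using P by (intro card_SigmaI) (auto simp: finite_disjoint_subfamilies)
  ultimately show ?thesis by (simp add: mult.commute)
qed

text \<open>The family covers 2 r points, and each of these lies in at most \<Delta> pairs of
  \<open>P\<close>.\<close>

lemma card_disjoint_from_family_ge:
  assumes P: "finite P" "\<forall>e\<in>P. card e = 2" and \<Delta>: "\<And>h. card {e\<in>P. h \<in> e} \<le> \<Delta>"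
    and R: "R \<in> disjoint_subfamilies P r"
  shows "real (card {e\<in>P. e \<inter> \<Union>R = {}}) \<ge> real (card P) - 2 * real r * real \<Delta>"
proof -
  have R': "disjoint R" "R \<subseteq> P" "card R = r" using R by (auto simp: disjoint_subfamilies_def)
  have c: "card (\<Union>R) = 2 * r" using card_Union_pairs[OF R'(1)] R' P by auto
  have "finite R" using R' P finite_subset by blast
  then have fU: "finite (\<Union>R)" using R' P by (auto simp: card_ge_0_finite subset_iff)
  have "card P = card ({e\<in>P. e \<inter> \<Union>R = {}} \<union> (\<Union>h\<in>\<Union>R. {e\<in>P. h \<in> e}))"
    by (rule arg_cong[where f = card]) auto
  also have "\<dots> \<le> card {e\<in>P. e \<inter> \<Union>R = {}} + card (\<Union>h\<in>\<Union>R. {e\<in>P. h \<in> e})"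
    by (rule card_Un_le)
  also have "card (\<Union>h\<in>\<Union>R. {e\<in>P. h \<in> e}) \<le> (\<Sum>h\<in>\<Union>R. card {e\<in>P. h \<in> e})"
    using fU by (rule card_UN_le)
  also have "\<dots> \<le> (\<Sum>h\<in>\<Union>R. \<Delta>)" by (intro sum_mono \<Delta>)
  also have "\<dots> = 2 * r * \<Delta>" using c by simp
  finally have "card P \<le> card {e\<in>P. e \<inter> \<Union>R = {}} + 2 * r * \<Delta>" by simp
  then have "real (card P) \<le> real (card {e\<in>P. e \<inter> \<Union>R = {}} + 2 * r * \<Delta>)" by (rule of_nat_mono)
  then show ?thesis by simp
qed

text \<open>For a family \<open>P\<close> of pairs in \<open>A\<close>, this is the mean of
  \<open>card (P \<inter> M) choose r\<close> over a uniform pairing \<open>M\<close>, that is, the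
  r-th factorial moment divided by r!.\<close>

definition matching_moment :: "'a set \<Rightarrow> 'a set set \<Rightarrow> nat \<Rightarrow> real" where
  "matching_moment A P r = real (card (disjoint_subfamilies P r)) * matchings (card A - 2 * r) / matchings (card A)"

lemma matching_moment_0: "finite P \<Longrightarrow> matching_moment A P 0 = 1"
proof -
  assume "finite P"
  then have "R = {}" if "R \<subseteq> P" "card R = 0" for R using that finite_subset by fastforce
  then have "disjoint_subfamilies P 0 = {{}}" by (auto simp: disjoint_subfamilies_def)
  then show ?thesis using matchings_pos[of "card A"] by (simp add: matching_moment_def)
qed

lemma matching_moment_nonneg: "matching_moment A P r \<ge> 0"
  by (simp add: matching_moment_def)

lemma matching_moment_bonferroni:
  assumes A: "finite A" "even (card A)" and P: "finite P" "\<forall>e\<in>P. e \<subseteq> A \<and> card e = 2"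
  shows "\<bar>real (card {M\<in>pairings A. P \<inter> M = {}}) / card (pairings A)
            - (\<Sum>i\<le>r. (-1)^i * matching_moment A P i)\<bar> \<le> matching_moment A P (Suc r)"
proof -
  let ?c = "real (card (pairings A))"
  have c: "?c = matchings (card A)" "?c > 0" using A matchings_pos by (simp_all add: card_pairings)
  have mm: "matching_moment A P i = (\<Sum>M\<in>pairings A. real (card (P \<inter> M) choose i)) / ?c" for i
    using sum_binomial_pairings[OF assms, of i] c
    by (simp add: matching_moment_def of_nat_sum[symmetric] del: of_nat_sum)
  have fin: "finite (pairings A)" using A by (simp add: finite_pairings)
  have "{M\<in>pairings A. P \<inter> M = {}} = {M\<in>pairings A. card (P \<inter> M) = 0}" using P by auto
  then have ind: "real (card {M\<in>pairings A. P \<inter> M = {}}) = (\<Sum>M\<in>pairings A. if card (P \<inter> M) = 0 then 1 else 0)"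
    using fin by (simp add: sum.If_cases Int_def)
  have "(\<Sum>i\<le>r. (-1)^i * matching_moment A P i)
      = (\<Sum>M\<in>pairings A. \<Sum>i\<le>r. (-1)^i * real (card (P \<inter> M) choose i)) / ?c"
    by (subst sum.swap) (simp add: mm sum_divide_distrib sum_distrib_left)
  then have "real (card {M\<in>pairings A. P \<inter> M = {}}) / ?c - (\<Sum>i\<le>r. (-1)^i * matching_moment A P i)
      = (\<Sum>M\<in>pairings A. (if card (P \<inter> M) = 0 then 1 else 0) - (\<Sum>i\<le>r. (-1)^i * real (card (P \<inter> M) choose i))) / ?c"
    by (simp add: ind sum_subtractf diff_divide_distrib)
  also have "\<bar>\<dots>\<bar> \<le> (\<Sum>M\<in>pairings A. real (card (P \<inter> M) choose Suc r)) / ?c"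
    unfolding abs_divide using c
    by (intro divide_mono order.trans[OF sum_abs] sum_mono bonferroni_pointwise) auto
  finally show ?thesis unfolding mm .
qed

text \<open>A disjoint family of size r extends to size r + 1 in at least
  \<open>card P - 2 * r * \<Delta>\<close> and at most \<open>card P\<close> ways, and prescribing
  one more pair divides the number of completions by \<open>card A - 2 * r - 1\<close>. A Poisson
  variable has the exact recursion with ratio \<open>card P / card A\<close>; the two corrections
  measure the distance to it.\<close>

lemma matching_moment_Suc:
  assumes A: "finite A" "2 * r + 2 \<le> card A" and P: "finite P" "\<forall>e\<in>P. card e = 2"
    and \<Delta>: "\<And>h. card {e\<in>P. h \<in> e} \<le> \<Delta>"
  shows "real (Suc r) * matching_moment A P (Suc r) * (real (card A) - 2 * r - 1) \<le> matching_moment A P r * card P"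
    and "matching_moment A P r * (real (card P) - 2 * r * \<Delta>)
           \<le> real (Suc r) * matching_moment A P (Suc r) * (real (card A) - 2 * r - 1)"
proof -
  obtain N where N: "card A = Suc (Suc N) + 2 * r" using A(2) by (intro that[of "card A - 2 * r - 2"]) simp
  \<comment> \<open>The share of pairings that contain a given disjoint family of size r, with the
    next factor N + 1 split off.\<close>
  define m where "m = real (matchings N) * real (N + 1) / real (matchings (card A))"
  have m: "m \<ge> 0" by (simp add: m_def)
  have e1: "matching_moment A P r = real (card (disjoint_subfamilies P r)) * m"
    by (simp add: matching_moment_def m_def N algebra_simps)
  have "real (Suc r) * matching_moment A P (Suc r) * (real (card A) - 2 * r - 1)
      = real (Suc r * card (disjoint_subfamilies P (Suc r))) * m"
    by (simp add: matching_moment_def m_def N field_simps)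
  also have "\<dots> = (\<Sum>R\<in>disjoint_subfamilies P r. real (card {e\<in>P. e \<inter> \<Union>R = {}})) * m"
    unfolding card_disjoint_subfamilies_Suc[OF P] by simp
  finally have e2: "real (Suc r) * matching_moment A P (Suc r) * (real (card A) - 2 * r - 1)
     = (\<Sum>R\<in>disjoint_subfamilies P r. real (card {e\<in>P. e \<inter> \<Union>R = {}})) * m" .
  have "(\<Sum>R\<in>disjoint_subfamilies P r. real (card {e\<in>P. e \<inter> \<Union>R = {}})) \<le> (\<Sum>R\<in>disjoint_subfamilies P r. real (card P))"
    using P by (intro sum_mono of_nat_mono card_mono) auto
  then show "real (Suc r) * matching_moment A P (Suc r) * (real (card A) - 2 * r - 1) \<le> matching_moment A P r * card P"
    unfolding e2 e1 using mult_right_mono[OF _ m] by (fastforce simp: algebra_simps)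
  have "(\<Sum>R\<in>disjoint_subfamilies P r. real (card P) - 2 * r * \<Delta>) \<le> (\<Sum>R\<in>disjoint_subfamilies P r. real (card {e\<in>P. e \<inter> \<Union>R = {}}))"
    using card_disjoint_from_family_ge[OF P \<Delta>] by (intro sum_mono) simp
  then show "matching_moment A P r * (real (card P) - 2 * r * \<Delta>)
           \<le> real (Suc r) * matching_moment A P (Suc r) * (real (card A) - 2 * r - 1)"
    unfolding e2 e1 using mult_right_mono[OF _ m] by (fastforce simp: algebra_simps)
qed

section \<open>Poisson limit\<close>

text \<open>The mean \<open>S j / L j\<close> is bounded but need not converge, so factorial moments
  are compared with its powers rather than with limits. The recursion multiplies by this mean, up to
  the factor \<open>L j / (L j - 2 * r - 1)\<close>, which tends to 1, and up to a loss of order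
  \<open>\<Delta> j / L j\<close>. The bound \<Lambda> keeps null sequences null when they are
  multiplied by powers of the mean.\<close>

lemma poisson_moment_limit:
  fixes p :: "nat \<Rightarrow> nat \<Rightarrow> real" and S L \<Delta> :: "nat \<Rightarrow> real"
  assumes p0: "\<And>j. p 0 j = 1" and nonneg: "\<And>r j. p r j \<ge> 0"
    and up: "\<And>r. eventually (\<lambda>j. real (Suc r) * p (Suc r) j * (L j - 2 * real r - 1) \<le> p r j * S j) sequentially"
    and low: "\<And>r. eventually (\<lambda>j. p r j * (S j - 2 * real r * \<Delta> j) \<le> real (Suc r) * p (Suc r) j * (L j - 2 * real r - 1)) sequentially"
    and L: "filterlim L at_top sequentially" and \<Delta>: "(\<lambda>j. \<Delta> j / L j) \<longlonglongrightarrow> 0"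
    and S: "\<And>j. 0 \<le> S j / L j" "\<And>j. S j / L j \<le> \<Lambda>"
  shows "(\<lambda>j. fact r * p r j - (S j / L j) ^ r) \<longlonglongrightarrow> 0"
proof (induction r)
  case 0
  then show ?case by (simp add: p0)
next
  case (Suc r)
  define u where "u j = S j / L j" for j
  define t where "t j = fact r * p r j" for j
  define a where "a j = L j / (L j - 2 * real r - 1)" for j
  have u: "0 \<le> u j" "u j \<le> \<Lambda>" for j using S by (auto simp: u_def)
  have \<Lambda>: "\<Lambda> \<ge> 0" using u[of 0] by linarith
  have IH: "(\<lambda>j. t j - u j ^ r) \<longlonglongrightarrow> 0" using Suc by (simp add: t_def u_def)
  have Lbig: "eventually (\<lambda>j. L j > 2 * real r + 1) sequentially"
    using L by (auto simp: filterlim_at_top_dense)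
  have inv: "(\<lambda>j. (2 * real r + 1) / L j) \<longlonglongrightarrow> 0"
    by (rule real_tendsto_divide_at_top[OF tendsto_const L])
  have "(\<lambda>j. 1 / (1 - (2 * real r + 1) / L j)) \<longlonglongrightarrow> 1 / (1 - 0)"
    by (intro tendsto_intros inv) auto
  moreover have "eventually (\<lambda>j. 1 / (1 - (2 * real r + 1) / L j) = a j) sequentially"
    using Lbig
  proof eventually_elim
    case (elim j)
    then have "1 - (2 * real r + 1) / L j = (L j - 2 * real r - 1) / L j"
      by (simp add: diff_divide_distrib add_divide_distrib)
    then show ?case by (simp add: a_def)
  qed
  ultimately have a: "a \<longlonglongrightarrow> 1"
    using Lim_transform_eventually by force
  have ub: "\<bar>u j ^ m\<bar> \<le> \<Lambda> ^ m" for j m using u[of j] by (simp add: power_mono)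
  have null: "(\<lambda>j. f j * u j ^ m) \<longlonglongrightarrow> 0" if "f \<longlonglongrightarrow> 0" for f m
    by (rule Lim_null_comparison[OF _ tendsto_mult_left_zero[OF tendsto_rabs_zero[OF that], of "\<Lambda> ^ m"]])
       (auto simp: abs_mult intro!: mult_left_mono always_eventually ub)
  have hi: "(\<lambda>j. t j * u j * a j - u j ^ Suc r) \<longlonglongrightarrow> 0"
  proof -
    have "(\<lambda>j. (t j - u j ^ r) * u j ^ 1 * a j + (a j - 1) * u j ^ Suc r) \<longlonglongrightarrow> 0 * 1 + 0"
      by (intro tendsto_add tendsto_mult null IH a) (use tendsto_diff[OF a tendsto_const[of 1]] in auto)
    then show ?thesis by (simp add: algebra_simps)
  qed
  have tu: "(\<lambda>j. t j * (\<Delta> j / L j)) \<longlonglongrightarrow> 0"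
  proof -
    have "(\<lambda>j. (t j - u j ^ r) * (\<Delta> j / L j) + (\<Delta> j / L j) * u j ^ r) \<longlonglongrightarrow> 0 * 0 + 0"
      by (intro tendsto_add tendsto_mult null IH \<Delta>)
    then show ?thesis by (simp add: algebra_simps)
  qed
  have lo: "(\<lambda>j. t j * u j * a j - u j ^ Suc r - 2 * real r * (t j * (\<Delta> j / L j)) * a j) \<longlonglongrightarrow> 0"
    using tendsto_diff[OF hi tendsto_mult[OF tendsto_mult[OF tendsto_const[of "2 * real r"] tu] a]] by simp
  show ?case
  proof (rule tendsto_sandwich[OF _ _ lo hi])
    show "eventually (\<lambda>j. fact (Suc r) * p (Suc r) j - (S j / L j) ^ Suc r \<le> t j * u j * a j - u j ^ Suc r) sequentially"
      using up[of r] Lbig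
    proof eventually_elim
      case (elim j)
      then have "real (Suc r) * p (Suc r) j \<le> p r j * S j / (L j - 2 * real r - 1)"
        by (simp add: pos_le_divide_eq)
      then have "fact r * (real (Suc r) * p (Suc r) j) \<le> fact r * (p r j * S j / (L j - 2 * real r - 1))"
        by (intro mult_left_mono) auto
      also have "\<dots> = t j * u j * a j"
        using elim by (simp add: t_def u_def a_def)
      finally show ?case by (simp add: u_def algebra_simps)
    qed
    show "eventually (\<lambda>j. t j * u j * a j - u j ^ Suc r - 2 * real r * (t j * (\<Delta> j / L j)) * a j
        \<le> fact (Suc r) * p (Suc r) j - (S j / L j) ^ Suc r) sequentially"
      using low[of r] Lbig
    proof eventually_elim
      case (elim j)
      then have "p r j * (S j - 2 * real r * \<Delta> j) / (L j - 2 * real r - 1) \<le> real (Suc r) * p (Suc r) j"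
        by (simp add: pos_divide_le_eq)
      then have "fact r * (p r j * (S j - 2 * real r * \<Delta> j) / (L j - 2 * real r - 1)) \<le> fact r * (real (Suc r) * p (Suc r) j)"
        by (intro mult_left_mono) auto
      moreover have "fact r * (p r j * (S j - 2 * real r * \<Delta> j) / (L j - 2 * real r - 1)) = t j * u j * a j - 2 * real r * (t j * (\<Delta> j / L j)) * a j"
      proof -
        have "S j = u j * L j" using elim by (simp add: u_def)
        moreover have "\<Delta> j = (\<Delta> j / L j) * L j" using elim by simp
        ultimately have "p r j * (S j - 2 * real r * \<Delta> j) = p r j * (u j - 2 * real r * (\<Delta> j / L j)) * L j"
          by algebra
        then have "fact r * (p r j * (S j - 2 * real r * \<Delta> j) / (L j - 2 * real r - 1))
            = t j * (u j - 2 * real r * (\<Delta> j / L j)) * a j"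
          by (simp add: a_def t_def)
        then show ?thesis by (simp only: algebra_simps)
      qed
      ultimately show ?case by (simp add: u_def algebra_simps)
    qed
  qed
qed

lemma exp_partial_sum_bound:
  fixes u :: real
  assumes "0 \<le> u" "u \<le> \<Lambda>"
  shows "\<bar>exp (- u) - (\<Sum>i\<le>r. (-1)^i * (u ^ i / fact i))\<bar> \<le> exp \<Lambda> * (\<Lambda> ^ Suc r / fact (Suc r))"
proof -
  obtain t where t: "\<bar>t\<bar> \<le> \<bar>- u\<bar>" "exp (- u) = (\<Sum>m<Suc r. (- u) ^ m / fact m) + exp t / fact (Suc r) * (- u) ^ Suc r"
    using Maclaurin_exp_le[of "- u" "Suc r"] by blast
  have "(\<Sum>i\<le>r. (-1)^i * (u ^ i / fact i)) = (\<Sum>m<Suc r. (- u) ^ m / fact m)"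
    unfolding lessThan_Suc_atMost by (intro sum.cong refl) (metis power_minus times_divide_eq_right)
  then have "\<bar>exp (- u) - (\<Sum>i\<le>r. (-1)^i * (u ^ i / fact i))\<bar> = \<bar>exp t / fact (Suc r) * (- u) ^ Suc r\<bar>"
    unfolding t(2) by simp
  also have "\<dots> = exp t * (u ^ Suc r / fact (Suc r))"
    using assms by (simp add: abs_mult power_abs)
  also have "\<dots> \<le> exp \<Lambda> * (\<Lambda> ^ Suc r / fact (Suc r))"
    using assms t(1) by (intro mult_mono divide_right_mono power_mono) auto
  finally show ?thesis .
qed

lemma power_div_fact_tendsto_0: "(\<lambda>n. x ^ n / fact n :: real) \<longlonglongrightarrow> 0"
  using summable_LIMSEQ_zero[OF summable_exp[of x]] by (simp add: field_simps)

text \<open>The order r of the expansion is fixed first, such that the last term is small for every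
  mean in [0, \<Lambda>]; after that only finitely many moments have to be close.\<close>

lemma poisson_limit:
  fixes p :: "nat \<Rightarrow> nat \<Rightarrow> real" and q u :: "nat \<Rightarrow> real"
  assumes mom: "\<And>r. (\<lambda>j. fact r * p r j - u j ^ r) \<longlonglongrightarrow> 0"
    and u: "\<And>j. 0 \<le> u j" "\<And>j. u j \<le> \<Lambda>"
    and bonf: "\<And>j r. \<bar>q j - (\<Sum>i\<le>r. (-1)^i * p i j)\<bar> \<le> p (Suc r) j"
  shows "(\<lambda>j. q j - exp (- u j)) \<longlonglongrightarrow> 0"
proof (rule LIMSEQ_I)
  fix \<epsilon> :: real assume \<epsilon>: "\<epsilon> > 0"
  have \<Lambda>: "\<Lambda> \<ge> 0" using u[of 0] by linarith
  \<comment> \<open>The 1 accounts for the Bonferroni error, which is close to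
    \<open>u j ^ Suc r / fact (Suc r)\<close>, and \<open>exp \<Lambda>\<close> for the Taylor
    remainder of the exponential.\<close>
  have "(\<lambda>r. (1 + exp \<Lambda>) * (\<Lambda> ^ Suc r / fact (Suc r))) \<longlonglongrightarrow> (1 + exp \<Lambda>) * 0"
    by (intro tendsto_intros LIMSEQ_Suc[OF power_div_fact_tendsto_0])
  then have "eventually (\<lambda>r. (1 + exp \<Lambda>) * (\<Lambda> ^ Suc r / fact (Suc r)) < \<epsilon> / 2) sequentially"
    using \<epsilon> by (intro order_tendstoD) auto
  then obtain r where r: "(1 + exp \<Lambda>) * (\<Lambda> ^ Suc r / fact (Suc r)) < \<epsilon> / 2"
    by (auto dest: eventually_happens)
  have d: "(\<lambda>j. p i j - u j ^ i / fact i) \<longlonglongrightarrow> 0" for i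
    using tendsto_divide[OF mom[of i] tendsto_const[of "fact i"]] by (simp add: diff_divide_distrib)
  have "(\<lambda>j. (\<Sum>i\<le>r. \<bar>p i j - u j ^ i / fact i\<bar>) + (p (Suc r) j - u j ^ Suc r / fact (Suc r))) \<longlonglongrightarrow> (\<Sum>i\<le>r. \<bar>0\<bar>) + 0"
    by (intro tendsto_intros d)
  then have "eventually (\<lambda>j. (\<Sum>i\<le>r. \<bar>p i j - u j ^ i / fact i\<bar>) + (p (Suc r) j - u j ^ Suc r / fact (Suc r)) < \<epsilon> / 2) sequentially"
    using \<epsilon> by (intro order_tendstoD) auto
  then obtain J where J: "\<And>j. j \<ge> J \<Longrightarrow> (\<Sum>i\<le>r. \<bar>p i j - u j ^ i / fact i\<bar>) + (p (Suc r) j - u j ^ Suc r / fact (Suc r)) < \<epsilon> / 2"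
    by (auto simp: eventually_sequentially)
  have "\<bar>q j - exp (- u j)\<bar> < \<epsilon>" if "j \<ge> J" for j
  proof -
    have a: "\<bar>q j - (\<Sum>i\<le>r. (-1)^i * p i j)\<bar> \<le> p (Suc r) j" by (rule bonf)
    have b: "\<bar>exp (- u j) - (\<Sum>i\<le>r. (-1)^i * (u j ^ i / fact i))\<bar> \<le> exp \<Lambda> * (\<Lambda> ^ Suc r / fact (Suc r))"
      by (intro exp_partial_sum_bound u)
    have "\<bar>(\<Sum>i\<le>r. (-1)^i * p i j) - (\<Sum>i\<le>r. (-1)^i * (u j ^ i / fact i))\<bar>
         = \<bar>\<Sum>i\<le>r. (-1)^i * (p i j - u j ^ i / fact i)\<bar>"
      by (simp add: sum_subtractf algebra_simps)
    also have "\<dots> \<le> (\<Sum>i\<le>r. \<bar>(-1)^i * (p i j - u j ^ i / fact i)\<bar>)" by (rule sum_abs)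
    finally have c: "\<bar>(\<Sum>i\<le>r. (-1)^i * p i j) - (\<Sum>i\<le>r. (-1)^i * (u j ^ i / fact i))\<bar>
        \<le> (\<Sum>i\<le>r. \<bar>p i j - u j ^ i / fact i\<bar>)" by (simp add: abs_mult)
    have "u j ^ Suc r / fact (Suc r) \<le> \<Lambda> ^ Suc r / fact (Suc r)"
      using u by (intro divide_right_mono power_mono) auto
    moreover have "\<Lambda> ^ Suc r / fact (Suc r) + exp \<Lambda> * (\<Lambda> ^ Suc r / fact (Suc r)) < \<epsilon> / 2"
      using r by (simp only: distrib_right mult_1)
    ultimately show ?thesis using a b c J[OF that] by linarith
  qed
  then show "\<exists>J. \<forall>j\<ge>J. norm (q j - exp (- u j) - 0) < \<epsilon>" by auto
qed

section \<open>Edge probabilities for given degrees\<close>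

definition edge_weight :: "(nat \<Rightarrow> nat) \<Rightarrow> nat set \<Rightarrow> real" where
  "edge_weight d e = (\<Prod>i\<in>e. real (d i))"

definition vertex_pairs :: "nat \<Rightarrow> nat set set" where
  "vertex_pairs n = {e. e \<subseteq> {1..n} \<and> card e = 2}"

definition edge_pairs :: "(nat \<Rightarrow> nat) \<Rightarrow> nat set \<Rightarrow> (nat \<times> nat) set set" where
  "edge_pairs d e = {{(u, i), (v, j)} | u v i j. e = {u, v} \<and> u \<noteq> v \<and> i < d u \<and> j < d v}"

text \<open>
  Presence of \<open>E\<close> together with absence of \<open>F\<close> covers both counts: subgraphs are the case
  \<open>F = {}\<close>, induced subgraphs the case where \<open>F\<close> consists of the non-edges.
\<close>

definition pattern_prob :: "nat \<Rightarrow> (nat \<Rightarrow> nat) \<Rightarrow> nat set set \<Rightarrow> nat set set \<Rightarrow> real" where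
  "pattern_prob n d E F =
     measure_pmf.prob (pmf_of_set (pairings (half_edges n (fix_parity n d))))
       {M. E \<subseteq> erase M \<and> F \<inter> erase M = {}}"

lemma edge_weight_nonneg [simp]: "edge_weight d e \<ge> 0"
  by (simp add: edge_weight_def prod_nonneg)

lemma edge_weight_doubleton: "u \<noteq> v \<Longrightarrow> edge_weight d {u, v} = real (d u) * real (d v)"
  by (simp add: edge_weight_def)

lemma finite_vertex_pairs [simp]: "finite (vertex_pairs n)"
  by (rule finite_subset[of _ "Pow {1..n}"]) (auto simp: vertex_pairs_def)

lemma vertex_pairsE:
  assumes "e \<in> vertex_pairs n"
  obtains u v where "e = {u, v}" "u \<noteq> v" "u \<in> {1..n}" "v \<in> {1..n}"
proof -
  from assms obtain u v where "e = {u, v}" "u \<noteq> v" by (auto simp: vertex_pairs_def card_2_iff)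
  then show ?thesis using assms that[of u v] by (simp add: vertex_pairs_def)
qed

lemma fix_parity_bounds: "d v \<le> fix_parity n d v" "fix_parity n d v \<le> d v + 1"
  by (auto simp: fix_parity_def)

lemma sum_fix_parity:
  "(\<Sum>v\<in>{1..n}. d v) \<le> (\<Sum>v\<in>{1..n}. fix_parity n d v)"
  "(\<Sum>v\<in>{1..n}. fix_parity n d v) \<le> (\<Sum>v\<in>{1..n}. d v) + 1"
  "even (\<Sum>v\<in>{1..n}. fix_parity n d v)"
proof -
  have "(\<Sum>v\<in>{1..n}. fix_parity n d v) \<le> (\<Sum>v\<in>{1..n}. d v) + 1 \<and> even (\<Sum>v\<in>{1..n}. fix_parity n d v)"
  proof (cases "n = 0")
    case False
    then have "(\<Sum>v\<in>{1..n}. (d(n := d n + 1)) v) = (\<Sum>v\<in>{1..n}. d v) + 1"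
      by (simp add: sum.remove[of _ n])
    then show ?thesis unfolding fix_parity_def by simp
  qed (simp add: fix_parity_def)
  then show "(\<Sum>v\<in>{1..n}. fix_parity n d v) \<le> (\<Sum>v\<in>{1..n}. d v) + 1"
    and "even (\<Sum>v\<in>{1..n}. fix_parity n d v)" by auto
qed (intro sum_mono fix_parity_bounds)

lemma half_edges_card: "card (half_edges n d) = (\<Sum>v\<in>{1..n}. d v)" "finite (half_edges n d)"
  by (simp_all add: half_edges_def)

text \<open>Ordering the endpoints turns the symmetric definition into the image of a rectangle,
  which can be counted.\<close>

lemma edge_pairs_doubleton:
  assumes "u \<noteq> v"
  shows "edge_pairs d {u, v} = (\<lambda>(i, j). {(u, i), (v, j)}) ` ({..<d u} \<times> {..<d v})"
proof safe
  fix x assume "x \<in> edge_pairs d {u, v}"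
  then obtain u' v' i j where x: "x = {(u', i), (v', j)}" "{u, v} = {u', v'}" "i < d u'" "j < d v'"
    by (auto simp: edge_pairs_def)
  from x(2) consider "u' = u" "v' = v" | "u' = v" "v' = u" by (auto simp: doubleton_eq_iff)
  then show "x \<in> (\<lambda>(i, j). {(u, i), (v, j)}) ` ({..<d u} \<times> {..<d v})"
  proof cases
    case 1
    then show ?thesis using x by auto
  next
    case 2
    then have "x = (\<lambda>(i, j). {(u, i), (v, j)}) (j, i)" "(j, i) \<in> {..<d u} \<times> {..<d v}"
      using x by auto
    then show ?thesis by blast
  qed
next
  fix i j assume "i < d u" "j < d v"
  then show "{(u, i), (v, j)} \<in> edge_pairs d {u, v}" using assms by (auto simp: edge_pairs_def)
qed

lemma inj_on_edge_pairs:
  assumes "u \<noteq> v" shows "inj_on (\<lambda>(i, j). {(u, i), (v, j)}) S"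
  using assms by (auto simp: inj_on_def doubleton_eq_iff)

lemma card_edge_pairs:
  assumes "e \<in> vertex_pairs n"
  shows "real (card (edge_pairs d e)) = edge_weight d e" "finite (edge_pairs d e)"
proof -
  obtain u v where e: "e = {u, v}" "u \<noteq> v" using assms by (rule vertex_pairsE)
  show "real (card (edge_pairs d e)) = edge_weight d e" "finite (edge_pairs d e)"
    unfolding e(1) edge_pairs_doubleton[OF e(2)]
    by (simp_all add: card_image[OF inj_on_edge_pairs[OF e(2)]] edge_weight_doubleton[OF e(2)])
qed

lemma edge_pairs_fst: "p \<in> edge_pairs d e \<Longrightarrow> fst ` p = e"
  by (auto simp: edge_pairs_def)

lemma edge_pairs_half_edges:
  assumes "e \<in> vertex_pairs n" "p \<in> edge_pairs d e"
  shows "p \<subseteq> half_edges n d" "card p = 2"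
proof -
  obtain u v where e: "e = {u, v}" "u \<noteq> v" "u \<in> {1..n}" "v \<in> {1..n}"
    using assms(1) by (rule vertex_pairsE)
  then obtain i j where p: "p = {(u, i), (v, j)}" "i < d u" "j < d v"
    using assms(2) by (auto simp: edge_pairs_doubleton)
  show "p \<subseteq> half_edges n d" using e p by (auto simp: half_edges_def)
  show "card p = 2" using e p by simp
qed

lemma mem_erase_iff:
  assumes "M \<in> pairings (half_edges n d)" "e \<in> vertex_pairs n"
  shows "e \<in> erase M \<longleftrightarrow> edge_pairs d e \<inter> M \<noteq> {}"
proof
  assume "e \<in> erase M"
  then obtain u v i j where e: "e = {u, v}" "u \<noteq> v" "{(u, i), (v, j)} \<in> M"
    by (auto simp: erase_def)
  moreover have "{(u, i), (v, j)} \<subseteq> half_edges n d"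
    using e(3) assms(1) unfolding pairings_iff by blast
  ultimately have "{(u, i), (v, j)} \<in> edge_pairs d e \<inter> M"
    by (auto simp: edge_pairs_def half_edges_def)
  then show "edge_pairs d e \<inter> M \<noteq> {}" by blast
qed (auto simp: edge_pairs_def erase_def)

lemma pattern_prob_eq_card:
  "pattern_prob n d E F =
     real (card {M \<in> pairings (half_edges n (fix_parity n d)). E \<subseteq> erase M \<and> F \<inter> erase M = {}})
       / card (pairings (half_edges n (fix_parity n d)))"
  unfolding pattern_prob_def
  by (subst measure_pmf_of_set) (simp_all add: pairings_half_edges Int_def)

lemma pattern_prob_bounds: "0 \<le> pattern_prob n d E F" "pattern_prob n d E F \<le> 1"
  by (simp_all add: pattern_prob_def)

text \<open>Presence of an edge is traded for its absence, so everything reduces to patterns without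
  required edges.\<close>

lemma pattern_prob_insert:
  "pattern_prob n d (insert e E) F = pattern_prob n d E F - pattern_prob n d E (insert e F)"
proof -
  let ?p = "pmf_of_set (pairings (half_edges n (fix_parity n d)))"
  have "{M. E \<subseteq> erase M \<and> F \<inter> erase M = {}} =
      {M. insert e E \<subseteq> erase M \<and> F \<inter> erase M = {}} \<union> {M. E \<subseteq> erase M \<and> insert e F \<inter> erase M = {}}"
    by auto
  moreover have "measure_pmf.prob ?p \<dots> = measure_pmf.prob ?p {M. insert e E \<subseteq> erase M \<and> F \<inter> erase M = {}}
      + measure_pmf.prob ?p {M. E \<subseteq> erase M \<and> insert e F \<inter> erase M = {}}"
    by (rule measure_pmf.finite_measure_Union) auto
  ultimately show ?thesis by (simp add: pattern_prob_def)
qed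

lemma pattern_prob_empty_eq:
  fixes d :: "nat \<Rightarrow> nat"
  assumes "F \<subseteq> vertex_pairs n"
  defines "d' \<equiv> fix_parity n d"
  shows "pattern_prob n d {} F =
     real (card {M \<in> pairings (half_edges n d'). (\<Union>e\<in>F. edge_pairs d' e) \<inter> M = {}})
       / card (pairings (half_edges n d'))"
proof -
  have "F \<inter> erase M = {} \<longleftrightarrow> (\<Union>e\<in>F. edge_pairs d' e) \<inter> M = {}"
    if "M \<in> pairings (half_edges n d')" for M
    using mem_erase_iff[OF that] assms(1) by blast
  then show ?thesis unfolding pattern_prob_eq_card d'_def by (simp cong: conj_cong)
qed

lemma card_UN_edge_pairs:
  assumes "F \<subseteq> vertex_pairs n"
  shows "real (card (\<Union>e\<in>F. edge_pairs d e)) = (\<Sum>e\<in>F. edge_weight d e)"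
    and "finite (\<Union>e\<in>F. edge_pairs d e)"
    and "\<forall>p\<in>(\<Union>e\<in>F. edge_pairs d e). p \<subseteq> half_edges n d \<and> card p = 2"
proof -
  have fin: "finite F" using assms finite_subset by fastforce
  have "edge_pairs d e \<inter> edge_pairs d f = {}" if "e \<noteq> f" for e f
    using that edge_pairs_fst by blast
  then have "card (\<Union>e\<in>F. edge_pairs d e) = (\<Sum>e\<in>F. card (edge_pairs d e))"
    using fin assms card_edge_pairs(2) by (intro card_UN_disjoint) auto
  then show "real (card (\<Union>e\<in>F. edge_pairs d e)) = (\<Sum>e\<in>F. edge_weight d e)"
    using assms card_edge_pairs(1) by (auto intro!: sum.cong)
  show "finite (\<Union>e\<in>F. edge_pairs d e)" using fin assms card_edge_pairs(2) by auto
  show "\<forall>p\<in>(\<Union>e\<in>F. edge_pairs d e). p \<subseteq> half_edges n d \<and> card p = 2"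
    using assms edge_pairs_half_edges by blast
qed

text \<open>The half-edge \<open>h\<close> can only be joined to half-edges at vertices covered by
  \<open>F\<close>, and there are at most \<open>2 * card F\<close> of these.\<close>

lemma card_edge_pairs_at_half_edge:
  assumes "F \<subseteq> vertex_pairs n" "\<And>e i. e \<in> F \<Longrightarrow> i \<in> e \<Longrightarrow> d i \<le> D"
  shows "card {p\<in>(\<Union>e\<in>F. edge_pairs d e). h \<in> p} \<le> 2 * card F * D"
proof -
  have fin: "finite F" using assms finite_subset by fastforce
  have "\<Union>F \<subseteq> {1..n}" using assms(1) unfolding vertex_pairs_def by blast
  then have finU: "finite (\<Union>F)" by (rule finite_subset) simp
  have "{p\<in>(\<Union>e\<in>F. edge_pairs d e). h \<in> p} \<subseteq> (\<lambda>x. {h, x}) ` (SIGMA x:\<Union>F. {..<d x})"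
  proof
    fix p assume "p \<in> {p\<in>(\<Union>e\<in>F. edge_pairs d e). h \<in> p}"
    then obtain e u v i j where p: "e \<in> F" "h \<in> p" "p = {(u, i), (v, j)}" "e = {u, v}" "i < d u" "j < d v"
      unfolding edge_pairs_def by blast
    have UF: "u \<in> \<Union>F" "v \<in> \<Union>F" using p(1,4) by auto
    from p(2,3) consider "h = (u, i)" | "h = (v, j)" by auto
    then show "p \<in> (\<lambda>x. {h, x}) ` (SIGMA x:\<Union>F. {..<d x})"
    proof cases
      case 1
      then have "p = {h, (v, j)}" using p(3) by simp
      moreover have "(v, j) \<in> (SIGMA x:\<Union>F. {..<d x})" using UF(2) p(6) by blast
      ultimately show ?thesis by (rule image_eqI)
    next
      case 2
      then have "p = {h, (u, i)}" using p(3) by (simp add: insert_commute)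
      moreover have "(u, i) \<in> (SIGMA x:\<Union>F. {..<d x})" using UF(1) p(5) by blast
      ultimately show ?thesis by (rule image_eqI)
    qed
  qed
  then have "card {p\<in>(\<Union>e\<in>F. edge_pairs d e). h \<in> p} \<le> card (SIGMA x:\<Union>F. {..<d x})"
    using finU by (intro surj_card_le) auto
  also have "\<dots> = (\<Sum>x\<in>\<Union>F. d x)" using finU by simp
  also have "\<dots> \<le> (\<Sum>x\<in>\<Union>F. D)" using assms(2) by (intro sum_mono) auto
  also have "\<dots> = card (\<Union>F) * D" by simp
  also have "card (\<Union>F) \<le> (\<Sum>e\<in>F. card e)" using fin card_UN_le[of F "\<lambda>e. e"] by simp
  also have "(\<Sum>e\<in>F. card e) = (\<Sum>e\<in>F. 2)" using assms(1) by (intro sum.cong) (auto simp: vertex_pairs_def)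
  finally show ?thesis by (simp add: mult.commute)
qed

section \<open>Poisson approximation for degrees of order sqrt n\<close>

lemma exp_minus_lipschitz:
  fixes u w :: real
  assumes "0 \<le> u" "0 \<le> w"
  shows "\<bar>exp (- u) - exp (- w)\<bar> \<le> \<bar>u - w\<bar>"
proof -
  have *: "exp (- a) - exp (- b) \<le> b - a" if "0 \<le> a" "a \<le> b" for a b :: real
  proof -
    have "exp (- a) - exp (- b) = exp (- a) * (1 - exp (- (b - a)))"
      by (simp add: right_diff_distrib mult_exp_exp)
    also have "1 - exp (- (b - a)) \<le> b - a" using exp_ge_add_one_self[of "- (b - a)"] by linarith
    then have "exp (- a) * (1 - exp (- (b - a))) \<le> 1 * (b - a)"
      using that by (intro mult_mono) auto
    finally show ?thesis by simp
  qed
  show ?thesis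
  proof (cases "u \<le> w")
    case True
    then have "exp (- w) \<le> exp (- u)" by simp
    then show ?thesis using *[of u w] assms True by linarith
  next
    case False
    then have "exp (- u) \<le> exp (- w)" by simp
    then show ?thesis using *[of w u] assms False by linarith
  qed
qed

text \<open>The parity correction adds at most 1 to a degree, so for degrees of order sqrt n it
  moves a weight by only O(sqrt n), negligible against the scale n.\<close>

lemma edge_weight_fix_parity_bounds:
  assumes e: "e \<in> vertex_pairs n" and B: "B > 0" "\<And>i. i \<in> e \<Longrightarrow> real (d i) \<le> B * sqrt n"
  shows "edge_weight d e \<le> edge_weight (fix_parity n d) e"
    and "edge_weight (fix_parity n d) e \<le> edge_weight d e + (2 * B + 1) * sqrt n"
    and "edge_weight (fix_parity n d) e \<le> (B + 1)\<^sup>2 * n"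
    and "\<And>i. i \<in> e \<Longrightarrow> real (fix_parity n d i) \<le> (B + 1) * sqrt n"
proof -
  obtain u v where uv: "e = {u, v}" "u \<noteq> v" "u \<in> {1..n}" "v \<in> {1..n}" using e by (rule vertex_pairsE)
  let ?d = "fix_parity n d"
  have n1: "1 \<le> sqrt n" using uv by auto
  have f: "real (d i) \<le> real (?d i)" "real (?d i) \<le> real (d i) + 1" for i
    using fix_parity_bounds[where d = d and v = i and n = n] by linarith+
  have b: "real (d u) \<le> B * sqrt n" "real (d v) \<le> B * sqrt n" using B uv by auto
  show D: "real (?d i) \<le> (B + 1) * sqrt n" if "i \<in> e" for i
    using f(2)[of i] B(2)[OF that] n1 unfolding distrib_right by linarith
  have ew: "edge_weight d e = real (d u) * real (d v)" "edge_weight ?d e = real (?d u) * real (?d v)"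
    using uv by (simp_all add: edge_weight_doubleton)
  show "edge_weight d e \<le> edge_weight ?d e" unfolding ew by (intro mult_mono f) auto
  have "edge_weight ?d e \<le> (real (d u) + 1) * (real (d v) + 1)"
    unfolding ew by (intro mult_mono f) auto
  also have "\<dots> = edge_weight d e + (real (d u) + real (d v) + 1)" by (simp add: ew algebra_simps)
  also have "real (d u) + real (d v) + 1 \<le> (2 * B + 1) * sqrt n"
    using b n1 unfolding distrib_right by linarith
  finally show "edge_weight ?d e \<le> edge_weight d e + (2 * B + 1) * sqrt n" by simp
  have "edge_weight ?d e \<le> ((B + 1) * sqrt n) * ((B + 1) * sqrt n)"
    unfolding ew using B(1) by (intro mult_mono D) (auto simp: uv)
  also have "\<dots> = (B + 1)\<^sup>2 * (sqrt n)\<^sup>2" by (simp add: power2_eq_square algebra_simps)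
  finally show "edge_weight ?d e \<le> (B + 1)\<^sup>2 * n" by simp
qed

text \<open>The Poisson limit for the number of matched pairs in \<open>P j\<close>, the union of
  all half-edge pairs realizing \<open>F j\<close>. Degrees of order sqrt n make the mean bounded
  and \<open>\<Delta> j\<close> of order sqrt n, hence small against the number of half-edges. The
  statement is about arbitrary sequences of sizes, degrees and vertex pairs so that uniformity can
  be read off by contradiction.\<close>

lemma pattern_prob_empty_limit:
  fixes n :: "nat \<Rightarrow> nat" and d :: "nat \<Rightarrow> nat \<Rightarrow> nat" and F :: "nat \<Rightarrow> nat set set"
  assumes \<mu>: "\<mu> > 0" and B: "B > 0"
    and n: "\<And>j. n j \<ge> Suc j"
    and sum: "(\<lambda>j. real (\<Sum>v\<in>{1..n j}. d j v) / n j) \<longlonglongrightarrow> \<mu>"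
    and sum_ge: "\<And>j. real (\<Sum>v\<in>{1..n j}. d j v) \<ge> \<mu> / 2 * n j"
    and F: "\<And>j. F j \<subseteq> vertex_pairs (n j)" "\<And>j. card (F j) \<le> K"
    and deg: "\<And>j e i. e \<in> F j \<Longrightarrow> i \<in> e \<Longrightarrow> real (d j i) \<le> B * sqrt (n j)"
  shows "(\<lambda>j. pattern_prob (n j) (d j) {} (F j)
            - exp (- ((\<Sum>e\<in>F j. edge_weight (d j) e) / (\<mu> * n j)))) \<longlonglongrightarrow> 0"
proof -
  define d' where "d' j = fix_parity (n j) (d j)" for j
  define A where "A j = half_edges (n j) (d' j)" for j
  define P where "P j = (\<Union>e\<in>F j. edge_pairs (d' j) e)" for j
  define L where "L j = real (card (A j))" for j
  define S where "S j = real (card (P j))" for j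
  define T where "T j = (\<Sum>e\<in>F j. edge_weight (d j) e)" for j
  define D where "D j = nat \<lfloor>(B + 1) * sqrt (n j)\<rfloor>" for j
  define \<Delta> where "\<Delta> j = 2 * K * D j" for j
  have n0: "real (n j) > 0" for j using n[of j] by simp
  have ninf: "filterlim (\<lambda>j. real (n j)) at_top sequentially"
    by (rule filterlim_at_top_mono[OF filterlim_real_sequentially]) (use n in \<open>auto intro!: always_eventually simp: Suc_leD\<close>)
  have Lb: "real (\<Sum>v\<in>{1..n j}. d j v) \<le> L j" "L j \<le> real (\<Sum>v\<in>{1..n j}. d j v) + 1" for j
    using sum_fix_parity(1)[where n = "n j" and d = "d j"] sum_fix_parity(2)[where n = "n j" and d = "d j"]
    unfolding L_def A_def d'_def half_edges_card by linarith+
  have Lge: "L j \<ge> \<mu> / 2 * n j" for j using Lb(1)[of j] sum_ge[of j] by linarith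
  have L0: "L j > 0" for j using Lge[of j] n0[of j] \<mu> by (smt (verit) mult_pos_pos half_gt_zero)
  have Linf: "filterlim L at_top sequentially"
    by (rule filterlim_at_top_mono[OF filterlim_tendsto_pos_mult_at_top[OF tendsto_const[of "\<mu> / 2"] _ ninf]])
       (use \<mu> Lge in \<open>auto intro!: always_eventually\<close>)
  have inv_n: "(\<lambda>j. c / real (n j)) \<longlonglongrightarrow> 0" for c
    by (rule real_tendsto_divide_at_top[OF tendsto_const ninf])
  have inv_sqrt: "(\<lambda>j. c / sqrt (real (n j))) \<longlonglongrightarrow> 0" for c
    by (rule real_tendsto_divide_at_top[OF tendsto_const filterlim_compose[OF sqrt_at_top ninf]])
  have Ln: "(\<lambda>j. L j / n j) \<longlonglongrightarrow> \<mu>"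
  proof (rule tendsto_sandwich[OF _ _ sum])
    show "(\<lambda>j. real (\<Sum>v\<in>{1..n j}. d j v) / n j + 1 / n j) \<longlonglongrightarrow> \<mu>"
      using tendsto_add[OF sum inv_n[of 1]] by simp
    show "\<forall>\<^sub>F j in sequentially. real (\<Sum>v\<in>{1..n j}. d j v) / n j \<le> L j / n j"
      using Lb by (intro always_eventually allI divide_right_mono) auto
    show "\<forall>\<^sub>F j in sequentially. L j / n j \<le> real (\<Sum>v\<in>{1..n j}. d j v) / n j + 1 / n j"
      unfolding add_divide_distrib[symmetric] using Lb by (intro always_eventually allI divide_right_mono) auto
  qed
  have A: "finite (A j)" "even (card (A j))" for j
    unfolding A_def half_edges_card d'_def using sum_fix_parity(3) by (simp_all add: half_edges_card)
  have P: "finite (P j)" "\<forall>p\<in>P j. p \<subseteq> A j \<and> card p = 2" for j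
    using card_UN_edge_pairs(2,3)[OF F(1)] unfolding P_def A_def by blast+
  then have P2: "\<forall>p\<in>P j. card p = 2" for j by blast
  have S_eq: "S j = (\<Sum>e\<in>F j. edge_weight (d' j) e)" for j
    unfolding S_def P_def by (rule card_UN_edge_pairs(1)[OF F(1)])
  have ew: "edge_weight (d j) e \<le> edge_weight (d' j) e"
      "edge_weight (d' j) e \<le> edge_weight (d j) e + (2 * B + 1) * sqrt (n j)"
      "edge_weight (d' j) e \<le> (B + 1)\<^sup>2 * n j"
      "\<And>i. i \<in> e \<Longrightarrow> real (d' j i) \<le> (B + 1) * sqrt (n j)"
    if e: "e \<in> F j" for e j
    using edge_weight_fix_parity_bounds[where d = "d j", OF subsetD[OF F(1) e] B deg[OF e]] unfolding d'_def by blast+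
  have sum_le: "(\<Sum>e\<in>F j. g e) \<le> K * C" if "\<And>e. e \<in> F j \<Longrightarrow> g e \<le> C" "C \<ge> 0" for j g and C :: real
  proof -
    have "(\<Sum>e\<in>F j. g e) \<le> (\<Sum>e\<in>F j. C)" by (intro sum_mono that)
    also have "\<dots> \<le> K * C" using F(2)[of j] that(2) by (simp add: mult_right_mono)
    finally show ?thesis .
  qed
  have S_le: "S j \<le> K * ((B + 1)\<^sup>2 * n j)" for j
    unfolding S_eq by (intro sum_le ew(3)) auto
  have TS: "T j \<le> S j" for j unfolding T_def S_eq by (intro sum_mono ew(1))
  have T0: "T j \<ge> 0" for j unfolding T_def by (simp add: sum_nonneg)
  have ST: "S j - T j \<le> K * ((2 * B + 1) * sqrt (n j))" for j
  proof -
    have "S j - T j = (\<Sum>e\<in>F j. edge_weight (d' j) e - edge_weight (d j) e)"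
      by (simp add: S_eq T_def sum_subtractf)
    also have "\<dots> \<le> K * ((2 * B + 1) * sqrt (n j))"
    proof (rule sum_le)
      fix e assume "e \<in> F j"
      then show "edge_weight (d' j) e - edge_weight (d j) e \<le> (2 * B + 1) * sqrt (n j)"
        using ew(2)[of e j] by simp
    qed (use B in auto)
    finally show ?thesis .
  qed
  have div_L: "x / L j \<le> (2 / \<mu>) * (x / n j)" if "x \<ge> 0" for x j
  proof -
    have "x / L j \<le> x / (\<mu> / 2 * n j)"
      using that \<mu> n0[of j] Lge[of j] L0[of j] by (intro divide_left_mono mult_pos_pos) auto
    then show ?thesis by (simp add: mult.commute)
  qed
  have SL: "0 \<le> S j / L j" "S j / L j \<le> (2 / \<mu>) * (K * (B + 1)\<^sup>2)" for j
  proof -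
    show "0 \<le> S j / L j" using L0[of j] by (simp add: S_def)
    have "S j / L j \<le> (2 / \<mu>) * (S j / n j)" by (rule div_L) (simp add: S_def)
    also have "\<dots> \<le> (2 / \<mu>) * (K * (B + 1)\<^sup>2)"
      using S_le[of j] n0[of j] \<mu> by (intro mult_left_mono) (auto simp: pos_divide_le_eq mult.assoc)
    finally show "S j / L j \<le> (2 / \<mu>) * (K * (B + 1)\<^sup>2)" .
  qed
  have sqrt_div: "sqrt (n j) / n j = 1 / sqrt (n j)" for j
    by (metis of_nat_0_le_iff real_div_sqrt real_sqrt_ge_zero divide_divide_eq_left divide_self_if inverse_eq_divide divide_inverse mult.right_neutral sqrt_divide_self_eq)
  have \<Delta>_ge: "card {p\<in>P j. h \<in> p} \<le> \<Delta> j" for j h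
  proof -
    have "card {p\<in>P j. h \<in> p} \<le> 2 * card (F j) * D j"
      unfolding P_def
    proof (rule card_edge_pairs_at_half_edge[OF F(1)])
      fix e i assume "e \<in> F j" "i \<in> e"
      then have "real (d' j i) \<le> (B + 1) * sqrt (n j)" by (rule ew(4))
      then show "d' j i \<le> D j" unfolding D_def by (simp add: le_nat_floor)
    qed
    also have "\<dots> \<le> 2 * K * D j" using F(2)[of j] by (intro mult_right_mono mult_left_mono) auto
    finally show ?thesis by (simp add: \<Delta>_def)
  qed
  have \<Delta>_lim: "(\<lambda>j. real (\<Delta> j) / L j) \<longlonglongrightarrow> 0"
  proof (rule tendsto_sandwich[OF _ _ tendsto_const])
    show "(\<lambda>j. (2 / \<mu>) * (2 * K * (B + 1)) / sqrt (n j)) \<longlonglongrightarrow> 0" by (rule inv_sqrt)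
    show "\<forall>\<^sub>F j in sequentially. real (\<Delta> j) / L j \<le> (2 / \<mu>) * (2 * K * (B + 1)) / sqrt (n j)"
    proof (intro always_eventually allI)
      fix j
      have "real (D j) \<le> (B + 1) * sqrt (n j)" unfolding D_def using B by simp
      then have "real (\<Delta> j) \<le> 2 * K * ((B + 1) * sqrt (n j))"
        unfolding \<Delta>_def by (simp add: mult_left_mono)
      then have "real (\<Delta> j) / n j \<le> 2 * K * ((B + 1) * sqrt (n j)) / n j" by (rule divide_right_mono) simp
      also have "\<dots> = 2 * K * (B + 1) * (sqrt (n j) / n j)" by simp
      finally have "(2 / \<mu>) * (real (\<Delta> j) / n j) \<le> (2 / \<mu>) * (2 * K * (B + 1) * (1 / sqrt (n j)))"
        unfolding sqrt_div using \<mu> by (intro mult_left_mono) auto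
      then show "real (\<Delta> j) / L j \<le> (2 / \<mu>) * (2 * K * (B + 1)) / sqrt (n j)"
        using div_L[of "real (\<Delta> j)" j] by simp
    qed
    show "\<forall>\<^sub>F j in sequentially. 0 \<le> real (\<Delta> j) / L j"
      using less_imp_le[OF L0] by (intro always_eventually allI divide_nonneg_nonneg) auto
  qed
  have Lbig: "\<forall>\<^sub>F j in sequentially. 2 * r + 2 \<le> card (A j)" for r
  proof -
    have "\<forall>\<^sub>F j in sequentially. real (2 * r + 2) \<le> L j" using Linf by (simp add: filterlim_at_top)
    then show ?thesis by (rule eventually_mono) (simp only: L_def of_nat_le_iff)
  qed
  have mom: "(\<lambda>j. fact r * matching_moment (A j) (P j) r - (S j / L j) ^ r) \<longlonglongrightarrow> 0" for r
  proof (rule poisson_moment_limit[where \<Delta> = "\<lambda>j. real (\<Delta> j)", OF _ _ _ _ Linf \<Delta>_lim SL])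
    show "matching_moment (A j) (P j) 0 = 1" for j using P(1) by (rule matching_moment_0)
    show "matching_moment (A j) (P j) r \<ge> 0" for r j by (rule matching_moment_nonneg)
    show "\<forall>\<^sub>F j in sequentially. real (Suc r) * matching_moment (A j) (P j) (Suc r) * (L j - 2 * real r - 1)
        \<le> matching_moment (A j) (P j) r * S j" for r
      using Lbig[of r]
    proof eventually_elim
      case (elim j)
      show ?case using matching_moment_Suc(1)[OF A(1) elim P(1) P2 \<Delta>_ge] by (simp add: L_def S_def)
    qed
    show "\<forall>\<^sub>F j in sequentially. matching_moment (A j) (P j) r * (S j - 2 * real r * real (\<Delta> j))
        \<le> real (Suc r) * matching_moment (A j) (P j) (Suc r) * (L j - 2 * real r - 1)" for r
      using Lbig[of r]
    proof eventually_elim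
      case (elim j)
      show ?case using matching_moment_Suc(2)[OF A(1) elim P(1) P2 \<Delta>_ge] by (simp add: L_def S_def)
    qed
  qed
  have "(\<lambda>j. pattern_prob (n j) (d j) {} (F j) - exp (- (S j / L j))) \<longlonglongrightarrow> 0"
  proof (rule poisson_limit[OF mom SL])
    show "\<bar>pattern_prob (n j) (d j) {} (F j) - (\<Sum>i\<le>r. (-1)^i * matching_moment (A j) (P j) i)\<bar>
        \<le> matching_moment (A j) (P j) (Suc r)" for j r
      using matching_moment_bonferroni[OF A P, of j r]
      unfolding pattern_prob_empty_eq[OF F(1)] A_def P_def d'_def by simp
  qed
  \<comment> \<open>Passage from the corrected degrees and the actual number of half-edges to
    \<open>T j\<close> and \<mu> n: the difference \<open>S j - T j\<close> is O(sqrt n), and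
    \<open>L j / n j\<close> tends to \<mu>.\<close>
  moreover have "(\<lambda>j. exp (- (S j / L j)) - exp (- (T j / (\<mu> * n j)))) \<longlonglongrightarrow> 0"
  proof (rule Lim_null_comparison)
    show "\<forall>\<^sub>F j in sequentially. norm (exp (- (S j / L j)) - exp (- (T j / (\<mu> * n j)))) \<le>
        (2 / \<mu>) * (K * (2 * B + 1)) / sqrt (n j) + (K * (B + 1)\<^sup>2) * \<bar>1 / (L j / n j) - 1 / \<mu>\<bar>"
    proof (intro always_eventually allI)
      fix j
      have "S j / L j - T j / (\<mu> * n j) = (S j - T j) / L j + (T j / n j) * (1 / (L j / n j) - 1 / \<mu>)"
        using n0[of j] L0[of j] by (simp add: field_simps)
      also have "\<bar>\<dots>\<bar> \<le> \<bar>(S j - T j) / L j\<bar> + \<bar>(T j / n j) * (1 / (L j / n j) - 1 / \<mu>)\<bar>"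
        by (rule abs_triangle_ineq)
      also have "\<dots> = (S j - T j) / L j + (T j / n j) * \<bar>1 / (L j / n j) - 1 / \<mu>\<bar>"
        using TS[of j] T0[of j] L0[of j] by (simp add: abs_mult)
      also have "(T j / n j) * \<bar>1 / (L j / n j) - 1 / \<mu>\<bar> \<le> (K * (B + 1)\<^sup>2) * \<bar>1 / (L j / n j) - 1 / \<mu>\<bar>"
        using TS[of j] S_le[of j] n0[of j] by (intro mult_right_mono) (auto simp: pos_divide_le_eq mult.assoc)
      also have "(S j - T j) / L j \<le> (2 / \<mu>) * ((S j - T j) / n j)"
        using TS[of j] by (intro div_L) simp
      also have "\<dots> \<le> (2 / \<mu>) * (K * ((2 * B + 1) * sqrt (n j)) / n j)"
        using ST[of j] \<mu> by (intro mult_left_mono divide_right_mono) auto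
      also have "\<dots> = (2 / \<mu>) * (K * (2 * B + 1)) * (sqrt (n j) / n j)" by simp
      also have "\<dots> = (2 / \<mu>) * (K * (2 * B + 1)) / sqrt (n j)" unfolding sqrt_div by simp
      finally have "\<bar>S j / L j - T j / (\<mu> * n j)\<bar> \<le> (2 / \<mu>) * (K * (2 * B + 1)) / sqrt (n j)
          + (K * (B + 1)\<^sup>2) * \<bar>1 / (L j / n j) - 1 / \<mu>\<bar>" by simp
      moreover have "\<bar>exp (- (S j / L j)) - exp (- (T j / (\<mu> * n j)))\<bar> \<le> \<bar>S j / L j - T j / (\<mu> * n j)\<bar>"
        using SL(1)[of j] T0[of j] n0[of j] \<mu> by (intro exp_minus_lipschitz) auto
      ultimately show "norm (exp (- (S j / L j)) - exp (- (T j / (\<mu> * n j)))) \<le>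
        (2 / \<mu>) * (K * (2 * B + 1)) / sqrt (n j) + (K * (B + 1)\<^sup>2) * \<bar>1 / (L j / n j) - 1 / \<mu>\<bar>"
        unfolding real_norm_def by linarith
    qed
    have "(\<lambda>j. 1 / (L j / n j) - 1 / \<mu>) \<longlonglongrightarrow> 1 / \<mu> - 1 / \<mu>"
      using \<mu> by (intro tendsto_intros Ln) auto
    then have "(\<lambda>j. \<bar>1 / (L j / n j) - 1 / \<mu>\<bar>) \<longlonglongrightarrow> 0" by (simp add: tendsto_rabs_zero)
    from tendsto_add[OF inv_sqrt[of "(2 / \<mu>) * (K * (2 * B + 1))"] tendsto_mult_right_zero[OF this, of "K * (B + 1)\<^sup>2"]]
    show "(\<lambda>j. (2 / \<mu>) * (K * (2 * B + 1)) / sqrt (n j) + (K * (B + 1)\<^sup>2) * \<bar>1 / (L j / n j) - 1 / \<mu>\<bar>) \<longlonglongrightarrow> 0"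
      by simp
  qed
  ultimately have "(\<lambda>j. (pattern_prob (n j) (d j) {} (F j) - exp (- (S j / L j)))
     + (exp (- (S j / L j)) - exp (- (T j / (\<mu> * n j))))) \<longlonglongrightarrow> 0 + 0" by (rule tendsto_add)
  then show ?thesis by (simp add: T_def)
qed

text \<open>If uniformity failed, there would be violations at every tolerance and beyond every
  size; a sequence of them contradicts \<open>pattern_prob_empty_limit\<close>.\<close>

lemma pattern_prob_empty_uniform:
  assumes \<mu>: "\<mu> > 0" and B: "B > 0" and \<eta>: "\<eta> > 0"
  shows "\<exists>\<rho>>0. \<exists>N. \<forall>n\<ge>N. \<forall>d F. \<bar>real (\<Sum>v\<in>{1..n}. d v) - \<mu> * real n\<bar> \<le> \<rho> * real n \<longrightarrow>
     F \<subseteq> vertex_pairs n \<longrightarrow> card F \<le> K \<longrightarrow> (\<forall>e\<in>F. \<forall>i\<in>e. real (d i) \<le> B * sqrt n) \<longrightarrow>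
     \<bar>pattern_prob n d {} F - exp (- ((\<Sum>e\<in>F. edge_weight d e) / (\<mu> * n)))\<bar> \<le> \<eta>"
proof (rule ccontr)
  assume neg: "\<not> ?thesis"
  \<comment> \<open>The tolerance \<open>\<mu> / 2 / Suc j\<close> tends to 0 and is at most
    \<mu>/2, so the total degree is asymptotically \<mu> n and never below \<mu> n / 2.\<close>
  have "\<forall>j::nat. \<exists>n d F. n \<ge> Suc j \<and> \<bar>real (\<Sum>v\<in>{1..n}. d v) - \<mu> * real n\<bar> \<le> (\<mu> / 2 / Suc j) * real n \<and>
     F \<subseteq> vertex_pairs n \<and> card F \<le> K \<and> (\<forall>e\<in>F. \<forall>i\<in>e. real (d i) \<le> B * sqrt n) \<and>
     \<eta> < \<bar>pattern_prob n d {} F - exp (- ((\<Sum>e\<in>F. edge_weight d e) / (\<mu> * n)))\<bar>"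
  proof
    fix j
    have pos: "\<mu> / 2 / Suc j > 0" using \<mu> by simp
    then have "\<not> (\<exists>N. \<forall>n\<ge>N. \<forall>d F. \<bar>real (\<Sum>v\<in>{1..n}. d v) - \<mu> * real n\<bar> \<le> (\<mu> / 2 / Suc j) * real n \<longrightarrow>
     F \<subseteq> vertex_pairs n \<longrightarrow> card F \<le> K \<longrightarrow> (\<forall>e\<in>F. \<forall>i\<in>e. real (d i) \<le> B * sqrt n) \<longrightarrow>
     \<bar>pattern_prob n d {} F - exp (- ((\<Sum>e\<in>F. edge_weight d e) / (\<mu> * n)))\<bar> \<le> \<eta>)"
      using neg by blast
    then show "\<exists>n d F. n \<ge> Suc j \<and> \<bar>real (\<Sum>v\<in>{1..n}. d v) - \<mu> * real n\<bar> \<le> (\<mu> / 2 / Suc j) * real n \<and>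
     F \<subseteq> vertex_pairs n \<and> card F \<le> K \<and> (\<forall>e\<in>F. \<forall>i\<in>e. real (d i) \<le> B * sqrt n) \<and>
     \<eta> < \<bar>pattern_prob n d {} F - exp (- ((\<Sum>e\<in>F. edge_weight d e) / (\<mu> * n)))\<bar>"
      unfolding not_ex not_all not_imp not_le by blast
  qed
  then obtain n d F where
    n: "\<And>j. n j \<ge> Suc j" and s: "\<And>j. \<bar>real (\<Sum>v\<in>{1..n j}. d j v) - \<mu> * real (n j)\<bar> \<le> (\<mu> / 2 / Suc j) * real (n j)"
    and F: "\<And>j. F j \<subseteq> vertex_pairs (n j)" "\<And>j. card (F j) \<le> K"
    and deg: "\<And>j. (\<forall>e\<in>F j. \<forall>i\<in>e. real (d j i) \<le> B * sqrt (n j))"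
    and bad: "\<And>j. \<eta> < \<bar>pattern_prob (n j) (d j) {} (F j) - exp (- ((\<Sum>e\<in>F j. edge_weight (d j) e) / (\<mu> * n j)))\<bar>"
    by metis
  have n0: "real (n j) > 0" for j using n[of j] by simp
  have lim: "(\<lambda>j. real (\<Sum>v\<in>{1..n j}. d j v) / n j) \<longlonglongrightarrow> \<mu>"
  proof (rule LIM_zero_cancel, rule Lim_null_comparison)
    show "\<forall>\<^sub>F j in sequentially. norm (real (\<Sum>v\<in>{1..n j}. d j v) / n j - \<mu>) \<le> \<mu> / 2 / Suc j"
    proof (intro always_eventually allI)
      fix j
      have "real (\<Sum>v\<in>{1..n j}. d j v) / n j - \<mu> = (real (\<Sum>v\<in>{1..n j}. d j v) - \<mu> * n j) / n j"
        using n0[of j] by (simp add: diff_divide_distrib del: of_nat_sum)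
      then have "\<bar>real (\<Sum>v\<in>{1..n j}. d j v) / n j - \<mu>\<bar> = \<bar>real (\<Sum>v\<in>{1..n j}. d j v) - \<mu> * n j\<bar> / n j"
        by (simp only: abs_divide abs_of_nat)
      also have "\<dots> \<le> \<mu> / 2 / Suc j" using s[of j] n0[of j] by (simp only: pos_divide_le_eq)
      finally show "norm (real (\<Sum>v\<in>{1..n j}. d j v) / n j - \<mu>) \<le> \<mu> / 2 / Suc j"
        by (simp only: real_norm_def)
    qed
    show "(\<lambda>j. \<mu> / 2 / Suc j) \<longlonglongrightarrow> 0"
      by (rule LIMSEQ_Suc[OF lim_const_over_n])
  qed
  have ge: "real (\<Sum>v\<in>{1..n j}. d j v) \<ge> \<mu> / 2 * n j" for j
  proof -
    have "\<mu> / 2 / Suc j \<le> \<mu> / 2 / 1" using \<mu> by (intro divide_left_mono) auto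
    then have "(\<mu> / 2 / Suc j) * n j \<le> \<mu> / 2 * n j" by (intro mult_right_mono) auto
    then show ?thesis using s[of j] by linarith
  qed
  have "(\<lambda>j. pattern_prob (n j) (d j) {} (F j)
            - exp (- ((\<Sum>e\<in>F j. edge_weight (d j) e) / (\<mu> * n j)))) \<longlonglongrightarrow> 0"
    by (rule pattern_prob_empty_limit[OF \<mu> B n lim ge F]) (use deg in auto)
  then obtain j where "\<bar>pattern_prob (n j) (d j) {} (F j)
            - exp (- ((\<Sum>e\<in>F j. edge_weight (d j) e) / (\<mu> * n j)))\<bar> < \<eta>"
    using \<eta> LIMSEQ_D by fastforce
  then show False using bad[of j] by linarith
qed

definition edge_prod_limit :: "real \<Rightarrow> (nat \<Rightarrow> nat) \<Rightarrow> nat set set \<Rightarrow> nat set set \<Rightarrow> real" where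
  "edge_prod_limit s d E F =
     (\<Prod>e\<in>E. 1 - exp (- (edge_weight d e / s))) * (\<Prod>e\<in>F. exp (- (edge_weight d e / s)))"

text \<open>Induction on the required edges with \<open>pattern_prob_insert\<close>, an identity
  that the product formula satisfies too. Each step moves an edge from \<open>E\<close> to
  \<open>F\<close>, so \<open>card E + card F\<close> does not grow, and doubles the error; hence
  the accuracy \<eta> / 2^K in the case without required edges.\<close>

theorem pattern_prob_uniform:
  assumes \<mu>: "\<mu> > 0" and B: "B > 0" and \<eta>: "\<eta> > 0"
  shows "\<exists>\<rho>>0. \<exists>N. \<forall>n\<ge>N. \<forall>d E F. \<bar>real (\<Sum>v\<in>{1..n}. d v) - \<mu> * real n\<bar> \<le> \<rho> * real n \<longrightarrow>
     E \<subseteq> vertex_pairs n \<longrightarrow> F \<subseteq> vertex_pairs n \<longrightarrow> E \<inter> F = {} \<longrightarrow> card E + card F \<le> K \<longrightarrow>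
     (\<forall>e\<in>E \<union> F. \<forall>i\<in>e. real (d i) \<le> B * sqrt n) \<longrightarrow>
     \<bar>pattern_prob n d E F - edge_prod_limit (\<mu> * n) d E F\<bar> \<le> \<eta>"
proof -
  have \<eta>': "\<eta> / 2 ^ K > 0" using \<eta> by simp
  obtain \<rho> N where \<rho>: "\<rho> > 0" and base: "\<forall>n\<ge>N. \<forall>d F. \<bar>real (\<Sum>v\<in>{1..n}. d v) - \<mu> * real n\<bar> \<le> \<rho> * real n \<longrightarrow>
     F \<subseteq> vertex_pairs n \<longrightarrow> card F \<le> K \<longrightarrow> (\<forall>e\<in>F. \<forall>i\<in>e. real (d i) \<le> B * sqrt n) \<longrightarrow>
     \<bar>pattern_prob n d {} F - exp (- ((\<Sum>e\<in>F. edge_weight d e) / (\<mu> * n)))\<bar> \<le> \<eta> / 2 ^ K"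
    using pattern_prob_empty_uniform[OF \<mu> B \<eta>', of K] by blast
  show ?thesis
  proof (intro exI[of _ \<rho>] exI[of _ N] conjI \<rho> allI impI)
    fix n d and E F :: "nat set set"
    assume n: "n \<ge> N" and s: "\<bar>real (\<Sum>v\<in>{1..n}. d v) - \<mu> * real n\<bar> \<le> \<rho> * real n"
      and EF: "E \<subseteq> vertex_pairs n" "F \<subseteq> vertex_pairs n" "E \<inter> F = {}" "card E + card F \<le> K"
      and deg: "\<forall>e\<in>E \<union> F. \<forall>i\<in>e. real (d i) \<le> B * sqrt n"
    have finite_edges: "finite E" using EF(1) finite_subset by fastforce
    have "\<bar>pattern_prob n d E F - edge_prod_limit (\<mu> * n) d E F\<bar> \<le> 2 ^ card E * (\<eta> / 2 ^ K)"
      using finite_edges EF deg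
    proof (induction E arbitrary: F rule: finite_induct)
      case empty
      have finF: "finite F" using empty finite_subset by fastforce
      have "edge_prod_limit (\<mu> * n) d {} F = exp (- ((\<Sum>e\<in>F. edge_weight d e) / (\<mu> * n)))"
        using finF by (simp add: edge_prod_limit_def exp_sum[symmetric] sum_negf sum_divide_distrib)
      then show ?case using base[rule_format, OF n s, of F] empty by simp
    next
      case (insert e E)
      have finF: "finite F" using insert.prems finite_subset by fastforce
      have eF: "e \<notin> F" using insert.prems by auto
      let ?a = "edge_weight d e / (\<mu> * n)"
      have p: "edge_prod_limit (\<mu> * n) d (insert e E) F = edge_prod_limit (\<mu> * n) d E F - edge_prod_limit (\<mu> * n) d E (insert e F)"
        using insert.hyps eF finF by (simp add: edge_prod_limit_def algebra_simps)
      have 1: "\<bar>pattern_prob n d E F - edge_prod_limit (\<mu> * n) d E F\<bar> \<le> 2 ^ card E * (\<eta> / 2 ^ K)"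
        by (rule insert.IH) (use insert.prems insert.hyps in auto)
      have 2: "\<bar>pattern_prob n d E (insert e F) - edge_prod_limit (\<mu> * n) d E (insert e F)\<bar> \<le> 2 ^ card E * (\<eta> / 2 ^ K)"
        by (rule insert.IH) (use insert.prems insert.hyps finF eF in auto)
      have "2 ^ card (insert e E) * (\<eta> / 2 ^ K) = 2 ^ card E * (\<eta> / 2 ^ K) + 2 ^ card E * (\<eta> / 2 ^ K)"
        using insert.hyps by simp
      moreover have "\<bar>a - b - (a' - b')\<bar> \<le> x + x" if "\<bar>a - a'\<bar> \<le> x" "\<bar>b - b'\<bar> \<le> x" for a a' b b' x :: real
        using that by linarith
      ultimately show ?case unfolding pattern_prob_insert p using 1 2 by presburger
    qed
    also have "\<dots> \<le> 2 ^ K * (\<eta> / 2 ^ K)"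
      using EF(4) \<eta> by (intro mult_right_mono power_increasing) auto
    finally show "\<bar>pattern_prob n d E F - edge_prod_limit (\<mu> * n) d E F\<bar> \<le> \<eta>" by simp
  qed
qed

section \<open>A uniform bound for edge probabilities\<close>

text \<open>As long as at most half of the points are covered, each further prescribed pair lowers
  the count by at least the factor L/2.\<close>

lemma matchings_ratio_le:
  assumes "4 * r \<le> L"
  shows "real (matchings (L - 2 * r)) / real (matchings L) \<le> (2 / real L) ^ r"
  using assms
proof (induction r)
  case 0
  then show ?case using matchings_pos[of L] by simp
next
  case (Suc r)
  obtain N where L_eq: "L = Suc (Suc N) + 2 * r" using Suc.prems by (intro that[of "L - 2 * r - 2"]) simp
  then have N: "L - 2 * r = Suc (Suc N)" by simp
  have L: "real L > 0" using Suc.prems by simp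
  have N': "L - 2 * Suc r = N" using N by simp
  have "L \<le> 2 * (N + 1)" using Suc.prems L_eq by simp
  then have "real L \<le> real (2 * (N + 1))" by (rule of_nat_mono)
  then have "real (N + 1) \<ge> real L / 2" by simp
  then have "real L / 2 * (real (matchings N) / real (matchings L)) \<le> real (N + 1) * (real (matchings N) / real (matchings L))"
    by (intro mult_right_mono) auto
  also have "\<dots> = real (matchings (L - 2 * r)) / real (matchings L)" by (simp add: N distrib_right)
  also have "\<dots> \<le> (2 / real L) ^ r" using Suc by simp
  finally have "(2 / real L) * (real L / 2 * (real (matchings N) / real (matchings L))) \<le> (2 / real L) * (2 / real L) ^ r"
    using L by (intro mult_left_mono) auto
  then show ?case using L unfolding N' by simp
qed

text \<open>After removal of \<open>R\<close>, the sets \<open>X\<close> and \<open>Y\<close> have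
  lost at most \<open>2 * card R\<close> points each. As \<open>card X + card Y\<close> is at most
  \<open>card A\<close>, the product of their sizes drops by at most
  \<open>2 * card R * card A\<close>, which costs the factor \<open>exp (card R)\<close>.\<close>

lemma card_pairings_containing_avoiding_le:
  assumes A: "finite A" "even (card A)" and R: "disjoint R" "\<Union>R \<subseteq> A" "\<forall>e\<in>R. card e = 2"
    and XY: "X \<subseteq> A" "Y \<subseteq> A" "X \<inter> Y = {}"
  shows "real (card {M \<in> pairings A. R \<subseteq> M \<and> (\<forall>x\<in>X. \<forall>y\<in>Y. {x, y} \<notin> M)})
    \<le> matchings (card A - 2 * card R) * (exp (real (card R)) * exp (- (real (card X) * real (card Y)) / (2 * real (card A))))"
proof (cases "A = {}")
  case True
  have "R = {}"
  proof (rule ccontr)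
    assume "R \<noteq> {}"
    then obtain e where "e \<in> R" by blast
    then have "e = {}" "card e = 2" using R True by auto
    then show False by simp
  qed
  have XY0: "X = {}" "Y = {}" using XY True by auto
  have "card (pairings A) = 1" using card_pairings[OF A] True by simp
  then show ?thesis unfolding \<open>R = {}\<close> XY0 True by simp
next
  case False
  let ?L = "real (card A)" and ?r = "real (card R)"
  let ?A' = "A - \<Union>R" and ?X' = "X - \<Union>R" and ?Y' = "Y - \<Union>R"
  let ?no = "\<lambda>X Y M. \<forall>x\<in>X. \<forall>y\<in>Y. {x, y} \<notin> M"
  have L: "?L > 0" using A False by (simp add: card_gt_0_iff)
  have fin: "finite (\<Union>R)" "finite X" "finite Y" using A R XY finite_subset by metis+
  have cU: "card (\<Union>R) = 2 * card R" by (rule card_Union_pairs[OF R(1,3)])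
  have cA': "card ?A' = card A - 2 * card R" using cU R(2) fin by (simp add: card_Diff_subset)
  have bij: "bij_betw (\<lambda>M. M - R) {M \<in> pairings A. R \<subseteq> M} (pairings ?A')"
    by (rule bij_betw_pairings_containing[OF R])
  have "card {M \<in> pairings A. R \<subseteq> M \<and> ?no X Y M} \<le> card {M \<in> pairings ?A'. ?no ?X' ?Y' M}"
  proof (rule card_inj_on_le[where f = "\<lambda>M. M - R"])
    show "inj_on (\<lambda>M. M - R) {M \<in> pairings A. R \<subseteq> M \<and> ?no X Y M}"
      using bij_betw_imp_inj_on[OF bij] by (rule inj_on_subset) blast
    show "(\<lambda>M. M - R) ` {M \<in> pairings A. R \<subseteq> M \<and> ?no X Y M} \<subseteq> {M \<in> pairings ?A'. ?no ?X' ?Y' M}"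
    proof (rule image_subsetI)
      fix M assume M: "M \<in> {M \<in> pairings A. R \<subseteq> M \<and> ?no X Y M}"
      then have "M - R \<in> pairings ?A'" using bij_betwE[OF bij] by simp
      then show "M - R \<in> {M \<in> pairings ?A'. ?no ?X' ?Y' M}" using M by blast
    qed
    show "finite {M \<in> pairings ?A'. ?no ?X' ?Y' M}" using finite_pairings[of ?A'] A by simp
  qed
  also have "real \<dots> \<le> matchings (card ?A') * exp (- real (card ?X') * real (card ?Y') / (2 * ?L))"
  proof (rule card_pairings_avoiding_le)
    show "finite ?A'" using A by simp
    show "even (card ?A')" using A cA' by simp
    show "?X' \<subseteq> ?A'" "?Y' \<subseteq> ?A'" "?X' \<inter> ?Y' = {}" using XY by blast+
    show "card ?A' \<le> card A" using cA' by simp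
  qed
  also have "\<dots> \<le> matchings (card ?A') * (exp ?r * exp (- (real (card X) * real (card Y)) / (2 * ?L)))"
  proof (intro mult_left_mono)
    let ?a = "real (card X)" and ?b = "real (card Y)"
    have ge: "real (card X) - 2 * ?r \<le> real (card ?X')" "real (card Y) - 2 * ?r \<le> real (card ?Y')"
      using diff_card_le_card_Diff[OF fin(1), of X] diff_card_le_card_Diff[OF fin(1), of Y] unfolding cU by linarith+
    have ab: "?a + ?b \<le> ?L"
      using card_mono[OF A(1), of "X \<union> Y"] card_Un_disjoint[OF fin(2,3) XY(3)] XY by simp
    \<comment> \<open>If one of the sets has fewer than 2 r points, the left-hand side is at most 0;
      otherwise the two lower bounds are nonnegative and can be multiplied.\<close>
    have "?a * ?b - 2 * ?r * (?a + ?b) \<le> real (card ?X') * real (card ?Y')"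
    proof (cases "?a \<ge> 2 * ?r \<and> ?b \<ge> 2 * ?r")
      case True
      have "?a * ?b - 2 * ?r * (?a + ?b) \<le> (?a - 2 * ?r) * (?b - 2 * ?r)" by (simp add: algebra_simps)
      also have "\<dots> \<le> real (card ?X') * real (card ?Y')" using ge True by (intro mult_mono) auto
      finally show ?thesis .
    next
      case False
      then have "?a * ?b \<le> 2 * ?r * ?b \<or> ?a * ?b \<le> ?a * (2 * ?r)"
        by (metis mult_left_mono mult_right_mono nle_le of_nat_0_le_iff)
      moreover have "0 \<le> ?r * ?a" "0 \<le> ?r * ?b" "0 \<le> real (card ?X') * real (card ?Y')" by simp_all
      ultimately show ?thesis by (simp only: algebra_simps) linarith
    qed
    moreover have "2 * ?r * (?a + ?b) \<le> 2 * ?r * ?L" using ab by (intro mult_left_mono) auto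
    ultimately have "?a * ?b - 2 * ?r * ?L \<le> real (card ?X') * real (card ?Y')" by linarith
    then have "- real (card ?X') * real (card ?Y') / (2 * ?L) \<le> (2 * ?r * ?L - ?a * ?b) / (2 * ?L)"
      using L by (intro divide_right_mono) auto
    also have "\<dots> = ?r + - (?a * ?b) / (2 * ?L)" using L by (simp add: diff_divide_distrib)
    finally show "exp (- real (card ?X') * real (card ?Y') / (2 * ?L)) \<le> exp ?r * exp (- (?a * ?b) / (2 * ?L))"
      by (simp add: exp_add[symmetric])
  qed auto
  finally show ?thesis unfolding cA' by simp
qed

text \<open>Union bound over the choice \<open>g\<close> of one half-edge pair for each required
  edge. Choices with overlapping pairs contribute nothing, since no pairing contains them.\<close>

lemma card_pairings_realizing_le:
  assumes A: "half_edges n d' = A" "even (card A)" "4 * card E \<le> card A"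
    and E: "E \<subseteq> vertex_pairs n" and XY: "X \<subseteq> A" "Y \<subseteq> A" "X \<inter> Y = {}"
  shows "real (card {M \<in> pairings A. (\<forall>e\<in>E. edge_pairs d' e \<inter> M \<noteq> {}) \<and> (\<forall>x\<in>X. \<forall>y\<in>Y. {x, y} \<notin> M)})
      / card (pairings A)
    \<le> (\<Prod>e\<in>E. 2 * edge_weight d' e / card A) *
      (exp (real (card E)) * exp (- (real (card X) * real (card Y)) / (2 * real (card A))))"
proof -
  let ?no = "\<lambda>M. \<forall>x\<in>X. \<forall>y\<in>Y. {x, y} \<notin> M"
  let ?W = "exp (real (card E)) * exp (- (real (card X) * real (card Y)) / (2 * real (card A)))"
  let ?m = "real (matchings (card A - 2 * card E))"
  have finA: "finite A" using A(1) half_edges_card(2) by blast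
  have finite_edges: "finite E" using E finite_subset by fastforce
  have finP: "finite (pairings A)" using finA by (rule finite_pairings)
  let ?G = "PiE E (edge_pairs d')"
  have fep: "finite (edge_pairs d' e)" if "e \<in> E" for e using E that card_edge_pairs(2) by blast
  have finG: "finite ?G" using finite_edges fep by (intro finite_PiE) auto
  have sub: "{M \<in> pairings A. (\<forall>e\<in>E. edge_pairs d' e \<inter> M \<noteq> {}) \<and> ?no M}
     \<subseteq> (\<Union>g\<in>?G. {M \<in> pairings A. g ` E \<subseteq> M \<and> ?no M})"
  proof
    fix M assume M: "M \<in> {M \<in> pairings A. (\<forall>e\<in>E. edge_pairs d' e \<inter> M \<noteq> {}) \<and> ?no M}"
    then have "\<forall>e\<in>E. \<exists>p. p \<in> edge_pairs d' e \<and> p \<in> M" by blast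
    then obtain g where g: "\<And>e. e \<in> E \<Longrightarrow> g e \<in> edge_pairs d' e \<and> g e \<in> M" by metis
    then have "restrict g E \<in> ?G" "restrict g E ` E \<subseteq> M" by auto
    then show "M \<in> (\<Union>g\<in>?G. {M \<in> pairings A. g ` E \<subseteq> M \<and> ?no M})" using M by blast
  qed
  have each: "real (card {M \<in> pairings A. g ` E \<subseteq> M \<and> ?no M}) \<le> ?m * ?W" if g: "g \<in> ?G" for g
  proof (cases "disjoint (g ` E)")
    case True
    have ge: "g e \<in> edge_pairs d' e" if "e \<in> E" for e using g that by auto
    \<comment> \<open>The vertices of a half-edge pair determine its edge, so the chosen pairs are
      distinct.\<close>
    have "inj_on g E"
    proof (rule inj_onI)
      fix e f assume "e \<in> E" "f \<in> E" "g e = g f"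
      then show "e = f" using edge_pairs_fst[OF ge] by metis
    qed
    then have c: "card (g ` E) = card E" by (rule card_image)
    have he: "g e \<subseteq> A \<and> card (g e) = 2" if "e \<in> E" for e
      using edge_pairs_half_edges[OF subsetD[OF E that] ge[OF that]] A(1) by simp
    have "real (card {M \<in> pairings A. g ` E \<subseteq> M \<and> ?no M}) \<le> matchings (card A - 2 * card (g ` E)) *
      (exp (real (card (g ` E))) * exp (- (real (card X) * real (card Y)) / (2 * real (card A))))"
      by (rule card_pairings_containing_avoiding_le[OF finA A(2) True _ _ XY]) (use he in auto)
    then show ?thesis unfolding c .
  next
    case False
    have "M \<notin> {M \<in> pairings A. g ` E \<subseteq> M \<and> ?no M}" for M
    proof
      assume "M \<in> {M \<in> pairings A. g ` E \<subseteq> M \<and> ?no M}"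
      then have "disjoint M" "g ` E \<subseteq> M" by (simp_all add: pairings_iff)
      then have "disjoint (g ` E)" by (rule pairwise_subset)
      then show False using False by simp
    qed
    then have e: "{M \<in> pairings A. g ` E \<subseteq> M \<and> ?no M} = {}" by blast
    show ?thesis unfolding e by simp
  qed
  have "real (card {M \<in> pairings A. (\<forall>e\<in>E. edge_pairs d' e \<inter> M \<noteq> {}) \<and> ?no M})
     \<le> real (card (\<Union>g\<in>?G. {M \<in> pairings A. g ` E \<subseteq> M \<and> ?no M}))"
    using sub finG finP by (intro of_nat_mono card_mono) auto
  also have "\<dots> \<le> real (\<Sum>g\<in>?G. card {M \<in> pairings A. g ` E \<subseteq> M \<and> ?no M})"
    using finG by (intro of_nat_mono card_UN_le)
  also have "\<dots> \<le> (\<Sum>g\<in>?G. ?m * ?W)" unfolding of_nat_sum by (intro sum_mono each)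
  also have "\<dots> = (\<Prod>e\<in>E. real (card (edge_pairs d' e))) * (?m * ?W)"
    using finite_edges by (simp add: card_PiE)
  also have "(\<Prod>e\<in>E. real (card (edge_pairs d' e))) = (\<Prod>e\<in>E. edge_weight d' e)"
    using E card_edge_pairs(1) by (intro prod.cong) auto
  finally have "real (card {M \<in> pairings A. (\<forall>e\<in>E. edge_pairs d' e \<inter> M \<noteq> {}) \<and> ?no M}) / card (pairings A)
     \<le> (\<Prod>e\<in>E. edge_weight d' e) * (?m * ?W) / card (pairings A)"
    by (rule divide_right_mono) simp
  also have "\<dots> = (\<Prod>e\<in>E. edge_weight d' e) * (?m / matchings (card A)) * ?W"
    using card_pairings[OF finA A(2)] by simp
  also have "\<dots> \<le> (\<Prod>e\<in>E. edge_weight d' e) * (2 / real (card A)) ^ card E * ?W"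
    using matchings_ratio_le[OF A(3)] by (intro mult_right_mono mult_left_mono prod_nonneg) auto
  also have "(\<Prod>e\<in>E. edge_weight d' e) * (2 / real (card A)) ^ card E = (\<Prod>e\<in>E. 2 * edge_weight d' e / card A)"
    using prod.distrib[of "\<lambda>e. edge_weight d' e" "\<lambda>_. 2 / real (card A)" E] by (simp add: mult.commute)
  finally show ?thesis .
qed

text \<open>This holds for all degrees, however large. A required edge of weight at least n is
  dropped, its factor in the bound being 1; the others enter through the union bound. Among the
  forbidden pairs only the heaviest is kept: its weight is at least the average, so its decay
  dominates the product over all of them once the rate is divided by their number.\<close>

theorem pattern_prob_upper_bound:
  fixes \<nu> :: real
  assumes \<nu>: "\<nu> > 0"
  shows "\<exists>C>0. \<exists>\<kappa>>0. \<forall>n. 4 * K \<le> n \<longrightarrow> (\<forall>d E F. n \<ge> 1 \<longrightarrow> (\<forall>v\<in>{1..n}. d v \<ge> 1) \<longrightarrow> real (\<Sum>v\<in>{1..n}. d v) \<le> \<nu> * n \<longrightarrow>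
     E \<subseteq> vertex_pairs n \<longrightarrow> F \<subseteq> vertex_pairs n \<longrightarrow> card E \<le> K \<longrightarrow> card F \<le> K \<longrightarrow>
     pattern_prob n d E F \<le> C * (\<Prod>e\<in>E. min 1 (edge_weight d e / n)) * (\<Prod>e\<in>F. exp (- \<kappa> * (edge_weight d e / n))))"
proof -
  \<comment> \<open>The 2 comes from \<open>card_pairings_avoiding_le\<close>, \<nu> + 1 bounds the
    number of half-edges per vertex, and \<open>Suc K\<close> shares the decay of the heaviest pair
    among all of \<open>F\<close>.\<close>
  define \<kappa> where "\<kappa> = 1 / (2 * (\<nu> + 1) * Suc K)"
  have \<kappa>: "\<kappa> > 0" using \<nu> by (simp add: \<kappa>_def)
  \<comment> \<open>Per edge a factor 2 from \<open>matchings_ratio_le\<close>, and 4 because the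
    parity correction at most doubles a degree that is at least 1. The exponential is the cost of
    prescribing pairs in \<open>card_pairings_containing_avoiding_le\<close>.\<close>
  define C where "C = 8 ^ K * exp (real K)"
  have C: "C > 0" by (simp add: C_def)
  show ?thesis
  proof (rule exI[of _ C], rule conjI[OF C], rule exI[of _ \<kappa>], rule conjI[OF \<kappa>], intro allI impI)
    fix n d and E F :: "nat set set"
    assume nK: "4 * K \<le> n" and n: "n \<ge> 1" and d1: "\<forall>v\<in>{1..n}. d v \<ge> 1" and s: "real (\<Sum>v\<in>{1..n}. d v) \<le> \<nu> * n"
      and E: "E \<subseteq> vertex_pairs n" and F: "F \<subseteq> vertex_pairs n" and card: "card E \<le> K" "card F \<le> K"
    define d' where "d' = fix_parity n d"
    define A where "A = half_edges n d'"
    have finA: "finite A" unfolding A_def by (rule half_edges_card)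
    have cA: "even (card A)" "n \<le> card A" "real (card A) \<le> (\<nu> + 1) * n"
    proof -
      show "even (card A)" unfolding A_def half_edges_card d'_def by (rule sum_fix_parity)
      have "n = (\<Sum>v\<in>{1..n}. 1)" by simp
      also have "\<dots> \<le> (\<Sum>v\<in>{1..n}. d v)" by (intro sum_mono) (use d1 in auto)
      also have "\<dots> \<le> card A" unfolding A_def half_edges_card d'_def by (rule sum_fix_parity)
      finally show "n \<le> card A" .
      have "card A \<le> (\<Sum>v\<in>{1..n}. d v) + 1" unfolding A_def half_edges_card d'_def by (rule sum_fix_parity)
      then have "real (card A) \<le> \<nu> * n + 1" using s by linarith
      then show "real (card A) \<le> (\<nu> + 1) * n" using n by (simp add: distrib_right)
    qed
    define E' where "E' = {e\<in>E. edge_weight d e < n}"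
    have finite_edges: "finite E" "finite F" using E F finite_subset by fastforce+
    have E': "E' \<subseteq> E" "E' \<subseteq> vertex_pairs n" "card E' \<le> K"
      using E card card_mono[OF finite_edges(1), of E'] by (auto simp: E'_def)
    let ?P = "\<Prod>e\<in>E. min 1 (edge_weight d e / n)"
    have P0: "?P \<ge> 0" by (intro prod_nonneg) auto
    have prodE: "(\<Prod>e\<in>E'. 2 * edge_weight d' e / card A) \<le> 8 ^ K * ?P"
    proof -
      have "(\<Prod>e\<in>E'. 2 * edge_weight d' e / card A) \<le> (\<Prod>e\<in>E'. 8 * min 1 (edge_weight d e / n))"
      proof (intro prod_mono conjI)
        fix e assume e: "e \<in> E'"
        show "0 \<le> 2 * edge_weight d' e / card A" by simp
        obtain u v where uv: "e = {u, v}" "u \<noteq> v" "u \<in> {1..n}" "v \<in> {1..n}"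
          using vertex_pairsE[OF subsetD[OF E'(2) e]] by metis
        have le2: "real (d' x) \<le> 2 * real (d x)" if "x \<in> {1..n}" for x
        proof -
          have "d' x \<le> d x + 1" unfolding d'_def by (rule fix_parity_bounds)
          moreover have "1 \<le> d x" using d1 that by blast
          ultimately show ?thesis by linarith
        qed
        have "edge_weight d' e \<le> (2 * real (d u)) * (2 * real (d v))"
          unfolding uv(1) edge_weight_doubleton[OF uv(2)] using uv by (intro mult_mono le2) auto
        also have "\<dots> = 4 * edge_weight d e" unfolding uv(1) edge_weight_doubleton[OF uv(2)] by simp
        finally have "2 * edge_weight d' e / card A \<le> 8 * edge_weight d e / n"
          using cA(2) n by (intro frac_le) auto
        also have "\<dots> = 8 * min 1 (edge_weight d e / n)" using e n by (simp add: E'_def)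
        finally show "2 * edge_weight d' e / card A \<le> 8 * min 1 (edge_weight d e / n)" .
      qed
      also have "\<dots> = 8 ^ card E' * (\<Prod>e\<in>E'. min 1 (edge_weight d e / n))" by (simp add: prod.distrib)
      also have "(\<Prod>e\<in>E'. min 1 (edge_weight d e / n)) = ?P"
      proof (rule prod.mono_neutral_left[OF finite_edges(1) E'(1)], rule ballI)
        fix e assume "e \<in> E - E'"
        then have "\<not> edge_weight d e < n" by (auto simp: E'_def)
        then show "min 1 (edge_weight d e / n) = 1" using n by simp
      qed
      also have "8 ^ card E' * ?P \<le> 8 ^ K * ?P"
        using E'(3) P0 by (intro mult_right_mono power_increasing) auto
      finally show ?thesis .
    qed
    have bound: "pattern_prob n d E F \<le> 8 ^ K * ?P * (exp K * exp (- (real (card X) * real (card Y)) / (2 * real (card A))))"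
      if XY: "X \<subseteq> A" "Y \<subseteq> A" "X \<inter> Y = {}"
        and no: "\<And>M. M \<in> pairings A \<Longrightarrow> F \<inter> erase M = {} \<Longrightarrow> \<forall>x\<in>X. \<forall>y\<in>Y. {x, y} \<notin> M" for X Y
    proof -
      let ?W = "exp (- (real (card X) * real (card Y)) / (2 * real (card A)))"
      have "pattern_prob n d E F = real (card {M \<in> pairings A. E \<subseteq> erase M \<and> F \<inter> erase M = {}}) / card (pairings A)"
        by (simp add: pattern_prob_eq_card A_def d'_def)
      also have "\<dots> \<le> real (card {M \<in> pairings A. (\<forall>e\<in>E'. edge_pairs d' e \<inter> M \<noteq> {}) \<and> (\<forall>x\<in>X. \<forall>y\<in>Y. {x, y} \<notin> M)}) / card (pairings A)"
      proof (intro divide_right_mono of_nat_mono card_mono)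
        show "finite {M \<in> pairings A. (\<forall>e\<in>E'. edge_pairs d' e \<inter> M \<noteq> {}) \<and> (\<forall>x\<in>X. \<forall>y\<in>Y. {x, y} \<notin> M)}"
          using finite_pairings[OF finA] by simp
        show "{M \<in> pairings A. E \<subseteq> erase M \<and> F \<inter> erase M = {}}
            \<subseteq> {M \<in> pairings A. (\<forall>e\<in>E'. edge_pairs d' e \<inter> M \<noteq> {}) \<and> (\<forall>x\<in>X. \<forall>y\<in>Y. {x, y} \<notin> M)}"
        proof
          fix M assume M: "M \<in> {M \<in> pairings A. E \<subseteq> erase M \<and> F \<inter> erase M = {}}"
          then have MA: "M \<in> pairings (half_edges n d')" by (simp add: A_def)
          have "edge_pairs d' e \<inter> M \<noteq> {}" if "e \<in> E'" for e
            using mem_erase_iff[OF MA subsetD[OF E'(2) that]] M that E'(1) by blast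
          then show "M \<in> {M \<in> pairings A. (\<forall>e\<in>E'. edge_pairs d' e \<inter> M \<noteq> {}) \<and> (\<forall>x\<in>X. \<forall>y\<in>Y. {x, y} \<notin> M)}"
            using M no[of M] by blast
        qed
      qed simp
      also have "\<dots> \<le> (\<Prod>e\<in>E'. 2 * edge_weight d' e / card A) * (exp (real (card E')) * ?W)"
        by (rule card_pairings_realizing_le[OF A_def[symmetric] cA(1) _ E'(2) XY])
           (use nK cA(2) E'(3) in linarith)
      also have "\<dots> \<le> (8 ^ K * ?P) * (exp K * ?W)"
        using E'(3) P0 by (intro mult_mono[OF prodE] mult_right_mono) auto
      finally show ?thesis .
    qed
    show "pattern_prob n d E F \<le> C * ?P * (\<Prod>e\<in>F. exp (- \<kappa> * (edge_weight d e / n)))"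
    proof (cases "F = {}")
      case True
      then show ?thesis using bound[of "{}" "{}"] by (simp add: C_def mult_ac)
    next
      case False
      define m where "m = Max (edge_weight d ` F)"
      have "m \<in> edge_weight d ` F" unfolding m_def using finite_edges False by (intro Max_in) auto
      then obtain f where f: "f \<in> F" "m = edge_weight d f" by blast
      have mmax: "edge_weight d e \<le> m" if "e \<in> F" for e unfolding m_def using finite_edges that by (intro Max_ge) auto
      have m0: "m \<ge> 0" using f by simp
      obtain u v where uv: "f = {u, v}" "u \<noteq> v" "u \<in> {1..n}" "v \<in> {1..n}"
        using vertex_pairsE[OF subsetD[OF F f(1)]] by metis
      let ?X = "(\<lambda>i. (u, i)) ` {..<d' u}" and ?Y = "(\<lambda>i. (v, i)) ` {..<d' v}"
      have cXY: "card ?X = d' u" "card ?Y = d' v" by (simp_all add: card_image inj_on_def)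
      have "pattern_prob n d E F \<le> 8 ^ K * ?P * (exp K * exp (- (real (card ?X) * real (card ?Y)) / (2 * real (card A))))"
      proof (rule bound)
        show "?X \<subseteq> A" "?Y \<subseteq> A" using uv by (auto simp: A_def half_edges_def)
        show "?X \<inter> ?Y = {}" using uv by auto
        fix M assume M: "M \<in> pairings A" "F \<inter> erase M = {}"
        then have "f \<notin> erase M" using f by blast
        then show "\<forall>x\<in>?X. \<forall>y\<in>?Y. {x, y} \<notin> M" using uv unfolding erase_def by blast
      qed
      also have "\<dots> \<le> 8 ^ K * ?P * (exp K * (\<Prod>e\<in>F. exp (- \<kappa> * (edge_weight d e / n))))"
      proof (intro mult_left_mono)
        have "real (d u) * real (d v) \<le> real (d' u) * real (d' v)"
          unfolding d'_def by (intro mult_mono of_nat_mono fix_parity_bounds) auto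
        then have "m \<le> real (card ?X) * real (card ?Y)" unfolding f(2) uv(1) edge_weight_doubleton[OF uv(2)] cXY .
        have "(\<Sum>e\<in>F. \<kappa> * (edge_weight d e / n)) \<le> (\<Sum>e\<in>F. \<kappa> * (m / n))"
          using mmax \<kappa> by (intro sum_mono mult_left_mono divide_right_mono) auto
        also have "\<dots> = card F * (\<kappa> * (m / n))" by simp
        also have "\<dots> \<le> Suc K * (\<kappa> * (m / n))" using card m0 \<kappa> by (intro mult_right_mono) auto
        also have "\<dots> = m / (2 * ((\<nu> + 1) * n))"
        proof -
          have "real (Suc K) * \<kappa> = 1 / (2 * (\<nu> + 1))" unfolding \<kappa>_def by simp
          then have "real (Suc K) * (\<kappa> * (m / n)) = 1 / (2 * (\<nu> + 1)) * (m / n)" by (metis mult.assoc)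
          then show ?thesis by simp
        qed
        also have "\<dots> \<le> m / (2 * real (card A))" using cA n m0 \<nu> by (intro divide_left_mono mult_left_mono) auto
        also have "\<dots> \<le> (real (card ?X) * real (card ?Y)) / (2 * real (card A))"
          using \<open>m \<le> real (card ?X) * real (card ?Y)\<close> by (intro divide_right_mono) auto
        finally have "exp (- (real (card ?X) * real (card ?Y)) / (2 * real (card A))) \<le> exp (\<Sum>e\<in>F. - \<kappa> * (edge_weight d e / n))"
          by (simp add: sum_negf)
        then show "exp (- (real (card ?X) * real (card ?Y)) / (2 * real (card A))) \<le> (\<Prod>e\<in>F. exp (- \<kappa> * (edge_weight d e / n)))"
          using finite_edges by (simp add: exp_sum)
      qed (use P0 in auto)
      finally show ?thesis by (simp add: C_def mult_ac)
    qed
  qed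
qed

section \<open>Coercivity on the logarithmic scale\<close>

definition pair_sum :: "('a \<Rightarrow> real) \<Rightarrow> 'a set \<Rightarrow> real" where
  "pair_sum u e = (\<Sum>i\<in>e. u i)"

text \<open>
  On the scale \<open>x i = exp (u i)\<close>, \<open>log_rate\<close> is the logarithm of
  \<open>(\<Prod>i\<in>V. x i powr (1 - \<tau>)) * (\<Prod>e\<in>E. min 1 y\<^sub>e) * (\<Prod>e\<in>F. min 1 (y\<^sub>e powr (- m)))\<close> with
  \<open>y\<^sub>e = (\<Prod>i\<in>e. x i)\<close>; the power \<open>m\<close> stands in for the exponential decay along the edges in \<open>F\<close>.
\<close>

definition log_rate :: "real \<Rightarrow> nat \<Rightarrow> 'a set \<Rightarrow> 'a set set \<Rightarrow> 'a set set \<Rightarrow> ('a \<Rightarrow> real) \<Rightarrow> real" where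
  "log_rate \<tau> m V E F u = (1 - \<tau>) * (\<Sum>i\<in>V. u i) + (\<Sum>e\<in>E. min 0 (pair_sum u e))
     - real m * (\<Sum>e\<in>F. max 0 (pair_sum u e))"

text \<open>The sign layer and the remainder never pull the sum in opposite directions: the layer
  contributes 0 when the signs are opposite, and otherwise both parts have the same weak sign. For
  such summands positive and negative parts are additive.\<close>

lemma min_max_layer:
  fixes a b t :: real
  assumes "t > 0" "a = 0 \<or> \<bar>a\<bar> \<ge> t" "b = 0 \<or> \<bar>b\<bar> \<ge> t"
  shows "min 0 (a + b) = t * min 0 (sgn a + sgn b) + min 0 ((a - t * sgn a) + (b - t * sgn b))"
    and "max 0 (a + b) = t * max 0 (sgn a + sgn b) + max 0 ((a - t * sgn a) + (b - t * sgn b))"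
proof -
  have "a = 0 \<and> sgn a = 0 \<or> a \<ge> t \<and> sgn a = 1 \<or> a \<le> - t \<and> sgn a = -1"
    "b = 0 \<and> sgn b = 0 \<or> b \<ge> t \<and> sgn b = 1 \<or> b \<le> - t \<and> sgn b = -1"
    using assms by (auto simp: sgn_if abs_if split: if_splits)
  then show "min 0 (a + b) = t * min 0 (sgn a + sgn b) + min 0 ((a - t * sgn a) + (b - t * sgn b))"
    "max 0 (a + b) = t * max 0 (sgn a + sgn b) + max 0 ((a - t * sgn a) + (b - t * sgn b))"
    using assms(1) by (elim disjE conjE; simp add: min_def max_def)+
qed

lemma log_rate_layer:
  fixes u :: "'a \<Rightarrow> real"
  assumes E: "\<forall>e\<in>E \<union> F. card e = 2 \<and> e \<subseteq> V" and t: "t > 0" "\<forall>i\<in>V. u i = 0 \<or> \<bar>u i\<bar> \<ge> t"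
  shows "log_rate \<tau> m V E F u = t * log_rate \<tau> m V E F (\<lambda>i. sgn (u i)) + log_rate \<tau> m V E F (\<lambda>i. u i - t * sgn (u i))"
proof -
  have p: "min 0 (pair_sum u e) = t * min 0 (pair_sum (\<lambda>i. sgn (u i)) e) + min 0 (pair_sum (\<lambda>i. u i - t * sgn (u i)) e)"
    "max 0 (pair_sum u e) = t * max 0 (pair_sum (\<lambda>i. sgn (u i)) e) + max 0 (pair_sum (\<lambda>i. u i - t * sgn (u i)) e)"
    if "e \<in> E \<union> F" for e
  proof -
    have "card e = 2" using E that by blast
    then obtain i j where e: "e = {i, j}" "i \<noteq> j" by (auto simp: card_2_iff)
    have "e \<subseteq> V" using E that by blast
    then have ij: "i \<in> V" "j \<in> V" using e by auto
    have "pair_sum w e = w i + w j" for w using e by (simp add: pair_sum_def)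
    then show "min 0 (pair_sum u e) = t * min 0 (pair_sum (\<lambda>i. sgn (u i)) e) + min 0 (pair_sum (\<lambda>i. u i - t * sgn (u i)) e)"
      "max 0 (pair_sum u e) = t * max 0 (pair_sum (\<lambda>i. sgn (u i)) e) + max 0 (pair_sum (\<lambda>i. u i - t * sgn (u i)) e)"
      using min_max_layer[OF t(1) bspec[OF t(2) ij(1)] bspec[OF t(2) ij(2)]] by (simp_all only:)
  qed
  have "(\<Sum>e\<in>E. min 0 (pair_sum u e)) = t * (\<Sum>e\<in>E. min 0 (pair_sum (\<lambda>i. sgn (u i)) e))
      + (\<Sum>e\<in>E. min 0 (pair_sum (\<lambda>i. u i - t * sgn (u i)) e))"
    unfolding sum_distrib_left sum.distrib[symmetric] by (intro sum.cong p) auto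
  moreover have "(\<Sum>e\<in>F. max 0 (pair_sum u e)) = t * (\<Sum>e\<in>F. max 0 (pair_sum (\<lambda>i. sgn (u i)) e))
      + (\<Sum>e\<in>F. max 0 (pair_sum (\<lambda>i. u i - t * sgn (u i)) e))"
    unfolding sum_distrib_left sum.distrib[symmetric] by (intro sum.cong p) auto
  moreover have "(\<Sum>i\<in>V. u i) = t * (\<Sum>i\<in>V. sgn (u i)) + (\<Sum>i\<in>V. u i - t * sgn (u i))"
    by (simp add: sum_distrib_left sum_subtractf)
  ultimately show ?thesis unfolding log_rate_def by (simp only: algebra_simps)
qed

text \<open>
  \<open>log_rate\<close> is additive along the decomposition of a vector into its level sets, so it suffices
  to control it on vectors with entries in \<open>{-1, 0, 1}\<close>.
\<close>

lemma log_rate_le: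
  fixes u :: "'a \<Rightarrow> real"
  assumes E: "\<forall>e\<in>E \<union> F. card e = 2 \<and> e \<subseteq> V" and V: "finite V"
    and sign: "\<And>s. (\<forall>i\<in>V. s i \<in> {-1, 0, 1}) \<Longrightarrow> (\<exists>i\<in>V. s i \<noteq> 0) \<Longrightarrow> log_rate \<tau> m V E F s \<le> - \<delta>"
    and \<delta>: "\<delta> > 0"
  shows "\<forall>i\<in>V. log_rate \<tau> m V E F u \<le> - \<delta> * \<bar>u i\<bar>"
proof (induction "card {i\<in>V. u i \<noteq> 0}" arbitrary: u rule: less_induct)
  case less
  show ?case
  proof (cases "\<forall>i\<in>V. u i = 0")
    case True
    have "pair_sum u e = 0" if "e \<in> E \<union> F" for e
      using E True that unfolding pair_sum_def by (intro sum.neutral) blast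
    then have "log_rate \<tau> m V E F u = 0" using True by (simp add: log_rate_def)
    then show ?thesis using True by simp
  next
    case False
    \<comment> \<open>Peeling off the smallest nonzero modulus sets at least one entry to 0 and
      creates no new nonzero entry, so the support shrinks.\<close>
    define t where "t = Min ((\<lambda>i. \<bar>u i\<bar>) ` {i\<in>V. u i \<noteq> 0})"
    have ne: "finite ((\<lambda>i. \<bar>u i\<bar>) ` {i\<in>V. u i \<noteq> 0})" "(\<lambda>i. \<bar>u i\<bar>) ` {i\<in>V. u i \<noteq> 0} \<noteq> {}"
      using V False by auto
    have "t \<in> (\<lambda>i. \<bar>u i\<bar>) ` {i\<in>V. u i \<noteq> 0}" unfolding t_def by (rule Min_in[OF ne])
    then obtain i0 where i0: "i0 \<in> V" "u i0 \<noteq> 0" "t = \<bar>u i0\<bar>" by auto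
    then have t: "t > 0" by simp
    have tle: "\<forall>i\<in>V. u i = 0 \<or> \<bar>u i\<bar> \<ge> t"
    proof
      fix i assume "i \<in> V"
      then show "u i = 0 \<or> \<bar>u i\<bar> \<ge> t"
        unfolding t_def by (cases "u i = 0") (auto intro!: Min_le[OF ne(1)])
    qed
    let ?s = "\<lambda>i. sgn (u i)" and ?v = "\<lambda>i. u i - t * sgn (u i)"
    have v0: "?v i0 = 0" using i0 by (simp add: sgn_if abs_if)
    have "card {i\<in>V. ?v i \<noteq> 0} < card {i\<in>V. u i \<noteq> 0}"
    proof (rule psubset_card_mono)
      show "{i\<in>V. ?v i \<noteq> 0} \<subset> {i\<in>V. u i \<noteq> 0}" using i0 v0 by auto
    qed (use V in simp)
    then have IH: "\<forall>i\<in>V. log_rate \<tau> m V E F ?v \<le> - \<delta> * \<bar>?v i\<bar>" by (rule less.hyps)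
    have s: "log_rate \<tau> m V E F ?s \<le> - \<delta>"
      using i0 by (intro sign) (auto simp: sgn_if)
    show ?thesis
    proof
      fix i assume i: "i \<in> V"
      have "log_rate \<tau> m V E F u = t * log_rate \<tau> m V E F ?s + log_rate \<tau> m V E F ?v"
        by (rule log_rate_layer[OF E t tle])
      also have "\<dots> \<le> t * (- \<delta>) + - \<delta> * \<bar>?v i\<bar>"
        using s t IH i by (intro add_mono mult_left_mono) auto
      also have "\<dots> = - \<delta> * (t + \<bar>?v i\<bar>)" by (simp add: algebra_simps)
      also have "\<dots> \<le> - \<delta> * \<bar>u i\<bar>"
      proof -
        have "\<bar>u i\<bar> \<le> t + \<bar>?v i\<bar>" using t by (auto simp: sgn_if)
        then show ?thesis using \<delta> by simp
      qed
      finally show "log_rate \<tau> m V E F u \<le> - \<delta> * \<bar>u i\<bar>" .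
    qed
  qed
qed

text \<open>
  This is uniqueness of the maximizer with value 0, on graphs without vertices of degree one: the
  value 0 is attained by \<open>S3 = V\<close>. The sets \<open>S1\<close>, \<open>S2\<close>, \<open>S3\<close> are the level sets of
  a vector in \<open>log_rate_sign_vector\<close> for the values \<open>-1\<close>, \<open>1\<close>, \<open>0\<close>.
\<close>

definition separating :: "'a set \<Rightarrow> 'a set set \<Rightarrow> real \<Rightarrow> 'a set set \<Rightarrow> bool" where
  "separating V E \<tau> F \<longleftrightarrow> (\<forall>S1 S2 S3. S1 \<union> S2 \<union> S3 = V \<longrightarrow> S1 \<inter> S2 = {} \<longrightarrow> S1 \<inter> S3 = {} \<longrightarrow> S2 \<inter> S3 = {} \<longrightarrow>
     (\<forall>i\<in>S2. \<forall>j\<in>S2 \<union> S3. i \<noteq> j \<longrightarrow> {i, j} \<notin> F) \<longrightarrow> S1 \<union> S2 \<noteq> {} \<longrightarrow>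
     real (card S1) - real (card S2) - (2 * real (edges_in E S1) + real (edges_between E S1 S3)) / (\<tau> - 1) < 0)"

text \<open>If some pair in \<open>F\<close> has a positive sum, the penalty of weight m outweighs
  the most that the linear term can contribute. Otherwise the level sets form an admissible
  partition, and \<open>separating\<close> applies.\<close>

lemma log_rate_sign_vector:
  fixes \<tau> :: real and s :: "'a \<Rightarrow> real"
  assumes E: "\<forall>e\<in>E \<union> F. card e = 2 \<and> e \<subseteq> V" and V: "finite V" and \<tau>: "\<tau> > 1"
    and m: "real m > (\<tau> - 1) * card V"
    and sep: "separating V E \<tau> F"
    and s: "\<forall>i\<in>V. s i \<in> {-1, 0, 1}" "\<exists>i\<in>V. s i \<noteq> 0"
  shows "log_rate \<tau> m V E F s < 0"
proof -
  define S1 where "S1 = {i\<in>V. s i = -1}"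
  define S2 where "S2 = {i\<in>V. s i = 1}"
  define S3 where "S3 = {i\<in>V. s i = 0}"
  have fin: "finite E" "finite F"
    using E V by (auto intro!: finite_subset[of _ "Pow V"])
  have S: "S1 \<union> S2 \<union> S3 = V" "S1 \<inter> S2 = {}" "S1 \<inter> S3 = {}" "S2 \<inter> S3 = {}"
    using s(1) by (auto simp: S1_def S2_def S3_def)
  have sumV: "(\<Sum>i\<in>V. s i) = real (card S2) - real (card S1)"
  proof -
    have "(\<Sum>i\<in>V. s i) = (\<Sum>i\<in>V. (if i \<in> S2 then 1 else 0) - (if i \<in> S1 then 1 else 0))"
      using s(1) by (intro sum.cong) (auto simp: S1_def S2_def)
    also have "\<dots> = real (card S2) - real (card S1)"
      using V S by (simp add: sum_subtractf sum.If_cases Int_absorb1 S1_def S2_def Int_def)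
    finally show ?thesis .
  qed
  have sumE: "(\<Sum>e\<in>E. min 0 (pair_sum s e)) = - (2 * real (edges_in E S1) + real (edges_between E S1 S3))"
  proof -
    have "(\<Sum>e\<in>E. min 0 (pair_sum s e)) =
      (\<Sum>e\<in>E. - (2 * (if e \<subseteq> S1 then 1 else 0) + (if \<exists>i\<in>S1. \<exists>j\<in>S3. e = {i, j} then 1 else 0)))"
    proof (intro sum.cong refl)
      fix e assume e: "e \<in> E"
      then have "card e = 2" using E by blast
      then obtain i j where ij: "e = {i, j}" "i \<noteq> j" by (auto simp: card_2_iff)
      have "e \<subseteq> V" using E e by blast
      then have V: "i \<in> V" "j \<in> V" using ij by auto
      have 1: "e \<subseteq> S1 \<longleftrightarrow> s i = -1 \<and> s j = -1" using ij V by (simp add: S1_def)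
      have 2: "(\<exists>i\<in>S1. \<exists>j\<in>S3. e = {i, j}) \<longleftrightarrow> s i = -1 \<and> s j = 0 \<or> s i = 0 \<and> s j = -1"
      proof
        assume "\<exists>i\<in>S1. \<exists>j\<in>S3. e = {i, j}"
        then obtain a b where "a \<in> S1" "b \<in> S3" "{i, j} = {a, b}" using ij by blast
        then show "s i = -1 \<and> s j = 0 \<or> s i = 0 \<and> s j = -1"
          unfolding doubleton_eq_iff S1_def S3_def by blast
      next
        assume "s i = -1 \<and> s j = 0 \<or> s i = 0 \<and> s j = -1"
        then show "\<exists>i\<in>S1. \<exists>j\<in>S3. e = {i, j}"
        proof
          assume "s i = -1 \<and> s j = 0"
          then have "i \<in> S1" "j \<in> S3" using V by (simp_all add: S1_def S3_def)
          then show ?thesis using ij by blast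
        next
          assume "s i = 0 \<and> s j = -1"
          then have "j \<in> S1" "i \<in> S3" using V by (simp_all add: S1_def S3_def)
          then show ?thesis using ij by (metis insert_commute)
        qed
      qed
      have "pair_sum s e = s i + s j" using ij by (simp add: pair_sum_def)
      then show "min 0 (pair_sum s e) = - (2 * (if e \<subseteq> S1 then 1 else 0) + (if \<exists>i\<in>S1. \<exists>j\<in>S3. e = {i, j} then 1 else 0))"
        unfolding 1 2 using bspec[OF s(1) V(1)] bspec[OF s(1) V(2)] by auto
    qed
    also have "\<dots> = - (2 * real (edges_in E S1) + real (edges_between E S1 S3))"
    proof -
      have "(\<Sum>e\<in>E. if Q e then 1 else 0) = real (card {e\<in>E. Q e})" for Q
        using fin by (simp add: sum.inter_filter[symmetric])
      then show ?thesis
        unfolding sum_negf sum.distrib sum_distrib_left[symmetric] edges_in_def edges_between_def by simp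
    qed
    finally show ?thesis .
  qed
  show ?thesis
  proof (cases "\<exists>e\<in>F. pair_sum s e > 0")
    case True
    then obtain e where e: "e \<in> F" "pair_sum s e > 0" by blast
    have "card e = 2" using E e by blast
    then obtain i j where ij: "e = {i, j}" "i \<noteq> j" by (auto simp: card_2_iff)
    have "e \<subseteq> V" using E e by blast
    then have V': "i \<in> V" "j \<in> V" using ij by auto
    \<comment> \<open>A sum of two entries in {-1, 0, 1} is an integer, so a positive one is at
      least 1.\<close>
    have "pair_sum s e \<ge> 1" using e(2) ij bspec[OF s(1) V'(1)] bspec[OF s(1) V'(2)] by (auto simp: pair_sum_def)
    then have "1 \<le> (\<Sum>e\<in>{e}. max 0 (pair_sum s e))" by simp
    also have "\<dots> \<le> (\<Sum>e\<in>F. max 0 (pair_sum s e))" using fin e by (intro sum_mono2) auto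
    finally have "real m * 1 \<le> real m * (\<Sum>e\<in>F. max 0 (pair_sum s e))" by (intro mult_left_mono) auto
    moreover have "(\<Sum>e\<in>E. min 0 (pair_sum s e)) \<le> 0" by (intro sum_nonpos) auto
    moreover have "(1 - \<tau>) * (\<Sum>i\<in>V. s i) \<le> (\<tau> - 1) * card V"
    proof -
      have "card S1 \<le> card V" using V S by (intro card_mono) auto
      then have "(\<tau> - 1) * (real (card S1) - real (card S2)) \<le> (\<tau> - 1) * card V"
        using \<tau> by (intro mult_left_mono) auto
      then show ?thesis unfolding sumV by (simp add: algebra_simps)
    qed
    ultimately show ?thesis using m unfolding log_rate_def by linarith
  next
    case False
    have no: "\<forall>i\<in>S2. \<forall>j\<in>S2 \<union> S3. i \<noteq> j \<longrightarrow> {i, j} \<notin> F"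
    proof (intro ballI impI notI)
      fix i j assume ij: "i \<in> S2" "j \<in> S2 \<union> S3" "i \<noteq> j" "{i, j} \<in> F"
      then have "pair_sum s {i, j} > 0" by (auto simp: pair_sum_def S2_def S3_def)
      then show False using False ij by blast
    qed
    have "S1 \<union> S2 \<noteq> {}" using s by (auto simp: S1_def S2_def)
    then have obj: "real (card S1) - real (card S2) - (2 * real (edges_in E S1) + real (edges_between E S1 S3)) / (\<tau> - 1) < 0"
      using sep S no unfolding separating_def by blast
    have "(\<tau> - 1) * (real (card S1) - real (card S2) - (2 * real (edges_in E S1) + real (edges_between E S1 S3)) / (\<tau> - 1)) < 0"
      using obj \<tau> by (intro mult_pos_neg) auto
    moreover have "(\<tau> - 1) * (real (card S1) - real (card S2) - (2 * real (edges_in E S1) + real (edges_between E S1 S3)) / (\<tau> - 1))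
        = (1 - \<tau>) * (real (card S2) - real (card S1)) - (2 * real (edges_in E S1) + real (edges_between E S1 S3))"
      using \<tau> by (simp add: right_diff_distrib) (simp add: algebra_simps)
    moreover have "(\<Sum>e\<in>F. max 0 (pair_sum s e)) = 0" using False by (intro sum.neutral) auto
    ultimately show ?thesis unfolding log_rate_def sumV sumE by simp
  qed
qed

text \<open>There are only finitely many sign vectors on \<open>V\<close>, so their strictly
  negative values are bounded away from 0. Then \<open>log_rate_le\<close> bounds the rate by each
  coordinate separately, and averaging over the coordinates gives the sum at the cost of a factor in
  \<delta>.\<close>

lemma log_rate_coercive:
  fixes \<tau> :: real and V :: "'a set"
  assumes E: "\<forall>e\<in>E \<union> F. card e = 2 \<and> e \<subseteq> V" and V: "finite V" and \<tau>: "\<tau> > 1"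
    and m: "real m > (\<tau> - 1) * card V" and sep: "separating V E \<tau> F"
  shows "\<exists>\<delta>>0. \<forall>u. log_rate \<tau> m V E F u \<le> - \<delta> * (\<Sum>i\<in>V. \<bar>u i\<bar>)"
proof -
  let ?T = "{s \<in> V \<rightarrow>\<^sub>E {-1, 0, 1 :: real}. \<exists>i\<in>V. s i \<noteq> 0}"
  have fin: "finite ?T" using V by (intro finite_subset[OF _ finite_PiE[of V "\<lambda>_. {-1, 0, 1 :: real}"]]) auto
  have "\<exists>\<delta>>0. \<forall>s\<in>?T. log_rate \<tau> m V E F s \<le> - \<delta>"
  proof (cases "?T = {}")
    case True
    then show ?thesis by (intro exI[of _ 1]) auto
  next
    case False
    let ?M = "Max (log_rate \<tau> m V E F ` ?T)"
    have "?M \<in> log_rate \<tau> m V E F ` ?T" using fin False by (intro Max_in) auto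
    then obtain s where s: "s \<in> ?T" "?M = log_rate \<tau> m V E F s" by blast
    then have "?M < 0" using log_rate_sign_vector[OF E V \<tau> m sep, of s] by auto
    moreover have "log_rate \<tau> m V E F s \<le> ?M" if "s \<in> ?T" for s using fin that by (intro Max_ge) auto
    ultimately show ?thesis by (intro exI[of _ "- ?M"]) auto
  qed
  then obtain \<delta> where \<delta>: "\<delta> > 0" "\<And>s. s \<in> ?T \<Longrightarrow> log_rate \<tau> m V E F s \<le> - \<delta>" by blast
  \<comment> \<open>The rate depends on \<open>s\<close> only through its values on
    \<open>V\<close>, so \<open>s\<close> may be replaced by its restriction, a member of the finite
    set \<open>?T\<close>.\<close>
  have sign: "log_rate \<tau> m V E F s \<le> - \<delta>" if s: "\<forall>i\<in>V. s i \<in> {-1, 0, 1}" "\<exists>i\<in>V. s i \<noteq> 0" for s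
  proof -
    have r: "restrict s V \<in> ?T" using s by auto
    have "pair_sum (restrict s V) e = pair_sum s e" if "e \<in> E \<union> F" for e
    proof -
      have "e \<subseteq> V" using E that by blast
      then show ?thesis unfolding pair_sum_def by (intro sum.cong) auto
    qed
    then have "log_rate \<tau> m V E F (restrict s V) = log_rate \<tau> m V E F s"
      unfolding log_rate_def by simp
    then show ?thesis using \<delta>(2)[OF r] by simp
  qed
  have le: "\<forall>i\<in>V. log_rate \<tau> m V E F u \<le> - \<delta> * \<bar>u i\<bar>" for u
    by (rule log_rate_le[OF E V sign \<delta>(1)])
  \<comment> \<open>One more than the number of coordinates, to have a positive divisor also for
    empty \<open>V\<close>.\<close>
  let ?c = "real (card V) + 1"
  show ?thesis
  proof (intro exI[of _ "\<delta> / ?c"] conjI allI)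
    show "\<delta> / ?c > 0" using \<delta> by (intro divide_pos_pos) auto
    fix u :: "'a \<Rightarrow> real"
    show "log_rate \<tau> m V E F u \<le> - (\<delta> / ?c) * (\<Sum>i\<in>V. \<bar>u i\<bar>)"
    proof (cases "V = {}")
      case True
      have "E = {}" "F = {}"
      proof -
        have "e \<notin> E \<union> F" for e
        proof
          assume "e \<in> E \<union> F"
          then have "e \<subseteq> V" "card e = 2" using E by blast+
          then have "e = {}" "card e = 2" using True by auto
          then show False by simp
        qed
        then show "E = {}" "F = {}" by blast+
      qed
      then show ?thesis using True by (simp add: log_rate_def)
    next
      case False
      then obtain i where "i \<in> V" by blast
      then have "log_rate \<tau> m V E F u \<le> - \<delta> * \<bar>u i\<bar>" using le by blast
      moreover have "\<delta> * \<bar>u i\<bar> \<ge> 0" using \<delta>(1) by simp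
      ultimately have "log_rate \<tau> m V E F u \<le> 0" by simp
      have "(\<Sum>i\<in>V. \<delta> * \<bar>u i\<bar>) \<le> (\<Sum>i\<in>V. - log_rate \<tau> m V E F u)"
        using le[of u] by (intro sum_mono) auto
      then have "\<delta> * (\<Sum>i\<in>V. \<bar>u i\<bar>) \<le> card V * (- log_rate \<tau> m V E F u)" by (simp add: sum_distrib_left)
      also have "\<dots> \<le> ?c * (- log_rate \<tau> m V E F u)"
        using \<open>log_rate \<tau> m V E F u \<le> 0\<close> by (intro mult_right_mono) auto
      finally have "\<delta> * (\<Sum>i\<in>V. \<bar>u i\<bar>) / ?c \<le> - log_rate \<tau> m V E F u" by (simp add: pos_divide_le_eq mult.commute add_pos_nonneg)
      then show ?thesis by simp
    qed
  qed
qed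

lemma exp_ge_power_div_fact:
  fixes x :: real
  assumes "x \<ge> 0" shows "x ^ m / fact m \<le> exp x"
proof -
  obtain t where t: "exp x = (\<Sum>i<Suc m. x ^ i / fact i) + exp t / fact (Suc m) * x ^ Suc m"
    using Maclaurin_exp_le[of x "Suc m"] by blast
  have "0 \<le> exp t / fact (Suc m) * x ^ Suc m" using assms by (intro mult_nonneg_nonneg) auto
  moreover have "0 \<le> (\<Sum>i<m. x ^ i / fact i)" using assms by (intro sum_nonneg) auto
  ultimately show ?thesis using t by simp
qed

text \<open>The exponential decay along a forbidden pair is not piecewise linear on the logarithmic
  scale, a power of order m is. The constant m!/\<kappa>^m comes from the exponential series, and
  the added 1 covers y \<le> 1.\<close>

lemma exp_minus_le_power:
  fixes \<kappa> y :: real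
  assumes "\<kappa> > 0" "y > 0"
  shows "exp (- \<kappa> * y) \<le> (1 + fact m / \<kappa> ^ m) * exp (- real m * max 0 (ln y))"
proof (cases "y \<le> 1")
  case True
  then have "max 0 (ln y) = 0" using assms by simp
  then have "(1 + fact m / \<kappa> ^ m) * exp (- real m * max 0 (ln y)) = 1 + fact m / \<kappa> ^ m" by simp
  moreover have "exp (- \<kappa> * y) \<le> 1" using assms by simp
  moreover have "fact m / \<kappa> ^ m \<ge> 0" using assms by simp
  ultimately show ?thesis by linarith
next
  case False
  then have m: "max 0 (ln y) = ln y" by simp
  have e: "exp (- real m * ln y) = 1 / y ^ m"
    using assms by (simp add: exp_minus exp_of_nat_mult inverse_eq_divide)
  have "exp (- \<kappa> * y) \<le> fact m / \<kappa> ^ m * (1 / y ^ m)"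
  proof -
    have "(\<kappa> * y) ^ m / fact m \<le> exp (\<kappa> * y)" using assms by (intro exp_ge_power_div_fact) auto
    then have "1 / exp (\<kappa> * y) \<le> 1 / ((\<kappa> * y) ^ m / fact m)"
      using assms by (intro divide_left_mono mult_pos_pos divide_pos_pos) auto
    then show ?thesis using assms by (simp add: exp_minus inverse_eq_divide power_mult_distrib)
  qed
  moreover have "fact m / \<kappa> ^ m * (1 / y ^ m) \<le> (1 + fact m / \<kappa> ^ m) * (1 / y ^ m)"
    using assms by (intro mult_right_mono) auto
  ultimately show ?thesis unfolding m e by linarith
qed

text \<open>Multiplied by x^(-\<tau>) this becomes \<open>log_kernel\<close>: the growth of order
  \<tau> - 1 is exactly what turns the power-law density into dx / x.\<close>

definition log_weight :: "real \<Rightarrow> real \<Rightarrow> real \<Rightarrow> real" where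
  "log_weight \<tau> \<delta> x = x powr (\<tau> - 1) * exp (- \<delta> * \<bar>ln x\<bar>)"

text \<open>The coercivity estimate exponentiated, with the linear part of the rate moved to the
  right. The right-hand side is a product over vertices, so its integrals and its expectations under
  independent degrees factorize. The rate \<delta> is the same for all \<kappa>, which enters only
  through \<open>C\<close>.\<close>

theorem pattern_product_dominated:
  fixes \<tau> :: real and V :: "'a set"
  assumes E: "\<forall>e\<in>E \<union> F. card e = 2 \<and> e \<subseteq> V" and V: "finite V" and \<tau>: "\<tau> > 1"
    and sep: "separating V E \<tau> F"
  shows "\<exists>\<delta>>0. \<forall>\<kappa>>0. \<exists>C>0. \<forall>x. (\<forall>i\<in>V. x i > 0) \<longrightarrow>
    (\<Prod>e\<in>E. min 1 (\<Prod>i\<in>e. x i)) * (\<Prod>e\<in>F. exp (- \<kappa> * (\<Prod>i\<in>e. x i))) \<le> C * (\<Prod>i\<in>V. log_weight \<tau> \<delta> (x i))"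
proof -
  obtain m where m: "real m > (\<tau> - 1) * card V" using reals_Archimedean2 by blast
  obtain \<delta> where \<delta>: "\<delta> > 0" and coer: "\<And>u. log_rate \<tau> m V E F u \<le> - \<delta> * (\<Sum>i\<in>V. \<bar>u i\<bar>)"
    using log_rate_coercive[OF E V \<tau> m sep] by blast
  have fin: "finite E" "finite F" using E V by (auto intro!: finite_subset[of _ "Pow V"])
  show ?thesis
  proof (rule exI[of _ \<delta>], rule conjI[OF \<delta>], intro allI impI)
    fix \<kappa> :: real assume \<kappa>: "\<kappa> > 0"
    define C1 where "C1 = 1 + fact m / \<kappa> ^ m"
    have C1: "C1 > 0" using \<kappa> by (simp add: C1_def add_pos_nonneg)
    show "\<exists>C>0. \<forall>x. (\<forall>i\<in>V. x i > 0) \<longrightarrow>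
      (\<Prod>e\<in>E. min 1 (\<Prod>i\<in>e. x i)) * (\<Prod>e\<in>F. exp (- \<kappa> * (\<Prod>i\<in>e. x i))) \<le> C * (\<Prod>i\<in>V. log_weight \<tau> \<delta> (x i))"
    proof (intro exI[of _ "C1 ^ card F"] conjI allI impI)
      show "C1 ^ card F > 0" using C1 by simp
      fix x :: "'a \<Rightarrow> real" assume x: "\<forall>i\<in>V. x i > 0"
      let ?u = "\<lambda>i. ln (x i)"
      have pe: "(\<Prod>i\<in>e. x i) > 0" "ln (\<Prod>i\<in>e. x i) = pair_sum ?u e" if "e \<in> E \<union> F" for e
      proof -
        have e: "finite e" "\<forall>i\<in>e. x i > 0" using E that V x finite_subset by blast+
        then show "(\<Prod>i\<in>e. x i) > 0" by (intro prod_pos) auto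
        show "ln (\<Prod>i\<in>e. x i) = pair_sum ?u e" unfolding pair_sum_def using e by (intro ln_prod) auto
      qed
      have "(\<Prod>e\<in>E. min 1 (\<Prod>i\<in>e. x i)) = (\<Prod>e\<in>E. exp (min 0 (pair_sum ?u e)))"
      proof (intro prod.cong refl)
        fix e assume "e \<in> E"
        then have "(\<Prod>i\<in>e. x i) = exp (pair_sum ?u e)" using pe[of e] by (metis UnI1 exp_ln)
        then show "min 1 (\<Prod>i\<in>e. x i) = exp (min 0 (pair_sum ?u e))" by (simp add: min_def)
      qed
      also have "\<dots> = exp (\<Sum>e\<in>E. min 0 (pair_sum ?u e))" using fin by (simp add: exp_sum)
      finally have pE: "(\<Prod>e\<in>E. min 1 (\<Prod>i\<in>e. x i)) = exp (\<Sum>e\<in>E. min 0 (pair_sum ?u e))" .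
      have "(\<Prod>e\<in>F. exp (- \<kappa> * (\<Prod>i\<in>e. x i))) \<le> (\<Prod>e\<in>F. C1 * exp (- real m * max 0 (pair_sum ?u e)))"
      proof (intro prod_mono conjI)
        fix e assume e: "e \<in> F"
        show "exp (- \<kappa> * (\<Prod>i\<in>e. x i)) \<le> C1 * exp (- real m * max 0 (pair_sum ?u e))"
          using exp_minus_le_power[OF \<kappa> pe(1), of e m] pe(2)[of e] e by (simp add: C1_def)
      qed auto
      also have "\<dots> = C1 ^ card F * exp (- real m * (\<Sum>e\<in>F. max 0 (pair_sum ?u e)))"
        using fin by (simp add: prod.distrib exp_sum[symmetric] sum_negf sum_distrib_left)
      finally have "(\<Prod>e\<in>E. min 1 (\<Prod>i\<in>e. x i)) * (\<Prod>e\<in>F. exp (- \<kappa> * (\<Prod>i\<in>e. x i)))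
        \<le> exp (\<Sum>e\<in>E. min 0 (pair_sum ?u e)) * (C1 ^ card F * exp (- real m * (\<Sum>e\<in>F. max 0 (pair_sum ?u e))))"
        unfolding pE by (intro mult_left_mono) auto
      also have "\<dots> = C1 ^ card F * exp ((\<tau> - 1) * (\<Sum>i\<in>V. ?u i) + log_rate \<tau> m V E F ?u)"
        unfolding log_rate_def by (simp add: exp_add[symmetric] algebra_simps)
      also have "\<dots> \<le> C1 ^ card F * exp ((\<tau> - 1) * (\<Sum>i\<in>V. ?u i) - \<delta> * (\<Sum>i\<in>V. \<bar>?u i\<bar>))"
        using coer[of ?u] C1 by (intro mult_left_mono) auto
      also have "exp ((\<tau> - 1) * (\<Sum>i\<in>V. ?u i) - \<delta> * (\<Sum>i\<in>V. \<bar>?u i\<bar>)) = (\<Prod>i\<in>V. exp ((\<tau> - 1) * ?u i - \<delta> * \<bar>?u i\<bar>))"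
        using V by (simp add: exp_sum[symmetric] sum_distrib_left sum_subtractf)
      also have "\<dots> = (\<Prod>i\<in>V. log_weight \<tau> \<delta> (x i))"
      proof (intro prod.cong refl)
        fix i assume "i \<in> V"
        then have "x i > 0" using x by blast
        then show "exp ((\<tau> - 1) * ?u i - \<delta> * \<bar>?u i\<bar>) = log_weight \<tau> \<delta> (x i)"
          by (simp add: log_weight_def powr_def exp_add[symmetric])
      qed
      finally show "(\<Prod>e\<in>E. min 1 (\<Prod>i\<in>e. x i)) * (\<Prod>e\<in>F. exp (- \<kappa> * (\<Prod>i\<in>e. x i)))
        \<le> C1 ^ card F * (\<Prod>i\<in>V. log_weight \<tau> \<delta> (x i))" .
    qed
  qed
qed

section \<open>Power-law sums and integrals\<close>

text \<open>The density of the image of exp (-\<delta> |u|) du under the exponential map, hence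
  integrable at 0 and at infinity for positive \<delta>.\<close>

definition log_kernel :: "real \<Rightarrow> real \<Rightarrow> real" where
  "log_kernel \<delta> y = (if y > 0 then exp (- \<delta> * \<bar>ln y\<bar>) / y else 0)"

lemma log_kernel_nonneg [simp]: "log_kernel \<delta> y \<ge> 0"
  by (simp add: log_kernel_def)

lemma log_kernel_measurable [measurable]: "log_kernel \<delta> \<in> borel_measurable borel"
  unfolding log_kernel_def by measurable

lemma nn_integral_log_kernel_finite:
  assumes \<delta>: "\<delta> > 0"
  shows "(\<integral>\<^sup>+y. ennreal (log_kernel \<delta> y) \<partial>lborel) < \<infinity>"
proof -
  have le: "ennreal (log_kernel \<delta> y)
      \<le> ennreal (y powr (\<delta> - 1)) * indicator {0..1} y + ennreal (y powr (- \<delta> - 1)) * indicator {1..} y" for y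
  proof (cases "y > 0")
    case True
    show ?thesis
    proof (cases "y \<le> 1")
      case True
      have "log_kernel \<delta> y = y powr (\<delta> - 1)"
        using True \<open>y > 0\<close> by (simp add: log_kernel_def powr_diff) (simp add: powr_def)
      then show ?thesis using True \<open>y > 0\<close> by (auto split: split_indicator)
    next
      case False
      have "log_kernel \<delta> y = y powr (- \<delta> - 1)"
        using False \<open>y > 0\<close> by (simp add: log_kernel_def powr_diff) (simp add: powr_def)
      then show ?thesis using False \<open>y > 0\<close> by (auto split: split_indicator)
    qed
  qed (simp add: log_kernel_def)
  have "(\<integral>\<^sup>+y. ennreal (log_kernel \<delta> y) \<partial>lborel) \<le>
     (\<integral>\<^sup>+y. ennreal (y powr (\<delta> - 1)) * indicator {0..1} y + ennreal (y powr (- \<delta> - 1)) * indicator {1..} y \<partial>lborel)"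
    by (intro nn_integral_mono le)
  also have "\<dots> = (\<integral>\<^sup>+y. ennreal (y powr (\<delta> - 1)) * indicator {0..1} y \<partial>lborel)
     + (\<integral>\<^sup>+y. ennreal (y powr (- \<delta> - 1)) * indicator {1..} y \<partial>lborel)"
    by (intro nn_integral_add) auto
  also have "(\<integral>\<^sup>+y. ennreal (y powr (\<delta> - 1)) * indicator {0..1} y \<partial>lborel) = ennreal (1 powr (\<delta> - 1 + 1) / (\<delta> - 1 + 1))"
    using \<delta> by (intro nn_integral_has_integral_lebesgue' has_integral_powr_from_0) auto
  also have "(\<integral>\<^sup>+y. ennreal (y powr (- \<delta> - 1)) * indicator {1..} y \<partial>lborel) = ennreal (- (1 powr (- \<delta> - 1 + 1)) / (- \<delta> - 1 + 1))"
    using \<delta> by (intro nn_integral_has_integral_lebesgue' has_integral_powr_to_inf) auto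
  finally show ?thesis by (rule order.strict_trans1) (simp add: ennreal_add_eq_top less_top[symmetric])
qed

text \<open>The lower threshold is 2 / (m + 2) because a rescaled degree at most 1 / (m + 2) stands
  for a cell that may reach twice as far.\<close>

lemma nn_integral_log_kernel_tail:
  assumes \<delta>: "\<delta> > 0"
  shows "(\<lambda>m. \<integral>\<^sup>+y. ennreal (log_kernel \<delta> y) * indicator {y. y \<le> 2 / real (m + 2) \<or> y > real (m + 2)} y \<partial>lborel) \<longlonglongrightarrow> 0"
proof -
  have "(\<lambda>m. \<integral>\<^sup>+y. ennreal (log_kernel \<delta> y) * indicator {y. y \<le> 2 / real (m + 2) \<or> y > real (m + 2)} y \<partial>lborel)
     \<longlonglongrightarrow> integral\<^sup>N (lborel :: real measure) (\<lambda>_. 0)"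
  proof (rule nn_integral_dominated_convergence[where w = "\<lambda>y. ennreal (log_kernel \<delta> y)"])
    show "(\<integral>\<^sup>+y. ennreal (log_kernel \<delta> y) \<partial>lborel) < \<infinity>" by (rule nn_integral_log_kernel_finite[OF \<delta>])
    show "AE y in lborel. (\<lambda>m. ennreal (log_kernel \<delta> y) * indicator {y. y \<le> 2 / real (m + 2) \<or> y > real (m + 2)} y) \<longlonglongrightarrow> 0"
    proof (rule AE_I2)
      fix y :: real
      show "(\<lambda>m. ennreal (log_kernel \<delta> y) * indicator {y. y \<le> 2 / real (m + 2) \<or> y > real (m + 2)} y) \<longlonglongrightarrow> 0"
      proof (cases "y > 0")
        case True
        have "(\<lambda>m. 2 / real (m + 2)) \<longlonglongrightarrow> 0" by (rule LIMSEQ_ignore_initial_segment[OF lim_const_over_n])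
        then have 1: "\<forall>\<^sub>F m in sequentially. 2 / real (m + 2) < y" using True by (rule order_tendstoD)
        have "filterlim (\<lambda>m. real (m + 2)) at_top sequentially"
          by (rule filterlim_compose[OF filterlim_real_sequentially filterlim_add_const_nat_at_top])
        then have 2: "\<forall>\<^sub>F m in sequentially. y \<le> real (m + 2)" by (simp add: filterlim_at_top)
        have "\<forall>\<^sub>F m in sequentially. ennreal (log_kernel \<delta> y) * indicator {y. y \<le> 2 / real (m + 2) \<or> y > real (m + 2)} y = 0"
          using 1 2 by eventually_elim simp
        then show ?thesis by (rule tendsto_eventually)
      qed (simp add: log_kernel_def)
    qed
  qed (auto split: split_indicator)
  then show ?thesis by simp
qed

text \<open>Within the cell of a degree at least 1 the position varies by a factor at most 2, so 1 /
  y changes by at most a factor 2 and |ln y| by at most ln 2.\<close>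

lemma log_kernel_cell:
  assumes \<delta>: "\<delta> > 0" and s: "s > 0" and d: "d \<ge> (1::nat)" and y: "real d / s \<le> y" "y < (real d + 1) / s"
  shows "log_kernel \<delta> (real d / s) \<le> (2 * exp (\<delta> * ln 2)) * log_kernel \<delta> y"
proof -
  let ?x = "real d / s"
  have x: "?x > 0" using d s by simp
  then have y0: "y > 0" using y by linarith
  have "(real d + 1) / s \<le> 2 * ?x" using d s by (simp add: divide_simps)
  then have y2: "y \<le> 2 * ?x" using y by linarith
  have "ln ?x \<le> ln y" "ln y \<le> ln (2 * ?x)" using x y y0 y2 by (simp_all only: ln_le_cancel_iff mult_pos_pos zero_less_numeral)
  moreover have "ln (2 * ?x) = ln 2 + ln ?x" using x by (intro ln_mult_pos) auto
  ultimately have "\<bar>ln y\<bar> \<le> \<bar>ln ?x\<bar> + ln 2" by linarith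
  then have "\<delta> * \<bar>ln y\<bar> \<le> \<delta> * (\<bar>ln ?x\<bar> + ln 2)" using \<delta> by (intro mult_left_mono) auto
  then have e: "exp (- \<delta> * \<bar>ln ?x\<bar>) \<le> exp (\<delta> * ln 2) * exp (- \<delta> * \<bar>ln y\<bar>)"
    by (simp add: exp_add[symmetric] algebra_simps)
  have "2 / (2 * ?x) \<le> 2 / y" using y2 x y0 by (intro divide_left_mono mult_pos_pos) auto
  then have "1 / ?x \<le> 2 / y" by simp
  then have "exp (- \<delta> * \<bar>ln ?x\<bar>) * (1 / ?x) \<le> (exp (\<delta> * ln 2) * exp (- \<delta> * \<bar>ln y\<bar>)) * (2 / y)"
    using e x s by (intro mult_mono) auto
  then show ?thesis using x y0 by (simp add: log_kernel_def mult_ac)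
qed

text \<open>Up to the constant of \<open>log_kernel_cell\<close>, each term is bounded by the
  integral over its own cell of length 1 / s, and the cells are disjoint. The term d = 0 vanishes
  because \<open>log_kernel\<close> is 0 at 0.\<close>

lemma log_kernel_sum_le:
  assumes \<delta>: "\<delta> > 0" and s: "s > 0" and B[measurable]: "B \<in> sets borel"
    and AB: "\<And>d y. d \<ge> (1::nat) \<Longrightarrow> real d / s \<in> A \<Longrightarrow> real d / s \<le> y \<Longrightarrow> y < (real d + 1) / s \<Longrightarrow> y \<in> B"
  shows "(\<Sum>d. ennreal (log_kernel \<delta> (real d / s) / s) * indicator A (real d / s))
    \<le> ennreal (2 * exp (\<delta> * ln 2)) * (\<integral>\<^sup>+y. ennreal (log_kernel \<delta> y) * indicator B y \<partial>lborel)"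
proof -
  let ?c = "2 * exp (\<delta> * ln 2)"
  let ?I = "\<lambda>d. {real d / s ..< (real d + 1) / s}"
  have one: "(\<Sum>d. indicator (?I d) y :: ennreal) \<le> 1" for y
  proof -
    have "?I d \<inter> ?I d' = {}" if "d < d'" for d d' :: nat
    proof -
      have "(real d + 1) / s \<le> real d' / s" using that s by (intro divide_right_mono) auto
      then show ?thesis by auto
    qed
    then have "disjoint_family ?I"
      unfolding disjoint_family_on_def by (metis inf_commute linorder_neq_iff)
    then have "(\<Sum>d. indicator (?I d) y :: ennreal) = indicator (\<Union>d. ?I d) y"
      by (rule suminf_indicator)
    then show ?thesis by (simp add: indicator_def)
  qed
  have each: "ennreal (log_kernel \<delta> (real d / s) / s) * indicator A (real d / s)
    \<le> (\<integral>\<^sup>+y. ennreal ?c * (ennreal (log_kernel \<delta> y) * indicator B y) * indicator (?I d) y \<partial>lborel)" for d :: nat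
  proof (cases "d \<ge> 1 \<and> real d / s \<in> A")
    case True
    have len: "(real d + 1) / s - real d / s = 1 / s" by (simp add: diff_divide_distrib[symmetric])
    have "emeasure lborel (?I d) = ennreal (1 / s)"
      using s by (subst emeasure_lborel_Ico) (simp_all add: len divide_right_mono)
    then have "ennreal (log_kernel \<delta> (real d / s) / s) * indicator A (real d / s)
        = (\<integral>\<^sup>+y. ennreal (log_kernel \<delta> (real d / s)) * indicator (?I d) y \<partial>lborel)"
      using True s by (simp add: nn_integral_cmult_indicator ennreal_mult[symmetric])
    also have "\<dots> \<le> (\<integral>\<^sup>+y. ennreal ?c * (ennreal (log_kernel \<delta> y) * indicator B y) * indicator (?I d) y \<partial>lborel)"
    proof (rule nn_integral_mono)
      fix y
      show "ennreal (log_kernel \<delta> (real d / s)) * indicator (?I d) y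
        \<le> ennreal ?c * (ennreal (log_kernel \<delta> y) * indicator B y) * indicator (?I d) y"
      proof (cases "y \<in> ?I d")
        case y: True
        then have "y \<in> B" using AB[of d y] True by simp
        moreover have "log_kernel \<delta> (real d / s) \<le> ?c * log_kernel \<delta> y"
          using log_kernel_cell[OF \<delta> s, of d y] True y by simp
        then have "ennreal (log_kernel \<delta> (real d / s)) \<le> ennreal ?c * ennreal (log_kernel \<delta> y)"
          by (simp add: ennreal_mult[symmetric] ennreal_leI)
        ultimately show ?thesis using y by simp
      qed simp
    qed
    finally show ?thesis .
  next
    case False
    then have "ennreal (log_kernel \<delta> (real d / s) / s) * indicator A (real d / s) = 0"
      by (cases "d = 0") (auto simp: log_kernel_def)
    then show ?thesis by (simp only: zero_le)
  qed
  have "(\<Sum>d. ennreal (log_kernel \<delta> (real d / s) / s) * indicator A (real d / s))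
     \<le> (\<Sum>d. \<integral>\<^sup>+y. ennreal ?c * (ennreal (log_kernel \<delta> y) * indicator B y) * indicator (?I d) y \<partial>lborel)"
    by (intro suminf_le each) auto
  also have "\<dots> = (\<integral>\<^sup>+y. (\<Sum>d. ennreal ?c * (ennreal (log_kernel \<delta> y) * indicator B y) * indicator (?I d) y) \<partial>lborel)"
    by (intro nn_integral_suminf[symmetric]) auto
  also have "\<dots> \<le> (\<integral>\<^sup>+y. ennreal ?c * (ennreal (log_kernel \<delta> y) * indicator B y) \<partial>lborel)"
  proof (rule nn_integral_mono)
    fix y
    have "(\<Sum>d. ennreal ?c * (ennreal (log_kernel \<delta> y) * indicator B y) * indicator (?I d) y)
       = ennreal ?c * (ennreal (log_kernel \<delta> y) * indicator B y) * (\<Sum>d. indicator (?I d) y)"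
      by simp
    also have "\<dots> \<le> ennreal ?c * (ennreal (log_kernel \<delta> y) * indicator B y) * 1"
      by (intro mult_left_mono one) auto
    finally show "(\<Sum>d. ennreal ?c * (ennreal (log_kernel \<delta> y) * indicator B y) * indicator (?I d) y)
       \<le> ennreal ?c * (ennreal (log_kernel \<delta> y) * indicator B y)" by simp
  qed
  also have "\<dots> = ennreal ?c * (\<integral>\<^sup>+y. ennreal (log_kernel \<delta> y) * indicator B y \<partial>lborel)"
    by (intro nn_integral_cmult) auto
  finally show ?thesis .
qed

section \<open>Power-law tail of the degree distribution\<close>

lemma pmf_tail_bound:
  fixes p :: "nat pmf"
  assumes "c > 0" and tail: "(\<lambda>d. pmf p d) \<sim>[sequentially] (\<lambda>d. c * real d powr (-\<tau>))"
  shows "\<exists>C>0. \<forall>d\<ge>1. pmf p d \<le> C * real d powr (- \<tau>)"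
proof -
  have ne: "\<forall>\<^sub>F d in sequentially. c * real d powr (-\<tau>) \<noteq> 0"
    using eventually_gt_at_top[of "0::nat"] assms(1) by (auto elim: eventually_mono)
  have "((\<lambda>d. pmf p d / (c * real d powr (-\<tau>))) \<longlongrightarrow> 1) sequentially"
    by (rule asymp_equivD_strong[OF tail]) (use ne in \<open>auto elim: eventually_mono\<close>)
  then have "\<forall>\<^sub>F d in sequentially. pmf p d / (c * real d powr (-\<tau>)) < 2"
    by (rule order_tendstoD) simp
  then obtain N where N: "\<And>d. d \<ge> N \<Longrightarrow> pmf p d / (c * real d powr (-\<tau>)) < 2"
    by (auto simp: eventually_sequentially)
  \<comment> \<open>The first summand covers large d. For d \<le> N the second is at least
    \<open>real d powr \<tau>\<close>, which suffices because a probability is at most 1.\<close>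
  define C where "C = 2 * c + (\<Sum>d\<le>N. real d powr \<tau>)"
  have C0: "(\<Sum>d\<le>N. real d powr \<tau>) \<ge> 0" by (intro sum_nonneg) auto
  show ?thesis
  proof (intro exI[of _ C] conjI allI impI)
    show "C > 0" using C0 assms(1) by (simp add: C_def)
    fix d :: nat assume d: "d \<ge> 1"
    have pos: "real d powr (-\<tau>) > 0" using d by simp
    show "pmf p d \<le> C * real d powr (- \<tau>)"
    proof (cases "d \<le> N")
      case True
      have "1 = real d powr \<tau> * real d powr (- \<tau>)" using d by (simp add: powr_add[symmetric])
      moreover have "real d powr \<tau> \<le> (\<Sum>d\<le>N. real d powr \<tau>)"
        using True by (intro member_le_sum) auto
      then have "real d powr \<tau> \<le> C" using assms(1) by (simp add: C_def)
      then have "real d powr \<tau> * real d powr (- \<tau>) \<le> C * real d powr (- \<tau>)" by (intro mult_right_mono) auto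
      ultimately have "1 \<le> C * real d powr (- \<tau>)" by linarith
      then show ?thesis using pmf_le_1[of p d] by linarith
    next
      case False
      then have "pmf p d / (c * real d powr (-\<tau>)) < 2" using N by simp
      then have "pmf p d < 2 * (c * real d powr (-\<tau>))" using pos assms(1) by (simp add: pos_divide_less_eq)
      also have "\<dots> \<le> C * real d powr (- \<tau>)" using C0 pos by (simp add: C_def algebra_simps)
      finally show ?thesis by simp
    qed
  qed
qed

text \<open>Since d^(-\<tau>) (d / s)^(\<tau> - 1) = s^(1 - \<tau>) / d, the expectation is at most
  C s^(1 - \<tau>) times a Riemann sum of \<open>log_kernel\<close> with step 1 / s.\<close>

lemma nn_integral_log_weight_le:
  fixes p :: "nat pmf"
  assumes \<delta>: "\<delta> > 0" and s: "s > 0" and B: "B \<in> sets borel" and C: "C > 0"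
    and p0: "pmf p 0 = 0" and pC: "\<forall>d\<ge>1. pmf p d \<le> C * real d powr (- \<tau>)"
    and AB: "\<And>d y. d \<ge> (1::nat) \<Longrightarrow> real d / s \<in> A \<Longrightarrow> real d / s \<le> y \<Longrightarrow> y < (real d + 1) / s \<Longrightarrow> y \<in> B"
  shows "(\<integral>\<^sup>+d. ennreal (log_weight \<tau> \<delta> (real d / s)) * indicator A (real d / s) \<partial>measure_pmf p)
    \<le> ennreal (C * s powr (1 - \<tau>)) * (ennreal (2 * exp (\<delta> * ln 2)) * (\<integral>\<^sup>+y. ennreal (log_kernel \<delta> y) * indicator B y \<partial>lborel))"
proof -
  have each: "pmf p d * log_weight \<tau> \<delta> (real d / s) \<le> C * s powr (1 - \<tau>) * (log_kernel \<delta> (real d / s) / s)" for d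
  proof (cases "d = 0")
    case True
    then show ?thesis using p0 by (simp add: log_kernel_def)
  next
    case False
    then have d: "real d > 0" "d \<ge> 1" by simp_all
    have "pmf p d * log_weight \<tau> \<delta> (real d / s) \<le> (C * real d powr (- \<tau>)) * log_weight \<tau> \<delta> (real d / s)"
      using pC d by (intro mult_right_mono) (auto simp: log_weight_def)
    also have "\<dots> = C * (real d powr (- \<tau>) * (real d / s) powr (\<tau> - 1)) * exp (- \<delta> * \<bar>ln (real d / s)\<bar>)"
      unfolding log_weight_def by (simp only: mult_ac)
    also have "real d powr (- \<tau>) * (real d / s) powr (\<tau> - 1) = s powr (1 - \<tau>) * (1 / s) * (1 / (real d / s))"
    proof -
      have "real d powr (- \<tau>) * (real d / s) powr (\<tau> - 1) = (real d powr (- \<tau>) * real d powr (\<tau> - 1)) * (1 / s powr (\<tau> - 1))"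
        using d s by (simp add: powr_divide)
      also have "real d powr (- \<tau>) * real d powr (\<tau> - 1) = 1 / real d"
      proof -
        have "real d powr (- \<tau>) * real d powr (\<tau> - 1) = real d powr (- \<tau> + (\<tau> - 1))"
          by (simp only: powr_add)
        also have "- \<tau> + (\<tau> - 1) = - 1" by simp
        also have "real d powr - 1 = 1 / real d" using d by (simp add: powr_minus_divide)
        finally show ?thesis .
      qed
      also have "1 / s powr (\<tau> - 1) = s powr (1 - \<tau>)" using powr_minus_divide[of s "\<tau> - 1"] by simp
      finally show ?thesis using s d by (simp add: field_simps)
    qed
    also have "C * (s powr (1 - \<tau>) * (1 / s) * (1 / (real d / s))) * exp (- \<delta> * \<bar>ln (real d / s)\<bar>)
       = C * s powr (1 - \<tau>) * (log_kernel \<delta> (real d / s) / s)"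
      using d s by (simp add: log_kernel_def)
    finally show ?thesis .
  qed
  have "(\<integral>\<^sup>+d. ennreal (log_weight \<tau> \<delta> (real d / s)) * indicator A (real d / s) \<partial>measure_pmf p)
     = (\<Sum>d. ennreal (pmf p d) * (ennreal (log_weight \<tau> \<delta> (real d / s)) * indicator A (real d / s)))"
    by (simp add: nn_integral_measure_pmf nn_integral_count_space_nat)
  also have "\<dots> \<le> (\<Sum>d. ennreal (C * s powr (1 - \<tau>)) * (ennreal (log_kernel \<delta> (real d / s) / s) * indicator A (real d / s)))"
  proof (intro suminf_le allI)
    fix d
    have "ennreal (pmf p d) * ennreal (log_weight \<tau> \<delta> (real d / s)) \<le> ennreal (C * s powr (1 - \<tau>)) * ennreal (log_kernel \<delta> (real d / s) / s)"
      using each[of d] s C by (subst (1 2) ennreal_mult[symmetric]) (auto simp: log_weight_def intro!: ennreal_leI)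
    then show "ennreal (pmf p d) * (ennreal (log_weight \<tau> \<delta> (real d / s)) * indicator A (real d / s))
      \<le> ennreal (C * s powr (1 - \<tau>)) * (ennreal (log_kernel \<delta> (real d / s) / s) * indicator A (real d / s))"
      by (simp add: indicator_def)
  qed auto
  also have "\<dots> = ennreal (C * s powr (1 - \<tau>)) * (\<Sum>d. ennreal (log_kernel \<delta> (real d / s) / s) * indicator A (real d / s))"
    by simp
  also have "\<dots> \<le> ennreal (C * s powr (1 - \<tau>)) * (ennreal (2 * exp (\<delta> * ln 2)) * (\<integral>\<^sup>+y. ennreal (log_kernel \<delta> y) * indicator B y \<partial>lborel))"
    by (intro mult_left_mono log_kernel_sum_le[OF \<delta> s B AB]) auto
  finally show ?thesis .
qed

lemma pmf_power_tail_integrable: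
  fixes p :: "nat pmf"
  assumes "\<tau> > 2" and pC: "\<forall>d\<ge>1. pmf p d \<le> C * real d powr (- \<tau>)"
  shows "integrable (measure_pmf p) real"
proof -
  have "summable (\<lambda>d. C * real d powr (1 - \<tau>))"
    using assms(1) by (intro summable_mult) (simp add: summable_real_powr_iff)
  then have sm: "summable (\<lambda>d. pmf p d * real d)"
  proof (rule summable_comparison_test'[where N = 1])
    fix d :: nat assume d: "d \<ge> 1"
    have "pmf p d * real d \<le> (C * real d powr (- \<tau>)) * real d" using pC d by (intro mult_right_mono) auto
    also have "\<dots> = C * real d powr (1 - \<tau>)" using d by (simp add: powr_diff powr_minus_divide)
    finally show "norm (pmf p d * real d) \<le> C * real d powr (1 - \<tau>)" by simp
  qed
  have "(\<integral>\<^sup>+d. ennreal (norm (real d)) \<partial>measure_pmf p) = (\<Sum>d. ennreal (pmf p d * real d))"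
    by (simp add: nn_integral_measure_pmf nn_integral_count_space_nat ennreal_mult)
  also have "\<dots> = ennreal (\<Sum>d. pmf p d * real d)"
    by (rule suminf_ennreal2[OF _ sm]) simp
  finally show ?thesis by (intro integrableI_bounded) auto
qed

section \<open>The limiting integral\<close>

definition pattern_density :: "real \<Rightarrow> 'a set \<Rightarrow> 'a set set \<Rightarrow> 'a set set \<Rightarrow> ('a \<Rightarrow> real) \<Rightarrow> real" where
  "pattern_density \<tau> V E F x = (\<Prod>i\<in>V. x i) powr (-\<tau>) * (\<Prod>e\<in>E. 1 - exp (- (\<Prod>i\<in>e. x i)))
     * (\<Prod>e\<in>F. exp (- (\<Prod>i\<in>e. x i)))"

definition pattern_integral :: "real \<Rightarrow> 'a set \<Rightarrow> 'a set set \<Rightarrow> 'a set set \<Rightarrow> real set \<Rightarrow> ennreal" where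
  "pattern_integral \<tau> V E F S = (\<integral>\<^sup>+x \<in> V \<rightarrow>\<^sub>E S. ennreal (pattern_density \<tau> V E F x) \<partial>(\<Pi>\<^sub>M i\<in>V. lborel))"

lemma edge_product_measurable:
  assumes "finite V" "e \<subseteq> V"
  shows "(\<lambda>x. \<Prod>i\<in>e. x i :: real) \<in> borel_measurable (\<Pi>\<^sub>M i\<in>V. lborel)"
proof (rule borel_measurable_prod)
  fix i assume "i \<in> e"
  then have "(\<lambda>x. x i) \<in> (\<Pi>\<^sub>M i\<in>V. lborel) \<rightarrow>\<^sub>M (lborel :: real measure)"
    using assms by (intro measurable_component_singleton) auto
  then show "(\<lambda>x. x i :: real) \<in> borel_measurable (\<Pi>\<^sub>M i\<in>V. lborel)" by simp
qed

lemma pattern_density_measurable: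
  assumes V: "finite V" and E: "\<forall>e\<in>E \<union> F. e \<subseteq> V"
  shows "pattern_density \<tau> V E F \<in> borel_measurable (\<Pi>\<^sub>M i\<in>V. lborel)"
proof -
  have [measurable]: "(\<lambda>x. \<Prod>i\<in>e. x i :: real) \<in> borel_measurable (\<Pi>\<^sub>M i\<in>V. lborel)" if "e \<in> E" for e
    using edge_product_measurable[OF V] E that by blast
  have [measurable]: "(\<lambda>x. \<Prod>i\<in>e. x i :: real) \<in> borel_measurable (\<Pi>\<^sub>M i\<in>V. lborel)" if "e \<in> F" for e
    using edge_product_measurable[OF V] E that by blast
  have [measurable]: "(\<lambda>x. \<Prod>i\<in>V. x i :: real) \<in> borel_measurable (\<Pi>\<^sub>M i\<in>V. lborel)"
    using edge_product_measurable[OF V] by blast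
  have 1: "(\<lambda>x. \<Prod>e\<in>E. 1 - exp (- (\<Prod>i\<in>e. x i :: real))) \<in> borel_measurable (\<Pi>\<^sub>M i\<in>V. lborel)"
    by (intro borel_measurable_prod) measurable
  have 2: "(\<lambda>x. \<Prod>e\<in>F. exp (- (\<Prod>i\<in>e. x i :: real))) \<in> borel_measurable (\<Pi>\<^sub>M i\<in>V. lborel)"
    by (intro borel_measurable_prod) measurable
  have 3: "(\<lambda>x. (\<Prod>i\<in>V. x i :: real) powr (-\<tau>)) \<in> borel_measurable (\<Pi>\<^sub>M i\<in>V. lborel)"
    by measurable
  show ?thesis unfolding pattern_density_def[abs_def] using 1 2 3 by (intro borel_measurable_times) auto
qed

lemma box_sets: "finite V \<Longrightarrow> S \<in> sets borel \<Longrightarrow> (V \<rightarrow>\<^sub>E S) \<in> sets (\<Pi>\<^sub>M i\<in>V. (lborel :: real measure))"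
  by (intro sets_PiM_I_finite) auto

lemma emeasure_box:
  assumes "finite V" "\<And>i. i \<in> V \<Longrightarrow> S i \<in> sets (borel :: real measure)"
  shows "emeasure (\<Pi>\<^sub>M i\<in>V. lborel) (Pi\<^sub>E V S) = (\<Prod>i\<in>V. emeasure lborel (S i))"
proof -
  interpret product_sigma_finite "\<lambda>_. lborel :: real measure"
    by standard
  show ?thesis using assms by (intro emeasure_PiM) auto
qed

text \<open>With 1 - exp (-y) \<le> min 1 y, the density is dominated by a constant times a product
  of \<open>log_kernel\<close> factors, whose integral factorizes into finite one-dimensional
  ones.\<close>

lemma pattern_integral_finite:
  fixes \<tau> :: real
  assumes E: "\<forall>e\<in>E \<union> F. card e = 2 \<and> e \<subseteq> V" and V: "finite V" and \<tau>: "\<tau> > 1"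
    and sep: "separating V E \<tau> F"
  shows "pattern_integral \<tau> V E F {0<..} < \<infinity>"
proof -
  obtain \<delta> where \<delta>: "\<delta> > 0" and dom: "\<forall>\<kappa>>0. \<exists>C>0. \<forall>x. (\<forall>i\<in>V. x i > 0) \<longrightarrow>
    (\<Prod>e\<in>E. min 1 (\<Prod>i\<in>e. x i)) * (\<Prod>e\<in>F. exp (- \<kappa> * (\<Prod>i\<in>e. x i))) \<le> C * (\<Prod>i\<in>V. log_weight \<tau> \<delta> (x i))"
    using pattern_product_dominated[OF E V \<tau> sep] by blast
  obtain C where C: "C > 0" and dom: "\<And>x. (\<forall>i\<in>V. x i > 0) \<Longrightarrow>
    (\<Prod>e\<in>E. min 1 (\<Prod>i\<in>e. x i)) * (\<Prod>e\<in>F. exp (- 1 * (\<Prod>i\<in>e. x i))) \<le> C * (\<Prod>i\<in>V. log_weight \<tau> \<delta> (x i))"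
    using dom[rule_format, of 1] by auto
  interpret product_sigma_finite "\<lambda>_::'a. lborel :: real measure"
    by standard
  have le: "ennreal (pattern_density \<tau> V E F x) * indicator (V \<rightarrow>\<^sub>E {0<..}) x \<le> ennreal C * (\<Prod>i\<in>V. ennreal (log_kernel \<delta> (x i)))" for x
  proof (cases "x \<in> V \<rightarrow>\<^sub>E {0<..}")
    case True
    then have x: "\<forall>i\<in>V. x i > 0" by auto
    have pos: "(\<Prod>i\<in>e. x i) > 0" if "e \<in> E \<union> F" for e
    proof -
      have "e \<subseteq> V" using E that by blast
      then show ?thesis using x by (intro prod_pos) auto
    qed
    have "(\<Prod>e\<in>E. 1 - exp (- (\<Prod>i\<in>e. x i))) \<le> (\<Prod>e\<in>E. min 1 (\<Prod>i\<in>e. x i))"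
    proof (intro prod_mono conjI)
      fix e assume "e \<in> E"
      then have "(\<Prod>i\<in>e. x i) > 0" using pos by blast
      then show "0 \<le> 1 - exp (- (\<Prod>i\<in>e. x i))" by simp
      show "1 - exp (- (\<Prod>i\<in>e. x i)) \<le> min 1 (\<Prod>i\<in>e. x i)"
        using exp_ge_add_one_self[of "- (\<Prod>i\<in>e. x i)"] by simp
    qed
    then have "pattern_density \<tau> V E F x \<le> (\<Prod>i\<in>V. x i) powr (-\<tau>) * ((\<Prod>e\<in>E. min 1 (\<Prod>i\<in>e. x i)) * (\<Prod>e\<in>F. exp (- 1 * (\<Prod>i\<in>e. x i))))"
      unfolding pattern_density_def mult.assoc
      by (intro mult_left_mono mult_mono prod_nonneg) (simp_all add: less_imp_le pos)
    also have "\<dots> \<le> (\<Prod>i\<in>V. x i) powr (-\<tau>) * (C * (\<Prod>i\<in>V. log_weight \<tau> \<delta> (x i)))"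
      by (intro mult_left_mono dom x powr_ge_zero)
    also have "(\<Prod>i\<in>V. x i) powr (-\<tau>) = (\<Prod>i\<in>V. x i powr (-\<tau>))"
      by (rule prod_powr_distrib)
    also have "(\<Prod>i\<in>V. x i powr (-\<tau>)) * (C * (\<Prod>i\<in>V. log_weight \<tau> \<delta> (x i))) = C * (\<Prod>i\<in>V. x i powr (-\<tau>) * log_weight \<tau> \<delta> (x i))"
      by (simp add: prod.distrib)
    also have "(\<Prod>i\<in>V. x i powr (-\<tau>) * log_weight \<tau> \<delta> (x i)) = (\<Prod>i\<in>V. log_kernel \<delta> (x i))"
    proof (intro prod.cong refl)
      fix i assume "i \<in> V"
      then have xi: "x i > 0" using x by blast
      have "x i powr (-\<tau>) * x i powr (\<tau> - 1) = x i powr (-\<tau> + (\<tau> - 1))" by (simp only: powr_add)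
      also have "-\<tau> + (\<tau> - 1) = -1" by simp
      finally have "x i powr (-\<tau>) * x i powr (\<tau> - 1) = 1 / x i" using xi by (simp add: powr_minus_divide)
      then show "x i powr (-\<tau>) * log_weight \<tau> \<delta> (x i) = log_kernel \<delta> (x i)"
        unfolding log_weight_def mult.assoc[symmetric] using xi by (simp add: log_kernel_def)
    qed
    finally have "ennreal (pattern_density \<tau> V E F x) \<le> ennreal (C * (\<Prod>i\<in>V. log_kernel \<delta> (x i)))" by (rule ennreal_leI)
    also have "\<dots> = ennreal C * (\<Prod>i\<in>V. ennreal (log_kernel \<delta> (x i)))"
      using C by (simp add: ennreal_mult prod_nonneg prod_ennreal)
    finally show ?thesis using True by simp
  qed simp
  have "pattern_integral \<tau> V E F {0<..} \<le> (\<integral>\<^sup>+x. ennreal C * (\<Prod>i\<in>V. ennreal (log_kernel \<delta> (x i))) \<partial>(\<Pi>\<^sub>M i\<in>V. lborel))"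
    unfolding pattern_integral_def by (intro nn_integral_mono le)
  also have "\<dots> = ennreal C * (\<integral>\<^sup>+x. (\<Prod>i\<in>V. ennreal (log_kernel \<delta> (x i))) \<partial>(\<Pi>\<^sub>M i\<in>V. lborel))"
    by (intro nn_integral_cmult borel_measurable_prod_ennreal) measurable
  also have "(\<integral>\<^sup>+x. (\<Prod>i\<in>V. ennreal (log_kernel \<delta> (x i))) \<partial>(\<Pi>\<^sub>M i\<in>V. lborel))
     = (\<Prod>i\<in>V. \<integral>\<^sup>+y. ennreal (log_kernel \<delta> y) \<partial>lborel)"
    by (rule product_nn_integral_prod) (use V in auto)
  also have "ennreal C * (\<Prod>i\<in>V. \<integral>\<^sup>+y. ennreal (log_kernel \<delta> y) \<partial>lborel) < \<infinity>"
    using nn_integral_log_kernel_finite[OF \<delta>] by (simp add: ennreal_mult_less_top power_less_top_ennreal)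
  finally show ?thesis .
qed

lemma pattern_integral_exhaust:
  assumes V: "finite V" and E: "\<forall>e\<in>E \<union> F. e \<subseteq> V"
  shows "(\<lambda>m. pattern_integral \<tau> V E F {1 / real (m + 2) <.. real (m + 2)}) \<longlonglongrightarrow> pattern_integral \<tau> V E F {0<..}"
  unfolding pattern_integral_def
proof (rule nn_integral_LIMSEQ)
  let ?B = "\<lambda>m. V \<rightarrow>\<^sub>E {1 / real (m + 2) <.. real (m + 2)}"
  have mono: "?B m \<subseteq> ?B m'" if "m \<le> m'" for m m'
  proof (rule PiE_mono)
    fix i
    have "1 / real (m' + 2) \<le> 1 / real (m + 2)" using that by (intro divide_left_mono) auto
    then show "{1 / real (m + 2) <.. real (m + 2)} \<subseteq> {1 / real (m' + 2) <.. real (m' + 2)}" using that by auto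
  qed
  then show "incseq (\<lambda>m x. ennreal (pattern_density \<tau> V E F x) * indicator (?B m) x)"
    unfolding incseq_def le_fun_def
    by (intro allI impI mult_left_mono) (auto split: split_indicator)
  show "(\<lambda>x. ennreal (pattern_density \<tau> V E F x) * indicator (?B m) x) \<in> borel_measurable (\<Pi>\<^sub>M i\<in>V. lborel)" for m
    using pattern_density_measurable[OF V E] box_sets[OF V] by (intro borel_measurable_times_ennreal borel_measurable_indicator measurable_compose[OF _ measurable_ennreal]) auto
  show "(\<lambda>m. ennreal (pattern_density \<tau> V E F x) * indicator (?B m) x) \<longlonglongrightarrow> ennreal (pattern_density \<tau> V E F x) * indicator (V \<rightarrow>\<^sub>E {0<..}) x" for x
  proof (cases "x \<in> V \<rightarrow>\<^sub>E {0<..}")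
    case True
    have "\<forall>\<^sub>F m in sequentially. \<forall>i\<in>V. 1 / real (m + 2) < x i \<and> x i \<le> real (m + 2)"
    proof (rule eventually_ball_finite[OF V], rule ballI)
      fix i assume "i \<in> V"
      then have "x i > 0" using True by auto
      have "(\<lambda>m. 1 / real (m + 2)) \<longlonglongrightarrow> 0" by (rule LIMSEQ_ignore_initial_segment[OF lim_const_over_n])
      then have 1: "\<forall>\<^sub>F m in sequentially. 1 / real (m + 2) < x i" using \<open>x i > 0\<close> by (rule order_tendstoD)
      have "filterlim (\<lambda>m. real (m + 2)) at_top sequentially"
        by (rule filterlim_compose[OF filterlim_real_sequentially filterlim_add_const_nat_at_top])
      then have 2: "\<forall>\<^sub>F m in sequentially. x i \<le> real (m + 2)" by (simp add: filterlim_at_top)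
      show "\<forall>\<^sub>F m in sequentially. 1 / real (m + 2) < x i \<and> x i \<le> real (m + 2)" using 1 2 by (rule eventually_conj)
    qed
    then have "\<forall>\<^sub>F m in sequentially. x \<in> ?B m"
      by (rule eventually_mono) (use True in auto)
    then have "\<forall>\<^sub>F m in sequentially. ennreal (pattern_density \<tau> V E F x) * indicator (?B m) x = ennreal (pattern_density \<tau> V E F x) * indicator (V \<rightarrow>\<^sub>E {0<..}) x"
      by (rule eventually_mono) (use True in simp)
    then show ?thesis by (rule tendsto_eventually)
  next
    case False
    have "x \<notin> ?B m" for m
    proof
      assume "x \<in> ?B m"
      moreover have "?B m \<subseteq> V \<rightarrow>\<^sub>E {0<..}"
      proof (rule PiE_mono)
        have "0 < 1 / real (m + 2)" by simp
        then show "{1 / real (m + 2) <.. real (m + 2)} \<subseteq> {0<..}"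
          by (meson greaterThanAtMost_iff greaterThan_iff order.strict_trans subsetI)
      qed
      ultimately show False using False by blast
    qed
    then show ?thesis using False by simp
  qed
qed

section \<open>Riemann sums\<close>

definition window :: "real \<Rightarrow> real \<Rightarrow> nat set" where
  "window \<epsilon> s = {d. \<epsilon> < real d / s \<and> real d / s \<le> 1 / \<epsilon>}"

text \<open>For s = sqrt (\<mu> n) this is the mean of the independent-edge product for one tuple of
  vertices, restricted to degrees in the window.\<close>

definition box_sum :: "nat pmf \<Rightarrow> nat set \<Rightarrow> nat set set \<Rightarrow> nat set set \<Rightarrow> real \<Rightarrow> real \<Rightarrow> real" where
  "box_sum p V E F \<epsilon> s = (\<Sum>d\<in>V \<rightarrow>\<^sub>E window \<epsilon> s. edge_prod_limit (s\<^sup>2) d E F * (\<Prod>i\<in>V. pmf p (d i)))"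

lemma finite_window: "s > 0 \<Longrightarrow> finite (window \<epsilon> s)"
proof -
  assume s: "s > 0"
  have "window \<epsilon> s \<subseteq> {..nat \<lfloor>s / \<epsilon>\<rfloor>}"
  proof
    fix d assume "d \<in> window \<epsilon> s"
    then have "real d \<le> s / \<epsilon>" using s by (simp add: window_def pos_divide_le_eq)
    then show "d \<in> {..nat \<lfloor>s / \<epsilon>\<rfloor>}" by (simp add: le_nat_floor)
  qed
  then show ?thesis using finite_subset by blast
qed

lemma edge_prod_limit_bounds:
  assumes "s > 0"
  shows "0 \<le> edge_prod_limit s d E F" "edge_prod_limit s d E F \<le> 1"
proof -
  have w: "0 \<le> edge_weight d e / s" for e using assms by simp
  show "0 \<le> edge_prod_limit s d E F" unfolding edge_prod_limit_def
    using w by (intro mult_nonneg_nonneg prod_nonneg) auto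
  have "(\<Prod>e\<in>E. 1 - exp (- (edge_weight d e / s))) \<le> 1" using w by (intro prod_le_1) auto
  moreover have "(\<Prod>e\<in>F. exp (- (edge_weight d e / s))) \<le> 1" using w by (intro prod_le_1) auto
  moreover have "0 \<le> (\<Prod>e\<in>F. exp (- (edge_weight d e / s)))" by (intro prod_nonneg) auto
  ultimately show "edge_prod_limit s d E F \<le> 1" unfolding edge_prod_limit_def by (intro mult_le_one)
qed

lemma edge_weight_scaled:
  assumes "card e = 2" "s > 0"
  shows "edge_weight d e / s\<^sup>2 = (\<Prod>i\<in>e. real (d i) / s)"
  using assms by (simp add: edge_weight_def prod_dividef)

lemma floor_scaled_limit:
  fixes y :: real and s :: "nat \<Rightarrow> real"
  assumes s: "filterlim s at_top sequentially" "\<And>n. s n \<ge> 1" and y: "y > 0"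
  shows "(\<lambda>n. real (nat \<lfloor>s n * y\<rfloor>) / s n) \<longlonglongrightarrow> y"
    and "filterlim (\<lambda>n. nat \<lfloor>s n * y\<rfloor>) sequentially sequentially"
proof -
  have s0: "s n > 0" for n using s(2)[of n] by linarith
  have b: "s n * y - 1 \<le> real (nat \<lfloor>s n * y\<rfloor>)" "real (nat \<lfloor>s n * y\<rfloor>) \<le> s n * y" for n
  proof -
    have "0 \<le> s n * y" using s0[of n] y by simp
    then show "s n * y - 1 \<le> real (nat \<lfloor>s n * y\<rfloor>)" "real (nat \<lfloor>s n * y\<rfloor>) \<le> s n * y" by linarith+
  qed
  show "(\<lambda>n. real (nat \<lfloor>s n * y\<rfloor>) / s n) \<longlonglongrightarrow> y"
  proof (rule tendsto_sandwich)
    have "(\<lambda>n. 1 / s n) \<longlonglongrightarrow> 0" by (rule real_tendsto_divide_at_top[OF tendsto_const s(1)])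
    then show "(\<lambda>n. y - 1 / s n) \<longlonglongrightarrow> y" using tendsto_diff[OF tendsto_const[of y]] by fastforce
    show "\<forall>\<^sub>F n in sequentially. y - 1 / s n \<le> real (nat \<lfloor>s n * y\<rfloor>) / s n"
    proof (intro always_eventually allI)
      fix n
      have "y - 1 / s n = (s n * y - 1) / s n" using s0[of n] by (simp add: field_simps)
      also have "\<dots> \<le> real (nat \<lfloor>s n * y\<rfloor>) / s n" using b(1)[of n] s0[of n] by (intro divide_right_mono) auto
      finally show "y - 1 / s n \<le> real (nat \<lfloor>s n * y\<rfloor>) / s n" .
    qed
    show "\<forall>\<^sub>F n in sequentially. real (nat \<lfloor>s n * y\<rfloor>) / s n \<le> y"
    proof (intro always_eventually allI)
      fix n
      show "real (nat \<lfloor>s n * y\<rfloor>) / s n \<le> y" using b(2)[of n] s0[of n] by (simp add: pos_divide_le_eq mult.commute)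
    qed
  qed simp
  have "filterlim (\<lambda>n. s n * y) at_top sequentially"
    by (rule filterlim_at_top_mult_tendsto_pos[OF tendsto_const y s(1)])
  then have "filterlim (\<lambda>n. - 1 + s n * y) at_top sequentially"
    by (rule filterlim_tendsto_add_at_top[OF tendsto_const])
  then have "filterlim (\<lambda>n. real (nat \<lfloor>s n * y\<rfloor>)) at_top sequentially"
    by (rule filterlim_at_top_mono) (use b(1) in \<open>auto intro!: always_eventually\<close>)
  then show "filterlim (\<lambda>n. nat \<lfloor>s n * y\<rfloor>) sequentially sequentially"
    by (simp add: filterlim_sequentially_iff_filterlim_real)
qed

text \<open>The rescaled sum is the integral of a step function \<open>g n\<close>, constant on
  cells of side 1 / s. It converges pointwise by the tail asymptotics. It is dominated because the
  window keeps degrees above \<epsilon> s, where s^\<tau> times the mass function is at most C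
  \<epsilon>^(-\<tau>).\<close>

theorem box_sum_limit:
  fixes \<tau> c \<epsilon> :: real and p :: "nat pmf" and s :: "nat \<Rightarrow> real"
  assumes V: "finite V" and E: "\<forall>e\<in>E \<union> F. card e = 2 \<and> e \<subseteq> V"
    and c: "c > 0" and tail: "(\<lambda>d. pmf p d) \<sim>[sequentially] (\<lambda>d. c * real d powr (-\<tau>))"
    and \<tau>: "\<tau> > 0" and \<epsilon>: "\<epsilon> > 0" and s: "filterlim s at_top sequentially" "\<And>n. s n \<ge> 1"
  shows "(\<lambda>n. ennreal (s n powr (real (card V) * (\<tau> - 1)) * box_sum p V E F \<epsilon> (s n)))
     \<longlonglongrightarrow> ennreal (c ^ card V) * pattern_integral \<tau> V E F {\<epsilon> <.. 1 / \<epsilon>}"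
proof -
  obtain C where C: "C > 0" and pC: "\<forall>d\<ge>1. pmf p d \<le> C * real d powr (- \<tau>)"
    using pmf_tail_bound[OF c tail] by blast
  have s0: "s n > 0" for n using s(2)[of n] by linarith
  let ?M = "\<Pi>\<^sub>M i\<in>V. (lborel :: real measure)"
  let ?W = "\<lambda>n. V \<rightarrow>\<^sub>E window \<epsilon> (s n)"
  define cell where "cell n d = (\<Pi>\<^sub>E i\<in>V. {real (d i) / s n ..< (real (d i) + 1) / s n})" for n and d :: "nat \<Rightarrow> nat"
  \<comment> \<open>The value on a cell: each mass is scaled by s^\<tau>, of which the volume of the
    cell takes back one power of s per coordinate.\<close>
  define H where "H n d = (\<Prod>i\<in>V. s n powr \<tau> * pmf p (d i)) * edge_prod_limit ((s n)\<^sup>2) d E F" for n d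
  define g where "g n y = (\<Sum>d\<in>?W n. ennreal (H n d) * indicator (cell n d) y)" for n and y :: "nat \<Rightarrow> real"
  define fl where "fl n y = (\<lambda>i\<in>V. nat \<lfloor>s n * y i\<rfloor>)" for n and y :: "nat \<Rightarrow> real"
  let ?B = "V \<rightarrow>\<^sub>E {\<epsilon> <.. 1 / \<epsilon>}"
  \<comment> \<open>A cell extends beyond its left endpoint by 1 / s \<le> 1, hence an enlarged box
    for the domination.\<close>
  let ?B' = "V \<rightarrow>\<^sub>E {0 .. 1 / \<epsilon> + 1}"
  let ?K = "(C * \<epsilon> powr (-\<tau>)) ^ card V"
  have finW: "finite (?W n)" for n using V finite_window[OF s0] by (intro finite_PiE) auto
  have epl: "0 \<le> edge_prod_limit ((s n)\<^sup>2) d E F" "edge_prod_limit ((s n)\<^sup>2) d E F \<le> 1" for n d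
    using edge_prod_limit_bounds[of "(s n)\<^sup>2"] s0[of n] by auto
  have H0: "H n d \<ge> 0" for n d unfolding H_def by (intro mult_nonneg_nonneg prod_nonneg epl) auto
  have HK: "H n d \<le> ?K" if "d \<in> ?W n" for n d
  proof -
    have "(\<Prod>i\<in>V. s n powr \<tau> * pmf p (d i)) \<le> (\<Prod>i\<in>V. C * \<epsilon> powr (-\<tau>))"
    proof (intro prod_mono conjI)
      fix i assume i: "i \<in> V"
      then have w: "\<epsilon> < real (d i) / s n" using that by (auto simp: window_def)
      then have pos: "real (d i) / s n > 0" using \<epsilon> by linarith
      then have d: "d i > 0" using s0[of n] by (simp add: zero_less_divide_iff)
      then have "s n powr \<tau> * pmf p (d i) \<le> s n powr \<tau> * (C * real (d i) powr (-\<tau>))"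
        using pC by (intro mult_left_mono) auto
      also have "\<dots> = C * (real (d i) / s n) powr (-\<tau>)"
        using s0[of n] d by (simp add: powr_divide powr_minus_divide)
      also have "\<dots> \<le> C * \<epsilon> powr (-\<tau>)"
        using w \<tau> \<epsilon> C by (intro mult_left_mono powr_mono2') auto
      finally show "s n powr \<tau> * pmf p (d i) \<le> C * \<epsilon> powr (-\<tau>)" .
    qed auto
    then have "H n d \<le> (\<Prod>i\<in>V. C * \<epsilon> powr (-\<tau>)) * 1"
      unfolding H_def using C by (intro mult_mono epl prod_nonneg) auto
    then show ?thesis by simp
  qed
  have cell_sets: "cell n d \<in> sets ?M" for n d
    unfolding cell_def using V by (intro sets_PiM_I_finite) auto
  have cell_emeasure: "emeasure ?M (cell n d) = ennreal ((1 / s n) ^ card V)" for n d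
  proof -
    have "emeasure ?M (cell n d) = (\<Prod>i\<in>V. emeasure lborel {real (d i) / s n ..< (real (d i) + 1) / s n})"
      unfolding cell_def by (rule emeasure_box[OF V]) auto
    also have "\<dots> = (\<Prod>i\<in>V. ennreal (1 / s n))"
    proof (intro prod.cong refl)
      fix i
      have "(real (d i) + 1) / s n - real (d i) / s n = 1 / s n" by (simp add: diff_divide_distrib[symmetric])
      then show "emeasure lborel {real (d i) / s n ..< (real (d i) + 1) / s n} = ennreal (1 / s n)"
        using s0[of n] by (subst emeasure_lborel_Ico) (simp_all add: divide_right_mono)
    qed
    finally show ?thesis using s0[of n] by (simp add: ennreal_power less_imp_le)
  qed
  have int_g: "(\<integral>\<^sup>+y. g n y \<partial>?M) = ennreal (s n powr (real (card V) * (\<tau> - 1)) * box_sum p V E F \<epsilon> (s n))" for n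
  proof -
    have "(\<integral>\<^sup>+y. g n y \<partial>?M) = (\<Sum>d\<in>?W n. \<integral>\<^sup>+y. ennreal (H n d) * indicator (cell n d) y \<partial>?M)"
      unfolding g_def by (rule nn_integral_sum)
        (intro borel_measurable_times_ennreal borel_measurable_const borel_measurable_indicator cell_sets)
    also have "\<dots> = (\<Sum>d\<in>?W n. ennreal (H n d * (1 / s n) ^ card V))"
      by (intro sum.cong refl) (simp add: nn_integral_cmult_indicator[OF cell_sets] cell_emeasure ennreal_mult H0 s0 less_imp_le)
    also have "\<dots> = ennreal (\<Sum>d\<in>?W n. H n d * (1 / s n) ^ card V)"
      using s0[of n] by (intro sum_ennreal mult_nonneg_nonneg H0) auto
    also have "(\<Sum>d\<in>?W n. H n d * (1 / s n) ^ card V)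
        = s n powr (real (card V) * (\<tau> - 1)) * box_sum p V E F \<epsilon> (s n)"
      unfolding box_sum_def sum_distrib_left
    proof (intro sum.cong refl)
      fix d
      have "(s n powr \<tau>) ^ card V * (1 / s n) ^ card V = (s n powr \<tau> * (1 / s n)) ^ card V"
        by (rule power_mult_distrib[symmetric])
      also have "s n powr \<tau> * (1 / s n) = s n powr (\<tau> - 1)" using s0[of n] by (simp add: powr_diff)
      also have "(s n powr (\<tau> - 1)) ^ card V = s n powr (real (card V) * (\<tau> - 1))"
        using s0[of n] by (simp add: powr_power mult.commute)
      finally have e: "(s n powr \<tau>) ^ card V * (1 / s n) ^ card V = s n powr (real (card V) * (\<tau> - 1))" .
      have "H n d * (1 / s n) ^ card V = ((s n powr \<tau>) ^ card V * (1 / s n) ^ card V) * (edge_prod_limit ((s n)\<^sup>2) d E F * (\<Prod>i\<in>V. pmf p (d i)))"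
        unfolding H_def prod.distrib prod_constant by (simp only: mult_ac)
      then show "H n d * (1 / s n) ^ card V = s n powr (real (card V) * (\<tau> - 1)) * (edge_prod_limit ((s n)\<^sup>2) d E F * (\<Prod>i\<in>V. pmf p (d i)))"
        unfolding e .
    qed
    finally show ?thesis .
  qed
  have in_cell: "y \<in> cell n d \<longleftrightarrow> d = fl n y" if y: "y \<in> V \<rightarrow>\<^sub>E UNIV" and d: "d \<in> ?W n" for n y d
  proof -
    have one: "y i \<in> {real (d i) / s n ..< (real (d i) + 1) / s n} \<longleftrightarrow> d i = nat \<lfloor>s n * y i\<rfloor>" if i: "i \<in> V" for i
    proof -
      have "\<epsilon> < real (d i) / s n" using i d by (auto simp: window_def)
      then have pos: "real (d i) / s n > 0" using \<epsilon> by linarith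
      then have "d i > 0" using s0[of n] by (simp add: zero_less_divide_iff)
      have "y i \<in> {real (d i) / s n ..< (real (d i) + 1) / s n} \<longleftrightarrow> real (d i) \<le> s n * y i \<and> s n * y i < real (d i) + 1"
        using s0[of n] by (simp add: pos_divide_le_eq pos_less_divide_eq mult.commute)
      also have "\<dots> \<longleftrightarrow> \<lfloor>s n * y i\<rfloor> = int (d i)" by (simp add: floor_eq_iff)
      also have "\<dots> \<longleftrightarrow> d i = nat \<lfloor>s n * y i\<rfloor>" using \<open>d i > 0\<close> by linarith
      finally show ?thesis .
    qed
    show ?thesis
    proof
      assume "y \<in> cell n d"
      then have "\<And>i. i \<in> V \<Longrightarrow> d i = nat \<lfloor>s n * y i\<rfloor>" using one unfolding cell_def by blast
      then show "d = fl n y" using d unfolding fl_def by (intro ext) (auto simp: PiE_def extensional_def)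
    next
      assume "d = fl n y"
      then have "d i = nat \<lfloor>s n * y i\<rfloor>" if "i \<in> V" for i using that by (simp add: fl_def)
      then have "y i \<in> {real (d i) / s n ..< (real (d i) + 1) / s n}" if "i \<in> V" for i using one that by blast
      then show "y \<in> cell n d" unfolding cell_def using y by (intro PiE_I) auto
    qed
  qed
  have g_eq: "g n y = (if fl n y \<in> ?W n then ennreal (H n (fl n y)) else 0)" if y: "y \<in> V \<rightarrow>\<^sub>E UNIV" for n y
  proof -
    have "g n y = (\<Sum>d\<in>?W n. if d = fl n y then ennreal (H n d) else 0)"
      unfolding g_def using in_cell[OF y] by (intro sum.cong) (auto simp: indicator_def)
    then show ?thesis using finW[of n] by (simp add: sum.delta)
  qed
  have fl_ext: "fl n y \<in> ?W n \<longleftrightarrow> (\<forall>i\<in>V. nat \<lfloor>s n * y i\<rfloor> \<in> window \<epsilon> (s n))" for n y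
    unfolding fl_def by (auto simp: PiE_def Pi_def)
  have "(\<lambda>n. \<integral>\<^sup>+y. g n y \<partial>?M) \<longlonglongrightarrow> (\<integral>\<^sup>+y. ennreal (c ^ card V * pattern_density \<tau> V E F y) * indicator ?B y \<partial>?M)"
  proof (rule nn_integral_dominated_convergence[where w = "\<lambda>y. ennreal ?K * indicator ?B' y"])
    show "g n \<in> borel_measurable ?M" for n
      unfolding g_def[abs_def]
      by (intro borel_measurable_sum borel_measurable_times_ennreal borel_measurable_const borel_measurable_indicator cell_sets)
    have "\<forall>e\<in>E \<union> F. e \<subseteq> V" using E by blast
    from pattern_density_measurable[OF V this, of \<tau>]
    have "(\<lambda>y. c ^ card V * pattern_density \<tau> V E F y) \<in> borel_measurable ?M"
      by (intro borel_measurable_times borel_measurable_const)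
    then show "(\<lambda>y. ennreal (c ^ card V * pattern_density \<tau> V E F y) * indicator ?B y) \<in> borel_measurable ?M"
      by (intro borel_measurable_times_ennreal borel_measurable_indicator box_sets V measurable_compose[OF _ measurable_ennreal]) auto
    have B': "?B' \<in> sets ?M" by (intro box_sets V) auto
    then show "(\<lambda>y. ennreal ?K * indicator ?B' y) \<in> borel_measurable ?M"
      by (intro borel_measurable_times_ennreal borel_measurable_indicator borel_measurable_const)
    have "emeasure ?M ?B' = (\<Prod>i\<in>V. emeasure lborel {0 .. 1 / \<epsilon> + 1})" by (rule emeasure_box[OF V]) auto
    also have "\<dots> = ennreal (1 / \<epsilon> + 1) ^ card V" using \<epsilon> by (simp add: add_nonneg_nonneg)
    finally show "(\<integral>\<^sup>+y. ennreal ?K * indicator ?B' y \<partial>?M) < \<infinity>"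
      using B' by (simp add: nn_integral_cmult_indicator ennreal_mult_less_top power_less_top_ennreal)
    show "AE y in ?M. g n y \<le> ennreal ?K * indicator ?B' y" for n
    proof (rule AE_I2)
      fix y assume "y \<in> space ?M"
      then have y: "y \<in> V \<rightarrow>\<^sub>E UNIV" by (simp add: space_PiM)
      show "g n y \<le> ennreal ?K * indicator ?B' y"
      proof (cases "fl n y \<in> ?W n")
        case True
        have "y \<in> ?B'"
        proof (rule PiE_I)
          fix i assume i: "i \<in> V"
          have w: "nat \<lfloor>s n * y i\<rfloor> \<in> window \<epsilon> (s n)" using True i unfolding fl_ext by blast
          have "y \<in> cell n (fl n y)" using in_cell[OF y True] by simp
          then have "y i \<in> {real (fl n y i) / s n ..< (real (fl n y i) + 1) / s n}"
            using i unfolding cell_def by (rule PiE_mem)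
          then have yc: "real (nat \<lfloor>s n * y i\<rfloor>) / s n \<le> y i" "y i < (real (nat \<lfloor>s n * y i\<rfloor>) + 1) / s n"
            using i by (simp_all add: fl_def)
          have "0 \<le> y i" using yc(1) w \<epsilon> unfolding window_def by simp
          moreover have "(real (nat \<lfloor>s n * y i\<rfloor>) + 1) / s n \<le> 1 / \<epsilon> + 1"
          proof -
            have "1 / s n \<le> 1" using s(2)[of n] by simp
            then show ?thesis using w by (simp add: window_def add_divide_distrib)
          qed
          ultimately show "y i \<in> {0 .. 1 / \<epsilon> + 1}" using yc(2) by simp
        qed (use y in \<open>auto simp: PiE_def extensional_def\<close>)
        then show ?thesis using g_eq[OF y, of n] True HK[OF True] by (simp add: ennreal_leI)
      next
        case False
        then show ?thesis using g_eq[OF y, of n] by simp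
      qed
    qed
    show "AE y in ?M. (\<lambda>n. g n y) \<longlonglongrightarrow> ennreal (c ^ card V * pattern_density \<tau> V E F y) * indicator ?B y"
    proof (rule AE_I2)
      fix y assume "y \<in> space ?M"
      then have y: "y \<in> V \<rightarrow>\<^sub>E UNIV" by (simp add: space_PiM)
      show "(\<lambda>n. g n y) \<longlonglongrightarrow> ennreal (c ^ card V * pattern_density \<tau> V E F y) * indicator ?B y"
      proof (cases "y \<in> ?B")
        case True
        then have yi: "\<epsilon> < y i" "y i \<le> 1 / \<epsilon>" "y i > 0" if "i \<in> V" for i
          using PiE_mem[OF True that] \<epsilon> by auto
        let ?D = "\<lambda>i n. nat \<lfloor>s n * y i\<rfloor>"
        have D: "(\<lambda>n. real (?D i n) / s n) \<longlonglongrightarrow> y i" "filterlim (?D i) sequentially sequentially" if "i \<in> V" for i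
          using floor_scaled_limit[OF s yi(3)[OF that]] by auto
        have "\<forall>\<^sub>F n in sequentially. \<forall>i\<in>V. ?D i n \<in> window \<epsilon> (s n)"
        proof (rule eventually_ball_finite[OF V], rule ballI)
          fix i assume i: "i \<in> V"
          have "\<forall>\<^sub>F n in sequentially. \<epsilon> < real (?D i n) / s n"
            by (rule order_tendstoD(1)[OF D(1)[OF i] yi(1)[OF i]])
          then show "\<forall>\<^sub>F n in sequentially. ?D i n \<in> window \<epsilon> (s n)"
          proof eventually_elim
            case (elim n)
            have "real (?D i n) \<le> s n * y i" using s0[of n] yi(3)[OF i] by simp
            then have "real (?D i n) / s n \<le> y i" using s0[of n] by (simp add: pos_divide_le_eq mult.commute)
            then show ?case using elim yi(2)[OF i] by (simp add: window_def)
          qed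
        qed
        then have ev: "\<forall>\<^sub>F n in sequentially. g n y = ennreal (H n (fl n y))"
          by (rule eventually_mono) (simp add: g_eq[OF y] fl_ext)
        have lim1: "(\<lambda>n. s n powr \<tau> * pmf p (?D i n)) \<longlonglongrightarrow> c * y i powr (-\<tau>)" if i: "i \<in> V" for i
        proof -
          have ne: "\<forall>\<^sub>F d in sequentially. c * real d powr (-\<tau>) \<noteq> 0"
            using eventually_gt_at_top[of "0::nat"] c by (auto elim: eventually_mono)
          have "((\<lambda>d. pmf p d / (c * real d powr (-\<tau>))) \<longlongrightarrow> 1) sequentially"
            by (rule asymp_equivD_strong[OF tail]) (use ne in \<open>auto elim: eventually_mono\<close>)
          from filterlim_compose[OF this D(2)[OF i]]
          have a: "(\<lambda>n. pmf p (?D i n) / (c * real (?D i n) powr (-\<tau>))) \<longlonglongrightarrow> 1" .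
          have b: "(\<lambda>n. (real (?D i n) / s n) powr (-\<tau>)) \<longlonglongrightarrow> y i powr (-\<tau>)"
            by (rule tendsto_powr[OF D(1)[OF i] tendsto_const]) (use yi(3)[OF i] in simp)
          have "(\<lambda>n. pmf p (?D i n) / (c * real (?D i n) powr (-\<tau>)) * (c * (real (?D i n) / s n) powr (-\<tau>))) \<longlonglongrightarrow> 1 * (c * y i powr (-\<tau>))"
            by (intro tendsto_mult a b tendsto_const)
          moreover have "\<forall>\<^sub>F n in sequentially. pmf p (?D i n) / (c * real (?D i n) powr (-\<tau>)) * (c * (real (?D i n) / s n) powr (-\<tau>))
              = s n powr \<tau> * pmf p (?D i n)"
          proof -
            have "\<forall>\<^sub>F n in sequentially. ?D i n > 0"
              by (rule eventually_compose_filterlim[OF eventually_gt_at_top[of "0::nat"] D(2)[OF i]])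
            then show ?thesis
            proof eventually_elim
              case (elim n)
              then have e: "(real (?D i n) / s n) powr (-\<tau>) = real (?D i n) powr (-\<tau>) * s n powr \<tau>"
                using s0[of n] by (simp add: powr_divide powr_minus_divide)
              have "real (?D i n) powr (-\<tau>) \<noteq> 0"
                using elim by (metis of_nat_eq_0_iff powr_eq_0_iff less_numeral_extra(3))
              moreover have "a / (c * q) * (c * (q * r)) = r * a" if "q \<noteq> 0" for a q r :: real
                using that c by simp
              ultimately show ?case unfolding e by blast
            qed
          qed
          ultimately show ?thesis using Lim_transform_eventually by fastforce
        qed
        have lim2: "(\<lambda>n. edge_weight (fl n y) e / (s n)\<^sup>2) \<longlonglongrightarrow> (\<Prod>i\<in>e. y i)" if e: "e \<in> E \<union> F" for e
        proof -
          have ce: "card e = 2" "e \<subseteq> V" using E e by blast+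
          have "(\<lambda>n. \<Prod>i\<in>e. real (?D i n) / s n) \<longlonglongrightarrow> (\<Prod>i\<in>e. y i)"
            using ce D(1) by (intro tendsto_prod) blast
          moreover have "edge_weight (fl n y) e / (s n)\<^sup>2 = (\<Prod>i\<in>e. real (?D i n) / s n)" for n
            unfolding edge_weight_scaled[OF ce(1) s0] fl_def using ce(2) by (intro prod.cong) auto
          ultimately show ?thesis by simp
        qed
        have "(\<lambda>n. (\<Prod>i\<in>V. s n powr \<tau> * pmf p (?D i n)) *
            ((\<Prod>e\<in>E. 1 - exp (- (edge_weight (fl n y) e / (s n)\<^sup>2))) * (\<Prod>e\<in>F. exp (- (edge_weight (fl n y) e / (s n)\<^sup>2)))))
          \<longlonglongrightarrow> (\<Prod>i\<in>V. c * y i powr (-\<tau>)) * ((\<Prod>e\<in>E. 1 - exp (- (\<Prod>i\<in>e. y i))) * (\<Prod>e\<in>F. exp (- (\<Prod>i\<in>e. y i))))"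
          by (intro tendsto_mult tendsto_prod tendsto_diff tendsto_const tendsto_exp tendsto_minus lim1 lim2) auto
        moreover have "(\<Prod>i\<in>V. s n powr \<tau> * pmf p (?D i n)) = (\<Prod>i\<in>V. s n powr \<tau> * pmf p (fl n y i))" for n
          by (intro prod.cong) (auto simp: fl_def)
        ultimately have "(\<lambda>n. H n (fl n y)) \<longlonglongrightarrow> (\<Prod>i\<in>V. c * y i powr (-\<tau>)) * ((\<Prod>e\<in>E. 1 - exp (- (\<Prod>i\<in>e. y i))) * (\<Prod>e\<in>F. exp (- (\<Prod>i\<in>e. y i))))"
          unfolding H_def edge_prod_limit_def by simp
        also have "(\<Prod>i\<in>V. c * y i powr (-\<tau>)) * ((\<Prod>e\<in>E. 1 - exp (- (\<Prod>i\<in>e. y i))) * (\<Prod>e\<in>F. exp (- (\<Prod>i\<in>e. y i))))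
            = c ^ card V * pattern_density \<tau> V E F y"
          unfolding pattern_density_def prod_powr_distrib by (simp add: prod.distrib)
        finally have "(\<lambda>n. ennreal (H n (fl n y))) \<longlonglongrightarrow> ennreal (c ^ card V * pattern_density \<tau> V E F y)"
          by (rule tendsto_ennrealI)
        then have "(\<lambda>n. g n y) \<longlonglongrightarrow> ennreal (c ^ card V * pattern_density \<tau> V E F y)"
          using ev by (simp add: tendsto_cong)
        then show ?thesis using True by simp
      next
        case False
        \<comment> \<open>One coordinate outside suffices. Rounding down keeps a coordinate at most
          \<epsilon> out of the half-open window for every n, and a coordinate above 1 / \<epsilon>
          is out eventually, so convergence holds at every point, the boundary included.\<close>
        then obtain i where i: "i \<in> V" "y i \<notin> {\<epsilon> <.. 1 / \<epsilon>}" using y unfolding PiE_iff by blast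
        have "\<forall>\<^sub>F n in sequentially. nat \<lfloor>s n * y i\<rfloor> \<notin> window \<epsilon> (s n)"
        proof (cases "y i \<le> \<epsilon>")
          case True
          have "nat \<lfloor>s n * y i\<rfloor> \<notin> window \<epsilon> (s n)" for n
          proof -
            have "real (nat \<lfloor>s n * y i\<rfloor>) \<le> s n * \<epsilon>"
            proof (cases "y i \<ge> 0")
              case yp: True
              then have "real (nat \<lfloor>s n * y i\<rfloor>) \<le> s n * y i" using s0[of n] by simp
              also have "\<dots> \<le> s n * \<epsilon>" using True s0[of n] by (intro mult_left_mono) auto
              finally show ?thesis .
            next
              case False
              then have "s n * y i \<le> 0" using s0[of n] by (simp add: mult_le_0_iff)
              then have "nat \<lfloor>s n * y i\<rfloor> = 0" by simp
              then show ?thesis using \<epsilon> s0[of n] by simp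
            qed
            then have "real (nat \<lfloor>s n * y i\<rfloor>) / s n \<le> \<epsilon>" using s0[of n] by (simp add: pos_divide_le_eq mult.commute)
            then show ?thesis by (simp add: window_def)
          qed
          then show ?thesis by simp
        next
          case False
          then have y1: "1 / \<epsilon> < y i" using i(2) by simp
          moreover have "0 < 1 / \<epsilon>" using \<epsilon> by simp
          ultimately have "y i > 0" by (rule less_trans[rotated])
          from order_tendstoD(1)[OF floor_scaled_limit(1)[OF s this] y1]
          show ?thesis by (rule eventually_mono) (simp add: window_def)
        qed
        then have "\<forall>\<^sub>F n in sequentially. g n y = 0"
          by (rule eventually_mono) (use i(1) in \<open>auto simp: g_eq[OF y] fl_ext\<close>)
        then have "(\<lambda>n. g n y) \<longlonglongrightarrow> 0" by (rule tendsto_eventually)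
        then show ?thesis using False by simp
      qed
    qed
  qed
  moreover have "(\<integral>\<^sup>+y. ennreal (c ^ card V * pattern_density \<tau> V E F y) * indicator ?B y \<partial>?M)
      = ennreal (c ^ card V) * pattern_integral \<tau> V E F {\<epsilon> <.. 1 / \<epsilon>}"
  proof -
    have "\<forall>e\<in>E \<union> F. e \<subseteq> V" using E by blast
    from pattern_density_measurable[OF V this, of \<tau>]
    have m: "(\<lambda>y. ennreal (pattern_density \<tau> V E F y) * indicator ?B y) \<in> borel_measurable ?M"
      by (intro borel_measurable_times_ennreal borel_measurable_indicator box_sets V measurable_compose[OF _ measurable_ennreal]) auto
    have "(\<integral>\<^sup>+y. ennreal (c ^ card V * pattern_density \<tau> V E F y) * indicator ?B y \<partial>?M)
      = (\<integral>\<^sup>+y. ennreal (c ^ card V) * (ennreal (pattern_density \<tau> V E F y) * indicator ?B y) \<partial>?M)"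
      using c by (intro nn_integral_cong) (simp add: ennreal_mult' mult.assoc)
    then show ?thesis unfolding pattern_integral_def nn_integral_cmult[OF m] .
  qed
  ultimately show ?thesis unfolding int_g by simp
qed

section \<open>Independent degrees\<close>

lemma expectation_Pi_pmf_component:
  fixes h :: "'b \<Rightarrow> real"
  assumes "finite A" "i \<in> A"
  shows "measure_pmf.expectation (Pi_pmf A dflt (\<lambda>_. p)) (\<lambda>d. h (d i)) = measure_pmf.expectation p h"
    and "integrable (measure_pmf p) h \<Longrightarrow> integrable (measure_pmf (Pi_pmf A dflt (\<lambda>_. p))) (\<lambda>d. h (d i))"
proof -
  have m: "map_pmf (\<lambda>f. f i) (Pi_pmf A dflt (\<lambda>_. p)) = p"
    using assms by (subst Pi_pmf_component) auto
  have "measure_pmf.expectation p h = measure_pmf.expectation (map_pmf (\<lambda>f. f i) (Pi_pmf A dflt (\<lambda>_. p))) h"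
    unfolding m ..
  then show "measure_pmf.expectation (Pi_pmf A dflt (\<lambda>_. p)) (\<lambda>d. h (d i)) = measure_pmf.expectation p h"
    by simp
  assume "integrable (measure_pmf p) h"
  then have "integrable (measure_pmf (map_pmf (\<lambda>f. f i) (Pi_pmf A dflt (\<lambda>_. p)))) h" unfolding m .
  then show "integrable (measure_pmf (Pi_pmf A dflt (\<lambda>_. p))) (\<lambda>d. h (d i))"
    unfolding map_pmf_rep_eq by (subst (asm) integrable_distr_eq) auto
qed

text \<open>Only a first moment is assumed, so degrees are truncated at a level K: Hoeffding's
  inequality handles the bounded part and Markov's inequality the excess, whose mean is below
  \<theta> per vertex. The index set is arbitrary because the law is also applied to the vertices
  outside a tuple.\<close>

theorem weak_law_Pi_pmf:
  fixes \<rho> \<beta> :: real and p :: "nat pmf"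
  assumes int: "integrable (measure_pmf p) real" and \<rho>: "\<rho> > 0" and \<beta>: "\<beta> > 0"
  defines "\<mu> \<equiv> measure_pmf.expectation p real"
  shows "\<exists>N. \<forall>A :: 'a set. finite A \<longrightarrow> card A \<ge> N \<longrightarrow>
     measure_pmf.prob (Pi_pmf A 0 (\<lambda>_. p)) {d. \<bar>(\<Sum>i\<in>A. real (d i)) - \<mu> * card A\<bar> > \<rho> * card A} \<le> \<beta>"
proof -
  let ?f = "\<lambda>K x. min (real x) (real K)"
  \<comment> \<open>The first bound keeps the truncated mean within \<rho>/4 of \<mu>; the second
    makes the Markov bound at level \<rho>/2 at most \<beta>/2.\<close>
  define \<theta> where "\<theta> = min (\<rho> / 4) (\<rho> * \<beta> / 4)"
  have \<theta>: "\<theta> > 0" "\<theta> \<le> \<rho> / 4" "\<theta> \<le> \<rho> * \<beta> / 4" using \<rho> \<beta> by (auto simp: \<theta>_def)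
  have "(\<lambda>K. measure_pmf.expectation p (?f K)) \<longlonglongrightarrow> measure_pmf.expectation p real"
  proof (rule integral_dominated_convergence[where w = real])
    show "AE x in measure_pmf p. (\<lambda>K. ?f K x) \<longlonglongrightarrow> real x"
    proof (rule AE_I2)
      fix x
      have "\<forall>\<^sub>F K in sequentially. ?f K x = real x" using eventually_ge_at_top[of x] by eventually_elim simp
      then show "(\<lambda>K. ?f K x) \<longlonglongrightarrow> real x" by (rule tendsto_eventually)
    qed
  qed (use int in auto)
  then have "\<forall>\<^sub>F K in sequentially. \<mu> - \<theta> < measure_pmf.expectation p (?f K)"
    unfolding \<mu>_def using \<theta>(1) by (intro order_tendstoD) auto
  then have "\<forall>\<^sub>F K in sequentially. \<mu> - \<theta> < measure_pmf.expectation p (?f K) \<and> K \<ge> 1"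
    using eventually_ge_at_top[of "1::nat"] by (rule eventually_conj)
  then obtain K where K: "\<mu> - \<theta> < measure_pmf.expectation p (?f K)" "K \<ge> 1"
    using eventually_happens by fastforce
  let ?m = "measure_pmf.expectation p (?f K)"
  have intf: "integrable (measure_pmf p) (?f K)"
    by (rule measure_pmf.integrable_const_bound[where B = "real K"]) auto
  have m_le: "?m \<le> \<mu>" unfolding \<mu>_def by (intro integral_mono intf int) auto
  have "(\<lambda>m. 2 * exp (- (\<rho>\<^sup>2 / (8 * (real K)\<^sup>2)) * real m)) \<longlonglongrightarrow> 2 * 0"
  proof (intro tendsto_mult tendsto_const filterlim_compose[OF exp_at_bot])
    show "filterlim (\<lambda>m. - (\<rho>\<^sup>2 / (8 * (real K)\<^sup>2)) * real m) at_bot sequentially"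
      using \<rho> K(2) by (intro filterlim_tendsto_neg_mult_at_bot[OF tendsto_const _ filterlim_real_sequentially]) auto
  qed
  then have "\<forall>\<^sub>F m in sequentially. 2 * exp (- (\<rho>\<^sup>2 / (8 * (real K)\<^sup>2)) * real m) < \<beta> / 2"
    by (rule order_tendstoD(2)) (use \<beta> in simp)
  then obtain N where N: "\<And>m. m \<ge> N \<Longrightarrow> 2 * exp (- (\<rho>\<^sup>2 / (8 * (real K)\<^sup>2)) * real m) < \<beta> / 2"
    by (auto simp: eventually_sequentially)
  show ?thesis
  proof (intro exI[of _ "max N 1"] allI impI)
    fix A :: "'a set" assume A: "finite A" "card A \<ge> max N 1"
    let ?P = "Pi_pmf A 0 (\<lambda>_. p)"
    define M where "M = real (card A)"
    have M: "M > 0" using A by (simp add: M_def)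
    interpret H: Hoeffding_ineq "measure_pmf ?P" A "\<lambda>i d. ?f K (d i)" "\<lambda>_. 0" "\<lambda>_. real K" "\<Sum>i\<in>A. measure_pmf.expectation ?P (\<lambda>d. ?f K (d i))"
    proof unfold_locales
      show "finite A" by (rule A)
      show "prob_space.indep_vars (measure_pmf ?P) (\<lambda>_. borel) (\<lambda>i d. ?f K (d i)) A"
        using prob_space.indep_vars_compose2[OF prob_space_measure_pmf indep_vars_Pi_pmf[OF A(1)], of "\<lambda>_. ?f K" "\<lambda>_. borel"] by simp
      show "AE x in measure_pmf ?P. ?f K (x i) \<in> {0..real K}" for i by simp
    qed simp
    have sm: "(\<Sum>i\<in>A. measure_pmf.expectation ?P (\<lambda>d. ?f K (d i))) = M * ?m"
    proof -
      have "(\<Sum>i\<in>A. measure_pmf.expectation ?P (\<lambda>d. ?f K (d i))) = (\<Sum>i\<in>A. ?m)"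
        by (intro sum.cong refl expectation_Pi_pmf_component(1)[OF A(1), where h = "?f K"])
      then show ?thesis by (simp add: M_def)
    qed
    have hoeff: "measure_pmf.prob ?P {d. \<bar>(\<Sum>i\<in>A. ?f K (d i)) - M * ?m\<bar> \<ge> \<rho> / 4 * M} \<le> \<beta> / 2"
    proof -
      have "measure_pmf.prob ?P {d \<in> space (measure_pmf ?P). \<bar>(\<Sum>i\<in>A. ?f K (d i)) - (\<Sum>i\<in>A. measure_pmf.expectation ?P (\<lambda>d. ?f K (d i)))\<bar> \<ge> \<rho> / 4 * M}
        \<le> 2 * exp (- 2 * (\<rho> / 4 * M)\<^sup>2 / (\<Sum>i\<in>A. (real K - 0)\<^sup>2))"
        by (rule H.Hoeffding_ineq_abs_ge) (use \<rho> M A K(2) in \<open>auto intro!: sum_pos\<close>)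
      also have "- 2 * (\<rho> / 4 * M)\<^sup>2 / (\<Sum>i\<in>A. (real K - 0)\<^sup>2) = - (\<rho>\<^sup>2 / (8 * (real K)\<^sup>2)) * M"
        using M K(2) by (simp add: M_def[symmetric] power2_eq_square field_simps)
      also have "2 * exp (- (\<rho>\<^sup>2 / (8 * (real K)\<^sup>2)) * M) \<le> \<beta> / 2" using N[of "card A"] A by (simp add: M_def)
      finally show ?thesis unfolding sm by simp
    qed
    have markov: "measure_pmf.prob ?P {d. (\<Sum>i\<in>A. real (d i) - ?f K (d i)) \<ge> \<rho> / 2 * M} \<le> \<beta> / 2"
    proof -
      have intg: "integrable (measure_pmf p) (\<lambda>x. real x - ?f K x)" by (intro Bochner_Integration.integrable_diff int intf)
      have i: "integrable (measure_pmf ?P) (\<lambda>d. real (d i) - ?f K (d i))" if "i \<in> A" for i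
        by (rule expectation_Pi_pmf_component(2)[OF A(1) that intg])
      have "measure_pmf.prob ?P {d \<in> space (measure_pmf ?P). (\<Sum>i\<in>A. real (d i) - ?f K (d i)) \<ge> \<rho> / 2 * M}
        \<le> measure_pmf.expectation ?P (\<lambda>d. \<Sum>i\<in>A. real (d i) - ?f K (d i)) / (\<rho> / 2 * M)"
      proof (rule integral_Markov_inequality_measure[where A = UNIV])
        show "integrable (measure_pmf ?P) (\<lambda>d. \<Sum>i\<in>A. real (d i) - ?f K (d i))" using i by (intro Bochner_Integration.integrable_sum)
      qed (use \<rho> M in \<open>auto intro!: sum_nonneg\<close>)
      also have "measure_pmf.expectation ?P (\<lambda>d. \<Sum>i\<in>A. real (d i) - ?f K (d i)) = (\<Sum>i\<in>A. measure_pmf.expectation ?P (\<lambda>d. real (d i) - ?f K (d i)))"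
        using i by (intro Bochner_Integration.integral_sum)
      also have "\<dots> = (\<Sum>i\<in>A. \<mu> - ?m)"
        unfolding \<mu>_def using expectation_Pi_pmf_component(1)[OF A(1), where h = "\<lambda>x. real x - ?f K x"] int intf
        by (intro sum.cong) (auto simp: Bochner_Integration.integral_diff)
      also have "\<dots> = M * (\<mu> - ?m)" by (simp add: M_def)
      also have "M * (\<mu> - ?m) / (\<rho> / 2 * M) = (\<mu> - ?m) / (\<rho> / 2)" using M by simp
      also have "\<dots> \<le> (\<rho> * \<beta> / 4) / (\<rho> / 2)" using K(1) \<theta> \<rho> by (intro divide_right_mono) auto
      also have "\<dots> = \<beta> / 2" using \<rho> by simp
      finally show ?thesis by simp
    qed
    \<comment> \<open>The tolerance \<rho> is shared out: \<rho>/4 for the truncated sum, \<rho>/2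
      for the excess, \<rho>/4 for the shift of the mean.\<close>
    have "{d. \<bar>(\<Sum>i\<in>A. real (d i)) - \<mu> * card A\<bar> > \<rho> * card A} \<subseteq>
      {d. \<bar>(\<Sum>i\<in>A. ?f K (d i)) - M * ?m\<bar> \<ge> \<rho> / 4 * M} \<union> {d. (\<Sum>i\<in>A. real (d i) - ?f K (d i)) \<ge> \<rho> / 2 * M}"
    proof
      fix d assume "d \<in> {d. \<bar>(\<Sum>i\<in>A. real (d i)) - \<mu> * card A\<bar> > \<rho> * card A}"
      then have a: "\<bar>(\<Sum>i\<in>A. real (d i)) - \<mu> * M\<bar> > \<rho> * M" by (simp add: M_def)
      have e: "(\<Sum>i\<in>A. real (d i)) - \<mu> * M = ((\<Sum>i\<in>A. ?f K (d i)) - M * ?m) + (\<Sum>i\<in>A. real (d i) - ?f K (d i)) - M * (\<mu> - ?m)"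
        by (simp add: sum_subtractf algebra_simps)
      have "0 \<le> (\<Sum>i\<in>A. real (d i) - ?f K (d i))" by (intro sum_nonneg) auto
      moreover have "0 \<le> M * (\<mu> - ?m)" using M m_le by simp
      moreover have "M * (\<mu> - ?m) \<le> M * (\<rho> / 4)" using M K(1) \<theta>(2) by (intro mult_left_mono) auto
      moreover have "\<rho> * M = 4 * (\<rho> / 4 * M)" "\<rho> / 2 * M = 2 * (\<rho> / 4 * M)" "M * (\<rho> / 4) = \<rho> / 4 * M" by simp_all
      ultimately have "\<bar>(\<Sum>i\<in>A. ?f K (d i)) - M * ?m\<bar> \<ge> \<rho> / 4 * M \<or> (\<Sum>i\<in>A. real (d i) - ?f K (d i)) \<ge> \<rho> / 2 * M"
        using a unfolding e by linarith
      then show "d \<in> {d. \<bar>(\<Sum>i\<in>A. ?f K (d i)) - M * ?m\<bar> \<ge> \<rho> / 4 * M} \<union> {d. (\<Sum>i\<in>A. real (d i) - ?f K (d i)) \<ge> \<rho> / 2 * M}"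
        by blast
    qed
    then have "measure_pmf.prob ?P {d. \<bar>(\<Sum>i\<in>A. real (d i)) - \<mu> * card A\<bar> > \<rho> * card A} \<le>
      measure_pmf.prob ?P ({d. \<bar>(\<Sum>i\<in>A. ?f K (d i)) - M * ?m\<bar> \<ge> \<rho> / 4 * M} \<union> {d. (\<Sum>i\<in>A. real (d i) - ?f K (d i)) \<ge> \<rho> / 2 * M})"
      by (intro measure_pmf.finite_measure_mono) auto
    also have "\<dots> \<le> measure_pmf.prob ?P {d. \<bar>(\<Sum>i\<in>A. ?f K (d i)) - M * ?m\<bar> \<ge> \<rho> / 4 * M} + measure_pmf.prob ?P {d. (\<Sum>i\<in>A. real (d i) - ?f K (d i)) \<ge> \<rho> / 2 * M}"
      by (intro measure_Un_le) auto
    finally show "measure_pmf.prob ?P {d. \<bar>(\<Sum>i\<in>A. real (d i)) - \<mu> * card A\<bar> > \<rho> * card A} \<le> \<beta>"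
      using hoeff markov by linarith
  qed
qed

lemma prob_Pi_pmf_subset:
  assumes "finite A" "U \<subseteq> A"
  shows "measure_pmf.prob (Pi_pmf A dflt (\<lambda>_. p)) {d. \<forall>u\<in>U. d u \<in> B u} = (\<Prod>u\<in>U. measure_pmf.prob p (B u))"
proof -
  have "{d. \<forall>u\<in>U. d u \<in> B u} = Pi A (\<lambda>u. if u \<in> U then B u else UNIV)"
    using assms(2) by (auto simp: Pi_def split: if_splits)
  then have "measure_pmf.prob (Pi_pmf A dflt (\<lambda>_. p)) {d. \<forall>u\<in>U. d u \<in> B u}
     = (\<Prod>u\<in>A. measure_pmf.prob p (if u \<in> U then B u else UNIV))"
    using assms(1) by (simp add: measure_Pi_pmf_Pi)
  also have "\<dots> = (\<Prod>u\<in>U. measure_pmf.prob p (if u \<in> U then B u else UNIV))"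
    using assms by (intro prod.mono_neutral_right) auto
  finally show ?thesis by simp
qed

lemma nn_integral_Pi_pmf_subset:
  assumes "finite A" "U \<subseteq> A"
  shows "(\<integral>\<^sup>+d. (\<Prod>u\<in>U. f u (d u)) \<partial>Pi_pmf A dflt (\<lambda>_. p)) = (\<Prod>u\<in>U. \<integral>\<^sup>+x. f u x \<partial>measure_pmf p)"
proof -
  have "(\<integral>\<^sup>+d. (\<Prod>u\<in>U. f u (d u)) \<partial>Pi_pmf A dflt (\<lambda>_. p)) = (\<integral>\<^sup>+d. (\<Prod>u\<in>A. (if u \<in> U then f u else (\<lambda>_. 1)) (d u)) \<partial>Pi_pmf A dflt (\<lambda>_. p))"
  proof (intro nn_integral_cong)
    fix d
    have "(\<Prod>u\<in>A. (if u \<in> U then f u else (\<lambda>_. 1)) (d u)) = (\<Prod>u\<in>U. (if u \<in> U then f u else (\<lambda>_. 1)) (d u))"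
      using assms by (intro prod.mono_neutral_right) auto
    then show "(\<Prod>u\<in>U. f u (d u)) = (\<Prod>u\<in>A. (if u \<in> U then f u else (\<lambda>_. 1)) (d u))" by simp
  qed
  also have "\<dots> = (\<Prod>u\<in>A. \<integral>\<^sup>+x. (if u \<in> U then f u else (\<lambda>_. 1)) x \<partial>measure_pmf p)"
    by (rule nn_integral_prod_Pi_pmf[OF assms(1)])
  also have "\<dots> = (\<Prod>u\<in>U. \<integral>\<^sup>+x. (if u \<in> U then f u else (\<lambda>_. 1)) x \<partial>measure_pmf p)"
    using assms by (intro prod.mono_neutral_right) auto
  finally show ?thesis by simp
qed

lemma measure_pair_pmf_Times:
  "measure_pmf.prob (pair_pmf M N) (S \<times> T) = measure_pmf.prob M S * measure_pmf.prob N T"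
proof -
  have "measure_pmf.prob (pair_pmf M N) (S \<times> T) = measure_pmf.prob (pair_pmf M N) ((S \<inter> set_pmf M) \<times> (T \<inter> set_pmf N))"
    by (subst measure_Int_set_pmf[symmetric]) (simp add: Times_Int_Times)
  also have "\<dots> = measure_pmf.prob M (S \<inter> set_pmf M) * measure_pmf.prob N (T \<inter> set_pmf N)"
    by (rule measure_pmf_prob_product) (auto intro: countable_Int2)
  finally show ?thesis by (simp add: measure_Int_set_pmf)
qed

text \<open>The hypotheses on \<open>S\<close> and \<open>T\<close> say that each event is decided
  by the coordinates in its own block; such events are independent.\<close>

lemma prob_Pi_pmf_split:
  fixes p :: "'a \<Rightarrow> 'b pmf"
  assumes "finite A" "finite B" "A \<inter> B = {}"
    and S: "\<And>d d'. (\<forall>u\<in>A. d u = d' u) \<Longrightarrow> d \<in> S \<Longrightarrow> d' \<in> S"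
    and T: "\<And>d d'. (\<forall>u\<in>B. d u = d' u) \<Longrightarrow> d \<in> T \<Longrightarrow> d' \<in> T"
  shows "measure_pmf.prob (Pi_pmf (A \<union> B) dflt p) (S \<inter> T)
     = measure_pmf.prob (Pi_pmf A dflt p) S * measure_pmf.prob (Pi_pmf B dflt p) T"
proof -
  let ?h = "\<lambda>(f, g) x. if x \<in> A then f x else g x"
  have "?h -` (S \<inter> T) = S \<times> T"
  proof (rule set_eqI)
    fix z :: "('a \<Rightarrow> 'b) \<times> ('a \<Rightarrow> 'b)"
    obtain f g where z: "z = (f, g)" by (cases z)
    have 1: "?h z \<in> S \<longleftrightarrow> f \<in> S" using S[of "?h z" f] S[of f "?h z"] by (auto simp: z)
    have "\<forall>u\<in>B. ?h z u = g u" using assms(3) by (auto simp: z)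
    then have 2: "?h z \<in> T \<longleftrightarrow> g \<in> T" using T[of "?h z" g] T[of g "?h z"] by auto
    show "z \<in> ?h -` (S \<inter> T) \<longleftrightarrow> z \<in> S \<times> T" using 1 2 by (simp add: z)
  qed
  then have "measure_pmf.prob (Pi_pmf (A \<union> B) dflt p) (S \<inter> T)
     = measure_pmf.prob (pair_pmf (Pi_pmf A dflt p) (Pi_pmf B dflt p)) (S \<times> T)"
    unfolding Pi_pmf_union[OF assms(1-3)] measure_map_pmf by simp
  also have "\<dots> = measure_pmf.prob (Pi_pmf A dflt p) S * measure_pmf.prob (Pi_pmf B dflt p) T"
    by (rule measure_pair_pmf_Times)
  finally show ?thesis .
qed

section \<open>Patterns in the erased configuration model\<close>

text \<open>The degrees are kept next to the graph because windows are events for the degrees, which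
  the erased graph does not determine.\<close>

definition joint_law :: "nat pmf \<Rightarrow> nat \<Rightarrow> ((nat \<Rightarrow> nat) \<times> nat set set) pmf" where
  "joint_law p n = bind_pmf (Pi_pmf {1..n} 0 (\<lambda>_. p)) (\<lambda>d.
     map_pmf (\<lambda>M. (d, erase M)) (pmf_of_set (pairings (half_edges n (fix_parity n d)))))"

lemma ECM_eq_map_joint_law: "ECM p n = map_pmf snd (joint_law p n)"
  unfolding ECM_def joint_law_def map_bind_pmf map_pmf_comp by simp

lemma joint_law_prob:
  "measure_pmf.prob (joint_law p n) {(d, G). d \<in> S \<and> E \<subseteq> G \<and> F \<inter> G = {}}
     = measure_pmf.expectation (Pi_pmf {1..n} 0 (\<lambda>_. p)) (\<lambda>d. indicator S d * pattern_prob n d E F)"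
proof -
  let ?D = "Pi_pmf {1..n} 0 (\<lambda>_. p)"
  let ?X = "{(d, G). d \<in> S \<and> E \<subseteq> G \<and> F \<inter> G = {}} :: ((nat \<Rightarrow> nat) \<times> nat set set) set"
  have "emeasure (joint_law p n) ?X = (\<integral>\<^sup>+d. ennreal (indicator S d * pattern_prob n d E F) \<partial>measure_pmf ?D)"
    unfolding joint_law_def emeasure_bind_pmf emeasure_map_pmf
  proof (intro nn_integral_cong)
    fix d
    show "emeasure (measure_pmf (pmf_of_set (pairings (half_edges n (fix_parity n d))))) ((\<lambda>M. (d, erase M)) -` ?X)
       = ennreal (indicator S d * pattern_prob n d E F)"
    proof (cases "d \<in> S")
      case True
      then have "(\<lambda>M. (d, erase M)) -` ?X = {M. E \<subseteq> erase M \<and> F \<inter> erase M = {}}" by auto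
      then show ?thesis using True by (simp add: pattern_prob_def measure_pmf.emeasure_eq_measure)
    next
      case False
      then have "(\<lambda>M. (d, erase M)) -` ?X = {}" by auto
      then show ?thesis using False by simp
    qed
  qed
  also have "\<dots> = ennreal (measure_pmf.expectation ?D (\<lambda>d. indicator S d * pattern_prob n d E F))"
  proof (rule nn_integral_eq_integral)
    show "integrable (measure_pmf ?D) (\<lambda>d. indicator S d * pattern_prob n d E F)"
      using pattern_prob_bounds[of n _ E F]
      by (intro measure_pmf.integrable_const_bound[where B = 1]) (auto simp: indicator_def)
  qed (use pattern_prob_bounds(1) in \<open>auto simp: indicator_def\<close>)
  finally show ?thesis
    by (simp add: measure_pmf.emeasure_eq_measure pattern_prob_bounds(1) Bochner_Integration.integral_nonneg indicator_def)
qed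

lemma edge_prod_limit_cong:
  assumes "\<forall>e\<in>E \<union> F. e \<subseteq> V" "\<And>i. i \<in> V \<Longrightarrow> d i = d' i"
  shows "edge_prod_limit s d E F = edge_prod_limit s d' E F"
proof -
  have "edge_weight d e = edge_weight d' e" if "e \<in> E \<union> F" for e
  proof -
    have "e \<subseteq> V" using assms(1) that by blast
    then show ?thesis unfolding edge_weight_def using assms(2) by (intro prod.cong) auto
  qed
  then show ?thesis unfolding edge_prod_limit_def by simp
qed

lemma edge_prod_limit_image:
  assumes "\<forall>e\<in>E \<union> F. e \<subseteq> V" "inj_on v V"
  shows "edge_prod_limit s d ((`) v ` E) ((`) v ` F) = edge_prod_limit s (d \<circ> v) E F"
proof -
  have w: "edge_weight d (v ` e) = edge_weight (d \<circ> v) e" if "e \<in> E \<union> F" for e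
  proof -
    have "e \<subseteq> V" using assms(1) that by blast
    then have "inj_on v e" using assms(2) inj_on_subset by blast
    then show ?thesis unfolding edge_weight_def by (subst prod.reindex) (simp_all add: o_def)
  qed
  have inj: "inj_on ((`) v) (E \<union> F)"
    by (rule inj_on_subset[OF inj_on_image_Pow[OF assms(2)]]) (use assms(1) in blast)
  have "inj_on ((`) v) E" "inj_on ((`) v) F" using inj by (auto intro: inj_on_subset)
  then show ?thesis unfolding edge_prod_limit_def by (simp add: prod.reindex w)
qed

lemma integrable_mult_indicator_pmf: "integrable (measure_pmf q) (\<lambda>d. a * indicator S d :: real)"
  by (rule measure_pmf.integrable_const_bound[where B = "\<bar>a\<bar>"]) (auto simp: indicator_def)

lemma expectation_mult_indicator_pmf:
  "measure_pmf.expectation q (\<lambda>d. a * indicator S d :: real) = a * measure_pmf.prob q S"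
  by simp

section \<open>Counting labeled copies\<close>

definition tuples :: "nat set \<Rightarrow> nat \<Rightarrow> (nat \<Rightarrow> nat) set" where
  "tuples V n = {v \<in> V \<rightarrow>\<^sub>E {1..n}. inj_on v V}"

definition pattern_at :: "nat set set \<Rightarrow> nat set set \<Rightarrow> (nat \<Rightarrow> nat) \<Rightarrow> nat set set \<Rightarrow> bool" where
  "pattern_at E F v G \<longleftrightarrow> (`) v ` E \<subseteq> G \<and> (`) v ` F \<inter> G = {}"

definition pattern_count :: "nat set \<Rightarrow> nat set set \<Rightarrow> nat set set \<Rightarrow> nat \<Rightarrow> nat set set \<Rightarrow> nat" where
  "pattern_count V E F n G = card {v \<in> tuples V n. pattern_at E F v G}"

lemma finite_tuples: "finite V \<Longrightarrow> finite (tuples V n)"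
  unfolding tuples_def by (rule finite_subset[OF _ finite_PiE[of V "\<lambda>_. {1..n}"]]) auto

lemma card_tuples_le:
  assumes V: "finite V"
  shows "real (card (tuples V n)) \<le> real n ^ card V"
proof -
  have "card (tuples V n) \<le> card (V \<rightarrow>\<^sub>E {1..n})"
    unfolding tuples_def using V by (intro card_mono finite_PiE) auto
  also have "\<dots> = n ^ card V" using V by (simp add: card_PiE)
  finally show ?thesis by (metis of_nat_le_iff of_nat_power)
qed

text \<open>A tuple is extended one coordinate at a time, each with at least n - K free values.
  \<open>K\<close> is kept apart from \<open>card V\<close> so that this factor stays the same
  throughout the induction.\<close>

lemma card_tuples_ge:
  assumes "finite V" "card V \<le> K" "K \<le> n"
  shows "(n - K) ^ card V \<le> card (tuples V n)"
  using assms
proof (induction V rule: finite_induct)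
  case empty
  then show ?case by (simp add: tuples_def)
next
  case (insert x V)
  let ?S = "SIGMA v:tuples V n. {1..n} - v ` V"
  let ?g = "\<lambda>(v, a). v(x := a)"
  have inj: "inj_on ?g ?S"
  proof (rule inj_onI)
    fix z z' assume z: "z \<in> ?S" "z' \<in> ?S" "?g z = ?g z'"
    obtain v a v' a' where e: "z = (v, a)" "z' = (v', a')" by (cases z, cases z')
    have ext: "v x = undefined" "v' x = undefined"
      using z(1,2) insert.hyps(2) unfolding e by (auto simp: tuples_def PiE_def extensional_def)
    have eq: "v(x := a) = v'(x := a')" using z(3) by (simp add: e)
    then have "a = a'" by (metis fun_upd_same)
    moreover have "v = v'"
    proof
      fix y show "v y = v' y" using fun_cong[OF eq, of y] ext by (cases "y = x") auto
    qed
    ultimately show "z = z'" by (simp add: e)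
  qed
  have sub: "?g ` ?S \<subseteq> tuples (insert x V) n"
  proof (rule image_subsetI)
    fix z assume "z \<in> ?S"
    then obtain v a where z: "z = (v, a)" and v: "v \<in> tuples V n" and a: "a \<in> {1..n}" "a \<notin> v ` V" by auto
    have "v(x := a) \<in> insert x V \<rightarrow>\<^sub>E {1..n}" using v a(1) by (intro PiE_fun_upd) (auto simp: tuples_def)
    moreover have "inj_on (v(x := a)) (insert x V)"
    proof -
      have "inj_on (v(x := a)) V" using v insert.hyps(2) by (simp add: tuples_def inj_on_fun_updI a(2))
      moreover have "(v(x := a)) ` (V - {x}) = v ` V" using insert.hyps(2) by (intro image_cong) auto
      ultimately show ?thesis using a(2) by (simp add: inj_on_insert)
    qed
    ultimately show "?g z \<in> tuples (insert x V) n" by (simp add: tuples_def z)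
  qed
  have le: "n - K \<le> card ({1..n} - v ` V)" if "v \<in> tuples V n" for v
  proof -
    have "card (v ` V) \<le> K" using card_image_le[OF insert.hyps(1), of v] insert.prems insert.hyps by simp
    then show ?thesis using diff_card_le_card_Diff[of "v ` V" "{1..n}"] insert.hyps(1) by simp
  qed
  have "(n - K) ^ card (insert x V) = (n - K) ^ card V * (n - K)" using insert.hyps by simp
  also have "\<dots> \<le> card (tuples V n) * (n - K)" using insert by (intro mult_right_mono insert.IH) auto
  also have "\<dots> = (\<Sum>v\<in>tuples V n. n - K)" by simp
  also have "\<dots> \<le> (\<Sum>v\<in>tuples V n. card ({1..n} - v ` V))" by (intro sum_mono le)
  also have "\<dots> = card ?S" using insert.hyps finite_tuples by (subst card_SigmaI) auto
  also have "\<dots> = card (?g ` ?S)" by (rule card_image[OF inj, symmetric])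
  also have "\<dots> \<le> card (tuples (insert x V) n)" using sub finite_tuples insert.hyps by (intro card_mono) auto
  finally show ?case .
qed

text \<open>Both counts are instances of this setting, so the probabilistic argument is carried out
  once; the optimization problem enters only through \<open>separating\<close>.\<close>

locale scale_free_pattern =
  fixes \<tau> c \<mu> :: real and p :: "nat pmf" and V :: "nat set" and E F :: "nat set set"
  assumes \<tau>: "2 < \<tau>" "\<tau> < 3" and c: "c > 0"
    and D_pos: "\<forall>d\<in>set_pmf p. d \<ge> 1"
    and D_tail: "(\<lambda>d. pmf p d) \<sim>[sequentially] (\<lambda>d. c * real d powr (-\<tau>))"
    and \<mu>_def: "\<mu> = measure_pmf.expectation p real"
    and V: "finite V" "V \<noteq> {}"
    and EF: "\<forall>e\<in>E \<union> F. card e = 2 \<and> e \<subseteq> V" "E \<inter> F = {}"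
    and sep: "separating V E \<tau> F"
begin

abbreviation "k \<equiv> card V"
abbreviation "degrees n \<equiv> Pi_pmf {1..n :: nat} 0 (\<lambda>_. p)"
abbreviation "s n \<equiv> sqrt (\<mu> * real n)"

definition win :: "real \<Rightarrow> nat \<Rightarrow> (nat \<Rightarrow> nat) \<Rightarrow> (nat \<Rightarrow> nat) set" where
  "win \<epsilon> n v = {d. \<forall>u\<in>v ` V. d u \<in> window \<epsilon> (s n)}"

definition window_prob :: "real \<Rightarrow> nat \<Rightarrow> real" where
  "window_prob \<epsilon> n = measure_pmf.prob p (window \<epsilon> (s n))"

definition phi :: "nat \<Rightarrow> (nat \<Rightarrow> nat) \<Rightarrow> (nat \<Rightarrow> nat) \<Rightarrow> real" where
  "phi n v d = edge_prod_limit (\<mu> * n) (d \<circ> v) E F"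

text \<open>Degrees are almost surely at least 1; having this in the event makes
  \<open>pattern_prob_upper_bound\<close> applicable to every member of it.\<close>

definition good :: "real \<Rightarrow> nat \<Rightarrow> (nat \<Rightarrow> nat) set" where
  "good \<rho> n = {d. (\<forall>v\<in>{1..n}. d v \<ge> 1) \<and> \<bar>real (\<Sum>v\<in>{1..n}. d v) - \<mu> * real n\<bar> \<le> \<rho> * real n}"

lemma finite_edges: "finite E" "finite F"
  using EF V by (auto intro!: finite_subset[of _ "Pow V"])

lemma EF_sub: "\<forall>e\<in>E \<union> F. e \<subseteq> V"
  using EF by blast

lemma pmf_0: "pmf p 0 = 0"
  using D_pos by (metis not_one_le_zero set_pmf_iff)

lemma integrable_degree: "integrable (measure_pmf p) real"
  using pmf_tail_bound[OF c D_tail] pmf_power_tail_integrable[OF \<tau>(1)] by blast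

lemma \<mu>_ge_1: "\<mu> \<ge> 1"
proof -
  have "measure_pmf.expectation p (\<lambda>_. 1) \<le> measure_pmf.expectation p real"
    using D_pos by (intro integral_mono_AE integrable_degree) (auto simp: AE_measure_pmf_iff)
  then show ?thesis by (simp add: \<mu>_def)
qed

lemma s_pos: "n \<ge> 1 \<Longrightarrow> s n > 0" and s_sq: "(s n)\<^sup>2 = \<mu> * real n"
  using \<mu>_ge_1 by auto

lemma k_pos: "k > 0" using V by (simp add: card_gt_0_iff)

lemma tuplesD:
  assumes "v \<in> tuples V n"
  shows "inj_on v V" "v ` V \<subseteq> {1..n}" "card (v ` V) = k" "v \<in> V \<rightarrow>\<^sub>E {1..n}"
  using assms by (auto simp: tuples_def card_image)

lemma prob_win:
  assumes "v \<in> tuples V n"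
  shows "measure_pmf.prob (degrees n) (win \<epsilon> n v) = window_prob \<epsilon> n ^ k"
  unfolding win_def window_prob_def
  using prob_Pi_pmf_subset[of "{1..n}" "v ` V" 0 p "\<lambda>_. window \<epsilon> (s n)"] tuplesD[OF assms] by simp

lemma prob_win_Int:
  assumes "v \<in> tuples V n" "w \<in> tuples V n"
  shows "measure_pmf.prob (degrees n) (win \<epsilon> n v \<inter> win \<epsilon> n w) = window_prob \<epsilon> n ^ card (v ` V \<union> w ` V)"
proof -
  have "win \<epsilon> n v \<inter> win \<epsilon> n w = {d. \<forall>u\<in>v ` V \<union> w ` V. d u \<in> window \<epsilon> (s n)}"
    by (auto simp: win_def)
  then show ?thesis unfolding window_prob_def
    using prob_Pi_pmf_subset[of "{1..n}" "v ` V \<union> w ` V" 0 p "\<lambda>_. window \<epsilon> (s n)"]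
      tuplesD(2)[OF assms(1)] tuplesD(2)[OF assms(2)] by simp
qed

text \<open>The event that the degree profile along the tuple is \<open>e\<close>, phrased vertex by
  vertex through \<open>inv_into\<close> so that \<open>prob_Pi_pmf_subset\<close> applies.\<close>

definition fibre :: "(nat \<Rightarrow> nat) \<Rightarrow> (nat \<Rightarrow> nat) \<Rightarrow> (nat \<Rightarrow> nat) set" where
  "fibre v e = {d. \<forall>u\<in>v ` V. d u \<in> {e (inv_into V v u)}}"

text \<open>Inside the window only finitely many degree profiles occur and \<open>phi\<close> is
  constant on each, so expectations of one or two such factors become finite sums of exact product
  probabilities.\<close>

lemma indicator_win_phi:
  assumes n: "n \<ge> 1" and v: "v \<in> tuples V n"
  shows "indicator (win \<epsilon> n v) d * phi n v d
     = (\<Sum>e\<in>V \<rightarrow>\<^sub>E window \<epsilon> (s n). edge_prod_limit ((s n)\<^sup>2) e E F * indicator (fibre v e) d)"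
proof -
  let ?W = "V \<rightarrow>\<^sub>E window \<epsilon> (s n)"
  let ?e = "restrict (d \<circ> v) V"
  have fin: "finite ?W" using V finite_window[OF s_pos[OF n]] by (intro finite_PiE) auto
  have inj: "inj_on v V" using tuplesD[OF v] by simp
  have fib: "d \<in> fibre v e \<longleftrightarrow> e = ?e" if "e \<in> ?W" for e
  proof -
    have "d \<in> fibre v e \<longleftrightarrow> (\<forall>i\<in>V. d (v i) = e i)"
      using inj by (simp add: fibre_def)
    also have "\<dots> \<longleftrightarrow> e = ?e"
    proof
      assume "\<forall>i\<in>V. d (v i) = e i"
      then show "e = ?e" using that by (intro ext) (auto simp: PiE_def extensional_def)
    next
      assume e: "e = ?e"
      show "\<forall>i\<in>V. d (v i) = e i" by (subst e) simp
    qed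
    finally show ?thesis .
  qed
  have win: "d \<in> win \<epsilon> n v \<longleftrightarrow> ?e \<in> ?W" by (auto simp: win_def)
  have "(\<Sum>e\<in>?W. edge_prod_limit ((s n)\<^sup>2) e E F * indicator (fibre v e) d)
      = (\<Sum>e\<in>?W. if e = ?e then edge_prod_limit ((s n)\<^sup>2) e E F else 0)"
    using fib by (intro sum.cong) (auto simp: indicator_def)
  also have "\<dots> = (if ?e \<in> ?W then edge_prod_limit ((s n)\<^sup>2) ?e E F else 0)"
    using fin by (simp add: sum.delta)
  also have "edge_prod_limit ((s n)\<^sup>2) ?e E F = phi n v d"
    unfolding phi_def s_sq by (rule edge_prod_limit_cong[OF EF_sub]) simp
  finally have S: "(\<Sum>e\<in>?W. edge_prod_limit ((s n)\<^sup>2) e E F * indicator (fibre v e) d)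
      = (if ?e \<in> ?W then phi n v d else 0)" .
  show ?thesis
    unfolding S win[symmetric] by (simp add: indicator_def)
qed

lemma prob_fibre:
  assumes "v \<in> tuples V n"
  shows "measure_pmf.prob (degrees n) (fibre v e) = (\<Prod>i\<in>V. pmf p (e i))"
proof -
  have "measure_pmf.prob (degrees n) (fibre v e) = (\<Prod>u\<in>v ` V. measure_pmf.prob p {e (inv_into V v u)})"
    unfolding fibre_def by (rule prob_Pi_pmf_subset) (use tuplesD[OF assms] in auto)
  also have "\<dots> = (\<Prod>i\<in>V. pmf p (e i))"
    using tuplesD(1)[OF assms] by (subst prod.reindex) (simp_all add: measure_pmf_single)
  finally show ?thesis .
qed

lemma prob_fibre_Int:
  assumes v: "v \<in> tuples V n" and w: "w \<in> tuples V n" and disj: "v ` V \<inter> w ` V = {}"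
  shows "measure_pmf.prob (degrees n) (fibre v e \<inter> fibre w e') = (\<Prod>i\<in>V. pmf p (e i)) * (\<Prod>i\<in>V. pmf p (e' i))"
proof -
  let ?B = "\<lambda>u. {if u \<in> v ` V then e (inv_into V v u) else e' (inv_into V w u)}"
  have "fibre v e \<inter> fibre w e' = {d. \<forall>u\<in>v ` V \<union> w ` V. d u \<in> ?B u}"
    using disj unfolding fibre_def by fastforce
  then have "measure_pmf.prob (degrees n) (fibre v e \<inter> fibre w e') = (\<Prod>u\<in>v ` V \<union> w ` V. measure_pmf.prob p (?B u))"
    using prob_Pi_pmf_subset[of "{1..n}" "v ` V \<union> w ` V" 0 p ?B] tuplesD(2)[OF v] tuplesD(2)[OF w] by simp
  also have "\<dots> = (\<Prod>u\<in>v ` V. measure_pmf.prob p (?B u)) * (\<Prod>u\<in>w ` V. measure_pmf.prob p (?B u))"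
    using V disj by (intro prod.union_disjoint) auto
  also have "(\<Prod>u\<in>v ` V. measure_pmf.prob p (?B u)) = (\<Prod>i\<in>V. pmf p (e i))"
    using tuplesD(1)[OF v] by (subst prod.reindex) (simp_all add: measure_pmf_single)
  also have "(\<Prod>u\<in>w ` V. measure_pmf.prob p (?B u)) = (\<Prod>u\<in>w ` V. measure_pmf.prob p {e' (inv_into V w u)})"
    using disj by (intro prod.cong) auto
  also have "\<dots> = (\<Prod>i\<in>V. pmf p (e' i))"
    using tuplesD(1)[OF w] by (subst prod.reindex) (simp_all add: measure_pmf_single)
  finally show ?thesis .
qed

lemma expectation_win_phi:
  assumes n: "n \<ge> 1" and v: "v \<in> tuples V n"
  shows "measure_pmf.expectation (degrees n) (\<lambda>d. indicator (win \<epsilon> n v) d * phi n v d) = box_sum p V E F \<epsilon> (s n)"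
proof -
  have "measure_pmf.expectation (degrees n) (\<lambda>d. indicator (win \<epsilon> n v) d * phi n v d)
    = (\<Sum>e\<in>V \<rightarrow>\<^sub>E window \<epsilon> (s n). edge_prod_limit ((s n)\<^sup>2) e E F * measure_pmf.prob (degrees n) (fibre v e))"
    unfolding indicator_win_phi[OF n v]
    by (simp only: Bochner_Integration.integral_sum[OF integrable_mult_indicator_pmf] expectation_mult_indicator_pmf)
  then show ?thesis unfolding box_sum_def prob_fibre[OF v] .
qed

lemma expectation_win_phi_product:
  assumes n: "n \<ge> 1" and v: "v \<in> tuples V n" and w: "w \<in> tuples V n" and disj: "v ` V \<inter> w ` V = {}"
  shows "measure_pmf.expectation (degrees n)
      (\<lambda>d. (indicator (win \<epsilon> n v) d * phi n v d) * (indicator (win \<epsilon> n w) d * phi n w d)) = (box_sum p V E F \<epsilon> (s n))\<^sup>2"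
proof -
  let ?W = "V \<rightarrow>\<^sub>E window \<epsilon> (s n)" and ?L = "\<lambda>e. edge_prod_limit ((s n)\<^sup>2) e E F"
  have eq: "(indicator (win \<epsilon> n v) d * phi n v d) * (indicator (win \<epsilon> n w) d * phi n w d)
      = (\<Sum>e\<in>?W. \<Sum>e'\<in>?W. (?L e * ?L e') * indicator (fibre v e \<inter> fibre w e') d)" for d
    unfolding indicator_win_phi[OF n v] indicator_win_phi[OF n w] sum_product
    by (intro sum.cong refl) (simp add: indicator_inter_arith mult_ac)
  have "measure_pmf.expectation (degrees n)
      (\<lambda>d. (indicator (win \<epsilon> n v) d * phi n v d) * (indicator (win \<epsilon> n w) d * phi n w d))
     = (\<Sum>e\<in>?W. \<Sum>e'\<in>?W. (?L e * ?L e') * measure_pmf.prob (degrees n) (fibre v e \<inter> fibre w e'))"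
    unfolding eq
    by (simp only: Bochner_Integration.integral_sum[OF Bochner_Integration.integrable_sum[OF integrable_mult_indicator_pmf]]
        Bochner_Integration.integral_sum[OF integrable_mult_indicator_pmf] expectation_mult_indicator_pmf)
  also have "\<dots> = (\<Sum>e\<in>?W. \<Sum>e'\<in>?W. (?L e * (\<Prod>i\<in>V. pmf p (e i))) * (?L e' * (\<Prod>i\<in>V. pmf p (e' i))))"
    unfolding prob_fibre_Int[OF v w disj] by (simp only: mult_ac)
  also have "\<dots> = (box_sum p V E F \<epsilon> (s n))\<^sup>2"
    unfolding box_sum_def power2_eq_square sum_product ..
  finally show ?thesis .
qed

lemma s_powr_le:
  assumes n: "n \<ge> 1"
  shows "s n powr (1 - \<tau>) \<le> real n powr ((1 - \<tau>) / 2)"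
proof -
  have "s n powr (1 - \<tau>) = (\<mu> * real n) powr ((1 - \<tau>) / 2)"
    using \<mu>_ge_1 by (simp add: powr_half_sqrt[symmetric] powr_powr)
  also have "\<dots> \<le> real n powr ((1 - \<tau>) / 2)"
    using \<mu>_ge_1 n \<tau> by (intro powr_mono2') auto
  finally show ?thesis .
qed

text \<open>The window has O(s) elements, each of mass O(s^(-\<tau>)), and s is of order sqrt
  n.\<close>

lemma window_prob_bound:
  assumes \<epsilon>: "\<epsilon> > 0"
  shows "\<exists>Q>0. \<forall>n\<ge>1. real n powr ((\<tau> - 1) / 2) * window_prob \<epsilon> n \<le> Q"
proof -
  obtain C where C: "C > 0" and pC: "\<forall>d\<ge>1. pmf p d \<le> C * real d powr (- \<tau>)"
    using pmf_tail_bound[OF c D_tail] by blast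
  let ?Q = "C * \<epsilon> powr (- \<tau>) * (1 / \<epsilon>)"
  show ?thesis
  proof (intro exI[of _ ?Q] conjI allI impI)
    show "?Q > 0" using C \<epsilon> by simp
    fix n :: nat assume n: "n \<ge> 1"
    have s0: "s n > 0" by (rule s_pos[OF n])
    let ?W = "window \<epsilon> (s n)"
    have each: "pmf p d \<le> C * (\<epsilon> powr (- \<tau>) * s n powr (- \<tau>))" if "d \<in> ?W" for d
    proof -
      have w: "\<epsilon> < real d / s n" using that by (simp add: window_def)
      then have "real d / s n > 0" using \<epsilon> by linarith
      then have d: "d \<ge> 1" using s0 by (simp add: zero_less_divide_iff)
      have "\<epsilon> * s n \<le> real d" using w s0 by (simp add: pos_less_divide_eq)
      then have "real d powr (- \<tau>) \<le> (\<epsilon> * s n) powr (- \<tau>)"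
        using \<epsilon> s0 \<tau> by (intro powr_mono2') auto
      also have "\<dots> = \<epsilon> powr (- \<tau>) * s n powr (- \<tau>)" by (rule powr_mult)
      finally have "C * real d powr (- \<tau>) \<le> C * (\<epsilon> powr (- \<tau>) * s n powr (- \<tau>))" using C by (intro mult_left_mono) auto
      then show ?thesis using pC d by force
    qed
    have "?W \<subseteq> {1..nat \<lfloor>s n / \<epsilon>\<rfloor>}"
    proof
      fix d assume d: "d \<in> ?W"
      then have w: "\<epsilon> < real d / s n" by (simp add: window_def)
      then have "real d / s n > 0" using \<epsilon> by linarith
      then have "d \<ge> 1" using s0 by (simp add: zero_less_divide_iff)
      moreover have "real d \<le> s n / \<epsilon>" using d s0 by (simp add: window_def pos_divide_le_eq)
      then have "d \<le> nat \<lfloor>s n / \<epsilon>\<rfloor>" by (rule le_nat_floor)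
      ultimately show "d \<in> {1..nat \<lfloor>s n / \<epsilon>\<rfloor>}" by simp
    qed
    then have "card ?W \<le> nat \<lfloor>s n / \<epsilon>\<rfloor>" using card_mono[of "{1..nat \<lfloor>s n / \<epsilon>\<rfloor>}" ?W] by simp
    moreover have "s n / \<epsilon> > 0" using s0 \<epsilon> by (rule divide_pos_pos)
    ultimately have cW: "real (card ?W) \<le> s n / \<epsilon>" by linarith
    have "window_prob \<epsilon> n = (\<Sum>d\<in>?W. pmf p d)"
      unfolding window_prob_def using finite_window[OF s0] by (rule measure_measure_pmf_finite)
    also have "\<dots> \<le> (\<Sum>d\<in>?W. C * (\<epsilon> powr (- \<tau>) * s n powr (- \<tau>)))" by (intro sum_mono each)
    also have "\<dots> = real (card ?W) * (C * (\<epsilon> powr (- \<tau>) * s n powr (- \<tau>)))" by simp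
    also have "\<dots> \<le> (s n / \<epsilon>) * (C * (\<epsilon> powr (- \<tau>) * s n powr (- \<tau>)))" using cW C by (intro mult_right_mono) auto
    also have "\<dots> = ?Q * (s n powr (- \<tau>) * s n)" by simp
    also have "s n powr (- \<tau>) * s n = s n powr (1 - \<tau>)"
    proof -
      have "s n powr (- \<tau>) * s n powr 1 = s n powr (- \<tau> + 1)" by (simp only: powr_add)
      also have "- \<tau> + 1 = 1 - \<tau>" by simp
      finally show ?thesis using s0 by simp
    qed
    finally have wp: "window_prob \<epsilon> n \<le> ?Q * s n powr (1 - \<tau>)" .
    have "s n powr (1 - \<tau>) \<le> real n powr ((1 - \<tau>) / 2)" by (rule s_powr_le[OF n])
    then have "?Q * s n powr (1 - \<tau>) \<le> ?Q * real n powr ((1 - \<tau>) / 2)"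
      using C \<epsilon> by (intro mult_left_mono) auto
    with wp have "window_prob \<epsilon> n \<le> ?Q * real n powr ((1 - \<tau>) / 2)" by linarith
    then have "real n powr ((\<tau> - 1) / 2) * window_prob \<epsilon> n \<le> real n powr ((\<tau> - 1) / 2) * (?Q * real n powr ((1 - \<tau>) / 2))"
      by (intro mult_left_mono) auto
    also have "\<dots> = ?Q * (real n powr ((\<tau> - 1) / 2) * real n powr ((1 - \<tau>) / 2))" by simp
    also have "real n powr ((\<tau> - 1) / 2) * real n powr ((1 - \<tau>) / 2) = 1"
    proof -
      have "real n powr ((\<tau> - 1) / 2) * real n powr ((1 - \<tau>) / 2) = real n powr ((\<tau> - 1) / 2 + (1 - \<tau>) / 2)"
        by (simp only: powr_add)
      also have "(\<tau> - 1) / 2 + (1 - \<tau>) / 2 = 0" by (simp add: field_simps)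
      finally show ?thesis using n by simp
    qed
    finally show "real n powr ((\<tau> - 1) / 2) * window_prob \<epsilon> n \<le> ?Q" by simp
  qed
qed

section \<open>Truncation of the degrees\<close>

lemma AE_degrees_pos: "AE d in measure_pmf (degrees n). \<forall>v\<in>{1..n}. d v \<ge> 1"
  unfolding AE_measure_pmf_iff
proof (intro ballI)
  fix d v assume "d \<in> set_pmf (degrees n)" "v \<in> {1..n}"
  then have "d v \<in> set_pmf p" using set_Pi_pmf[OF finite_atLeastAtMost, of 1 n 0 "\<lambda>_. p"] by (simp add: PiE_dflt_def)
  then show "d v \<ge> 1" using D_pos by blast
qed

lemma prob_not_good:
  assumes "\<rho> > 0" "\<beta> > 0"
  shows "\<exists>N. \<forall>n\<ge>N. measure_pmf.prob (degrees n) (- good \<rho> n) \<le> \<beta>"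
proof -
  obtain N where N: "\<And>A :: nat set. finite A \<Longrightarrow> card A \<ge> N \<Longrightarrow>
     measure_pmf.prob (Pi_pmf A 0 (\<lambda>_. p)) {d. \<bar>(\<Sum>i\<in>A. real (d i)) - \<mu> * card A\<bar> > \<rho> * card A} \<le> \<beta>"
    using weak_law_Pi_pmf[OF integrable_degree assms] unfolding \<mu>_def by blast
  have "measure_pmf.prob (degrees n) (- good \<rho> n) \<le> \<beta>" if n: "n \<ge> N" for n
  proof -
    have "measure_pmf.prob (degrees n) (- good \<rho> n) \<le>
       measure_pmf.prob (degrees n) {d. \<bar>(\<Sum>i\<in>{1..n}. real (d i)) - \<mu> * card {1..n}\<bar> > \<rho> * card {1..n}}"
    proof (rule measure_pmf.finite_measure_mono_AE)
      show "AE d in measure_pmf (degrees n). d \<in> - good \<rho> n \<longrightarrow> d \<in> {d. \<bar>(\<Sum>i\<in>{1..n}. real (d i)) - \<mu> * card {1..n}\<bar> > \<rho> * card {1..n}}"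
        using AE_degrees_pos[of n] by eventually_elim (simp add: good_def not_le)
    qed simp
    also have "\<dots> \<le> \<beta>" by (rule N) (use n in auto)
    finally show ?thesis .
  qed
  then show ?thesis by blast
qed

text \<open>A bound by \<beta> alone would be useless after summing over n^k tuples; the factor
  \<open>window_prob \<epsilon> n ^ k\<close> has to be retained. The degrees of the tuple
  contribute only O(sqrt n) to the total, so failure of \<open>good\<close> inside the window forces
  a deviation among the remaining vertices, whose degrees are independent of those of the
  tuple.\<close>

lemma prob_win_not_good:
  assumes \<rho>: "\<rho> > 0" and \<beta>: "\<beta> > 0" and \<epsilon>: "\<epsilon> > 0"
  shows "\<exists>N. \<forall>n\<ge>N. \<forall>v\<in>tuples V n. measure_pmf.prob (degrees n) (win \<epsilon> n v \<inter> - good \<rho> n) \<le> window_prob \<epsilon> n ^ k * \<beta>"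
proof -
  have \<rho>2: "\<rho> / 2 > 0" using \<rho> by simp
  obtain N where N: "\<And>A :: nat set. finite A \<Longrightarrow> card A \<ge> N \<Longrightarrow>
     measure_pmf.prob (Pi_pmf A 0 (\<lambda>_. p)) {d. \<bar>(\<Sum>i\<in>A. real (d i)) - \<mu> * card A\<bar> > \<rho> / 2 * card A} \<le> \<beta>"
    using weak_law_Pi_pmf[OF integrable_degree \<rho>2 \<beta>] unfolding \<mu>_def by blast
  have "(\<lambda>n. (k * (sqrt \<mu> / \<epsilon>)) / sqrt (real n) + (\<mu> * k) / real n) \<longlonglongrightarrow> 0 + 0"
    by (intro tendsto_add real_tendsto_divide_at_top[OF tendsto_const] filterlim_real_sequentially
        filterlim_compose[OF sqrt_at_top filterlim_real_sequentially])
  then have "\<forall>\<^sub>F n in sequentially. (k * (sqrt \<mu> / \<epsilon>)) / sqrt (real n) + (\<mu> * k) / real n < \<rho> / 2"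
    by (rule order_tendstoD(2)) (use \<rho> in simp)
  then obtain N' where N': "\<And>n. n \<ge> N' \<Longrightarrow> (k * (sqrt \<mu> / \<epsilon>)) / sqrt (real n) + (\<mu> * k) / real n < \<rho> / 2"
    by (auto simp: eventually_sequentially)
  show ?thesis
  \<comment> \<open>N + k because the law of large numbers is applied to the n - k other
    vertices.\<close>
  proof (intro exI[of _ "max (N + k) (max N' 1)"] allI impI ballI)
    fix n v assume n: "max (N + k) (max N' 1) \<le> n" and v: "v \<in> tuples V n"
    then have n1: "n \<ge> 1" by simp
    let ?A = "v ` V" let ?B = "{1..n} - ?A"
    have A: "?A \<subseteq> {1..n}" "card ?A = k" using tuplesD[OF v] by auto
    have cB: "card ?B = n - k" using A V by (simp add: card_Diff_subset)
    have kn: "k \<le> n" using n by simp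
    \<comment> \<open>The tuple's own degrees and the missing mean \<mu> k together use at most half
      of the tolerance.\<close>
    have small: "k * (s n / \<epsilon>) + \<mu> * k \<le> \<rho> / 2 * n"
    proof -
      have e1: "(k * (sqrt \<mu> / \<epsilon>)) / sqrt (real n) * n + (\<mu> * k) / real n * n \<le> \<rho> / 2 * n"
        unfolding distrib_right[symmetric] using N'[of n] n by (intro mult_right_mono) auto
      have e2: "(k * (sqrt \<mu> / \<epsilon>)) / sqrt (real n) * n = k * (s n / \<epsilon>)"
      proof -
        have "real n / sqrt (real n) = sqrt (real n)" by (simp add: real_div_sqrt)
        then have "(k * (sqrt \<mu> / \<epsilon>)) * (real n / sqrt (real n)) = k * (s n / \<epsilon>)"
          by (simp add: real_sqrt_mult)
        then show ?thesis by simp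
      qed
      have e3: "(\<mu> * k) / real n * n = \<mu> * k" using n1 by simp
      show ?thesis using e1 unfolding e2 e3 .
    qed
    let ?T = "{d. \<bar>(\<Sum>i\<in>?B. real (d i)) - \<mu> * card ?B\<bar> > \<rho> / 2 * card ?B}"
    have "measure_pmf.prob (degrees n) (win \<epsilon> n v \<inter> - good \<rho> n) \<le> measure_pmf.prob (degrees n) (win \<epsilon> n v \<inter> ?T)"
    proof (rule measure_pmf.finite_measure_mono_AE)
      show "AE d in measure_pmf (degrees n). d \<in> win \<epsilon> n v \<inter> - good \<rho> n \<longrightarrow> d \<in> win \<epsilon> n v \<inter> ?T"
        using AE_degrees_pos[of n]
      proof eventually_elim
        case (elim d)
        show ?case
        proof (intro impI IntI)
          assume d: "d \<in> win \<epsilon> n v \<inter> - good \<rho> n"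
          then show "d \<in> win \<epsilon> n v" by simp
          have big: "\<bar>(\<Sum>i\<in>{1..n}. real (d i)) - \<mu> * n\<bar> > \<rho> * n"
          proof -
            have "d \<notin> good \<rho> n" using d by simp
            then have "\<not> \<bar>real (\<Sum>v\<in>{1..n}. d v) - \<mu> * real n\<bar> \<le> \<rho> * real n"
              unfolding good_def using elim by blast
            then show ?thesis by simp
          qed
          have "(\<Sum>i\<in>{1..n}. real (d i)) = (\<Sum>i\<in>?B. real (d i)) + (\<Sum>i\<in>?A. real (d i))"
            using A(1) by (subst sum.subset_diff[of ?A]) auto
          moreover have "0 \<le> (\<Sum>i\<in>?A. real (d i))" by (intro sum_nonneg) auto
          moreover have "(\<Sum>i\<in>?A. real (d i)) \<le> k * (s n / \<epsilon>)"
          proof -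
            have "(\<Sum>i\<in>?A. real (d i)) \<le> (\<Sum>i\<in>?A. s n / \<epsilon>)"
            proof (rule sum_mono)
              fix i assume "i \<in> ?A"
              then have "d i \<in> window \<epsilon> (s n)" using d by (auto simp: win_def)
              then have "real (d i) / s n \<le> 1 / \<epsilon>" unfolding window_def by blast
              then show "real (d i) \<le> s n / \<epsilon>" using s_pos[OF n1] by (simp only: pos_divide_le_eq) simp
            qed
            then show ?thesis using A(2) by simp
          qed
          moreover have "\<mu> * n = \<mu> * card ?B + \<mu> * k"
            unfolding cB of_nat_diff[OF kn] by (simp add: algebra_simps)
          moreover have "0 \<le> \<mu> * k" using \<mu>_ge_1 by simp
          moreover have "\<rho> / 2 * card ?B \<le> \<rho> / 2 * n" unfolding cB using \<rho> by (intro mult_left_mono) auto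
          moreover have "\<rho> * n = \<rho> / 2 * n + \<rho> / 2 * n" by simp
          ultimately have "\<bar>(\<Sum>i\<in>?B. real (d i)) - \<mu> * card ?B\<bar> > \<rho> / 2 * card ?B"
            using big small by linarith
          then show "d \<in> ?T" by simp
        qed
      qed
    qed simp
    also have "\<dots> = measure_pmf.prob (Pi_pmf (?A \<union> ?B) 0 (\<lambda>_. p)) (win \<epsilon> n v \<inter> ?T)"
      using A(1) by (simp add: Un_absorb1)
    also have "\<dots> = measure_pmf.prob (Pi_pmf ?A 0 (\<lambda>_. p)) (win \<epsilon> n v) * measure_pmf.prob (Pi_pmf ?B 0 (\<lambda>_. p)) ?T"
    proof (rule prob_Pi_pmf_split)
      show "finite ?A" using V by simp
      show "d' \<in> win \<epsilon> n v" if "\<forall>u\<in>?A. d u = d' u" "d \<in> win \<epsilon> n v" for d d'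
        using that by (auto simp: win_def)
      show "d' \<in> ?T" if "\<forall>u\<in>?B. d u = d' u" "d \<in> ?T" for d d'
      proof -
        have "(\<Sum>i\<in>?B. real (d i)) = (\<Sum>i\<in>?B. real (d' i))" using that(1) by (intro sum.cong) auto
        then show ?thesis using that(2) by simp
      qed
    qed auto
    also have "measure_pmf.prob (Pi_pmf ?A 0 (\<lambda>_. p)) (win \<epsilon> n v) = window_prob \<epsilon> n ^ k"
      unfolding win_def window_prob_def
      using prob_Pi_pmf_subset[of ?A ?A 0 p "\<lambda>_. window \<epsilon> (s n)"] V A(2) by simp
    also have "window_prob \<epsilon> n ^ k * measure_pmf.prob (Pi_pmf ?B 0 (\<lambda>_. p)) ?T \<le> window_prob \<epsilon> n ^ k * \<beta>"
    proof (intro mult_left_mono)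
      show "measure_pmf.prob (Pi_pmf ?B 0 (\<lambda>_. p)) ?T \<le> \<beta>" by (rule N) (use cB n in auto)
    qed (simp add: window_prob_def)
    finally show "measure_pmf.prob (degrees n) (win \<epsilon> n v \<inter> - good \<rho> n) \<le> window_prob \<epsilon> n ^ k * \<beta>" .
  qed
qed

section \<open>Domination of pattern probabilities by a product over the vertices\<close>

lemma image_vertex_pairs:
  assumes "v \<in> tuples V n" "X \<subseteq> E \<union> F"
  shows "(`) v ` X \<subseteq> vertex_pairs n"
proof
  fix f assume "f \<in> (`) v ` X"
  then obtain e where e: "e \<in> E \<union> F" "f = v ` e" using assms(2) by auto
  then have "card e = 2" "e \<subseteq> V" using EF by blast+
  moreover have "inj_on v e" using tuplesD(1)[OF assms(1)] \<open>e \<subseteq> V\<close> inj_on_subset by blast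
  ultimately show "f \<in> vertex_pairs n"
    using tuplesD(2)[OF assms(1)] unfolding vertex_pairs_def e(2) by (auto simp: card_image)
qed

lemma min_scale_le:
  fixes y :: real
  assumes "y \<ge> 0" "a \<ge> 1"
  shows "min 1 (a * y) \<le> a * min 1 y"
proof (cases "y \<le> 1")
  case True
  then show ?thesis by simp
next
  case False
  then show ?thesis using assms by (simp add: min.coboundedI1)
qed

text \<open>This combines \<open>pattern_prob_upper_bound\<close>, applicable because
  \<open>good \<mu> n\<close> caps the total degree at 2 \<mu> n, with
  \<open>pattern_product_dominated\<close>. Passing from the scale n to \<mu> n costs a factor \<mu>
  per required edge and only helps in the exponentials, as \<mu> \<ge> 1.\<close>

lemma pattern_prob_dominated:
  "\<exists>\<delta>>0. \<exists>C>0. \<exists>N. \<forall>n\<ge>N. \<forall>v\<in>tuples V n. \<forall>d\<in>good \<mu> n.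
     pattern_prob n d ((`) v ` E) ((`) v ` F) \<le> C * (\<Prod>i\<in>V. log_weight \<tau> \<delta> (real (d (v i)) / s n))"
proof -
  let ?K = "card E + card F"
  have "\<mu> > 0" using \<mu>_ge_1 by simp
  then obtain C \<kappa> where C: "C > 0" and \<kappa>: "\<kappa> > 0" and ub: "\<And>n d E F. 4 * ?K \<le> n \<Longrightarrow> n \<ge> 1 \<Longrightarrow> (\<forall>v\<in>{1..n}. d v \<ge> 1) \<Longrightarrow>
     real (\<Sum>v\<in>{1..n}. d v) \<le> (2 * \<mu>) * n \<Longrightarrow>
     E \<subseteq> vertex_pairs n \<Longrightarrow> F \<subseteq> vertex_pairs n \<Longrightarrow> card E \<le> ?K \<Longrightarrow> card F \<le> ?K \<Longrightarrow>
     pattern_prob n d E F \<le> C * (\<Prod>e\<in>E. min 1 (edge_weight d e / n)) * (\<Prod>e\<in>F. exp (- \<kappa> * (edge_weight d e / n)))"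
    using pattern_prob_upper_bound[of "2 * \<mu>" ?K] by auto
  have \<tau>1: "\<tau> > 1" using \<tau> by simp
  obtain \<delta> where \<delta>: "\<delta> > 0" and dom: "\<forall>\<kappa>>0. \<exists>C>0. \<forall>x. (\<forall>i\<in>V. x i > 0) \<longrightarrow>
    (\<Prod>e\<in>E. min 1 (\<Prod>i\<in>e. x i)) * (\<Prod>e\<in>F. exp (- \<kappa> * (\<Prod>i\<in>e. x i))) \<le> C * (\<Prod>i\<in>V. log_weight \<tau> \<delta> (x i))"
    using pattern_product_dominated[OF EF(1) V(1) \<tau>1 sep] by blast
  obtain C2 where C2: "C2 > 0" and dom: "\<And>x. (\<forall>i\<in>V. x i > 0) \<Longrightarrow>
    (\<Prod>e\<in>E. min 1 (\<Prod>i\<in>e. x i)) * (\<Prod>e\<in>F. exp (- \<kappa> * (\<Prod>i\<in>e. x i))) \<le> C2 * (\<Prod>i\<in>V. log_weight \<tau> \<delta> (x i))"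
    using dom[rule_format, OF \<kappa>] by blast
  let ?C = "C * \<mu> ^ card E * C2"
  have bound: "pattern_prob n d ((`) v ` E) ((`) v ` F) \<le> ?C * (\<Prod>i\<in>V. log_weight \<tau> \<delta> (real (d (v i)) / s n))"
    if n: "n \<ge> max (4 * ?K) 1" and v: "v \<in> tuples V n" and d: "d \<in> good \<mu> n" for n v d
  proof -
    have n1: "n \<ge> 1" using n by simp
    let ?x = "\<lambda>i. real (d (v i)) / s n"
    have d1: "\<forall>u\<in>{1..n}. d u \<ge> 1" using d unfolding good_def by blast
    have "\<bar>real (\<Sum>v\<in>{1..n}. d v) - \<mu> * real n\<bar> \<le> \<mu> * real n" using d unfolding good_def by blast
    then have sum: "real (\<Sum>v\<in>{1..n}. d v) \<le> (2 * \<mu>) * n" by linarith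
    have x: "\<forall>i\<in>V. ?x i > 0"
    proof
      fix i assume "i \<in> V"
      then have "v i \<in> {1..n}" using tuplesD(2)[OF v] by blast
      then have "d (v i) \<ge> 1" using d1 by blast
      then show "?x i > 0" using s_pos[OF n1] by simp
    qed
    have w: "edge_weight d (v ` e) / n = \<mu> * (\<Prod>i\<in>e. ?x i)" "0 \<le> (\<Prod>i\<in>e. ?x i)" if "e \<in> E \<union> F" for e
    proof -
      have e: "card e = 2" "e \<subseteq> V" using EF that by blast+
      then have inj: "inj_on v e" using tuplesD(1)[OF v] inj_on_subset by blast
      have "edge_weight d (v ` e) = edge_weight (d \<circ> v) e"
        unfolding edge_weight_def using inj by (subst prod.reindex) (simp_all add: o_def)
      also have "edge_weight (d \<circ> v) e = (\<mu> * real n) * (\<Prod>i\<in>e. ?x i)"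
        using edge_weight_scaled[OF e(1) s_pos[OF n1], of "d \<circ> v"] n1 \<mu>_ge_1 unfolding s_sq by (simp add: field_simps)
      finally show "edge_weight d (v ` e) / n = \<mu> * (\<Prod>i\<in>e. ?x i)" using n1 by simp
      show "0 \<le> (\<Prod>i\<in>e. ?x i)" using e(2) x by (intro prod_nonneg) (meson less_imp_le subsetD)
    qed
    have inj: "inj_on ((`) v) (E \<union> F)"
      by (rule inj_on_subset[OF inj_on_image_Pow[OF tuplesD(1)[OF v]]]) (use EF_sub in blast)
    then have injE: "inj_on ((`) v) E" "inj_on ((`) v) F" by (auto intro: inj_on_subset)
    have "pattern_prob n d ((`) v ` E) ((`) v ` F) \<le>
       C * (\<Prod>e\<in>(`) v ` E. min 1 (edge_weight d e / n)) * (\<Prod>e\<in>(`) v ` F. exp (- \<kappa> * (edge_weight d e / n)))"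
      using n d1 sum image_vertex_pairs[OF v] card_image_le[OF finite_edges(1), of "(`) v"] card_image_le[OF finite_edges(2), of "(`) v"]
      by (intro ub) auto
    also have "(\<Prod>e\<in>(`) v ` E. min 1 (edge_weight d e / n)) = (\<Prod>e\<in>E. min 1 (\<mu> * (\<Prod>i\<in>e. ?x i)))"
      using injE w by (simp add: prod.reindex)
    also have "(\<Prod>e\<in>(`) v ` F. exp (- \<kappa> * (edge_weight d e / n))) = (\<Prod>e\<in>F. exp (- \<kappa> * (\<mu> * (\<Prod>i\<in>e. ?x i))))"
      unfolding prod.reindex[OF injE(2)] o_def
    proof (intro prod.cong refl)
      fix e assume "e \<in> F"
      then have e: "e \<in> E \<union> F" by blast
      show "exp (- \<kappa> * (edge_weight d (v ` e) / n)) = exp (- \<kappa> * (\<mu> * (\<Prod>i\<in>e. ?x i)))"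
        unfolding w(1)[OF e] ..
    qed
    also have "C * (\<Prod>e\<in>E. min 1 (\<mu> * (\<Prod>i\<in>e. ?x i))) * (\<Prod>e\<in>F. exp (- \<kappa> * (\<mu> * (\<Prod>i\<in>e. ?x i))))
       \<le> C * (\<mu> ^ card E * (\<Prod>e\<in>E. min 1 (\<Prod>i\<in>e. ?x i))) * (\<Prod>e\<in>F. exp (- \<kappa> * (\<Prod>i\<in>e. ?x i)))"
    proof (intro mult_mono mult_left_mono)
      have "(\<Prod>e\<in>E. min 1 (\<mu> * (\<Prod>i\<in>e. ?x i))) \<le> (\<Prod>e\<in>E. \<mu> * min 1 (\<Prod>i\<in>e. ?x i))"
      proof (intro prod_mono conjI)
        fix e assume "e \<in> E"
        then have y: "0 \<le> (\<Prod>i\<in>e. ?x i)" using w(2) by blast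
        then show "0 \<le> min 1 (\<mu> * (\<Prod>i\<in>e. ?x i))" using \<mu>_ge_1 by simp
        show "min 1 (\<mu> * (\<Prod>i\<in>e. ?x i)) \<le> \<mu> * min 1 (\<Prod>i\<in>e. ?x i)" by (rule min_scale_le[OF y \<mu>_ge_1])
      qed
      then show "(\<Prod>e\<in>E. min 1 (\<mu> * (\<Prod>i\<in>e. ?x i))) \<le> \<mu> ^ card E * (\<Prod>e\<in>E. min 1 (\<Prod>i\<in>e. ?x i))"
        by (simp add: prod.distrib)
      show "(\<Prod>e\<in>F. exp (- \<kappa> * (\<mu> * (\<Prod>i\<in>e. ?x i)))) \<le> (\<Prod>e\<in>F. exp (- \<kappa> * (\<Prod>i\<in>e. ?x i)))"
      proof (intro prod_mono conjI)
        fix e assume "e \<in> F"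
        then have y: "0 \<le> (\<Prod>i\<in>e. ?x i)" using w(2) by blast
        then have "1 * (\<Prod>i\<in>e. ?x i) \<le> \<mu> * (\<Prod>i\<in>e. ?x i)" using \<mu>_ge_1 by (intro mult_right_mono) auto
        then show "exp (- \<kappa> * (\<mu> * (\<Prod>i\<in>e. ?x i))) \<le> exp (- \<kappa> * (\<Prod>i\<in>e. ?x i))" using \<kappa> by simp
      qed auto
      show "0 \<le> C * (\<mu> ^ card E * (\<Prod>e\<in>E. min 1 (\<Prod>i\<in>e. ?x i)))"
        using C \<mu>_ge_1 w(2) by (intro mult_nonneg_nonneg prod_nonneg) auto
    qed (use C w(2) \<mu>_ge_1 in \<open>auto intro!: prod_nonneg mult_nonneg_nonneg\<close>)
    also have "\<dots> = (C * \<mu> ^ card E) * ((\<Prod>e\<in>E. min 1 (\<Prod>i\<in>e. ?x i)) * (\<Prod>e\<in>F. exp (- \<kappa> * (\<Prod>i\<in>e. ?x i))))"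
      by (simp only: mult_ac)
    also have "\<dots> \<le> (C * \<mu> ^ card E) * (C2 * (\<Prod>i\<in>V. log_weight \<tau> \<delta> (?x i)))"
      using C \<mu>_ge_1 by (intro mult_left_mono dom[OF x]) auto
    finally show ?thesis by (simp only: mult.assoc)
  qed
  have C3: "?C > 0" using C C2 \<mu>_ge_1 by simp
  show ?thesis
    by (rule exI[of _ \<delta>], rule conjI[OF \<delta>], rule exI[of _ ?C], rule conjI[OF C3],
        rule exI[of _ "max (4 * ?K) 1"]) (use bound in blast)
qed

end

lemma prod_mono_ennreal:
  fixes f g :: "'a \<Rightarrow> ennreal"
  assumes "\<And>i. i \<in> A \<Longrightarrow> f i \<le> g i"
  shows "prod f A \<le> prod g A"
  using assms by (induction A rule: infinite_finite_induct) (auto intro!: mult_mono)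

context scale_free_pattern
begin

text \<open>Union bound over the coordinate that leaves the window. Its factor becomes a tail
  integral, which vanishes as m grows; the other factors are full integrals, and each coordinate
  brings the power s^(1 - \<tau>).\<close>

lemma outside_probability_bound:
  "\<exists>t N. t \<longlonglongrightarrow> 0 \<and> (\<forall>m. \<forall>n\<ge>N. \<forall>v\<in>tuples V n. n \<ge> 1 \<longrightarrow>
     measure_pmf.prob (joint_law p n) {(d, G). d \<in> good \<mu> n - win (1 / real (m + 2)) n v \<and> (`) v ` E \<subseteq> G \<and> (`) v ` F \<inter> G = {}}
       \<le> t m * (s n powr (1 - \<tau>)) ^ k)"
proof -
  obtain \<delta> C N where \<delta>: "\<delta> > 0" and C: "C > 0" and dom: "\<And>n v d. n \<ge> N \<Longrightarrow> v \<in> tuples V n \<Longrightarrow> d \<in> good \<mu> n \<Longrightarrow>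
     pattern_prob n d ((`) v ` E) ((`) v ` F) \<le> C * (\<Prod>i\<in>V. log_weight \<tau> \<delta> (real (d (v i)) / s n))"
    using pattern_prob_dominated by blast
  obtain Cp where Cp: "Cp > 0" and pC: "\<forall>d\<ge>1. pmf p d \<le> Cp * real d powr (- \<tau>)"
    using pmf_tail_bound[OF c D_tail] by blast
  define c2 where "c2 = 2 * exp (\<delta> * ln 2)"
  have c2: "c2 > 0" by (simp add: c2_def)
  let ?I = "\<integral>\<^sup>+y. ennreal (log_kernel \<delta> y) \<partial>lborel"
  define B where "B m = {y :: real. y \<le> 2 / real (m + 2) \<or> y > real (m + 2)}" for m
  define tl where "tl m = (\<integral>\<^sup>+y. ennreal (log_kernel \<delta> y) * indicator (B m) y \<partial>lborel)" for m
  have I_fin: "?I < \<infinity>" by (rule nn_integral_log_kernel_finite[OF \<delta>])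
  have tl_le: "tl m \<le> ?I" for m unfolding tl_def by (intro nn_integral_mono) (auto split: split_indicator)
  define Ir where "Ir = enn2real ?I"
  define tr where "tr m = enn2real (tl m)" for m
  have Ir: "?I = ennreal Ir" "Ir \<ge> 0" using I_fin by (simp_all add: Ir_def)
  have tr: "tl m = ennreal (tr m)" "tr m \<ge> 0" for m
    using order.strict_trans1[OF tl_le I_fin] by (simp_all add: tr_def)
  have "tl \<longlonglongrightarrow> 0" unfolding tl_def B_def by (rule nn_integral_log_kernel_tail[OF \<delta>])
  then have "tl \<longlonglongrightarrow> ennreal 0" by simp
  then have "(\<lambda>m. enn2real (tl m)) \<longlonglongrightarrow> 0" by (rule tendsto_enn2real) simp
  then have tr_lim: "tr \<longlonglongrightarrow> 0" unfolding tr_def .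
  \<comment> \<open>The number of choices for the outlying coordinate, times one tail factor, times
    k - 1 full factors.\<close>
  define t where "t m = real k * (C * (Cp * (c2 * tr m)) * (Cp * (c2 * Ir)) ^ (k - 1))" for m
  have t_lim: "t \<longlonglongrightarrow> 0"
  proof -
    have "t \<longlonglongrightarrow> real k * (C * (Cp * (c2 * 0)) * (Cp * (c2 * Ir)) ^ (k - 1))"
      unfolding t_def by (intro tendsto_intros tr_lim)
    then show ?thesis by simp
  qed
  have main: "measure_pmf.prob (joint_law p n) {(d, G). d \<in> good \<mu> n - win (1 / real (m + 2)) n v \<and> (`) v ` E \<subseteq> G \<and> (`) v ` F \<inter> G = {}}
       \<le> t m * (s n powr (1 - \<tau>)) ^ k"
    if n: "n \<ge> N" and n1: "n \<ge> 1" and v: "v \<in> tuples V n" for m n v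
  proof -
    let ?\<epsilon> = "1 / real (m + 2)"
    let ?S = "good \<mu> n - win ?\<epsilon> n v"
    let ?pp = "\<lambda>d. pattern_prob n d ((`) v ` E) ((`) v ` F)"
    define Out where "Out = {x :: real. \<not> (?\<epsilon> < x \<and> x \<le> 1 / ?\<epsilon>)}"
    \<comment> \<open>The restriction to values outside the window is attached to the single vertex
      of the outlying coordinate, so the product over vertices still factorizes.\<close>
    define f where "f i0 u x = ennreal (log_weight \<tau> \<delta> (real x / s n)) * indicator (if u = v i0 then Out else UNIV) (real x / s n)"
      for i0 u :: nat and x :: nat
    have s0: "s n > 0" by (rule s_pos[OF n1])
    have inj: "inj_on v V" by (rule tuplesD(1)[OF v])
    let ?a = "Cp * s n powr (1 - \<tau>)"
    have a0: "?a > 0"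
    proof (intro mult_pos_pos Cp)
      show "s n powr (1 - \<tau>) > 0" using s0 by (metis powr_gt_zero less_irrefl)
    qed
    have int_f: "(\<integral>\<^sup>+x. f i0 u x \<partial>measure_pmf p) \<le> (if u = v i0 then ennreal (?a * (c2 * tr m)) else ennreal (?a * (c2 * Ir)))" for i0 u
    proof (cases "u = v i0")
      case True
      have "(\<integral>\<^sup>+x. f i0 u x \<partial>measure_pmf p) = (\<integral>\<^sup>+x. ennreal (log_weight \<tau> \<delta> (real x / s n)) * indicator Out (real x / s n) \<partial>measure_pmf p)"
        using True by (simp add: f_def)
      also have "\<dots> \<le> ennreal ?a * (ennreal (2 * exp (\<delta> * ln 2)) * (\<integral>\<^sup>+y. ennreal (log_kernel \<delta> y) * indicator (B m) y \<partial>lborel))"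
      proof (rule nn_integral_log_weight_le[OF \<delta> s0 _ Cp pmf_0 pC])
        show "B m \<in> sets borel" unfolding B_def by measurable
        fix d :: nat and y assume d: "d \<ge> 1" "real d / s n \<in> Out" and y: "real d / s n \<le> y" "y < (real d + 1) / s n"
        have "real d / s n \<le> ?\<epsilon> \<or> real d / s n > real (m + 2)" using d(2) by (auto simp: Out_def)
        moreover have "(real d + 1) / s n \<le> 2 * (real d / s n)" using d(1) s0 by (simp add: divide_right_mono)
        ultimately have "y \<le> 2 * ?\<epsilon> \<or> y > real (m + 2)" using y by linarith
        then show "y \<in> B m" unfolding B_def by simp
      qed
      also have "\<dots> = ennreal (?a * (c2 * tr m))"
        unfolding tl_def[symmetric] tr(1) c2_def[symmetric] using a0 c2 tr(2) by (simp add: ennreal_mult)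
      finally show ?thesis using True by simp
    next
      case False
      have "(\<integral>\<^sup>+x. f i0 u x \<partial>measure_pmf p) = (\<integral>\<^sup>+x. ennreal (log_weight \<tau> \<delta> (real x / s n)) * indicator UNIV (real x / s n) \<partial>measure_pmf p)"
        using False by (simp add: f_def)
      also have "\<dots> \<le> ennreal ?a * (ennreal (2 * exp (\<delta> * ln 2)) * (\<integral>\<^sup>+y. ennreal (log_kernel \<delta> y) * indicator UNIV y \<partial>lborel))"
        by (rule nn_integral_log_weight_le[OF \<delta> s0 _ Cp pmf_0 pC]) auto
      also have "\<dots> = ennreal (?a * (c2 * Ir))"
        unfolding c2_def[symmetric] using a0 c2 Ir by (simp add: ennreal_mult)
      finally show ?thesis using False by simp
    qed
    have pointwise: "ennreal (indicator ?S d * ?pp d) \<le> (\<Sum>i0\<in>V. ennreal C * (\<Prod>u\<in>v ` V. f i0 u (d u)))" for d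
    proof (cases "d \<in> ?S")
      case True
      then obtain i0 where i0: "i0 \<in> V" "d (v i0) \<notin> window ?\<epsilon> (s n)" by (auto simp: win_def)
      then have out: "real (d (v i0)) / s n \<in> Out" unfolding window_def Out_def by blast
      have "ennreal (indicator ?S d * ?pp d) \<le> ennreal (C * (\<Prod>i\<in>V. log_weight \<tau> \<delta> (real (d (v i)) / s n)))"
        using dom[OF n v, of d] True by (simp add: ennreal_leI)
      also have "\<dots> = ennreal C * (\<Prod>i\<in>V. ennreal (log_weight \<tau> \<delta> (real (d (v i)) / s n)))"
      proof -
        have "log_weight \<tau> \<delta> x \<ge> 0" for x by (simp add: log_weight_def)
        then show ?thesis using C by (simp add: ennreal_mult' prod_ennreal)
      qed
      also have "(\<Prod>i\<in>V. ennreal (log_weight \<tau> \<delta> (real (d (v i)) / s n))) = (\<Prod>i\<in>V. f i0 (v i) (d (v i)))"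
      proof (intro prod.cong refl)
        fix i assume i: "i \<in> V"
        show "ennreal (log_weight \<tau> \<delta> (real (d (v i)) / s n)) = f i0 (v i) (d (v i))"
        proof (cases "v i = v i0")
          case True
          then show ?thesis using out by (simp add: f_def)
        qed (simp add: f_def)
      qed
      also have "\<dots> = (\<Prod>u\<in>v ` V. f i0 u (d u))" using inj by (simp add: prod.reindex)
      also have "ennreal C * \<dots> = (\<Sum>i0\<in>{i0}. ennreal C * (\<Prod>u\<in>v ` V. f i0 u (d u)))" by simp
      also have "\<dots> \<le> (\<Sum>i0\<in>V. ennreal C * (\<Prod>u\<in>v ` V. f i0 u (d u)))"
        using V i0 by (intro sum_mono2) auto
      finally show ?thesis .
    qed simp
    have "ennreal (measure_pmf.prob (joint_law p n) {(d, G). d \<in> ?S \<and> (`) v ` E \<subseteq> G \<and> (`) v ` F \<inter> G = {}})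
       = (\<integral>\<^sup>+d. ennreal (indicator ?S d * ?pp d) \<partial>measure_pmf (degrees n))"
      unfolding joint_law_prob
    proof (rule nn_integral_eq_integral[symmetric])
      show "integrable (measure_pmf (degrees n)) (\<lambda>d. indicator ?S d * ?pp d)"
        using pattern_prob_bounds[of n]
        by (intro measure_pmf.integrable_const_bound[where B = 1]) (auto simp: indicator_def)
    qed (use pattern_prob_bounds(1) in \<open>auto simp: indicator_def\<close>)
    also have "\<dots> \<le> (\<integral>\<^sup>+d. (\<Sum>i0\<in>V. ennreal C * (\<Prod>u\<in>v ` V. f i0 u (d u))) \<partial>measure_pmf (degrees n))"
      by (intro nn_integral_mono pointwise)
    also have "\<dots> = (\<Sum>i0\<in>V. \<integral>\<^sup>+d. ennreal C * (\<Prod>u\<in>v ` V. f i0 u (d u)) \<partial>measure_pmf (degrees n))"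
      by (rule nn_integral_sum) simp
    also have "\<dots> = (\<Sum>i0\<in>V. ennreal C * (\<Prod>u\<in>v ` V. \<integral>\<^sup>+x. f i0 u x \<partial>measure_pmf p))"
    proof (intro sum.cong refl)
      fix i0
      show "(\<integral>\<^sup>+d. ennreal C * (\<Prod>u\<in>v ` V. f i0 u (d u)) \<partial>measure_pmf (degrees n)) = ennreal C * (\<Prod>u\<in>v ` V. \<integral>\<^sup>+x. f i0 u x \<partial>measure_pmf p)"
        using nn_integral_Pi_pmf_subset[where A = "{1..n}" and U = "v ` V" and f = "f i0" and dflt = 0 and p = p] tuplesD(2)[OF v] by (simp add: nn_integral_cmult)
    qed
    also have "\<dots> \<le> (\<Sum>i0\<in>V. ennreal (C * (?a * (c2 * tr m)) * (?a * (c2 * Ir)) ^ (k - 1)))"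
    proof (rule sum_mono)
      fix i0 assume i0: "i0 \<in> V"
      have "(\<Prod>u\<in>v ` V. \<integral>\<^sup>+x. f i0 u x \<partial>measure_pmf p)
         \<le> (\<Prod>u\<in>v ` V. if u = v i0 then ennreal (?a * (c2 * tr m)) else ennreal (?a * (c2 * Ir)))"
        by (intro prod_mono_ennreal int_f)
      also have "\<dots> = ennreal (?a * (c2 * tr m)) * (\<Prod>u\<in>v ` V - {v i0}. if u = v i0 then ennreal (?a * (c2 * tr m)) else ennreal (?a * (c2 * Ir)))"
        using V i0 by (subst prod.remove[of _ "v i0"]) auto
      also have "(\<Prod>u\<in>v ` V - {v i0}. if u = v i0 then ennreal (?a * (c2 * tr m)) else ennreal (?a * (c2 * Ir)))
         = (\<Prod>u\<in>v ` V - {v i0}. ennreal (?a * (c2 * Ir)))"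
        by (intro prod.cong) auto
      also have "\<dots> = ennreal ((?a * (c2 * Ir)) ^ (k - 1))"
      proof -
        have "card (v ` V - {v i0}) = k - 1" using V i0 tuplesD(3)[OF v] by simp
        then show ?thesis using a0 c2 Ir(2) by (simp add: ennreal_power)
      qed
      finally have "ennreal C * (\<Prod>u\<in>v ` V. \<integral>\<^sup>+x. f i0 u x \<partial>measure_pmf p)
         \<le> ennreal C * (ennreal (?a * (c2 * tr m)) * ennreal ((?a * (c2 * Ir)) ^ (k - 1)))"
        by (intro mult_left_mono) auto
      also have "\<dots> = ennreal (C * (?a * (c2 * tr m)) * (?a * (c2 * Ir)) ^ (k - 1))"
      proof -
        have "ennreal C * (ennreal X * ennreal Y) = ennreal (C * X * Y)" if "X \<ge> 0" "Y \<ge> 0" for X Y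
          using C that by (simp add: ennreal_mult mult.assoc)
        moreover have "?a * (c2 * tr m) \<ge> 0" "(?a * (c2 * Ir)) ^ (k - 1) \<ge> 0"
          using a0 c2 tr(2) Ir(2) by (auto intro!: mult_nonneg_nonneg zero_le_power simp: less_imp_le)
        ultimately show ?thesis by blast
      qed
      finally show "ennreal C * (\<Prod>u\<in>v ` V. \<integral>\<^sup>+x. f i0 u x \<partial>measure_pmf p)
         \<le> ennreal (C * (?a * (c2 * tr m)) * (?a * (c2 * Ir)) ^ (k - 1))" .
    qed
    also have "\<dots> = ennreal (\<Sum>i0\<in>V. C * (?a * (c2 * tr m)) * (?a * (c2 * Ir)) ^ (k - 1))"
      using C Cp c2 tr(2) Ir(2) by (intro sum_ennreal mult_nonneg_nonneg zero_le_power) auto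
    also have "(\<Sum>i0\<in>V. C * (?a * (c2 * tr m)) * (?a * (c2 * Ir)) ^ (k - 1)) = t m * (s n powr (1 - \<tau>)) ^ k"
    proof -
      obtain j where j: "k = Suc j" using k_pos by (metis gr0_implies_Suc)
      have "(?a * (c2 * Ir)) ^ j = (Cp * (c2 * Ir)) ^ j * (s n powr (1 - \<tau>)) ^ j"
        by (simp add: power_mult_distrib)
      then show ?thesis by (simp add: t_def j)
    qed
    finally show ?thesis
    proof (rule ennreal_le_iff[THEN iffD1, rotated])
      have "0 \<le> t m" unfolding t_def using C Cp c2 tr(2) Ir(2) by (intro mult_nonneg_nonneg zero_le_power) auto
      then show "0 \<le> t m * (s n powr (1 - \<tau>)) ^ k" by simp
    qed
  qed
  show ?thesis
    by (rule exI[of _ t], rule exI[of _ N]) (use t_lim main in blast)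
qed

text \<open>There are at most n^k tuples, and n n^((1 - \<tau>)/2) = n^((3 - \<tau>)/2), so the sum
  is on the scale of the normalization.\<close>

lemma outside_first_moment:
  "\<exists>t N. t \<longlonglongrightarrow> 0 \<and> (\<forall>m. \<forall>n\<ge>N. n \<ge> 1 \<longrightarrow> (\<Sum>v\<in>tuples V n.
     measure_pmf.prob (joint_law p n) {(d, G). d \<in> good \<mu> n - win (1 / real (m + 2)) n v \<and> (`) v ` E \<subseteq> G \<and> (`) v ` F \<inter> G = {}})
       \<le> t m * (real n powr ((3 - \<tau>) / 2)) ^ k)"
proof -
  obtain t N where t: "t \<longlonglongrightarrow> 0" and bound: "\<And>m n v. n \<ge> N \<Longrightarrow> n \<ge> 1 \<Longrightarrow> v \<in> tuples V n \<Longrightarrow>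
     measure_pmf.prob (joint_law p n) {(d, G). d \<in> good \<mu> n - win (1 / real (m + 2)) n v \<and> (`) v ` E \<subseteq> G \<and> (`) v ` F \<inter> G = {}}
       \<le> t m * (s n powr (1 - \<tau>)) ^ k"
    using outside_probability_bound by blast
  \<comment> \<open>The sign of \<open>t\<close> is not recorded, hence the absolute value before
    summing over tuples.\<close>
  have "(\<Sum>v\<in>tuples V n.
     measure_pmf.prob (joint_law p n) {(d, G). d \<in> good \<mu> n - win (1 / real (m + 2)) n v \<and> (`) v ` E \<subseteq> G \<and> (`) v ` F \<inter> G = {}})
       \<le> \<bar>t m\<bar> * (real n powr ((3 - \<tau>) / 2)) ^ k" if n: "n \<ge> N" "n \<ge> 1" for m n
  proof -
    have "(\<Sum>v\<in>tuples V n.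
     measure_pmf.prob (joint_law p n) {(d, G). d \<in> good \<mu> n - win (1 / real (m + 2)) n v \<and> (`) v ` E \<subseteq> G \<and> (`) v ` F \<inter> G = {}})
      \<le> (\<Sum>v\<in>tuples V n. \<bar>t m\<bar> * (s n powr (1 - \<tau>)) ^ k)"
    proof (rule sum_mono)
      fix v assume "v \<in> tuples V n"
      from bound[OF n this, of m]
      show "measure_pmf.prob (joint_law p n) {(d, G). d \<in> good \<mu> n - win (1 / real (m + 2)) n v \<and> (`) v ` E \<subseteq> G \<and> (`) v ` F \<inter> G = {}}
         \<le> \<bar>t m\<bar> * (s n powr (1 - \<tau>)) ^ k"
        by (rule order_trans) (intro mult_right_mono, auto)
    qed
    also have "\<dots> = real (card (tuples V n)) * (\<bar>t m\<bar> * (s n powr (1 - \<tau>)) ^ k)" by simp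
    also have "\<dots> \<le> real n ^ k * (\<bar>t m\<bar> * (real n powr ((1 - \<tau>) / 2)) ^ k)"
      using card_tuples_le[OF V(1), of n] s_powr_le[OF n(2)]
      by (intro mult_mono mult_left_mono power_mono) auto
    also have "\<dots> = \<bar>t m\<bar> * (real n * real n powr ((1 - \<tau>) / 2)) ^ k" by (simp add: power_mult_distrib)
    also have "real n * real n powr ((1 - \<tau>) / 2) = real n powr ((3 - \<tau>) / 2)"
    proof -
      have "real n powr 1 * real n powr ((1 - \<tau>) / 2) = real n powr (1 + (1 - \<tau>) / 2)" by (simp only: powr_add)
      also have "1 + (1 - \<tau>) / 2 = (3 - \<tau>) / 2" by (simp add: field_simps)
      finally show ?thesis using n by simp
    qed
    finally show ?thesis .
  qed
  moreover have "(\<lambda>m. \<bar>t m\<bar>) \<longlonglongrightarrow> 0" using t by (rule tendsto_rabs_zero)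
  ultimately show ?thesis by (intro exI[of _ "\<lambda>m. \<bar>t m\<bar>"] exI[of _ N]) blast
qed

section \<open>Moments of the truncated count\<close>

definition occurs :: "real \<Rightarrow> real \<Rightarrow> nat \<Rightarrow> (nat \<Rightarrow> nat) \<Rightarrow> ((nat \<Rightarrow> nat) \<times> nat set set) set" where
  "occurs \<epsilon> \<rho> n v = {(d, G). d \<in> win \<epsilon> n v \<inter> good \<rho> n \<and> (`) v ` E \<subseteq> G \<and> (`) v ` F \<inter> G = {}}"

definition window_count :: "real \<Rightarrow> real \<Rightarrow> nat \<Rightarrow> ((nat \<Rightarrow> nat) \<times> nat set set) \<Rightarrow> real" where
  "window_count \<epsilon> \<rho> n x = (\<Sum>v\<in>tuples V n. indicator (occurs \<epsilon> \<rho> n v) x)"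

lemma phi_bounds: "n \<ge> 1 \<Longrightarrow> 0 \<le> phi n v d" "n \<ge> 1 \<Longrightarrow> phi n v d \<le> 1"
  unfolding phi_def using edge_prod_limit_bounds[of "\<mu> * n"] \<mu>_ge_1 by auto

text \<open>Pairs are nonempty, so disjoint tuples have disjoint sets of image pairs and the
  products split.\<close>

lemma edge_prod_limit_pair:
  assumes v: "v \<in> tuples V n" and w: "w \<in> tuples V n" and disj: "v ` V \<inter> w ` V = {}"
  shows "edge_prod_limit (\<mu> * n) d ((`) v ` E \<union> (`) w ` E) ((`) v ` F \<union> (`) w ` F) = phi n v d * phi n w d"
proof -
  have ne: "e \<noteq> {}" if "e \<in> E \<union> F" for e
  proof -
    have "card e = 2" using EF(1) that by blast
    then show ?thesis by auto
  qed
  have dis: "(`) v ` X \<inter> (`) w ` Y = {}" if "X \<subseteq> E \<union> F" "Y \<subseteq> E \<union> F" for X Y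
  proof (rule ccontr)
    assume "(`) v ` X \<inter> (`) w ` Y \<noteq> {}"
    then obtain e f where ef: "e \<in> X" "f \<in> Y" "v ` e = w ` f" by blast
    then have "e \<subseteq> V" "f \<subseteq> V" "e \<noteq> {}" using that EF_sub ne by blast+
    then show False using ef(3) disj by blast
  qed
  have "edge_prod_limit (\<mu> * n) d ((`) v ` E \<union> (`) w ` E) ((`) v ` F \<union> (`) w ` F)
      = edge_prod_limit (\<mu> * n) d ((`) v ` E) ((`) v ` F) * edge_prod_limit (\<mu> * n) d ((`) w ` E) ((`) w ` F)"
    unfolding edge_prod_limit_def
      prod.union_disjoint[OF finite_imageI[OF finite_edges(1)] finite_imageI[OF finite_edges(1)] dis[OF Un_upper1 Un_upper1]]
      prod.union_disjoint[OF finite_imageI[OF finite_edges(2)] finite_imageI[OF finite_edges(2)] dis[OF Un_upper2 Un_upper2]]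
    by (simp only: mult_ac)
  also have "\<dots> = phi n v d * phi n w d"
    unfolding phi_def edge_prod_limit_image[OF EF_sub tuplesD(1)[OF v]] edge_prod_limit_image[OF EF_sub tuplesD(1)[OF w]] ..
  finally show ?thesis .
qed

lemma image_EF_disjoint:
  assumes v: "v \<in> tuples V n"
  shows "(`) v ` E \<inter> (`) v ` F = {}"
proof -
  have "inj_on ((`) v) (E \<union> F)"
    by (rule inj_on_subset[OF inj_on_image_Pow[OF tuplesD(1)[OF v]]]) (use EF_sub in blast)
  then have "(`) v ` E \<inter> (`) v ` F = (`) v ` (E \<inter> F)" by (intro inj_on_image_Int[symmetric]) auto
  then show ?thesis using EF(2) by simp
qed

text \<open>One \<rho> serves single tuples and pairs of disjoint tuples alike, since the bound on
  the number of edges covers two copies. The cap \<rho> \<le> \<mu> makes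
  \<open>good \<rho> n\<close> a part of \<open>good \<mu> n\<close>, where the bound outside the
  window holds.\<close>

lemma pattern_prob_approx:
  assumes \<eta>: "\<eta> > 0" and \<epsilon>: "\<epsilon> > 0"
  shows "\<exists>\<rho>>0. \<rho> \<le> \<mu> \<and> (\<exists>N. \<forall>n\<ge>N. n \<ge> 1 \<longrightarrow> (\<forall>v\<in>tuples V n. \<forall>d\<in>good \<rho> n \<inter> win \<epsilon> n v.
       \<bar>pattern_prob n d ((`) v ` E) ((`) v ` F) - phi n v d\<bar> \<le> \<eta> \<and>
       (\<forall>w\<in>tuples V n. v ` V \<inter> w ` V = {} \<longrightarrow> d \<in> win \<epsilon> n w \<longrightarrow>
         \<bar>pattern_prob n d ((`) v ` E \<union> (`) w ` E) ((`) v ` F \<union> (`) w ` F) - phi n v d * phi n w d\<bar> \<le> \<eta>)))"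
proof -
  let ?K = "2 * (card E + card F)"
  \<comment> \<open>Degrees in the window are at most sqrt (\<mu> n) / \<epsilon>, which is
    \<open>B * sqrt n\<close>.\<close>
  define B where "B = sqrt \<mu> / \<epsilon>"
  have \<mu>0: "\<mu> > 0" using \<mu>_ge_1 by simp
  have B: "B > 0" using \<mu>0 \<epsilon> by (simp add: B_def)
  obtain \<rho> N where \<rho>: "\<rho> > 0" and unif: "\<forall>n\<ge>N. \<forall>d E F. \<bar>real (\<Sum>v\<in>{1..n}. d v) - \<mu> * real n\<bar> \<le> \<rho> * real n \<longrightarrow>
     E \<subseteq> vertex_pairs n \<longrightarrow> F \<subseteq> vertex_pairs n \<longrightarrow> E \<inter> F = {} \<longrightarrow> card E + card F \<le> ?K \<longrightarrow>
     (\<forall>e\<in>E \<union> F. \<forall>i\<in>e. real (d i) \<le> B * sqrt n) \<longrightarrow>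
     \<bar>pattern_prob n d E F - edge_prod_limit (\<mu> * n) d E F\<bar> \<le> \<eta>"
    using pattern_prob_uniform[OF \<mu>0 B \<eta>, of ?K] by blast
  note u = unif[rule_format]
  define \<rho>' where "\<rho>' = min \<rho> \<mu>"
  have \<rho>': "\<rho>' > 0" "\<rho>' \<le> \<mu>" "\<rho>' \<le> \<rho>" using \<rho> \<mu>0 by (auto simp: \<rho>'_def)
  have sum: "\<bar>real (\<Sum>v\<in>{1..n}. d v) - \<mu> * real n\<bar> \<le> \<rho> * real n" if "d \<in> good \<rho>' n" for d n
  proof -
    have "\<bar>real (\<Sum>v\<in>{1..n}. d v) - \<mu> * real n\<bar> \<le> \<rho>' * real n" using that unfolding good_def by blast
    also have "\<dots> \<le> \<rho> * real n" using \<rho>' by (intro mult_right_mono) auto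
    finally show ?thesis .
  qed
  have deg: "\<forall>e\<in>(`) v ` X. \<forall>i\<in>e. real (d i) \<le> B * sqrt n"
    if n: "n \<ge> 1" and v: "v \<in> tuples V n" and d: "d \<in> win \<epsilon> n v" and X: "X \<subseteq> E \<union> F" for n v d X
  proof (intro ballI)
    fix f i assume "f \<in> (`) v ` X" "i \<in> f"
    then have "i \<in> v ` V" using X EF_sub by blast
    then have "d i \<in> window \<epsilon> (s n)" using d unfolding win_def by blast
    then have "real (d i) / s n \<le> 1 / \<epsilon>" unfolding window_def by blast
    then have "real (d i) \<le> 1 / \<epsilon> * s n" using s_pos[OF n] by (simp only: pos_divide_le_eq)
    then show "real (d i) \<le> B * sqrt n" by (simp add: B_def real_sqrt_mult)
  qed
  have cardle: "card ((`) v ` X) \<le> card X" if "finite X" for v :: "nat \<Rightarrow> nat" and X using that by (rule card_image_le)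
  show ?thesis
  proof (rule exI[of _ \<rho>'], intro conjI \<rho>'(1,2), rule exI[of _ N], intro allI impI ballI conjI)
    fix n v d assume n: "N \<le> n" "1 \<le> n" and v: "v \<in> tuples V n" and d: "d \<in> good \<rho>' n \<inter> win \<epsilon> n v"
    have "\<bar>pattern_prob n d ((`) v ` E) ((`) v ` F) - edge_prod_limit (\<mu> * n) d ((`) v ` E) ((`) v ` F)\<bar> \<le> \<eta>"
    proof (rule u[OF n(1)])
      show "\<bar>real (\<Sum>v\<in>{1..n}. d v) - \<mu> * real n\<bar> \<le> \<rho> * real n" using d by (intro sum) blast
      show "card ((`) v ` E) + card ((`) v ` F) \<le> ?K" using cardle[OF finite_edges(1), of v] cardle[OF finite_edges(2), of v] by simp
      show "real (d i) \<le> B * sqrt n" if "e \<in> (`) v ` E \<union> (`) v ` F" "i \<in> e" for e i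
      proof -
        have "e \<in> (`) v ` (E \<union> F)" using that(1) by (simp add: image_Un)
        from bspec[OF bspec[OF deg[OF n(2) v IntD2[OF d] subset_refl] this] that(2)] show ?thesis .
      qed
      show "(`) v ` E \<subseteq> vertex_pairs n" "(`) v ` F \<subseteq> vertex_pairs n"
        by (intro image_vertex_pairs[OF v] Un_upper1 Un_upper2)+
      show "(`) v ` E \<inter> (`) v ` F = {}" by (rule image_EF_disjoint[OF v])
    qed
    then show "\<bar>pattern_prob n d ((`) v ` E) ((`) v ` F) - phi n v d\<bar> \<le> \<eta>"
      unfolding phi_def edge_prod_limit_image[OF EF_sub tuplesD(1)[OF v]] .
    fix w assume w: "w \<in> tuples V n" and disj: "v ` V \<inter> w ` V = {}" and dw: "d \<in> win \<epsilon> n w"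
    have cross: "(`) v ` X \<inter> (`) w ` Y = {}" if "X \<subseteq> E \<union> F" "Y \<subseteq> E \<union> F" for X Y
    proof (rule ccontr)
      assume "(`) v ` X \<inter> (`) w ` Y \<noteq> {}"
      then obtain e f where ef: "e \<in> X" "f \<in> Y" "v ` e = w ` f" by blast
      have "card e = 2" using ef(1) that EF(1) by blast
      then have "e \<noteq> {}" by auto
      moreover have "e \<subseteq> V" "f \<subseteq> V" using that EF_sub ef by blast+
      ultimately show False using ef(3) disj by blast
    qed
    have "\<bar>pattern_prob n d ((`) v ` E \<union> (`) w ` E) ((`) v ` F \<union> (`) w ` F)
       - edge_prod_limit (\<mu> * n) d ((`) v ` E \<union> (`) w ` E) ((`) v ` F \<union> (`) w ` F)\<bar> \<le> \<eta>"
    proof (rule u[OF n(1)])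
      show "\<bar>real (\<Sum>v\<in>{1..n}. d v) - \<mu> * real n\<bar> \<le> \<rho> * real n" using d by (intro sum) blast
      show "(`) v ` E \<union> (`) w ` E \<subseteq> vertex_pairs n" "(`) v ` F \<union> (`) w ` F \<subseteq> vertex_pairs n"
        by (intro Un_least image_vertex_pairs[OF v] image_vertex_pairs[OF w] Un_upper1 Un_upper2)+
      have "(`) w ` E \<inter> (`) v ` F = {}"
        using cross[OF Un_upper2 Un_upper1] by (simp only: Int_commute)
      then show "((`) v ` E \<union> (`) w ` E) \<inter> ((`) v ` F \<union> (`) w ` F) = {}"
        unfolding Int_Un_distrib Int_Un_distrib2
        by (simp only: image_EF_disjoint[OF v] image_EF_disjoint[OF w] cross[OF Un_upper1 Un_upper2] Un_empty_left)
      show "card ((`) v ` E \<union> (`) w ` E) + card ((`) v ` F \<union> (`) w ` F) \<le> ?K"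
        using cardle[OF finite_edges(1), of v] cardle[OF finite_edges(2), of v] cardle[OF finite_edges(1), of w] cardle[OF finite_edges(2), of w]
          card_Un_le[of "(`) v ` E" "(`) w ` E"] card_Un_le[of "(`) v ` F" "(`) w ` F"] by simp
      have "\<forall>e\<in>(`) v ` (E \<union> F). \<forall>i\<in>e. real (d i) \<le> B * sqrt n"
        using deg[OF n(2) v IntD2[OF d] subset_refl] .
      note dv = this
      have dw': "\<forall>e\<in>(`) w ` (E \<union> F). \<forall>i\<in>e. real (d i) \<le> B * sqrt n"
        using deg[OF n(2) w dw subset_refl] .
      show "real (d i) \<le> B * sqrt n"
        if "e \<in> ((`) v ` E \<union> (`) w ` E) \<union> ((`) v ` F \<union> (`) w ` F)" "i \<in> e" for e i
      proof -
        have "e \<in> (`) v ` (E \<union> F) \<or> e \<in> (`) w ` (E \<union> F)" using that(1) unfolding image_Un by blast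
        then show ?thesis
          using bspec[OF bspec[OF dv] that(2)] bspec[OF bspec[OF dw'] that(2)] by (elim disjE)
      qed
    qed
    then show "\<bar>pattern_prob n d ((`) v ` E \<union> (`) w ` E) ((`) v ` F \<union> (`) w ` F) - phi n v d * phi n w d\<bar> \<le> \<eta>"
      unfolding edge_prod_limit_pair[OF v w disj] .
  qed
qed

section \<open>Occurrence probabilities for one and two tuples\<close>

lemma integrable_bounded_degrees:
  fixes f :: "(nat \<Rightarrow> nat) \<Rightarrow> real"
  assumes "\<And>d. \<bar>f d\<bar> \<le> K"
  shows "integrable (measure_pmf (degrees n)) f"
  by (rule measure_pmf.integrable_const_bound[where B = K]) (use assms in auto)

lemma abs_indicator_mult_le: "\<bar>x\<bar> \<le> (1 :: real) \<Longrightarrow> \<bar>indicator S d * x\<bar> \<le> 1"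
  by (simp add: indicator_def)

text \<open>A lower bound is enough: in the mean square distance of the rescaled count from its
  limit a, the first moment appears with the nonpositive coefficient -2 a.\<close>

lemma prob_occurs_ge:
  assumes n: "n \<ge> 1" and v: "v \<in> tuples V n" and \<eta>: "\<eta> \<ge> 0"
    and approx: "\<And>d. d \<in> good \<rho> n \<inter> win \<epsilon> n v \<Longrightarrow> \<bar>pattern_prob n d ((`) v ` E) ((`) v ` F) - phi n v d\<bar> \<le> \<eta>"
    and bad: "measure_pmf.prob (degrees n) (win \<epsilon> n v \<inter> - good \<rho> n) \<le> window_prob \<epsilon> n ^ k * \<beta>"
  shows "box_sum p V E F \<epsilon> (s n) - (\<eta> + \<beta>) * window_prob \<epsilon> n ^ k \<le> measure_pmf.prob (joint_law p n) (occurs \<epsilon> \<rho> n v)"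
proof -
  let ?pp = "\<lambda>d. pattern_prob n d ((`) v ` E) ((`) v ` F)"
  have le: "indicator (win \<epsilon> n v) d * phi n v d - \<eta> * indicator (win \<epsilon> n v) d - 1 * indicator (win \<epsilon> n v \<inter> - good \<rho> n) d
      \<le> indicator (win \<epsilon> n v \<inter> good \<rho> n) d * ?pp d" for d
  proof (cases "d \<in> win \<epsilon> n v")
    case True
    show ?thesis
    proof (cases "d \<in> good \<rho> n")
      case g: True
      have "\<bar>?pp d - phi n v d\<bar> \<le> \<eta>" by (rule approx) (use True g in blast)
      then show ?thesis using True g by simp
    next
      case False
      then show ?thesis using True phi_bounds(2)[OF n, of v d] \<eta> by simp
    qed
  qed simp
  have i1: "integrable (measure_pmf (degrees n)) (\<lambda>d. indicator (win \<epsilon> n v) d * phi n v d)"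
    using phi_bounds[OF n] by (intro integrable_bounded_degrees[where K = 1] abs_indicator_mult_le) auto
  have i2: "integrable (measure_pmf (degrees n)) (\<lambda>d. indicator (win \<epsilon> n v \<inter> good \<rho> n) d * ?pp d)"
    using pattern_prob_bounds by (intro integrable_bounded_degrees[where K = 1] abs_indicator_mult_le) (simp add: abs_of_nonneg)
  have "box_sum p V E F \<epsilon> (s n) - (\<eta> + \<beta>) * window_prob \<epsilon> n ^ k
      \<le> box_sum p V E F \<epsilon> (s n) - \<eta> * window_prob \<epsilon> n ^ k - 1 * measure_pmf.prob (degrees n) (win \<epsilon> n v \<inter> - good \<rho> n)"
    using bad by (simp add: algebra_simps)
  also have "\<dots> = measure_pmf.expectation (degrees n)
     (\<lambda>d. indicator (win \<epsilon> n v) d * phi n v d - \<eta> * indicator (win \<epsilon> n v) d - 1 * indicator (win \<epsilon> n v \<inter> - good \<rho> n) d)"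
    unfolding Bochner_Integration.integral_diff[OF Bochner_Integration.integrable_diff[OF i1 integrable_mult_indicator_pmf] integrable_mult_indicator_pmf]
      Bochner_Integration.integral_diff[OF i1 integrable_mult_indicator_pmf] expectation_mult_indicator_pmf
      expectation_win_phi[OF n v] prob_win[OF v] ..
  also have "\<dots> \<le> measure_pmf.expectation (degrees n) (\<lambda>d. indicator (win \<epsilon> n v \<inter> good \<rho> n) d * ?pp d)"
    by (intro integral_mono i2 le Bochner_Integration.integrable_diff i1 integrable_mult_indicator_pmf)
  also have "\<dots> = measure_pmf.prob (joint_law p n) (occurs \<epsilon> \<rho> n v)"
    unfolding occurs_def joint_law_prob ..
  finally show ?thesis .
qed

lemma prob_occurs_disjoint_le:
  assumes n: "n \<ge> 1" and v: "v \<in> tuples V n" and w: "w \<in> tuples V n" and disj: "v ` V \<inter> w ` V = {}" and \<eta>: "\<eta> \<ge> 0"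
    and approx: "\<And>d. d \<in> good \<rho> n \<inter> win \<epsilon> n v \<Longrightarrow> d \<in> win \<epsilon> n w \<Longrightarrow>
      \<bar>pattern_prob n d ((`) v ` E \<union> (`) w ` E) ((`) v ` F \<union> (`) w ` F) - phi n v d * phi n w d\<bar> \<le> \<eta>"
  shows "measure_pmf.prob (joint_law p n) (occurs \<epsilon> \<rho> n v \<inter> occurs \<epsilon> \<rho> n w)
     \<le> (box_sum p V E F \<epsilon> (s n))\<^sup>2 + \<eta> * (window_prob \<epsilon> n ^ k)\<^sup>2"
proof -
  let ?pp = "\<lambda>d. pattern_prob n d ((`) v ` E \<union> (`) w ` E) ((`) v ` F \<union> (`) w ` F)"
  let ?S = "(win \<epsilon> n v \<inter> good \<rho> n) \<inter> (win \<epsilon> n w \<inter> good \<rho> n)"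
  let ?X = "\<lambda>v d. indicator (win \<epsilon> n v) d * phi n v d"
  have eq: "occurs \<epsilon> \<rho> n v \<inter> occurs \<epsilon> \<rho> n w
     = {(d, G). d \<in> ?S \<and> (`) v ` E \<union> (`) w ` E \<subseteq> G \<and> ((`) v ` F \<union> (`) w ` F) \<inter> G = {}}"
  proof (rule set_eqI)
    fix x :: "(nat \<Rightarrow> nat) \<times> nat set set"
    obtain d G where x: "x = (d, G)" by (cases x)
    show "x \<in> occurs \<epsilon> \<rho> n v \<inter> occurs \<epsilon> \<rho> n w \<longleftrightarrow>
      x \<in> {(d, G). d \<in> ?S \<and> (`) v ` E \<union> (`) w ` E \<subseteq> G \<and> ((`) v ` F \<union> (`) w ` F) \<inter> G = {}}"
      unfolding x occurs_def Int_iff mem_Collect_eq case_prod_conv Un_subset_iff Int_Un_distrib2 Un_empty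
      by (simp only: conj_ac)
  qed
  have le: "indicator ?S d * ?pp d \<le> ?X v d * ?X w d + \<eta> * indicator (win \<epsilon> n v \<inter> win \<epsilon> n w) d" for d
  proof (cases "d \<in> ?S")
    case True
    then have "\<bar>?pp d - phi n v d * phi n w d\<bar> \<le> \<eta>" by (intro approx) auto
    then show ?thesis using True by simp
  next
    case False
    have "0 \<le> ?X v d * ?X w d" using phi_bounds(1)[OF n] by simp
    moreover have "0 \<le> \<eta> * indicator (win \<epsilon> n v \<inter> win \<epsilon> n w) d" using \<eta> by simp
    ultimately show ?thesis using False by simp
  qed
  have X1: "\<bar>?X v d\<bar> \<le> 1" for v d using phi_bounds[OF n] by (intro abs_indicator_mult_le) (simp add: abs_of_nonneg)
  have i1: "integrable (measure_pmf (degrees n)) (\<lambda>d. ?X v d * ?X w d)"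
  proof (rule integrable_bounded_degrees[where K = 1])
    fix d
    have "\<bar>?X v d * ?X w d\<bar> = \<bar>?X v d\<bar> * \<bar>?X w d\<bar>" by (rule abs_mult)
    also have "\<dots> \<le> 1" by (intro mult_le_one X1 abs_ge_zero)
    finally show "\<bar>?X v d * ?X w d\<bar> \<le> 1" .
  qed
  have i2: "integrable (measure_pmf (degrees n)) (\<lambda>d. indicator ?S d * ?pp d)"
    using pattern_prob_bounds by (intro integrable_bounded_degrees[where K = 1] abs_indicator_mult_le) (simp add: abs_of_nonneg)
  have cU: "card (v ` V \<union> w ` V) = k + k"
    using V disj tuplesD(3)[OF v] tuplesD(3)[OF w] by (subst card_Un_disjoint) auto
  have "measure_pmf.prob (joint_law p n) (occurs \<epsilon> \<rho> n v \<inter> occurs \<epsilon> \<rho> n w)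
     = measure_pmf.expectation (degrees n) (\<lambda>d. indicator ?S d * ?pp d)"
    unfolding eq joint_law_prob ..
  also have "\<dots> \<le> measure_pmf.expectation (degrees n) (\<lambda>d. ?X v d * ?X w d + \<eta> * indicator (win \<epsilon> n v \<inter> win \<epsilon> n w) d)"
    by (intro integral_mono i2 le Bochner_Integration.integrable_add i1 integrable_mult_indicator_pmf)
  also have "\<dots> = (box_sum p V E F \<epsilon> (s n))\<^sup>2 + \<eta> * window_prob \<epsilon> n ^ card (v ` V \<union> w ` V)"
    unfolding Bochner_Integration.integral_add[OF i1 integrable_mult_indicator_pmf] expectation_mult_indicator_pmf
      expectation_win_phi_product[OF n v w disj] prob_win_Int[OF v w] ..
  finally show ?thesis unfolding cU by (simp add: power_add power2_eq_square)
qed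

text \<open>The graph is ignored here: for overlapping tuples the degree condition at the vertices
  involved is already restrictive enough.\<close>

lemma prob_occurs_Int_le:
  assumes v: "v \<in> tuples V n" and w: "w \<in> tuples V n"
  shows "measure_pmf.prob (joint_law p n) (occurs \<epsilon> \<rho> n v \<inter> occurs \<epsilon> \<rho> n w) \<le> window_prob \<epsilon> n ^ card (v ` V \<union> w ` V)"
proof -
  let ?pp = "\<lambda>d. pattern_prob n d {} {}"
  have "measure_pmf.prob (joint_law p n) (occurs \<epsilon> \<rho> n v \<inter> occurs \<epsilon> \<rho> n w)
     \<le> measure_pmf.prob (joint_law p n) {(d, G). d \<in> win \<epsilon> n v \<inter> win \<epsilon> n w \<and> {} \<subseteq> G \<and> {} \<inter> G = {}}"
    by (intro measure_pmf.finite_measure_mono) (auto simp: occurs_def)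
  also have "\<dots> = measure_pmf.expectation (degrees n) (\<lambda>d. indicator (win \<epsilon> n v \<inter> win \<epsilon> n w) d * ?pp d)"
    by (rule joint_law_prob)
  also have "\<dots> = measure_pmf.expectation (degrees n) (\<lambda>d. 1 * indicator (win \<epsilon> n v \<inter> win \<epsilon> n w) d)"
    by (simp add: pattern_prob_def)
  also have "\<dots> = window_prob \<epsilon> n ^ card (v ` V \<union> w ` V)"
    unfolding expectation_mult_indicator_pmf prob_win_Int[OF v w] by simp
  finally show ?thesis .
qed

text \<open>Every vertex of w outside the image of v costs a factor
  \<open>window_prob \<epsilon> n\<close>. Some coordinate i0 of w must land in that image; after a
  union bound over i0 the sum factorizes over the coordinates, with factor k for i0 and at most
  \<open>k + n * window_prob \<epsilon> n\<close> for each other one.\<close>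

lemma sum_overlapping_le:
  assumes v: "v \<in> tuples V n"
  shows "(\<Sum>w\<in>{w \<in> tuples V n. v ` V \<inter> w ` V \<noteq> {}}. window_prob \<epsilon> n ^ card (v ` V \<union> w ` V))
    \<le> window_prob \<epsilon> n ^ k * (real k * (real k * (real k + real n * window_prob \<epsilon> n) ^ (k - 1)))"
proof -
  let ?q = "window_prob \<epsilon> n"
  have q: "0 \<le> ?q" by (simp add: window_prob_def)
  let ?U = "v ` V"
  let ?a = "\<lambda>u. if u \<in> ?U then 1 else ?q"
  \<comment> \<open>The weights of the coordinates when i0 is the one forced into the image.\<close>
  let ?b = "\<lambda>i0 i u. if i = i0 then indicator ?U u else ?a u"
  have card_eq: "?q ^ card (?U \<union> w ` V) = ?q ^ k * (\<Prod>i\<in>V. ?a (w i))" if w: "w \<in> tuples V n" for w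
  proof -
    have "card (?U \<union> w ` V) = card ?U + card (w ` V - ?U)"
      using V card_Un_disjoint[of ?U "w ` V - ?U"] by (simp add: Un_Diff_cancel)
    then have "?q ^ card (?U \<union> w ` V) = ?q ^ k * ?q ^ card (w ` V - ?U)"
      using tuplesD(3)[OF v] by (simp add: power_add)
    also have "?q ^ card (w ` V - ?U) = (\<Prod>u\<in>w ` V - ?U. ?a u)" by simp
    also have "\<dots> = (\<Prod>u\<in>w ` V. ?a u)" using V by (intro prod.mono_neutral_left) auto
    also have "\<dots> = (\<Prod>i\<in>V. ?a (w i))" using tuplesD(1)[OF w] by (simp add: prod.reindex o_def)
    finally show ?thesis .
  qed
  have b0: "0 \<le> ?b i0 i u" for i0 i u using q by simp
  have le: "(\<Prod>i\<in>V. ?a (w i)) \<le> (\<Sum>i0\<in>V. \<Prod>i\<in>V. ?b i0 i (w i))" if "?U \<inter> w ` V \<noteq> {}" for w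
  proof -
    from that obtain u where u: "u \<in> ?U" "u \<in> w ` V" by blast
    from u(2) obtain i0 where "u = w i0" "i0 \<in> V" by (rule imageE)
    then have i0: "i0 \<in> V" "w i0 \<in> ?U" using u(1) by simp_all
    have "(\<Prod>i\<in>V. ?a (w i)) = (\<Prod>i\<in>V. ?b i0 i (w i))"
      using i0(2) by (intro prod.cong refl) (simp split: if_split)
    also have "\<dots> = (\<Sum>i0\<in>{i0}. \<Prod>i\<in>V. ?b i0 i (w i))" by simp
    also have "\<dots> \<le> (\<Sum>i0\<in>V. \<Prod>i\<in>V. ?b i0 i (w i))"
    proof (rule sum_mono2)
      show "0 \<le> (\<Prod>i\<in>V. ?b j i (w i))" for j by (intro prod_nonneg b0)
    qed (use V i0(1) in auto)
    finally show ?thesis .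
  qed
  have Un: "?U \<subseteq> {1..n}" "card ?U = k" using tuplesD[OF v] by auto
  have sum_b: "(\<Sum>u\<in>{1..n}. indicator ?U u) = real k"
    using Un by (simp add: sum.If_cases indicator_def Int_absorb1)
  have sum_a: "(\<Sum>u\<in>{1..n}. ?a u) \<le> real k + real n * ?q"
  proof -
    have "(\<Sum>u\<in>{1..n}. ?a u) \<le> (\<Sum>u\<in>{1..n}. indicator ?U u + ?q)" using q by (intro sum_mono) auto
    then show ?thesis unfolding sum.distrib sum_b by simp
  qed
  have "(\<Sum>w\<in>{w \<in> tuples V n. ?U \<inter> w ` V \<noteq> {}}. ?q ^ card (?U \<union> w ` V))
     \<le> (\<Sum>w\<in>{w \<in> tuples V n. ?U \<inter> w ` V \<noteq> {}}. ?q ^ k * (\<Sum>i0\<in>V. \<Prod>i\<in>V. ?b i0 i (w i)))"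
    using q le by (intro sum_mono) (simp add: card_eq mult_left_mono)
  also have "\<dots> \<le> (\<Sum>w\<in>V \<rightarrow>\<^sub>E {1..n}. ?q ^ k * (\<Sum>i0\<in>V. \<Prod>i\<in>V. ?b i0 i (w i)))"
  proof (rule sum_mono2)
    show "finite (V \<rightarrow>\<^sub>E {1..n})" using V by (intro finite_PiE) auto
    show "{w \<in> tuples V n. ?U \<inter> w ` V \<noteq> {}} \<subseteq> V \<rightarrow>\<^sub>E {1..n}" unfolding tuples_def by blast
    show "0 \<le> ?q ^ k * (\<Sum>i0\<in>V. \<Prod>i\<in>V. ?b i0 i (w i))" for w
      using q by (intro mult_nonneg_nonneg sum_nonneg prod_nonneg b0) simp
  qed
  also have "\<dots> = ?q ^ k * (\<Sum>i0\<in>V. \<Sum>w\<in>V \<rightarrow>\<^sub>E {1..n}. \<Prod>i\<in>V. ?b i0 i (w i))"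
    by (subst sum.swap) (simp add: sum_distrib_left)
  also have "\<dots> = ?q ^ k * (\<Sum>i0\<in>V. \<Prod>i\<in>V. \<Sum>u\<in>{1..n}. ?b i0 i u)"
    using V by (simp add: prod_sum_PiE)
  also have "\<dots> \<le> ?q ^ k * (\<Sum>i0\<in>V. real k * (real k + real n * ?q) ^ (k - 1))"
  proof (intro mult_left_mono sum_mono)
    fix i0 assume i0: "i0 \<in> V"
    have "(\<Prod>i\<in>V. \<Sum>u\<in>{1..n}. ?b i0 i u) = (\<Sum>u\<in>{1..n}. ?b i0 i0 u) * (\<Prod>i\<in>V - {i0}. \<Sum>u\<in>{1..n}. ?b i0 i u)"
      by (rule prod.remove[OF V(1) i0])
    also have "(\<Sum>u\<in>{1..n}. ?b i0 i0 u) = real k" using sum_b by simp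
    also have "(\<Prod>i\<in>V - {i0}. \<Sum>u\<in>{1..n}. ?b i0 i u) = (\<Prod>i\<in>V - {i0}. \<Sum>u\<in>{1..n}. ?a u)"
      by (intro prod.cong sum.cong) auto
    also have "\<dots> = (\<Sum>u\<in>{1..n}. ?a u) ^ (k - 1)" using V i0 by simp
    also have "real k * \<dots> \<le> real k * (real k + real n * ?q) ^ (k - 1)"
      using sum_a q by (intro mult_left_mono power_mono sum_nonneg) auto
    finally show "(\<Prod>i\<in>V. \<Sum>u\<in>{1..n}. ?b i0 i u) \<le> real k * (real k + real n * ?q) ^ (k - 1)" .
  qed (use q in simp)
  finally show ?thesis by simp
qed

end

lemma real_powr_filterlim_at_top:
  assumes "(a::real) > 0"
  shows "filterlim (\<lambda>n. real n powr a) at_top sequentially"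
proof -
  have "filterlim (\<lambda>n. exp (a * ln (real n))) at_top sequentially"
    by (intro filterlim_compose[OF exp_at_top] filterlim_tendsto_pos_mult_at_top[OF tendsto_const assms]
        filterlim_compose[OF ln_at_top filterlim_real_sequentially])
  moreover have "\<forall>\<^sub>F n in sequentially. exp (a * ln (real n)) = real n powr a"
    using eventually_gt_at_top[of 0] by eventually_elim (simp add: powr_def)
  ultimately show ?thesis by (rule filterlim_mono_eventually[OF _ order_refl order_refl])
qed

context scale_free_pattern
begin

section \<open>Chebyshev estimate for the truncated count\<close>

lemma finite_tuples_V: "finite (tuples V n)" by (rule finite_tuples[OF V(1)])

lemma window_count_bounds: "0 \<le> window_count \<epsilon> \<rho> n x" "window_count \<epsilon> \<rho> n x \<le> real (card (tuples V n))"
proof -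
  show "0 \<le> window_count \<epsilon> \<rho> n x" unfolding window_count_def by (intro sum_nonneg) auto
  have "window_count \<epsilon> \<rho> n x \<le> (\<Sum>v\<in>tuples V n. 1)" unfolding window_count_def by (intro sum_mono) (simp add: indicator_def)
  then show "window_count \<epsilon> \<rho> n x \<le> real (card (tuples V n))" by simp
qed

lemma integrable_window_count:
  "integrable (measure_pmf (joint_law p n)) (window_count \<epsilon> \<rho> n)"
  "integrable (measure_pmf (joint_law p n)) (\<lambda>x. (window_count \<epsilon> \<rho> n x)\<^sup>2)"
proof -
  show "integrable (measure_pmf (joint_law p n)) (window_count \<epsilon> \<rho> n)"
    using window_count_bounds by (intro measure_pmf.integrable_const_bound[where B = "real (card (tuples V n))"]) auto
  show "integrable (measure_pmf (joint_law p n)) (\<lambda>x. (window_count \<epsilon> \<rho> n x)\<^sup>2)"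
    using window_count_bounds
    by (intro measure_pmf.integrable_const_bound[where B = "(real (card (tuples V n)))\<^sup>2"]) (auto intro!: power_mono)
qed

lemma expectation_indicator_sum:
  assumes "finite T"
  shows "measure_pmf.expectation q (\<lambda>x. \<Sum>v\<in>T. indicator (S v) x :: real) = (\<Sum>v\<in>T. measure_pmf.prob q (S v))"
proof -
  have i: "integrable (measure_pmf q) (\<lambda>x. indicator (S v) x :: real)" for v
    using integrable_mult_indicator_pmf[of q 1] by simp
  show ?thesis unfolding Bochner_Integration.integral_sum[OF i] by simp
qed

lemma expectation_window_count:
  "measure_pmf.expectation (joint_law p n) (window_count \<epsilon> \<rho> n)
     = (\<Sum>v\<in>tuples V n. measure_pmf.prob (joint_law p n) (occurs \<epsilon> \<rho> n v))"
  unfolding window_count_def[abs_def] by (rule expectation_indicator_sum[OF finite_tuples_V])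

lemma expectation_window_count_sq:
  "measure_pmf.expectation (joint_law p n) (\<lambda>x. (window_count \<epsilon> \<rho> n x)\<^sup>2)
     = (\<Sum>v\<in>tuples V n. \<Sum>w\<in>tuples V n. measure_pmf.prob (joint_law p n) (occurs \<epsilon> \<rho> n v \<inter> occurs \<epsilon> \<rho> n w))"
proof -
  have eq: "(window_count \<epsilon> \<rho> n x)\<^sup>2 = (\<Sum>z\<in>tuples V n \<times> tuples V n. indicator (occurs \<epsilon> \<rho> n (fst z) \<inter> occurs \<epsilon> \<rho> n (snd z)) x)" for x
    unfolding window_count_def power2_eq_square sum_product sum.cartesian_product
    by (simp add: indicator_inter_arith case_prod_unfold)
  have "measure_pmf.expectation (joint_law p n) (\<lambda>x. (window_count \<epsilon> \<rho> n x)\<^sup>2)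
     = (\<Sum>z\<in>tuples V n \<times> tuples V n. measure_pmf.prob (joint_law p n) (occurs \<epsilon> \<rho> n (fst z) \<inter> occurs \<epsilon> \<rho> n (snd z)))"
    unfolding eq using finite_tuples_V by (intro expectation_indicator_sum finite_cartesian_product)
  then show ?thesis by (simp add: sum.cartesian_product case_prod_unfold)
qed

lemma tuples_ratio_limit: "(\<lambda>n. real (card (tuples V n)) / real n ^ k) \<longlonglongrightarrow> 1"
proof (rule tendsto_sandwich)
  have "(\<lambda>n. (1 - real k / real n) ^ k) \<longlonglongrightarrow> (1 - 0) ^ k"
    by (intro tendsto_intros real_tendsto_divide_at_top[OF tendsto_const filterlim_real_sequentially])
  then show "(\<lambda>n. (1 - real k / real n) ^ k) \<longlonglongrightarrow> 1" by simp
  show "\<forall>\<^sub>F n in sequentially. (1 - real k / real n) ^ k \<le> real (card (tuples V n)) / real n ^ k"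
    using eventually_ge_at_top[of "max k 1"]
  proof eventually_elim
    case (elim n)
    then have n: "k \<le> n" "real n > 0" by auto
    have "real ((n - k) ^ k) \<le> real (card (tuples V n))" by (intro of_nat_mono card_tuples_ge[OF V(1) _ n(1)]) simp
    then have "(real n - real k) ^ k \<le> real (card (tuples V n))" using n by (simp add: of_nat_diff)
    then have "(real n - real k) ^ k / real n ^ k \<le> real (card (tuples V n)) / real n ^ k" by (rule divide_right_mono) simp
    moreover have "(1 - real k / real n) = (real n - real k) / real n" using n by (simp add: diff_divide_distrib)
    ultimately show ?case by (simp add: power_divide)
  qed
  show "\<forall>\<^sub>F n in sequentially. real (card (tuples V n)) / real n ^ k \<le> 1"
    using eventually_ge_at_top[of 1]
  proof eventually_elim
    case (elim n)
    then have "real n ^ k > 0" by simp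
    then show ?case using card_tuples_le[OF V(1), of n] by (simp add: pos_divide_le_eq)
  qed
qed simp

text \<open>Disjoint pairs of tuples factorize up to \<eta>. Overlapping pairs are bounded through
  their degrees alone and are of lower order, because one coordinate has only k values left.\<close>

lemma second_moment_bound:
  assumes n: "n \<ge> 1" and \<eta>: "\<eta> \<ge> 0"
    and approx: "\<And>v w d. v \<in> tuples V n \<Longrightarrow> w \<in> tuples V n \<Longrightarrow> v ` V \<inter> w ` V = {} \<Longrightarrow> d \<in> good \<rho> n \<inter> win \<epsilon> n v \<Longrightarrow> d \<in> win \<epsilon> n w \<Longrightarrow>
      \<bar>pattern_prob n d ((`) v ` E \<union> (`) w ` E) ((`) v ` F \<union> (`) w ` F) - phi n v d * phi n w d\<bar> \<le> \<eta>"
  defines "q \<equiv> window_prob \<epsilon> n" and "b \<equiv> box_sum p V E F \<epsilon> (s n)"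
  shows "measure_pmf.expectation (joint_law p n) (\<lambda>x. (window_count \<epsilon> \<rho> n x)\<^sup>2)
     \<le> (real n ^ k)\<^sup>2 * (b\<^sup>2 + \<eta> * (q ^ k)\<^sup>2) + real n ^ k * (q ^ k * (real k * (real k * (real k + real n * q) ^ (k - 1))))"
proof -
  let ?P = "\<lambda>v w. measure_pmf.prob (joint_law p n) (occurs \<epsilon> \<rho> n v \<inter> occurs \<epsilon> \<rho> n w)"
  let ?T = "tuples V n"
  have q0: "q \<ge> 0" by (simp add: q_def window_prob_def)
  have T: "real (card ?T) \<le> real n ^ k" by (rule card_tuples_le[OF V(1)])
  let ?D = "b\<^sup>2 + \<eta> * (q ^ k)\<^sup>2" and ?O = "q ^ k * (real k * (real k * (real k + real n * q) ^ (k - 1)))"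
  have D0: "?D \<ge> 0" using \<eta> by simp
  have O0: "?O \<ge> 0" using q0 by simp
  have inner: "(\<Sum>w\<in>?T. ?P v w) \<le> real n ^ k * ?D + ?O" if v: "v \<in> ?T" for v
  proof -
    let ?A = "{w \<in> ?T. v ` V \<inter> w ` V = {}}" and ?B = "{w \<in> ?T. v ` V \<inter> w ` V \<noteq> {}}"
    have "?T = ?A \<union> ?B" by (rule set_eqI) auto
    then have "(\<Sum>w\<in>?T. ?P v w) = (\<Sum>w\<in>?A \<union> ?B. ?P v w)" by (rule sum.cong) (rule refl)
    also have "\<dots> = (\<Sum>w\<in>?A. ?P v w) + (\<Sum>w\<in>?B. ?P v w)"
    proof (rule sum.union_disjoint)
      show "?A \<inter> ?B = {}" by (intro equals0I, elim IntE CollectE conjE, erule notE, assumption)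
    qed (use finite_tuples_V in simp_all)
    also have "(\<Sum>w\<in>?A. ?P v w) \<le> (\<Sum>w\<in>?A. ?D)"
    proof (rule sum_mono)
      fix w assume "w \<in> ?A"
      then have w: "w \<in> ?T" "v ` V \<inter> w ` V = {}" by auto
      show "?P v w \<le> ?D" unfolding b_def q_def
        by (rule prob_occurs_disjoint_le[OF n v w \<eta> approx[OF v w]])
    qed
    also have "(\<Sum>w\<in>?A. ?D) = real (card ?A) * ?D" by simp
    also have "\<dots> \<le> real n ^ k * ?D"
    proof (rule mult_right_mono[OF _ D0])
      have "card ?A \<le> card ?T" using finite_tuples_V by (intro card_mono) auto
      then show "real (card ?A) \<le> real n ^ k" using T by linarith
    qed
    also have "(\<Sum>w\<in>?B. ?P v w) \<le> (\<Sum>w\<in>?B. window_prob \<epsilon> n ^ card (v ` V \<union> w ` V))"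
      using prob_occurs_Int_le[OF v] by (intro sum_mono) auto
    also have "\<dots> \<le> ?O" unfolding q_def by (rule sum_overlapping_le[OF v])
    finally show ?thesis by simp
  qed
  have "measure_pmf.expectation (joint_law p n) (\<lambda>x. (window_count \<epsilon> \<rho> n x)\<^sup>2) \<le> (\<Sum>v\<in>?T. real n ^ k * ?D + ?O)"
    unfolding expectation_window_count_sq by (intro sum_mono inner)
  also have "\<dots> = real (card ?T) * (real n ^ k * ?D + ?O)" by simp
  also have "\<dots> \<le> real n ^ k * (real n ^ k * ?D + ?O)"
    using T D0 O0 by (intro mult_right_mono) auto
  also have "\<dots> = (real n ^ k)\<^sup>2 * ?D + real n ^ k * ?O" by (simp add: algebra_simps power2_eq_square)
  finally show ?thesis .
qed

text \<open>Chebyshev's inequality around \<open>a\<close> rather than around the mean. With W the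
  rescaled count, E (W - a)^2 = E W^2 - 2 a E W + a^2, so an upper bound for the second and a lower
  bound for the first moment suffice. The radius \<rho> is produced here because it depends on the
  accuracy \<eta>.\<close>

lemma window_count_concentration:
  assumes \<epsilon>: "\<epsilon> > 0" and a: "a \<ge> 0"
    and lim: "(\<lambda>n. (real n powr ((\<tau> - 1) / 2)) ^ k * box_sum p V E F \<epsilon> (s n)) \<longlonglongrightarrow> a"
    and \<epsilon>0: "\<epsilon>0 > 0" and \<beta>0: "\<beta>0 > 0"
  shows "\<exists>\<rho>>0. \<rho> \<le> \<mu> \<and> (\<exists>N. \<forall>n\<ge>N. measure_pmf.prob (joint_law p n)
     {x. \<bar>window_count \<epsilon> \<rho> n x / (real n powr ((3 - \<tau>) / 2)) ^ k - a\<bar> \<ge> \<epsilon>0} \<le> \<beta>0)"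
proof -
  obtain Q where Q: "Q > 0" and Qb: "\<And>n. n \<ge> 1 \<Longrightarrow> real n powr ((\<tau> - 1) / 2) * window_prob \<epsilon> n \<le> Q"
    using window_prob_bound[OF \<epsilon>] by blast
  define r where "r n = real n powr ((\<tau> - 1) / 2)" for n :: nat
  define z where "z n = real n powr ((3 - \<tau>) / 2)" for n :: nat
  define \<alpha> where "\<alpha> n = r n ^ k * box_sum p V E F \<epsilon> (s n)" for n
  define \<theta> where "\<theta> n = real (card (tuples V n)) / real n ^ k" for n
  define M where "M = Q ^ k * (real k * (real k * (real k + Q) ^ (k - 1)))"
  \<comment> \<open>D - 1 is the coefficient of \<eta> in the limit of \<open>U\<close> below; the
    added 1 makes D positive and leaves room for a strict inequality.\<close>
  define D where "D = Q ^ k * Q ^ k + 4 * a * Q ^ k + 1"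
  have D: "D > 0" using Q a by (simp add: D_def add_nonneg_pos)
  define \<eta> where "\<eta> = \<beta>0 * \<epsilon>0\<^sup>2 / (2 * D)"
  have \<eta>: "\<eta> > 0" using \<beta>0 \<epsilon>0 D by (simp add: \<eta>_def)
  obtain \<rho> N1 where \<rho>: "\<rho> > 0" "\<rho> \<le> \<mu>" and N1: "\<forall>n\<ge>N1. n \<ge> 1 \<longrightarrow> (\<forall>v\<in>tuples V n. \<forall>d\<in>good \<rho> n \<inter> win \<epsilon> n v.
       \<bar>pattern_prob n d ((`) v ` E) ((`) v ` F) - phi n v d\<bar> \<le> \<eta> \<and>
       (\<forall>w\<in>tuples V n. v ` V \<inter> w ` V = {} \<longrightarrow> d \<in> win \<epsilon> n w \<longrightarrow>
         \<bar>pattern_prob n d ((`) v ` E \<union> (`) w ` E) ((`) v ` F \<union> (`) w ` F) - phi n v d * phi n w d\<bar> \<le> \<eta>))"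
    using pattern_prob_approx[OF \<eta> \<epsilon>] by blast
  obtain N2 where N2: "\<And>n v. n \<ge> N2 \<Longrightarrow> v \<in> tuples V n \<Longrightarrow>
      measure_pmf.prob (degrees n) (win \<epsilon> n v \<inter> - good \<rho> n) \<le> window_prob \<epsilon> n ^ k * \<eta>"
    using prob_win_not_good[OF \<rho>(1) \<eta> \<epsilon>] by blast
  define U where "U n = (\<alpha> n)\<^sup>2 + \<eta> * (Q ^ k * Q ^ k) + M / z n - 2 * a * (\<theta> n * (\<alpha> n - 2 * \<eta> * Q ^ k)) + a\<^sup>2" for n
  have \<alpha>_lim: "\<alpha> \<longlonglongrightarrow> a" using lim unfolding \<alpha>_def r_def .
  have \<theta>_lim: "\<theta> \<longlonglongrightarrow> 1" unfolding \<theta>_def by (rule tuples_ratio_limit)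
  have zinf: "filterlim z at_top sequentially"
    unfolding z_def using \<tau> by (intro real_powr_filterlim_at_top) auto
  have "(\<lambda>n. U n) \<longlonglongrightarrow> a\<^sup>2 + \<eta> * (Q ^ k * Q ^ k) + 0 - 2 * a * (1 * (a - 2 * \<eta> * Q ^ k)) + a\<^sup>2"
    unfolding U_def by (intro tendsto_intros \<alpha>_lim \<theta>_lim real_tendsto_divide_at_top[OF tendsto_const zinf])
  also have "a\<^sup>2 + \<eta> * (Q ^ k * Q ^ k) + 0 - 2 * a * (1 * (a - 2 * \<eta> * Q ^ k)) + a\<^sup>2 = \<eta> * (D - 1)"
    by (simp add: D_def power2_eq_square algebra_simps)
  finally have U_lim: "U \<longlonglongrightarrow> \<eta> * (D - 1)" .
  have "\<eta> * (D - 1) < \<eta> * D" using \<eta> by simp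
  also have "\<eta> * D = \<beta>0 * \<epsilon>0\<^sup>2 / 2" using D by (simp add: \<eta>_def)
  also have "\<dots> \<le> \<beta>0 * \<epsilon>0\<^sup>2" using \<beta>0 by simp
  finally have "\<forall>\<^sub>F n in sequentially. U n < \<beta>0 * \<epsilon>0\<^sup>2" by (rule order_tendstoD(2)[OF U_lim])
  then obtain N3 where N3: "\<And>n. n \<ge> N3 \<Longrightarrow> U n < \<beta>0 * \<epsilon>0\<^sup>2" by (auto simp: eventually_sequentially)
  have main: "measure_pmf.prob (joint_law p n) {x. \<bar>window_count \<epsilon> \<rho> n x / z n ^ k - a\<bar> \<ge> \<epsilon>0} \<le> \<beta>0"
    if n: "n \<ge> N1" "n \<ge> N2" "n \<ge> N3" "n \<ge> 1" for n
  proof -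
    let ?J = "joint_law p n" and ?Y = "window_count \<epsilon> \<rho> n"
    define b where "b = box_sum p V E F \<epsilon> (s n)"
    define q where "q = window_prob \<epsilon> n"
    have q0: "q \<ge> 0" by (simp add: q_def window_prob_def)
    have r0: "r n \<ge> 0" by (simp add: r_def)
    have z1: "z n \<ge> 1" unfolding z_def using n(4) \<tau> by (intro ge_one_powr_ge_zero) auto
    have rq: "0 \<le> r n * q" "r n * q \<le> Q" using Qb[OF n(4)] r0 q0 by (simp_all add: r_def q_def)
    have rqk: "(r n * q) ^ k \<le> Q ^ k" by (rule power_mono[OF rq(2,1)])
    \<comment> \<open>n splits into the normalization per vertex and the reciprocal of the order of
      the window probability.\<close>
    have nzr: "real n = z n * r n"
    proof -
      have "z n * r n = real n powr ((3 - \<tau>) / 2 + (\<tau> - 1) / 2)" unfolding z_def r_def by (simp only: powr_add)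
      also have "(3 - \<tau>) / 2 + (\<tau> - 1) / 2 = 1" by (simp add: field_simps)
      finally show ?thesis using n(4) by simp
    qed
    then have nk: "real n ^ k = z n ^ k * r n ^ k" by (simp add: power_mult_distrib)
    have zk: "z n ^ k > 0" using z1 by simp
    have \<alpha>n: "\<alpha> n = r n ^ k * b" by (simp add: \<alpha>_def b_def)
    have EY: "\<theta> n * (\<alpha> n - 2 * \<eta> * Q ^ k) \<le> measure_pmf.expectation ?J ?Y / z n ^ k"
    proof -
      have "(\<Sum>v\<in>tuples V n. b - (\<eta> + \<eta>) * q ^ k) \<le> measure_pmf.expectation ?J ?Y"
        unfolding expectation_window_count b_def q_def
        using N1 n N2 \<eta> by (intro sum_mono prob_occurs_ge) auto
      then have "real (card (tuples V n)) * (b - 2 * \<eta> * q ^ k) / z n ^ k \<le> measure_pmf.expectation ?J ?Y / z n ^ k"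
        using zk by (intro divide_right_mono) auto
      moreover have "real (card (tuples V n)) * (b - 2 * \<eta> * q ^ k) / z n ^ k = \<theta> n * (\<alpha> n - 2 * \<eta> * (r n * q) ^ k)"
      proof -
        have rk: "r n \<noteq> 0" using n(4) by (simp add: r_def)
        have "\<theta> n = real (card (tuples V n)) / (z n ^ k * r n ^ k)" by (simp add: \<theta>_def nk)
        moreover have "\<alpha> n - 2 * \<eta> * (r n * q) ^ k = r n ^ k * (b - 2 * \<eta> * q ^ k)"
          by (simp add: \<alpha>_def b_def power_mult_distrib algebra_simps)
        ultimately show ?thesis using rk by simp
      qed
      moreover have "\<theta> n * (\<alpha> n - 2 * \<eta> * Q ^ k) \<le> \<theta> n * (\<alpha> n - 2 * \<eta> * (r n * q) ^ k)"
        using rqk \<eta> by (intro mult_left_mono diff_left_mono) (auto simp: \<theta>_def)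
      ultimately show ?thesis by linarith
    qed
    have EY2: "measure_pmf.expectation ?J (\<lambda>x. (?Y x)\<^sup>2) / (z n ^ k)\<^sup>2 \<le> (\<alpha> n)\<^sup>2 + \<eta> * (Q ^ k * Q ^ k) + M / z n"
    proof -
      have "measure_pmf.expectation ?J (\<lambda>x. (?Y x)\<^sup>2)
        \<le> (real n ^ k)\<^sup>2 * (b\<^sup>2 + \<eta> * (q ^ k)\<^sup>2) + real n ^ k * (q ^ k * (real k * (real k * (real k + real n * q) ^ (k - 1))))"
        unfolding b_def q_def using N1 n \<eta> by (intro second_moment_bound) auto
      also have "\<dots> = (z n ^ k)\<^sup>2 * ((\<alpha> n)\<^sup>2 + \<eta> * ((r n * q) ^ k * (r n * q) ^ k))
         + z n ^ k * ((r n * q) ^ k * (real k * (real k * (real k + z n * (r n * q)) ^ (k - 1))))"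
        unfolding nk nzr \<alpha>n by (simp add: power_mult_distrib power2_eq_square algebra_simps)
      \<comment> \<open>Overlapping pairs reach only the power 2 k - 1 of \<open>z n\<close>, hence
        contribute O(1 / \<open>z n\<close>) after normalization.\<close>
      also have "\<dots> \<le> (z n ^ k)\<^sup>2 * ((\<alpha> n)\<^sup>2 + \<eta> * (Q ^ k * Q ^ k)) + z n ^ k * (M * z n ^ (k - 1))"
      proof (intro add_mono mult_left_mono)
        show "(r n * q) ^ k * (r n * q) ^ k \<le> Q ^ k * Q ^ k" using rqk rq Q by (intro mult_mono) auto
        have "real k + z n * (r n * q) \<le> z n * (real k + Q)"
        proof -
          have "real k * 1 \<le> real k * z n" using z1 by (intro mult_left_mono) auto
          moreover have "z n * (r n * q) \<le> z n * Q" using z1 rq by (intro mult_left_mono) auto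
          ultimately show ?thesis by (simp add: algebra_simps)
        qed
        then have "(real k + z n * (r n * q)) ^ (k - 1) \<le> (z n * (real k + Q)) ^ (k - 1)"
          using rq z1 by (intro power_mono) auto
        then have "(r n * q) ^ k * (real k * (real k * (real k + z n * (r n * q)) ^ (k - 1)))
            \<le> Q ^ k * (real k * (real k * (z n * (real k + Q)) ^ (k - 1)))"
          using rqk rq Q z1 by (intro mult_mono mult_left_mono) auto
        also have "\<dots> = M * z n ^ (k - 1)" by (simp add: M_def power_mult_distrib)
        finally show "(r n * q) ^ k * (real k * (real k * (real k + z n * (r n * q)) ^ (k - 1))) \<le> M * z n ^ (k - 1)" .
      qed (use \<eta> zk in auto)
      finally have "measure_pmf.expectation ?J (\<lambda>x. (?Y x)\<^sup>2) / (z n ^ k)\<^sup>2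
        \<le> ((z n ^ k)\<^sup>2 * ((\<alpha> n)\<^sup>2 + \<eta> * (Q ^ k * Q ^ k)) + z n ^ k * (M * z n ^ (k - 1))) / (z n ^ k)\<^sup>2"
        by (rule divide_right_mono) simp
      also have "\<dots> = (\<alpha> n)\<^sup>2 + \<eta> * (Q ^ k * Q ^ k) + M / z n"
      proof -
        obtain j where j: "k = Suc j" using k_pos by (metis gr0_implies_Suc)
        have "z n \<noteq> 0" using z1 by simp
        then have "(z n ^ k * (M * z n ^ (k - 1))) / (z n ^ k)\<^sup>2 = M / z n"
          by (simp add: j power2_eq_square)
        then show ?thesis using zk \<open>z n \<noteq> 0\<close> by (simp add: add_divide_distrib)
      qed
      finally show ?thesis .
    qed
    define W where "W x = ?Y x / z n ^ k" for x
    have iW: "integrable (measure_pmf ?J) W" "integrable (measure_pmf ?J) (\<lambda>x. (W x)\<^sup>2)"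
      using integrable_window_count[of n \<epsilon> \<rho>] unfolding W_def power_divide by auto
    have eqsq: "(W x - a)\<^sup>2 = (W x)\<^sup>2 - 2 * a * W x + a\<^sup>2" for x by (simp add: power2_eq_square algebra_simps)
    have i3: "integrable (measure_pmf ?J) (\<lambda>x. (W x)\<^sup>2 - 2 * a * W x + a\<^sup>2)" using iW by auto
    have "measure_pmf.expectation ?J (\<lambda>x. (W x - a)\<^sup>2)
       = measure_pmf.expectation ?J (\<lambda>x. (W x)\<^sup>2) - 2 * a * measure_pmf.expectation ?J W + a\<^sup>2"
      unfolding eqsq using iW by simp
    also have "\<dots> = measure_pmf.expectation ?J (\<lambda>x. (?Y x)\<^sup>2) / (z n ^ k)\<^sup>2 - 2 * a * (measure_pmf.expectation ?J ?Y / z n ^ k) + a\<^sup>2"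
      by (simp add: W_def[abs_def] power_divide)
    also have "\<dots> \<le> U n"
    proof -
      have "2 * a * (\<theta> n * (\<alpha> n - 2 * \<eta> * Q ^ k)) \<le> 2 * a * (measure_pmf.expectation ?J ?Y / z n ^ k)"
        using EY a by (intro mult_left_mono) auto
      then show ?thesis using EY2 unfolding U_def by linarith
    qed
    finally have EW: "measure_pmf.expectation ?J (\<lambda>x. (W x - a)\<^sup>2) \<le> \<beta>0 * \<epsilon>0\<^sup>2" using N3[OF n(3)] by linarith
    have "measure_pmf.prob ?J {x \<in> space (measure_pmf ?J). \<bar>W x - a\<bar> \<ge> \<epsilon>0} \<le> measure_pmf.expectation ?J (\<lambda>x. (W x - a)\<^sup>2) / \<epsilon>0\<^sup>2"
      using i3 \<epsilon>0 by (intro measure_pmf.second_moment_method) (auto simp: eqsq)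
    also have "\<dots> \<le> \<beta>0 * \<epsilon>0\<^sup>2 / \<epsilon>0\<^sup>2" using EW by (rule divide_right_mono) simp
    also have "\<dots> = \<beta>0" using \<epsilon>0 by simp
    finally show ?thesis unfolding W_def by simp
  qed
  show ?thesis
  proof (rule exI[of _ \<rho>], intro conjI \<rho>, rule exI[of _ "max (max N1 N2) (max N3 1)"], intro allI impI)
    fix n assume "max (max N1 N2) (max N3 1) \<le> n"
    then show "measure_pmf.prob (joint_law p n) {x. \<bar>window_count \<epsilon> \<rho> n x / (real n powr ((3 - \<tau>) / 2)) ^ k - a\<bar> \<ge> \<epsilon>0} \<le> \<beta>0"
      using main[of n] unfolding z_def by simp
  qed
qed

end

section \<open>Convergence in probability\<close>

lemma pattern_integral_mono:
  assumes "S \<subseteq> T"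
  shows "pattern_integral \<tau> V E F S \<le> pattern_integral \<tau> V E F T"
  unfolding pattern_integral_def
proof (rule nn_integral_mono)
  fix x :: "'a \<Rightarrow> real"
  have "V \<rightarrow>\<^sub>E S \<subseteq> V \<rightarrow>\<^sub>E T" using assms by (intro PiE_mono)
  then show "ennreal (pattern_density \<tau> V E F x) * indicator (V \<rightarrow>\<^sub>E S) x \<le> ennreal (pattern_density \<tau> V E F x) * indicator (V \<rightarrow>\<^sub>E T) x"
    by (intro mult_left_mono indicator_leI) auto
qed

context scale_free_pattern
begin

definition limit_const :: "real set \<Rightarrow> ennreal" where
  "limit_const S = ennreal (c ^ k * \<mu> powr (- (real k / 2) * (\<tau> - 1))) * pattern_integral \<tau> V E F S"

lemma limit_const_finite: "limit_const {0<..} < \<infinity>"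
  using pattern_integral_finite[OF EF(1) V(1) _ sep] \<tau> by (simp add: limit_const_def ennreal_mult_less_top)

lemma limit_const_exhaust:
  "(\<lambda>m. enn2real (limit_const {1 / real (m + 2) <.. real (m + 2)})) \<longlonglongrightarrow> enn2real (limit_const {0<..})"
proof (rule tendsto_enn2real)
  have "(\<lambda>m. limit_const {1 / real (m + 2) <.. real (m + 2)}) \<longlonglongrightarrow> limit_const {0<..}"
    unfolding limit_const_def by (intro ennreal_tendsto_cmult pattern_integral_exhaust[OF V(1) EF_sub]) simp
  then show "(\<lambda>m. limit_const {1 / real (m + 2) <.. real (m + 2)}) \<longlonglongrightarrow> ennreal (enn2real (limit_const {0<..}))"
    using limit_const_finite by simp
qed simp

lemma box_sum_nonneg: "S \<ge> 0 \<Longrightarrow> box_sum p V E F \<epsilon> S \<ge> 0"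
  unfolding box_sum_def edge_prod_limit_def
  by (intro sum_nonneg mult_nonneg_nonneg prod_nonneg ballI) (auto intro!: divide_nonneg_nonneg)

text \<open>The power of \<mu> in the constant arises here: the Riemann sum lives on the scale s =
  sqrt (\<mu> n), while the normalization is a power of n alone.\<close>

lemma scaled_box_sum_limit:
  assumes \<epsilon>: "\<epsilon> > 0"
  shows "(\<lambda>n. (real n powr ((\<tau> - 1) / 2)) ^ k * box_sum p V E F \<epsilon> (s n)) \<longlonglongrightarrow> enn2real (limit_const {\<epsilon> <.. 1 / \<epsilon>})"
proof -
  let ?I = "pattern_integral \<tau> V E F {\<epsilon> <.. 1 / \<epsilon>}" and ?w = "real k * (\<tau> - 1)"
  have "?I \<le> pattern_integral \<tau> V E F {0<..}" using \<epsilon> by (intro pattern_integral_mono) auto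
  then have I: "?I < \<infinity>" using pattern_integral_finite[OF EF(1) V(1) _ sep] \<tau> by (auto intro: le_less_trans)
  \<comment> \<open>Shifted by one, as \<open>box_sum_limit\<close> asks for s \<ge> 1 at every
    index, which fails at n = 0.\<close>
  have "filterlim (\<lambda>n. sqrt (\<mu> * real (Suc n))) at_top sequentially"
    using \<mu>_ge_1
    by (intro filterlim_compose[OF sqrt_at_top] filterlim_tendsto_pos_mult_at_top[OF tendsto_const]
        filterlim_compose[OF filterlim_real_sequentially filterlim_Suc]) auto
  moreover have "s (Suc n) \<ge> 1" for n
  proof -
    have "1 * 1 \<le> \<mu> * real (Suc n)" using \<mu>_ge_1 by (intro mult_mono) auto
    then show ?thesis by simp
  qed
  ultimately have "(\<lambda>n. ennreal (s (Suc n) powr ?w * box_sum p V E F \<epsilon> (s (Suc n)))) \<longlonglongrightarrow> ennreal (c ^ k) * ?I"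
    using \<tau> by (intro box_sum_limit[OF V(1) EF(1) c D_tail _ \<epsilon>]) auto
  then have "(\<lambda>n. ennreal (s n powr ?w * box_sum p V E F \<epsilon> (s n))) \<longlonglongrightarrow> ennreal (c ^ k) * ?I"
    by (rule LIMSEQ_imp_Suc)
  also have "ennreal (c ^ k) * ?I = ennreal (c ^ k * enn2real ?I)"
    using I c by (simp add: ennreal_mult)
  finally have "(\<lambda>n. enn2real (ennreal (s n powr ?w * box_sum p V E F \<epsilon> (s n)))) \<longlonglongrightarrow> c ^ k * enn2real ?I"
    using c by (intro tendsto_enn2real) auto
  moreover have "enn2real (ennreal (s n powr ?w * box_sum p V E F \<epsilon> (s n))) = s n powr ?w * box_sum p V E F \<epsilon> (s n)" for n
    using \<mu>_ge_1 by (intro enn2real_ennreal mult_nonneg_nonneg box_sum_nonneg) auto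
  ultimately have "(\<lambda>n. s n powr ?w * box_sum p V E F \<epsilon> (s n)) \<longlonglongrightarrow> c ^ k * enn2real ?I" by simp
  then have "(\<lambda>n. \<mu> powr (- (real k / 2) * (\<tau> - 1)) * (s n powr ?w * box_sum p V E F \<epsilon> (s n)))
      \<longlonglongrightarrow> \<mu> powr (- (real k / 2) * (\<tau> - 1)) * (c ^ k * enn2real ?I)" by (rule tendsto_mult_left)
  also have "\<mu> powr (- (real k / 2) * (\<tau> - 1)) * (c ^ k * enn2real ?I) = enn2real (limit_const {\<epsilon> <.. 1 / \<epsilon>})"
    using c by (simp add: limit_const_def enn2real_mult)
  also have "(\<lambda>n. \<mu> powr (- (real k / 2) * (\<tau> - 1)) * (s n powr ?w * box_sum p V E F \<epsilon> (s n)))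
     = (\<lambda>n. (real n powr ((\<tau> - 1) / 2)) ^ k * box_sum p V E F \<epsilon> (s n))"
  proof
    fix n
    have "s n powr ?w = (\<mu> * real n) powr (real k / 2 * (\<tau> - 1))"
      using \<mu>_ge_1 by (simp add: powr_half_sqrt[symmetric] powr_powr)
    also have "\<dots> = \<mu> powr (real k / 2 * (\<tau> - 1)) * real n powr (real k / 2 * (\<tau> - 1))" by (rule powr_mult)
    also have "real n powr (real k / 2 * (\<tau> - 1)) = (real n powr ((\<tau> - 1) / 2)) ^ k"
      using k_pos by (cases "n = 0") (simp_all add: powr_power mult_ac)
    finally have "\<mu> powr (- (real k / 2) * (\<tau> - 1)) * s n powr ?w
       = (\<mu> powr (- (real k / 2) * (\<tau> - 1)) * \<mu> powr (real k / 2 * (\<tau> - 1))) * (real n powr ((\<tau> - 1) / 2)) ^ k" by simp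
    also have "\<mu> powr (- (real k / 2) * (\<tau> - 1)) * \<mu> powr (real k / 2 * (\<tau> - 1)) = 1"
      using \<mu>_ge_1 by (simp add: powr_add[symmetric])
    finally show "\<mu> powr (- (real k / 2) * (\<tau> - 1)) * (s n powr ?w * box_sum p V E F \<epsilon> (s n))
      = (real n powr ((\<tau> - 1) / 2)) ^ k * box_sum p V E F \<epsilon> (s n)" by (simp only: mult.assoc[symmetric] mult_1)
  qed
  finally show ?thesis .
qed

lemma joint_law_not_good:
  "measure_pmf.prob (joint_law p n) {x. fst x \<notin> good \<rho> n} = measure_pmf.prob (degrees n) (- good \<rho> n)"
proof -
  have eq: "{x. fst x \<notin> good \<rho> n} = {(d, G :: nat set set). d \<in> - good \<rho> n \<and> {} \<subseteq> G \<and> {} \<inter> G = {}}" by auto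
  have one: "pattern_prob n d {} {} = 1" for d by (simp add: pattern_prob_def)
  show ?thesis unfolding eq joint_law_prob one mult_1_right by simp
qed

text \<open>The tolerance is \<mu> here and not \<rho>, so the bound outside the window can be fixed
  before \<rho> is chosen.\<close>

definition outside :: "real \<Rightarrow> nat \<Rightarrow> (nat \<Rightarrow> nat) \<Rightarrow> ((nat \<Rightarrow> nat) \<times> nat set set) set" where
  "outside \<epsilon> n v = {(d, G). d \<in> good \<mu> n - win \<epsilon> n v \<and> (`) v ` E \<subseteq> G \<and> (`) v ` F \<inter> G = {}}"

text \<open>Since \<rho> \<le> \<mu>, the degrees are good in both senses, and the window condition
  alone decides to which sum a copy belongs.\<close>

lemma pattern_count_split:
  assumes \<rho>: "\<rho> \<le> \<mu>" and d: "fst x \<in> good \<rho> n"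
  shows "real (pattern_count V E F n (snd x)) = window_count \<epsilon> \<rho> n x + (\<Sum>v\<in>tuples V n. indicator (outside \<epsilon> n v) x)"
proof -
  have "\<rho> * real n \<le> \<mu> * real n" using \<rho> by (rule mult_right_mono) simp
  then have d': "fst x \<in> good \<mu> n" using d unfolding good_def by fastforce
  have "real (pattern_count V E F n (snd x)) = (\<Sum>v\<in>tuples V n. indicator {v. pattern_at E F v (snd x)} v)"
    unfolding pattern_count_def using finite_tuples_V by (simp add: indicator_def sum.If_cases Int_def)
  also have "\<dots> = (\<Sum>v\<in>tuples V n. indicator (occurs \<epsilon> \<rho> n v) x + indicator (outside \<epsilon> n v) x)"
  proof (rule sum.cong[OF refl])
    fix v
    have "x \<in> occurs \<epsilon> \<rho> n v \<longleftrightarrow> fst x \<in> win \<epsilon> n v \<and> pattern_at E F v (snd x)"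
      using d by (simp add: occurs_def pattern_at_def case_prod_beta)
    moreover have "x \<in> outside \<epsilon> n v \<longleftrightarrow> fst x \<notin> win \<epsilon> n v \<and> pattern_at E F v (snd x)"
      using d' by (simp add: outside_def pattern_at_def case_prod_beta)
    ultimately show "(indicator {v. pattern_at E F v (snd x)} v :: real) = indicator (occurs \<epsilon> \<rho> n v) x + indicator (outside \<epsilon> n v) x"
      by (simp add: indicator_def)
  qed
  finally show ?thesis by (simp add: sum.distrib window_count_def)
qed

lemma prob_outside_large:
  assumes le: "(\<Sum>v\<in>tuples V n. measure_pmf.prob (joint_law p n) (outside \<epsilon> n v)) \<le> \<delta> * y" and y: "y > 0"
  shows "measure_pmf.prob (joint_law p n) {x. (\<Sum>v\<in>tuples V n. indicator (outside \<epsilon> n v) x) \<ge> y} \<le> \<delta>"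
proof -
  let ?J = "measure_pmf (joint_law p n)" and ?O = "\<lambda>x. \<Sum>v\<in>tuples V n. indicator (outside \<epsilon> n v) x :: real"
  have i: "integrable ?J (\<lambda>x. indicator (outside \<epsilon> n v) x :: real)" for v
    using integrable_mult_indicator_pmf[of "joint_law p n" 1] by simp
  have "measure ?J {x \<in> space ?J. ?O x \<ge> y} \<le> measure_pmf.expectation (joint_law p n) ?O / y"
    using y i by (intro integral_Markov_inequality_measure[where A = UNIV]) (auto intro!: Bochner_Integration.integrable_sum sum_nonneg)
  also have "\<dots> \<le> \<delta> * y / y"
    using le y unfolding expectation_indicator_sum[OF finite_tuples_V] by (intro divide_right_mono) auto
  finally show ?thesis using y by simp
qed

text \<open>The window is chosen first, wide enough both for the first moment outside it and for the
  truncation of the constant; then \<rho> from the concentration inside it; then n. The exceptional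
  probability is shared equally by three events: atypical degrees, deviation inside the window, many
  copies outside.\<close>

lemma pattern_count_deviation:
  assumes \<epsilon>0: "\<epsilon>0 > 0" and \<beta>0: "\<beta>0 > 0"
  shows "\<exists>N. \<forall>n\<ge>N. measure_pmf.prob (joint_law p n)
     {x. \<bar>real (pattern_count V E F n (snd x)) / (real n powr ((3 - \<tau>) / 2)) ^ k - enn2real (limit_const {0<..})\<bar> > \<epsilon>0} \<le> \<beta>0"
proof -
  define a where "a = enn2real (limit_const {0<..})"
  define X where "X n = (real n powr ((3 - \<tau>) / 2)) ^ k" for n :: nat
  obtain t N1 where t: "t \<longlonglongrightarrow> 0" and N1: "\<And>m n. n \<ge> N1 \<Longrightarrow> n \<ge> 1 \<Longrightarrow>
      (\<Sum>v\<in>tuples V n. measure_pmf.prob (joint_law p n) (outside (1 / real (m + 2)) n v)) \<le> t m * X n"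
    using outside_first_moment unfolding outside_def X_def by blast
  \<comment> \<open>The count outside is to exceed \<epsilon>0/3 of the normalization with
    probability at most \<beta>0/3; by Markov's inequality a mean of the product of the two
    suffices.\<close>
  have "\<beta>0 * \<epsilon>0 / 9 > 0" using \<epsilon>0 \<beta>0 by simp
  then have "\<forall>\<^sub>F m in sequentially. t m < \<beta>0 * \<epsilon>0 / 9" by (rule order_tendstoD(2)[OF t])
  moreover have "\<forall>\<^sub>F m in sequentially. dist (enn2real (limit_const {1 / real (m + 2) <.. real (m + 2)})) a < \<epsilon>0 / 3"
    using limit_const_exhaust \<epsilon>0 unfolding a_def by (intro tendstoD) auto
  ultimately have "\<forall>\<^sub>F m in sequentially. t m < \<beta>0 * \<epsilon>0 / 9 \<and> dist (enn2real (limit_const {1 / real (m + 2) <.. real (m + 2)})) a < \<epsilon>0 / 3"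
    by (rule eventually_conj)
  then obtain m where m: "t m < \<beta>0 * \<epsilon>0 / 9" "dist (enn2real (limit_const {1 / real (m + 2) <.. real (m + 2)})) a < \<epsilon>0 / 3"
    using eventually_happens'[OF sequentially_bot] by blast
  define \<epsilon> where "\<epsilon> = 1 / real (m + 2)"
  define b where "b = enn2real (limit_const {\<epsilon> <.. 1 / \<epsilon>})"
  have ab: "\<bar>b - a\<bar> < \<epsilon>0 / 3" using m(2) by (simp add: b_def \<epsilon>_def dist_real_def)
  have \<epsilon>: "\<epsilon> > 0" by (simp add: \<epsilon>_def)
  have b: "b \<ge> 0" by (simp add: b_def)
  have "\<exists>\<rho>>0. \<rho> \<le> \<mu> \<and> (\<exists>N. \<forall>n\<ge>N. measure_pmf.prob (joint_law p n)
     {x. \<bar>window_count \<epsilon> \<rho> n x / (real n powr ((3 - \<tau>) / 2)) ^ k - b\<bar> \<ge> \<epsilon>0 / 3} \<le> \<beta>0 / 3)"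
    using \<epsilon>0 \<beta>0 by (intro window_count_concentration[OF \<epsilon> b]) (auto simp: b_def intro: scaled_box_sum_limit[OF \<epsilon>])
  then obtain \<rho> N2 where \<rho>: "\<rho> > 0" "\<rho> \<le> \<mu>" and N2: "\<And>n. n \<ge> N2 \<Longrightarrow> measure_pmf.prob (joint_law p n)
     {x. \<bar>window_count \<epsilon> \<rho> n x / X n - b\<bar> \<ge> \<epsilon>0 / 3} \<le> \<beta>0 / 3"
    unfolding X_def by blast
  obtain N3 where N3: "\<And>n. n \<ge> N3 \<Longrightarrow> measure_pmf.prob (joint_law p n) {x. fst x \<notin> good \<rho> n} \<le> \<beta>0 / 3"
    using prob_not_good[OF \<rho>(1), of "\<beta>0 / 3"] \<beta>0 unfolding joint_law_not_good by auto
  have "measure_pmf.prob (joint_law p n) {x. \<bar>real (pattern_count V E F n (snd x)) / X n - a\<bar> > \<epsilon>0} \<le> \<beta>0"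
    if n: "n \<ge> N1" "n \<ge> N2" "n \<ge> N3" "n \<ge> 1" for n
  proof -
    let ?O = "\<lambda>x. \<Sum>v\<in>tuples V n. indicator (outside \<epsilon> n v) x :: real"
    let ?G = "{x. fst x \<notin> good \<rho> n} :: ((nat \<Rightarrow> nat) \<times> nat set set) set"
      and ?W = "{x. \<bar>window_count \<epsilon> \<rho> n x / X n - b\<bar> \<ge> \<epsilon>0 / 3}" and ?Z = "{x. ?O x \<ge> X n * (\<epsilon>0 / 3)}"
    have X: "X n > 0" using n(4) by (simp add: X_def)
    have y: "X n * (\<epsilon>0 / 3) > 0" using X \<epsilon>0 by simp
    have "{x. \<bar>real (pattern_count V E F n (snd x)) / X n - a\<bar> > \<epsilon>0} \<subseteq> ?G \<union> (?W \<union> ?Z)"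
    proof (rule subsetI, rule ccontr)
      fix x assume x: "x \<in> {x. \<bar>real (pattern_count V E F n (snd x)) / X n - a\<bar> > \<epsilon>0}" and nx: "x \<notin> ?G \<union> (?W \<union> ?Z)"
      have g: "fst x \<in> good \<rho> n" and w: "\<bar>window_count \<epsilon> \<rho> n x / X n - b\<bar> < \<epsilon>0 / 3" and o: "?O x < X n * (\<epsilon>0 / 3)"
        using nx by (simp_all add: not_le)
      have "real (pattern_count V E F n (snd x)) / X n = window_count \<epsilon> \<rho> n x / X n + ?O x / X n"
        using pattern_count_split[OF \<rho>(2) g, of \<epsilon>] by (simp add: add_divide_distrib)
      moreover have "0 \<le> ?O x / X n" using X by (intro divide_nonneg_nonneg sum_nonneg) auto
      moreover have "?O x / X n < \<epsilon>0 / 3" using o X by (simp add: pos_divide_less_eq mult.commute)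
      ultimately have "\<bar>real (pattern_count V E F n (snd x)) / X n - a\<bar> < \<epsilon>0" using w ab by linarith
      then show False using x by simp
    qed
    then have "measure_pmf.prob (joint_law p n) {x. \<bar>real (pattern_count V E F n (snd x)) / X n - a\<bar> > \<epsilon>0}
       \<le> measure_pmf.prob (joint_law p n) (?G \<union> (?W \<union> ?Z))" by (intro measure_pmf.finite_measure_mono) simp_all
    also have "\<dots> \<le> measure_pmf.prob (joint_law p n) ?G + measure_pmf.prob (joint_law p n) (?W \<union> ?Z)"
      by (rule measure_Un_le) simp_all
    also have "measure_pmf.prob (joint_law p n) (?W \<union> ?Z) \<le> measure_pmf.prob (joint_law p n) ?W + measure_pmf.prob (joint_law p n) ?Z"
      by (rule measure_Un_le) simp_all
    also have "measure_pmf.prob (joint_law p n) ?Z \<le> \<beta>0 / 3"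
    proof (rule prob_outside_large[OF _ y])
      have "(\<Sum>v\<in>tuples V n. measure_pmf.prob (joint_law p n) (outside \<epsilon> n v)) \<le> t m * X n"
        unfolding \<epsilon>_def by (rule N1[OF n(1,4)])
      also have "\<dots> \<le> \<beta>0 * \<epsilon>0 / 9 * X n" using m(1) X by (intro mult_right_mono) auto
      finally show "(\<Sum>v\<in>tuples V n. measure_pmf.prob (joint_law p n) (outside \<epsilon> n v)) \<le> \<beta>0 / 3 * (X n * (\<epsilon>0 / 3))"
        by (simp add: mult_ac)
    qed
    finally show ?thesis using N2[OF n(2)] N3[OF n(3)] by linarith
  qed
  then show ?thesis unfolding X_def a_def
    by (intro exI[of _ "max (max N1 N2) (max N3 1)"]) simp
qed

theorem pattern_count_limit:
  "limit_const {0<..} < \<infinity>"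
  "conv_in_prob (\<lambda>n. measure_pmf (ECM p n))
     (\<lambda>n G. real (pattern_count V E F n G) / real n powr (real k / 2 * (3 - \<tau>))) (enn2real (limit_const {0<..}))"
proof -
  show "limit_const {0<..} < \<infinity>" by (rule limit_const_finite)
  let ?a = "enn2real (limit_const {0<..})"
  have X: "real n powr (real k / 2 * (3 - \<tau>)) = (real n powr ((3 - \<tau>) / 2)) ^ k" for n
    using k_pos by (cases "n = 0") (simp_all add: powr_power mult_ac)
  show "conv_in_prob (\<lambda>n. measure_pmf (ECM p n))
     (\<lambda>n G. real (pattern_count V E F n G) / real n powr (real k / 2 * (3 - \<tau>))) ?a"
    unfolding conv_in_prob_def
  proof (intro allI impI LIMSEQ_I)
    fix \<epsilon>0 r :: real assume "\<epsilon>0 > 0" "r > 0"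
    then obtain N where N: "\<And>n. n \<ge> N \<Longrightarrow> measure_pmf.prob (joint_law p n)
       {x. \<bar>real (pattern_count V E F n (snd x)) / (real n powr ((3 - \<tau>) / 2)) ^ k - ?a\<bar> > \<epsilon>0} \<le> r / 2"
      using pattern_count_deviation[of \<epsilon>0 "r / 2"] by auto
    show "\<exists>no. \<forall>n\<ge>no. norm (measure_pmf.prob (ECM p n) {\<omega> \<in> space (measure_pmf (ECM p n)).
        \<bar>real (pattern_count V E F n \<omega>) / real n powr (real k / 2 * (3 - \<tau>)) - ?a\<bar> > \<epsilon>0} - 0) < r"
    proof (intro exI[of _ N] allI impI)
      fix n assume n: "N \<le> n"
      have "measure_pmf.prob (ECM p n) {\<omega> \<in> space (measure_pmf (ECM p n)).
        \<bar>real (pattern_count V E F n \<omega>) / real n powr (real k / 2 * (3 - \<tau>)) - ?a\<bar> > \<epsilon>0}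
        = measure_pmf.prob (joint_law p n)
           {x. \<bar>real (pattern_count V E F n (snd x)) / (real n powr ((3 - \<tau>) / 2)) ^ k - ?a\<bar> > \<epsilon>0}"
        unfolding ECM_eq_map_joint_law X by (simp add: vimage_def)
      then show "norm (measure_pmf.prob (ECM p n) {\<omega> \<in> space (measure_pmf (ECM p n)).
        \<bar>real (pattern_count V E F n \<omega>) / real n powr (real k / 2 * (3 - \<tau>)) - ?a\<bar> > \<epsilon>0} - 0) < r"
        using N[OF n] \<open>r > 0\<close> by simp
    qed
  qed
qed

end

section \<open>From the optimization problem to patterns\<close>

lemma unique_maximizer_less:
  assumes uniq: "unique_maximizer f X" and X: "finite X" and P0: "P0 \<in> X" "f P0 = Max (f ` X)"
    and P: "P \<in> X" "P \<noteq> P0"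
  shows "f P < f P0"
proof -
  have le: "f Q \<le> f P0" if "Q \<in> X" for Q using that X P0(2) by simp
  then have max: "is_arg_max f (\<lambda>P. P \<in> X) P0" using P0(1) by (force simp: is_arg_max_linorder)
  have "\<not> is_arg_max f (\<lambda>P. P \<in> X) P"
    using uniq max P(2) unfolding unique_maximizer_def by blast
  then obtain Q where "Q \<in> X" "f P < f Q" using P(1) by (auto simp: is_arg_max_linorder not_le)
  then show ?thesis using le[of Q] by linarith
qed

lemma edges_between_empty [simp]: "edges_between E S {} = 0" "edges_between E {} S = 0"
  by (simp_all add: edges_between_def)

text \<open>\<open>X\<close> stands for either family of partitions; the hypothesis on
  \<open>F\<close> says that a partition respecting the forbidden pairs is admissible. Uniqueness
  forces every admissible partition other than ({}, {}, V) strictly below the maximum.\<close>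

lemma separating_if_unique_maximizer:
  assumes E: "simple_graph V E" "deg1_vertices V E = {}"
    and X: "X \<subseteq> partitions_sub V E" "({}, {}, V) \<in> X"
    and F: "\<And>S1 S2 S3. (S1, S2, S3) \<in> partitions_sub V E \<Longrightarrow> (\<forall>i\<in>S2. \<forall>j\<in>S2 \<union> S3. i \<noteq> j \<longrightarrow> {i, j} \<notin> F) \<Longrightarrow> (S1, S2, S3) \<in> X"
    and uniq: "unique_maximizer (objective \<tau> V E) X" and max: "Max (objective \<tau> V E ` X) = 0"
  shows "separating V E \<tau> F"
  unfolding separating_def
proof (intro allI impI)
  fix S1 S2 S3
  assume part: "S1 \<union> S2 \<union> S3 = V" "S1 \<inter> S2 = {}" "S1 \<inter> S3 = {}" "S2 \<inter> S3 = {}"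
    and nF: "\<forall>i\<in>S2. \<forall>j\<in>S2 \<union> S3. i \<noteq> j \<longrightarrow> {i, j} \<notin> F" and ne: "S1 \<union> S2 \<noteq> {}"
  have "finite V" using E(1) by (simp add: simple_graph_def)
  moreover have "partitions_sub V E \<subseteq> Pow V \<times> Pow V \<times> Pow V" by (auto simp: partitions_sub_def)
  ultimately have "finite (partitions_sub V E)" by (meson finite_Pow_iff finite_SigmaI finite_subset)
  then have fX: "finite X" using X(1) finite_subset by blast
  have "{} \<notin> E" using E(1) by (auto simp: simple_graph_def)
  then have "edges_in E {} = 0" by (simp add: edges_in_def)
  then have P0: "objective \<tau> V E ({}, {}, V) = 0" by (simp add: objective_def E(2))
  have P: "(S1, S2, S3) \<in> X" using part nF by (intro F) (simp_all add: partitions_sub_def E(2))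
  have "objective \<tau> V E (S1, S2, S3) < objective \<tau> V E ({}, {}, V)"
    using unique_maximizer_less[OF uniq fX X(2) _ P] ne P0 max by auto
  then show "real (card S1) - real (card S2) - (2 * real (edges_in E S1) + real (edges_between E S1 S3)) / (\<tau> - 1) < 0"
    unfolding P0 by (simp add: objective_def E(2))
qed

lemma separating_sub:
  assumes E: "simple_graph V E" "deg1_vertices V E = {}"
    and uniq: "unique_maximizer (objective \<tau> V E) (partitions_sub V E)" and max: "B_sub \<tau> V E = 0"
  shows "separating V E \<tau> {}"
  by (rule separating_if_unique_maximizer[OF E _ _ _ uniq max[unfolded B_sub_def]])
    (simp_all add: partitions_sub_def E(2))

lemma separating_ind:
  assumes E: "simple_graph V E" "deg1_vertices V E = {}"
    and uniq: "unique_maximizer (objective \<tau> V E) (partitions_ind V E)" and max: "B_ind \<tau> V E = 0"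
  shows "separating V E \<tau> (non_edges V E)"
proof (rule separating_if_unique_maximizer[OF E _ _ _ uniq max[unfolded B_ind_def]])
  show "partitions_ind V E \<subseteq> partitions_sub V E" by (auto simp: partitions_ind_def)
  show "({}, {}, V) \<in> partitions_ind V E" by (simp add: partitions_ind_def partitions_sub_def E(2))
  fix S1 S2 S3
  assume S: "(S1, S2, S3) \<in> partitions_sub V E" and nF: "\<forall>i\<in>S2. \<forall>j\<in>S2 \<union> S3. i \<noteq> j \<longrightarrow> {i, j} \<notin> non_edges V E"
  have "{i, j} \<in> E" if "i \<in> S2" "j \<in> S2 \<union> S3" "i \<noteq> j" for i j
  proof -
    have "i \<in> V" "j \<in> V" using S that(1,2) unfolding partitions_sub_def by blast+
    moreover have "{i, j} \<notin> non_edges V E" using nF that by blast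
    ultimately show ?thesis using that(3) by (simp add: non_edges_def)
  qed
  then show "(S1, S2, S3) \<in> partitions_ind V E" using S by (simp add: partitions_ind_def)
qed

section \<open>The two counts as pattern counts\<close>

lemma ball_edges_image_iff:
  assumes E: "\<And>e. e \<in> E \<Longrightarrow> e \<subseteq> V \<and> card e = 2"
  shows "(\<forall>e\<in>E. P (v ` e)) \<longleftrightarrow> (\<forall>i\<in>V. \<forall>j\<in>V. {i, j} \<in> E \<longrightarrow> P {v i, v j})"
proof
  assume "\<forall>e\<in>E. P (v ` e)"
  then show "\<forall>i\<in>V. \<forall>j\<in>V. {i, j} \<in> E \<longrightarrow> P {v i, v j}" by force
next
  assume r: "\<forall>i\<in>V. \<forall>j\<in>V. {i, j} \<in> E \<longrightarrow> P {v i, v j}"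
  show "\<forall>e\<in>E. P (v ` e)"
  proof
    fix e assume e: "e \<in> E"
    then obtain i j where ij: "e = {i, j}" using E by (meson card_2_iff)
    then have "i \<in> V" "j \<in> V" using E[OF e] by auto
    then show "P (v ` e)" using r e by (simp add: ij)
  qed
qed

lemma N_sub_eq_pattern_count:
  assumes "simple_graph {1..k} E"
  shows "N_sub k E n G = pattern_count {1..k} E {} n G"
proof -
  have "pattern_at E {} v G \<longleftrightarrow> (\<forall>i\<in>{1..k}. \<forall>j\<in>{1..k}. {i, j} \<in> E \<longrightarrow> {v i, v j} \<in> G)" for v
    using ball_edges_image_iff[of E "{1..k}" "\<lambda>e. e \<in> G" v] assms
    unfolding pattern_at_def simple_graph_def by blast
  then show ?thesis unfolding N_sub_def pattern_count_def tuples_def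
    by (intro arg_cong[where f = card]) auto
qed

lemma N_ind_eq_pattern_count:
  assumes "simple_graph {1..k} E"
  shows "N_ind k E n G = pattern_count {1..k} E (non_edges {1..k} E) n G"
proof -
  let ?F = "non_edges {1..k} E"
  have "pattern_at E ?F v G \<longleftrightarrow> (\<forall>e\<in>E. v ` e \<in> G) \<and> (\<forall>e\<in>?F. v ` e \<notin> G)" for v
    unfolding pattern_at_def by blast
  moreover have "(\<forall>e\<in>E. v ` e \<in> G) \<longleftrightarrow> (\<forall>i\<in>{1..k}. \<forall>j\<in>{1..k}. {i, j} \<in> E \<longrightarrow> {v i, v j} \<in> G)" for v
    using assms by (intro ball_edges_image_iff) (simp add: simple_graph_def)
  moreover have "(\<forall>e\<in>?F. v ` e \<notin> G) \<longleftrightarrow> (\<forall>i\<in>{1..k}. \<forall>j\<in>{1..k}. {i, j} \<in> ?F \<longrightarrow> {v i, v j} \<notin> G)" for v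
    by (intro ball_edges_image_iff) (simp add: non_edges_def)
  moreover have "{i, j} \<in> ?F \<longleftrightarrow> i \<noteq> j \<and> {i, j} \<notin> E" if "i \<in> {1..k}" "j \<in> {1..k}" for i j
    using that by (cases "i = j") (simp_all add: non_edges_def)
  ultimately have "pattern_at E ?F v G \<longleftrightarrow> (\<forall>i\<in>{1..k}. \<forall>j\<in>{1..k}. {i, j} \<in> E \<longrightarrow> {v i, v j} \<in> G) \<and>
     (\<forall>i\<in>{1..k}. \<forall>j\<in>{1..k}. i \<noteq> j \<and> {i, j} \<notin> E \<longrightarrow> {v i, v j} \<notin> G)" for v
    by (simp del: atLeastAtMost_iff cong: ball_cong)
  then show ?thesis unfolding N_ind_def pattern_count_def tuples_def
    by (intro arg_cong[where f = card]) auto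
qed

theorem theorem2p2:
  fixes \<tau> c \<mu> :: real and p :: "nat pmf" and k :: nat and E :: "nat set set"
  assumes \<tau>: "2 < \<tau>" "\<tau> < 3"
    and c: "c > 0"
    and D_pos: "\<forall>d\<in>set_pmf p. d \<ge> 1"
    and D_tail: "(\<lambda>d. pmf p d) \<sim>[sequentially] (\<lambda>d. c * real d powr (-\<tau>))"
    and \<mu>: "\<mu> = measure_pmf.expectation p real"
    and k: "k \<ge> 3"
    and H: "simple_graph {1..k} E" "connected_graph {1..k} E"
    and min_deg: "\<forall>v\<in>{1..k}. vertex_degree E v \<ge> 2"
  shows
    "(unique_maximizer (objective \<tau> {1..k} E) (partitions_sub {1..k} E) \<and> B_sub \<tau> {1..k} E = 0
        \<longrightarrow> A_sub \<tau> c \<mu> k E < \<infinity> \<and>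
            conv_in_prob (\<lambda>n. measure_pmf (ECM p n))
              (\<lambda>n G. real (N_sub k E n G) / real n powr (real k / 2 * (3 - \<tau>)))
              (enn2real (A_sub \<tau> c \<mu> k E))) \<and>
     (unique_maximizer (objective \<tau> {1..k} E) (partitions_ind {1..k} E) \<and> B_ind \<tau> {1..k} E = 0
        \<longrightarrow> A_ind \<tau> c \<mu> k E < \<infinity> \<and>
            conv_in_prob (\<lambda>n. measure_pmf (ECM p n))
              (\<lambda>n G. real (N_ind k E n G) / real n powr (real k / 2 * (3 - \<tau>)))
              (enn2real (A_ind \<tau> c \<mu> k E)))"
proof -
  \<comment> \<open>Minimum degree 2 makes the set of degree-one vertices empty, so the
    corresponding terms of the objective vanish.\<close>
  have deg1: "deg1_vertices {1..k} E = {}"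
  proof (rule equals0I)
    fix v assume "v \<in> deg1_vertices {1..k} E"
    then have "v \<in> {1..k}" "vertex_degree E v = 1" unfolding deg1_vertices_def by blast+
    then show False using bspec[OF min_deg, of v] by simp
  qed
  have V: "finite {1..k}" "{1..k} \<noteq> {}" using k by simp_all
  have E: "card e = 2" "e \<subseteq> {1..k}" if "e \<in> E" for e
    using H(1) that by (simp_all add: simple_graph_def)
  have pattern: "scale_free_pattern \<tau> c \<mu> p {1..k} E F"
    if "F \<subseteq> non_edges {1..k} E" "separating {1..k} E \<tau> F" for F
  proof (unfold_locales; (rule \<tau> c D_pos D_tail \<mu> V that(2))?)
    show "\<forall>e\<in>E \<union> F. card e = 2 \<and> e \<subseteq> {1..k}"
      using E that(1) unfolding non_edges_def by blast
    show "E \<inter> F = {}" using that(1) unfolding non_edges_def by blast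
  qed
  show ?thesis
  proof (intro conjI[of "_ \<longrightarrow> _"] impI; elim conjE)
    assume "unique_maximizer (objective \<tau> {1..k} E) (partitions_sub {1..k} E)" "B_sub \<tau> {1..k} E = 0"
    then interpret scale_free_pattern \<tau> c \<mu> p "{1..k}" E "{}"
      by (intro pattern separating_sub[OF H(1) deg1]) simp_all
    have "limit_const {0<..} = A_sub \<tau> c \<mu> k E"
      unfolding limit_const_def A_sub_def pattern_integral_def pattern_density_def by simp
    then show "A_sub \<tau> c \<mu> k E < \<infinity> \<and> conv_in_prob (\<lambda>n. measure_pmf (ECM p n))
              (\<lambda>n G. real (N_sub k E n G) / real n powr (real k / 2 * (3 - \<tau>))) (enn2real (A_sub \<tau> c \<mu> k E))"
      using pattern_count_limit unfolding N_sub_eq_pattern_count[OF H(1)] card_atLeastAtMost by simp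
  next
    assume "unique_maximizer (objective \<tau> {1..k} E) (partitions_ind {1..k} E)" "B_ind \<tau> {1..k} E = 0"
    then interpret scale_free_pattern \<tau> c \<mu> p "{1..k}" E "non_edges {1..k} E"
      by (intro pattern separating_ind[OF H(1) deg1]) simp_all
    have "limit_const {0<..} = A_ind \<tau> c \<mu> k E"
      unfolding limit_const_def A_ind_def pattern_integral_def pattern_density_def by simp
    then show "A_ind \<tau> c \<mu> k E < \<infinity> \<and> conv_in_prob (\<lambda>n. measure_pmf (ECM p n))
              (\<lambda>n G. real (N_ind k E n G) / real n powr (real k / 2 * (3 - \<tau>))) (enn2real (A_ind \<tau> c \<mu> k E))"
      using pattern_count_limit unfolding N_ind_eq_pattern_count[OF H(1)] card_atLeastAtMost by simp
  qed
qed

end
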